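(* Let $p$ be a prime. Suppose the finite group $A$ acts on a finite group $G$ by automorphisms and let $N \unlhd G$ be an $A$-invariant subgroup. Let $\hat{A} = A \ltimes N$ and let $B$ be a subnormal $p$-subgroup of $\hat{A}$, where $p$ does not divide $|G:N|$. Let $C/N = \mathbf{C}_{G/N}(B)$. Let $C \leq H \leq G$ be an $A$-invariant subgroup, let $\chi \in \mathrm{Irr}_B(G)$ and let $\varphi = f_B(\chi) \in \mathrm{Irr}_B(H)$ be its correspondent. Then $A_\chi = A_\varphi$. Furthermore, for all $p$-subgroups $D \leq A_\chi$ such that $\mathbf{C}_{G/N}(D) \leq H/N$, one has $f_D(\chi) = \varphi$.
   Context: All groups are finite and characters are complex. The semidirect product $\hat A = A \ltimes N$ acts on $G$, with $A$ acting by the given action and $N$ acting by conjugation. $\mathrm{Irr}_B(G)$ is the set of $B$-invariant irreducible characters of $G$, and $A_\chi$ is the stabilizer of $\chi$ in $A$. The correspondence $f_B$: let $B$ be a $p$-group acting by automorphisms on a finite group $G$, let $N \unlhd G$ be $B$-invariant with $p \nmid |G/N|$, let $C/N = \mathbf{C}_{G/N}(B)$, and let $C \le H \le G$ with $H$ $B$-invariant. Then for each $\chi \in \mathrm{Irr}_B(G)$ the restriction $\chi_H$ has a unique $B$-invariant irreducible constituent with multiplicity not divisible by $p$; it is denoted $f_B(\chi)$, and $f_B: \mathrm{Irr}_B(G) \to \mathrm{Irr}_B(H)$ is a bijection. *)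

theory Defs
  imports
    "HOL-Computational_Algebra.Primes"
    "HOL-Algebra.Bij"
    "HOL-Algebra.Group_Action"
    "Jordan_Normal_Form.VS_Connect"
begin

section \<open>Complex characters of finite groups\<close>

definition GL :: "nat \<Rightarrow> complex mat monoid" where
  "GL n = units_of (ring_mat TYPE(complex) n ())"

definition irreducible_rep ::
    "('g, 'm) monoid_scheme \<Rightarrow> nat \<Rightarrow> ('g \<Rightarrow> complex mat) \<Rightarrow> bool" where
  "irreducible_rep G n \<rho> \<longleftrightarrow>
     n > 0 \<and> \<rho> \<in> hom G (GL n) \<and>
     (\<forall>W. VectorSpace.subspace class_ring W (module_vec TYPE(complex) n) \<and>
          (\<forall>g\<in>carrier G. \<forall>v\<in>W. \<rho> g *\<^sub>v v \<in> W) \<longrightarrow>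
          W = {0\<^sub>v n} \<or> W = carrier_vec n)"

definition mat_trace :: "complex mat \<Rightarrow> complex" where
  "mat_trace M = (\<Sum>i<dim_row M. M $$ (i, i))"

text \<open>Characters are extensional functions on the carrier (\<open>undefined\<close> elsewhere), so that
  equality of characters is equality of HOL functions.\<close>

definition Irr :: "('g, 'm) monoid_scheme \<Rightarrow> ('g \<Rightarrow> complex) set" where
  "Irr G = {\<chi>. \<exists>n \<rho>. irreducible_rep G n \<rho> \<and> \<chi> = (\<lambda>g\<in>carrier G. mat_trace (\<rho> g))}"

text \<open>The usual inner product of class functions. For a character \<open>\<theta>\<close> and an irreducible
  character \<open>\<psi>\<close> of \<open>G\<close> it is the multiplicity of \<open>\<psi>\<close> in \<open>\<theta>\<close>.\<close>

definition char_inner ::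
    "('g, 'm) monoid_scheme \<Rightarrow> ('g \<Rightarrow> complex) \<Rightarrow> ('g \<Rightarrow> complex) \<Rightarrow> complex" where
  "char_inner G \<theta> \<psi> = (\<Sum>g\<in>carrier G. \<theta> g * cnj (\<psi> g)) / of_nat (card (carrier G))"


section \<open>Actions on groups and characters\<close>

text \<open>An action of a group \<open>X\<close> on \<open>G\<close> by automorphisms is a homomorphism
  \<open>\<sigma> \<in> hom X (AutoGroup G)\<close>; it is a left action. The induced left action on functions
  on an invariant subgroup uses the inverse.\<close>

definition char_act ::
    "('x, 'n) monoid_scheme \<Rightarrow> ('x \<Rightarrow> 'g \<Rightarrow> 'g) \<Rightarrow> ('g, 'm) monoid_scheme \<Rightarrow>
     'x \<Rightarrow> ('g \<Rightarrow> complex) \<Rightarrow> 'g \<Rightarrow> complex" where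
  "char_act X \<sigma> G x \<chi> = (\<lambda>g\<in>carrier G. \<chi> (\<sigma> (inv\<^bsub>X\<^esub> x) g))"

definition Irr_inv ::
    "('x, 'n) monoid_scheme \<Rightarrow> ('x \<Rightarrow> 'g \<Rightarrow> 'g) \<Rightarrow> 'x set \<Rightarrow> ('g, 'm) monoid_scheme \<Rightarrow>
     ('g \<Rightarrow> complex) set" where
  "Irr_inv X \<sigma> B G = {\<chi> \<in> Irr G. \<forall>b\<in>B. char_act X \<sigma> G b \<chi> = \<chi>}"

definition invariant_subset ::
    "('x, 'n) monoid_scheme \<Rightarrow> ('x \<Rightarrow> 'g \<Rightarrow> 'g) \<Rightarrow> 'g set \<Rightarrow> bool" where
  "invariant_subset X \<sigma> S \<longleftrightarrow> (\<forall>x\<in>carrier X. \<sigma> x ` S = S)"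

text \<open>The centralizer of \<open>B\<close> in \<open>G/N\<close>, as a subset of \<open>carrier (G Mod N)\<close>.\<close>

definition quot_centralizer ::
    "('x \<Rightarrow> 'g \<Rightarrow> 'g) \<Rightarrow> 'x set \<Rightarrow> ('g, 'm) monoid_scheme \<Rightarrow> 'g set \<Rightarrow> 'g set set" where
  "quot_centralizer \<sigma> B G N = {X \<in> carrier (G Mod N). \<forall>b\<in>B. \<sigma> b ` X = X}"


section \<open>Semidirect products and subnormal subgroups\<close>

text \<open>The pair \<open>(a, n)\<close> stands for the product \<open>n a\<close>: it acts on \<open>G\<close> by first applying
  \<open>a\<close> and then conjugating by \<open>n\<close>, and \<open>(n a) (m b) = n (a \<cdot> m) a b\<close>.\<close>

definition semidirect ::
    "('a, 'n) monoid_scheme \<Rightarrow> ('a \<Rightarrow> 'g \<Rightarrow> 'g) \<Rightarrow> ('g, 'm) monoid_scheme \<Rightarrow> 'g set \<Rightarrow>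
     ('a \<times> 'g) monoid" where
  "semidirect A \<alpha> G N =
     \<lparr>carrier = carrier A \<times> N,
      mult = (\<lambda>(a, n) (b, m). (a \<otimes>\<^bsub>A\<^esub> b, n \<otimes>\<^bsub>G\<^esub> \<alpha> a m)),
      one = (\<one>\<^bsub>A\<^esub>, \<one>\<^bsub>G\<^esub>)\<rparr>"

definition semidirect_act ::
    "('a \<Rightarrow> 'g \<Rightarrow> 'g) \<Rightarrow> ('g, 'm) monoid_scheme \<Rightarrow> 'a \<times> 'g \<Rightarrow> 'g \<Rightarrow> 'g" where
  "semidirect_act \<alpha> G = (\<lambda>(a, n). \<lambda>g\<in>carrier G. n \<otimes>\<^bsub>G\<^esub> \<alpha> a g \<otimes>\<^bsub>G\<^esub> inv\<^bsub>G\<^esub> n)"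

inductive subnormal :: "('g, 'm) monoid_scheme \<Rightarrow> 'g set \<Rightarrow> bool" for G where
  whole: "subnormal G (carrier G)"
| step: "subnormal G K \<Longrightarrow> L \<lhd> (G\<lparr>carrier := K\<rparr>) \<Longrightarrow> subnormal G L"

definition p_subgroup :: "nat \<Rightarrow> ('g, 'm) monoid_scheme \<Rightarrow> 'g set \<Rightarrow> bool" where
  "p_subgroup p G P \<longleftrightarrow> subgroup P G \<and> (\<exists>k. card P = p ^ k)"


section \<open>The correspondence\<close>

text \<open>\<open>f_corr p X \<sigma> B G H \<chi>\<close> is \<open>f\<^sub>B(\<chi>)\<close>: the unique \<open>B\<close>-invariant irreducible character of
  \<open>H\<close> whose multiplicity in the restriction of \<open>\<chi>\<close> to \<open>H\<close> is not divisible by \<open>p\<close> (in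
  particular nonzero, so it is a constituent). Here \<open>B\<close> is a subgroup of \<open>X\<close>, which acts
  on \<open>G\<close> via \<open>\<sigma>\<close>.\<close>

definition f_corr ::
    "nat \<Rightarrow> ('x, 'n) monoid_scheme \<Rightarrow> ('x \<Rightarrow> 'g \<Rightarrow> 'g) \<Rightarrow> 'x set \<Rightarrow> ('g, 'm) monoid_scheme \<Rightarrow>
     'g set \<Rightarrow> ('g \<Rightarrow> complex) \<Rightarrow> 'g \<Rightarrow> complex" where
  "f_corr p X \<sigma> B G H \<chi> =
     (THE \<phi>. \<phi> \<in> Irr_inv X \<sigma> B (G\<lparr>carrier := H\<rparr>) \<and>
        (\<exists>m::nat. char_inner (G\<lparr>carrier := H\<rparr>) (restrict \<chi> H) \<phi> = of_nat m \<and> \<not> p dvd m))"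

end

theory Submission
  imports Defs "Jordan_Normal_Form.Spectral_Radius" "HOL-Algebra.Multiplicative_Group"
    "HOL-Algebra.SndIsomorphismGrp"
begin

text \<open>A subnormal \<open>p\<close>-subgroup \<open>B\<close> of the semidirect product lies in a normal \<open>p\<close>-subgroup \<open>P\<close>. Let
  \<open>x\<close> stabilize \<open>\<chi>\<close>, and let \<open>Q\<close> be the stabilizer of \<open>\<chi>\<close> in \<open>P\<close>, which contains \<open>B\<close> and is
  normalized by \<open>x\<close>. Then \<open>f\<^sub>Q(\<chi>)\<close> is \<open>B\<close>-invariant, hence equal to \<open>f\<^sub>B(\<chi>) = \<phi>\<close>, and \<open>x\<close> fixes it by
  uniqueness. The converse is symmetric, with \<open>f\<^sub>Q\<inverse>\<close> in place of \<open>f\<^sub>Q\<close>, and the last claim is again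
  uniqueness, for \<open>D\<close> in place of \<open>B\<close>.

  The correspondence itself comes from congruences modulo \<open>p\<close> for the multiplicities of
  \<open>\<psi> \<in> Irr\<^sub>B(H)\<close> in \<open>\<chi> \<in> Irr\<^sub>B(G)\<close>. If \<open>\<chi> \<noteq> \<chi>'\<close>, their idempotents annihilate each other; in a
  \<open>p\<close>-integral form of the algebra spanned by the elements commuting with \<open>N\<close> and supported on a
  \<open>B\<close>-invariant \<open>\<theta> \<in> Irr(N)\<close>, the cosets outside \<open>H\<close> contribute multiples of \<open>p\<close>, as \<open>B\<close> fixes
  none of them. So \<open>p\<close> divides the product of the multiplicities of \<open>\<psi>\<close> in \<open>\<chi>\<close> and \<open>\<chi>'\<close>, and at most one
  \<open>\<chi>\<close> corresponds to \<open>\<psi>\<close>. Mackey's formula gives the same for two characters of \<open>H\<close>, and counting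
  degrees gives existence.\<close>

section \<open>Sums of roots of unity and \<open>p\<close>-integral numbers\<close>

text \<open>The obstacle is that p may divide the order of N, so that neither the idempotents of G
  nor the reciprocals of degrees are p-integral by themselves. Everything is therefore measured
  relative to a B-invariant constituent \<theta> on N: degrees are divided by \<theta>(1), and
  values at 1 of group algebra elements by e(1), where e is the idempotent of \<theta>. The elements
  commuting with N and absorbed by e form a twisted group algebra of a subgroup of G/N, whose
  cocycle can be normalized to roots of unity. In the resulting basis the idempotents lying over
  \<theta> have coefficients whose denominators divide an index prime to p.

  Subnormality enters because an element stabilizing \<chi> need not normalize B. Inside a normal
  p-subgroup there is a group that it does normalize, and since this group contains B, it fixes no
  coset outside H either.

  Numbers are handled through sums of roots of unity, that is, cyclotomic integers of all orders at
  once. Closure under sums and products is elementary, and negation is multiplication by the root of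
  unity -1.\<close>

inductive_set unity_sums :: "complex set" where
  zero: "0 \<in> unity_sums"
| add: "x \<in> unity_sums \<Longrightarrow> z ^ n = 1 \<Longrightarrow> n > 0 \<Longrightarrow> x + z \<in> unity_sums"

lemma unity_sums_root: "z ^ n = 1 \<Longrightarrow> n > 0 \<Longrightarrow> z \<in> unity_sums"
  using unity_sums.add[OF unity_sums.zero] by simp

lemma unity_sums_add:
  assumes "x \<in> unity_sums" "y \<in> unity_sums"
  shows "x + y \<in> unity_sums"
  using assms(2)
proof (induction y rule: unity_sums.induct)
  case (add y z n)
  then show ?case using unity_sums.add[of "x + y" z n] by (simp add: add.assoc)
qed (simp add: assms)

lemma unity_sums_mult_root:
  assumes "x \<in> unity_sums" "w ^ m = 1" "m > 0"
  shows "w * x \<in> unity_sums"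
  using assms(1)
proof (induction x rule: unity_sums.induct)
  case (add x z n)
  have "(w * z) ^ (m * n) = (w ^ m) ^ n * (z ^ n) ^ m"
    by (simp add: power_mult_distrib power_mult mult.commute flip: power_mult)
  then have "(w * z) ^ (m * n) = 1" using add assms by simp
  then show ?case
    using unity_sums.add[OF add.IH, of "w * z" "m * n"] add assms by (simp add: distrib_left)
qed (simp add: unity_sums.zero)

lemma unity_sums_mult: "x \<in> unity_sums \<Longrightarrow> y \<in> unity_sums \<Longrightarrow> x * y \<in> unity_sums"
proof (induction x rule: unity_sums.induct)
  case (add x z n)
  then show ?case
    using unity_sums_add unity_sums_mult_root[of y z n] by (simp add: distrib_right)
qed (simp add: unity_sums.zero)

lemma unity_sums_of_nat: "of_nat n \<in> unity_sums"
proof (induction n)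
  case (Suc n)
  then show ?case using unity_sums.add[of "of_nat n" 1 1] by (simp add: add.commute)
qed (simp add: unity_sums.zero)

text \<open>All roots are collected at one common order, with integer multiplicities as
  coefficients. This is the input for the integer matrix in
  \<open>algebraic_int_unity_sums\<close>.\<close>

lemma unity_sums_repr:
  assumes "x \<in> unity_sums"
  obtains N :: nat and c :: "complex \<Rightarrow> int"
  where "N > 0" "x = (\<Sum>z | z ^ N = 1. of_int (c z) * z)"
proof -
  have "\<exists>N>0. \<exists>c :: complex \<Rightarrow> int. x = (\<Sum>z | z ^ N = 1. of_int (c z) * z)"
    using assms
  proof (induction x rule: unity_sums.induct)
    case zero
    show ?case by (intro exI[of _ 1] conjI exI[of _ "\<lambda>_. 0"]) auto
  next
    case (add x z n)
    then obtain N c where N: "N > 0" and x: "x = (\<Sum>z | z ^ N = 1. of_int (c z) * z)" by blast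
    let ?M = "N * n"
    have M: "?M > 0" using N add by simp
    have fin: "finite {z :: complex. z ^ ?M = 1}" using M by (intro finite_roots_unity) simp
    have sub: "{z :: complex. z ^ N = 1} \<subseteq> {z. z ^ ?M = 1}" by (auto simp: power_mult)
    have zM: "z ^ ?M = 1" using add by (simp add: power_mult mult.commute[of N])
    define d where "d = (\<lambda>w. (if w ^ N = 1 then c w else 0) + (if w = z then 1 else 0 :: int))"
    have "(\<Sum>w | w ^ ?M = 1. of_int (d w) * w) =
        (\<Sum>w | w ^ ?M = 1. (if w ^ N = 1 then of_int (c w) * w else 0)) +
        (\<Sum>w | w ^ ?M = 1. (if w = z then z else 0))"
      unfolding d_def sum.distrib[symmetric] by (intro sum.cong) (auto simp: algebra_simps)
    also have "(\<Sum>w | w ^ ?M = 1. (if w ^ N = 1 then of_int (c w) * w else 0)) = x"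
      unfolding x using fin sub by (intro sum.mono_neutral_cong_right) auto
    also have "(\<Sum>w | w ^ ?M = 1. (if w = z then z else 0)) = z"
      using fin zM by (simp add: sum.delta)
    finally show ?case using M by metis
  qed
  then show ?thesis using that by blast
qed

text \<open>Multiplication by x sends each N-th root of unity to an integer combination of N-th
  roots of unity. So x is an eigenvalue of an integer matrix and a root of its monic characteristic
  polynomial.\<close>

lemma algebraic_int_unity_sums:
  assumes "x \<in> unity_sums"
  shows "algebraic_int x"
proof -
  obtain N c where N: "N > 0" and x: "x = (\<Sum>z | z ^ N = 1. of_int (c z) * z)"
    using assms by (rule unity_sums_repr)
  define U where "U = {z :: complex. z ^ N = 1}"
  have fin: "finite U" unfolding U_def using N by (intro finite_roots_unity) simp
  obtain us where us: "set us = U" "distinct us" using fin finite_distinct_list by blast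
  define k where "k = length us"
  \<comment> \<open>Row i expresses x times the i-th root u: in this product the root w occurs with
    coefficient \<open>c (w / u)\<close>.\<close>
  define A :: "int mat" where "A = mat k k (\<lambda>(i, j). c (us ! j / us ! i))"
  let ?A = "map_mat of_int A :: complex mat"
  define v where "v = vec k (\<lambda>i. us ! i)"
  have A: "A \<in> carrier_mat k k" unfolding A_def by simp
  have bij: "bij_betw (\<lambda>i. us ! i) {0..<k} U"
    unfolding k_def us(1)[symmetric] using us(2) bij_betw_nth[of us "{0..<length us}" "set us"]
    by (simp add: atLeast0LessThan)
  have nz: "u \<noteq> 0" if "u \<in> U" for u using that N unfolding U_def by (auto simp: power_0_left)
  have row: "(\<Sum>j<k. of_int (c (us ! j / us ! i)) * us ! j) = x * us ! i" if "i < k" for i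
  proof -
    have ui: "us ! i \<in> U" using that us unfolding k_def by auto
    have "(\<Sum>j<k. of_int (c (us ! j / us ! i)) * us ! j) = (\<Sum>w\<in>U. of_int (c (w / us ! i)) * w)"
      by (rule sum.reindex_bij_betw[OF bij[unfolded atLeast0LessThan], of "\<lambda>w. of_int (c (w / us ! i)) * w"])
    also have "\<dots> = (\<Sum>z\<in>U. of_int (c z) * (z * us ! i))"
      by (rule sum.reindex_bij_witness[of _ "\<lambda>z. z * us ! i" "\<lambda>w. w / us ! i"])
        (use ui nz[OF ui] in \<open>auto simp: U_def power_mult_distrib power_divide\<close>)
    also have "\<dots> = x * us ! i"
      unfolding x U_def by (simp add: sum_distrib_right mult.assoc)
    finally show ?thesis .
  qed
  have "?A *\<^sub>v v = x \<cdot>\<^sub>v v"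
    by (rule eq_vecI) (use row in \<open>auto simp: A_def v_def scalar_prod_def atLeast0LessThan\<close>)
  moreover have "v \<noteq> 0\<^sub>v k"
  proof -
    have "1 \<in> U" unfolding U_def by simp
    then obtain i where "i < k" "us ! i = 1" using bij unfolding bij_betw_def by auto
    then show ?thesis unfolding v_def by (metis index_vec index_zero_vec(1) zero_neq_one)
  qed
  ultimately have "eigenvector ?A v x" unfolding eigenvector_def v_def using A by auto
  then have "eigenvalue ?A x" unfolding eigenvalue_def by blast
  then have "poly (char_poly ?A) x = 0" using eigenvalue_root_char_poly[of ?A k x] A by simp
  then have "poly (map_poly of_int (char_poly A)) x = 0"
    by (simp add: of_int_hom.char_poly_hom[OF A])
  moreover have "lead_coeff (char_poly A) = 1" using degree_monic_char_poly[OF A] by auto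
  ultimately show ?thesis unfolding algebraic_int_altdef_ipoly by blast
qed

text \<open>Cyclotomic integers with denominators prime to p. Indices prime to p become invertible
  while p does not, so congruences modulo p make sense for quotients of degrees and orders.\<close>

definition p_integral :: "nat \<Rightarrow> complex set" where
  "p_integral p = {x. \<exists>k::nat. \<not> p dvd k \<and> of_nat k * x \<in> unity_sums}"

lemma p_integralI: "\<not> p dvd k \<Longrightarrow> of_nat k * x \<in> unity_sums \<Longrightarrow> x \<in> p_integral p"
  unfolding p_integral_def by blast

context
  fixes p :: nat
  assumes p: "prime p"
begin

lemma unity_sums_p_integral: "x \<in> unity_sums \<Longrightarrow> x \<in> p_integral p"
  using p_integralI[of p 1 x] p by (simp add: prime_nat_iff)

lemma p_integral_of_nat: "of_nat n \<in> p_integral p"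
  by (simp add: unity_sums_p_integral unity_sums_of_nat)

lemma p_integral_root: "z ^ n = 1 \<Longrightarrow> n > 0 \<Longrightarrow> z \<in> p_integral p"
  using unity_sums_p_integral unity_sums_root by blast

lemma p_integral_add:
  assumes "x \<in> p_integral p" "y \<in> p_integral p"
  shows "x + y \<in> p_integral p"
proof -
  obtain k l where k: "\<not> p dvd k" "of_nat k * x \<in> unity_sums" and l: "\<not> p dvd l" "of_nat l * y \<in> unity_sums"
    using assms unfolding p_integral_def by blast
  have "of_nat l * (of_nat k * x) + of_nat k * (of_nat l * y) \<in> unity_sums"
    by (intro unity_sums_add unity_sums_mult unity_sums_of_nat k l)
  then show ?thesis
    by (intro p_integralI[of p "k * l"]) (use p k l in \<open>auto simp: prime_dvd_mult_iff algebra_simps\<close>)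
qed

lemma p_integral_mult:
  assumes "x \<in> p_integral p" "y \<in> p_integral p"
  shows "x * y \<in> p_integral p"
proof -
  obtain k l where k: "\<not> p dvd k" "of_nat k * x \<in> unity_sums" and l: "\<not> p dvd l" "of_nat l * y \<in> unity_sums"
    using assms unfolding p_integral_def by blast
  have "(of_nat k * x) * (of_nat l * y) \<in> unity_sums"
    by (intro unity_sums_mult k l)
  then show ?thesis
    by (intro p_integralI[of p "k * l"]) (use p k l in \<open>auto simp: prime_dvd_mult_iff algebra_simps\<close>)
qed

lemma p_integral_uminus: "x \<in> p_integral p \<Longrightarrow> - x \<in> p_integral p"
  using p_integral_mult[of "-1" x] p_integral_root[of "-1" 2] by simp

lemma p_integral_diff: "x \<in> p_integral p \<Longrightarrow> y \<in> p_integral p \<Longrightarrow> x - y \<in> p_integral p"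
  using p_integral_add[of x "- y"] p_integral_uminus by simp

lemma p_integral_sum: "(\<And>i. i \<in> I \<Longrightarrow> f i \<in> p_integral p) \<Longrightarrow> sum f I \<in> p_integral p"
  by (induction I rule: infinite_finite_induct)
    (use p_integral_of_nat[of 0] in \<open>auto intro: p_integral_add\<close>)

lemma p_integral_divide_nat:
  assumes "x \<in> p_integral p" "\<not> p dvd k"
  shows "x / of_nat k \<in> p_integral p"
proof -
  have "k \<noteq> 0" using assms(2) by (intro notI) simp
  then have "1 / of_nat k \<in> p_integral p"
    by (intro p_integralI[OF assms(2)]) (use unity_sums_of_nat[of 1] in auto)
  then show ?thesis using p_integral_mult[OF assms(1)] by fastforce
qed

text \<open>After clearing the denominator k, the number k n / p is rational and an algebraic
  integer, hence an integer; and p does not divide k. Every congruence returns to the integers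
  through this lemma.\<close>

lemma p_dvd_if_p_integral:
  assumes "of_nat n = of_nat p * x" "x \<in> p_integral p"
  shows "p dvd n"
proof (rule ccontr)
  assume ndvd: "\<not> p dvd n"
  obtain k where k: "\<not> p dvd k" "of_nat k * x \<in> unity_sums"
    using assms(2) unfolding p_integral_def by blast
  have p0: "p > 0" using p prime_gt_0_nat by blast
  have "of_nat k * x = of_nat (k * n) / of_nat p" using assms(1) p0 by (simp add: field_simps)
  also have "\<dots> \<in> \<rat>" by (intro Rats_divide Rats_of_nat)
  finally have "of_nat k * x \<in> \<int>"
    using rational_algebraic_int_is_int algebraic_int_unity_sums[OF k(2)] by blast
  then obtain i where "of_nat k * x = of_int i" by (auto elim: Ints_cases)
  then have "(of_int (int (k * n)) :: complex) = of_int (int p * i)"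
    using assms(1) by (simp add: mult_ac)
  then have "int (k * n) = int p * i" using of_int_eq_iff by blast
  then have "int p dvd int (k * n)" by simp
  then have "p dvd k * n" using int_dvd_int_iff by blast
  then show False using p k(1) ndvd by (simp add: prime_dvd_mult_iff)
qed

text \<open>This refutes an idempotent that is divisible by every power of p in a lattice: up to
  normalization its value at 1 is a fixed positive integer.\<close>

lemma not_p_divisible:
  assumes "n > 0" "\<And>j. \<exists>x\<in>p_integral p. of_nat n = of_nat p ^ j * x"
  shows False
proof -
  \<comment> \<open>One power more than n contains.\<close>
  obtain x where x: "x \<in> p_integral p" "of_nat n = of_nat p ^ Suc (multiplicity p n) * x"
    using assms(2) by blast
  obtain n' where n': "n = p ^ multiplicity p n * n'" using multiplicity_dvd[of p n] by (auto elim: dvdE)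
  have p0: "p > 0" using p prime_gt_0_nat by blast
  have "of_nat p ^ multiplicity p n * of_nat n' = (of_nat n :: complex)"
    by (subst (2) n') simp
  then have "of_nat n' = of_nat p * x" using x p0 by auto
  then have "p dvd n'" using x p_dvd_if_p_integral by blast
  then have "p ^ Suc (multiplicity p n) dvd n" by (subst n') (simp add: mult.commute mult_dvd_mono)
  then show False using multiplicity_geI[of n p "Suc (multiplicity p n)"] assms(1) p prime_gt_1_nat[OF p] by auto
qed

end

section \<open>Traces of matrices equal to one of their higher powers\<close>

lemma upper_triangular_mult_diag:
  fixes A B :: "'a :: semiring_0 mat"
  assumes "A \<in> carrier_mat n n" "B \<in> carrier_mat n n" "upper_triangular A" "upper_triangular B"
  shows "upper_triangular (A * B)" "i < n \<Longrightarrow> (A * B) $$ (i, i) = A $$ (i, i) * B $$ (i, i)"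
proof -
  have term0: "A $$ (i, k) * B $$ (k, j) = 0" if "i < n" "j < n" "k < n" "j \<le> i" "k \<noteq> i \<or> j \<noteq> i" for i j k
    using that assms(3,4)[THEN upper_triangularD] assms(1,2) by (cases "k < i"; cases "k = i") auto
  show "upper_triangular (A * B)"
    by (rule upper_triangularI) (use assms term0 in \<open>auto simp: scalar_prod_def intro!: sum.neutral\<close>)
  assume i: "i < n"
  have "(A * B) $$ (i, i) = (\<Sum>k\<in>{0..<n}. if k = i then A $$ (i, i) * B $$ (i, i) else 0)"
    using assms(1,2) i by (simp add: scalar_prod_def sum.remove[of "{0..<n}" i] term0[OF i i])
  then show "(A * B) $$ (i, i) = A $$ (i, i) * B $$ (i, i)" using i by simp
qed

lemma upper_triangular_power_diag:
  fixes A :: "'a :: comm_semiring_1 mat"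
  assumes "A \<in> carrier_mat n n" "upper_triangular A"
  shows "upper_triangular (A ^\<^sub>m k) \<and> (\<forall>i<n. (A ^\<^sub>m k) $$ (i, i) = A $$ (i, i) ^ k)"
proof (induction k)
  case (Suc k)
  then show ?case
    using upper_triangular_mult_diag[of "A ^\<^sub>m k" n A] assms by (auto simp: mult.commute)
qed (use assms in auto)

lemma mat_trace_comm:
  assumes "A \<in> carrier_mat m n" "B \<in> carrier_mat n m"
  shows "mat_trace (A * B) = mat_trace (B * A)"
proof -
  have "mat_trace (A * B) = (\<Sum>i<m. \<Sum>k<n. A $$ (i, k) * B $$ (k, i))"
    using assms by (auto simp: mat_trace_def scalar_prod_def atLeast0LessThan)
  also have "\<dots> = (\<Sum>k<n. \<Sum>i<m. B $$ (k, i) * A $$ (i, k))"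
    by (subst sum.swap) (simp add: mult.commute)
  also have "\<dots> = mat_trace (B * A)"
    using assms by (auto simp: mat_trace_def scalar_prod_def atLeast0LessThan)
  finally show ?thesis .
qed

text \<open>Triangularize U: on the diagonal, powers are taken entrywise. The hypothesis allows the
  eigenvalue 0, so that it covers idempotents and elements that act with finite order on one summand
  and by 0 on the others.\<close>

lemma trace_power_eigenvalues:
  fixes U :: "complex mat"
  assumes U: "U \<in> carrier_mat n n" and k: "U ^\<^sub>m Suc k = U"
  obtains z where "\<And>j. mat_trace (U ^\<^sub>m j) = (\<Sum>i<n. z i ^ j)" "\<And>i. i < n \<Longrightarrow> z i ^ Suc k = z i"
proof -
  obtain es where "char_poly U = (\<Prod>e\<leftarrow>es. [:- e, 1:])" using char_poly_factorized[OF U] by blast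
  then obtain T where T: "T \<in> carrier_mat n n" "upper_triangular T" "similar_mat U T"
    using schur_decomposition_exists[OF U] by blast
  then obtain P Q where wit: "similar_mat_wit U T P Q" unfolding similar_mat_def by blast
  have PQ: "P \<in> carrier_mat n n" "Q \<in> carrier_mat n n" "Q * P = 1\<^sub>m n" "P * Q = 1\<^sub>m n"
    using similar_mat_witD2[OF U wit] by auto
  have pow: "U ^\<^sub>m j = P * T ^\<^sub>m j * Q" for j using similar_mat_wit_pow_id[OF wit] .
  have conj: "Q * (P * M * Q) * P = M" if M: "M \<in> carrier_mat n n" for M
  proof -
    have "Q * (P * M * Q) * P = (Q * P) * M * (Q * P)"
      using PQ(1,2) M by (simp add: assoc_mult_mat[of _ n n _ n _ n])
    then show ?thesis using PQ(3) M by simp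
  qed
  have Tk: "T ^\<^sub>m Suc k = T"
  proof -
    have "T ^\<^sub>m Suc k = Q * U ^\<^sub>m Suc k * P"
      unfolding pow using conj[of "T ^\<^sub>m Suc k"] pow_carrier_mat[OF T(1)] by metis
    also have "\<dots> = Q * (P * T * Q) * P" unfolding k using pow[of 1] T U by simp
    also have "\<dots> = T" using conj T by simp
    finally show ?thesis .
  qed
  define z where "z i = T $$ (i, i)" for i
  have diag: "(T ^\<^sub>m j) $$ (i, i) = z i ^ j" if "i < n" for i j
    using upper_triangular_power_diag[OF T(1,2), of j] that z_def by auto
  show ?thesis
  proof (rule that)
    fix j
    have "mat_trace (U ^\<^sub>m j) = mat_trace (P * (T ^\<^sub>m j * Q))"
      unfolding pow using PQ T by (simp add: assoc_mult_mat[of _ n n _ n _ n])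
    also have "\<dots> = mat_trace (T ^\<^sub>m j * Q * P)" using mat_trace_comm[of P n n "T ^\<^sub>m j * Q"] PQ T
      by (simp add: mult_carrier_mat[OF pow_carrier_mat])
    also have "\<dots> = mat_trace (T ^\<^sub>m j)"
      using PQ T by (simp add: assoc_mult_mat[of _ n n _ n _ n])
    also have "\<dots> = (\<Sum>i<n. z i ^ j)" unfolding mat_trace_def using diag T by auto
    finally show "mat_trace (U ^\<^sub>m j) = (\<Sum>i<n. z i ^ j)" .
  next
    fix i assume "i < n"
    then show "z i ^ Suc k = z i" using diag[of i "Suc k"] Tk unfolding z_def by metis
  qed
qed

text \<open>Nonzero eigenvalues are k-th roots of unity. For k = 0 the equation would say nothing
  about U.\<close>

lemma mat_trace_unity_sums:
  assumes "U \<in> carrier_mat n n" "U ^\<^sub>m Suc k = U" "k > 0"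
  shows "mat_trace U \<in> unity_sums"
proof -
  obtain z where z: "\<And>j. mat_trace (U ^\<^sub>m j) = (\<Sum>i<n. z i ^ j)" "\<And>i. i < n \<Longrightarrow> z i ^ Suc k = z i"
    using trace_power_eigenvalues[OF assms(1,2)] by blast
  have "z i \<in> unity_sums" if "i < n" for i
    using z(2)[OF that] unity_sums_root[of "z i" k] assms(3) unity_sums.zero by (cases "z i = 0") auto
  then have "(\<Sum>i<m. z i) \<in> unity_sums" if "m \<le> n" for m
    using that by (induction m) (auto intro: unity_sums.zero unity_sums_add)
  then show ?thesis using z(1)[of 1] assms(1) by simp
qed

text \<open>The eigenvalues are 0 or 1 and the trace counts the latter. Multiplicities become
  natural numbers through this lemma.\<close>

lemma mat_trace_idempotent:
  assumes "E \<in> carrier_mat n n" "E * E = E"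
  shows "\<exists>m::nat. m \<le> n \<and> mat_trace E = of_nat m"
proof -
  have "E ^\<^sub>m Suc 1 = E" using assms by simp
  then obtain z where z: "\<And>j. mat_trace (E ^\<^sub>m j) = (\<Sum>i<n. z i ^ j)" "\<And>i. i < n \<Longrightarrow> z i ^ Suc 1 = z i"
    using trace_power_eigenvalues[OF assms(1)] by blast
  have "mat_trace E = (\<Sum>i<n. z i)" using z(1)[of 1] assms(1) by simp
  also have "\<dots> = (\<Sum>i<n. if z i = 1 then 1 else 0)"
    by (intro sum.cong) (use z(2) in \<open>force simp: power2_eq_square\<close>)+
  also have "\<dots> = of_nat (card {i\<in>{..<n}. z i = 1})" by (simp add: sum.If_cases Int_def)
  finally show ?thesis
    by (intro exI[of _ "card {i\<in>{..<n}. z i = 1}"]) (use card_mono[of "{..<n}" "{i\<in>{..<n}. z i = 1}"] in auto)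
qed

section \<open>Matrix representations and Schur orthogonality\<close>

lemma index_mult_mat_sum:
  assumes "A \<in> carrier_mat m n" "B \<in> carrier_mat n l" "i < m" "j < l"
  shows "(A * B) $$ (i, j) = (\<Sum>k<n. A $$ (i, k) * B $$ (k, j))"
  using assms by (simp add: scalar_prod_def atLeast0LessThan)

lemma index_mult_vec_sum:
  assumes "A \<in> carrier_mat m n" "v \<in> carrier_vec n" "i < m"
  shows "(A *\<^sub>v v) $ i = (\<Sum>k<n. A $$ (i, k) * v $ k)"
  using assms by (simp add: scalar_prod_def atLeast0LessThan)

lemma mult_unit_vec_index:
  fixes A :: "'a :: semiring_1 mat"
  assumes "A \<in> carrier_mat m n" "i < m" "j < n"
  shows "(A *\<^sub>v unit_vec n j) $ i = A $$ (i, j)"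
proof -
  have "(A *\<^sub>v unit_vec n j) $ i = (\<Sum>k<n. if k = j then A $$ (i, j) else 0)"
    unfolding index_mult_vec_sum[OF assms(1) unit_vec_carrier assms(2)]
    using assms by (intro sum.cong) (auto simp: unit_vec_def)
  then show ?thesis using assms by simp
qed

lemma mat_eq_by_vec:
  fixes A :: "'a :: semiring_1 mat"
  assumes A: "A \<in> carrier_mat m n" and B: "B \<in> carrier_mat m n"
    and eq: "\<And>v. v \<in> carrier_vec n \<Longrightarrow> A *\<^sub>v v = B *\<^sub>v v"
  shows "A = B"
proof (rule eq_matI)
  fix i j assume "i < dim_row B" "j < dim_col B"
  then show "A $$ (i, j) = B $$ (i, j)"
    using mult_unit_vec_index[OF A, of i j] mult_unit_vec_index[OF B, of i j] eq[of "unit_vec n j"] B by simp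
qed (use A B in auto)

definition lin_closed :: "nat \<Rightarrow> complex vec set \<Rightarrow> bool" where
  "lin_closed n W \<longleftrightarrow> W \<subseteq> carrier_vec n \<and> 0\<^sub>v n \<in> W \<and>
     (\<forall>v\<in>W. \<forall>w\<in>W. v + w \<in> W) \<and> (\<forall>c. \<forall>v\<in>W. c \<cdot>\<^sub>v v \<in> W)"

lemma subspace_iff_lin_closed:
  "VectorSpace.subspace class_ring W (module_vec TYPE(complex) n) \<longleftrightarrow> lin_closed n W"
proof -
  interpret V: vec_space "TYPE(complex)" n .
  have m: "Module.module (class_ring :: complex ring) (module_vec TYPE(complex) n)" by (rule V.module_axioms)
  have v: "vectorspace (class_ring :: complex ring) (module_vec TYPE(complex) n)" by (rule V.vectorspace_axioms)
  show ?thesis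
    unfolding VectorSpace.subspace_def LinearCombinations.submodule_def lin_closed_def module_vec_simps
    using m v by auto
qed

text \<open>A working form of \<open>hom G (GL n)\<close>, see \<open>hom_GL_iff\<close>: on a
  group, the condition at the unit gives the invertibility of all values.\<close>

definition mat_rep :: "('g, 'm) monoid_scheme \<Rightarrow> nat \<Rightarrow> ('g \<Rightarrow> complex mat) \<Rightarrow> bool" where
  "mat_rep G n \<rho> \<longleftrightarrow> (\<forall>g\<in>carrier G. \<rho> g \<in> carrier_mat n n) \<and>
     (\<forall>g\<in>carrier G. \<forall>h\<in>carrier G. \<rho> (g \<otimes>\<^bsub>G\<^esub> h) = \<rho> g * \<rho> h) \<and> \<rho> \<one>\<^bsub>G\<^esub> = 1\<^sub>m n"

lemma mat_repD:
  assumes "mat_rep G n \<rho>"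
  shows "g \<in> carrier G \<Longrightarrow> \<rho> g \<in> carrier_mat n n"
    and "g \<in> carrier G \<Longrightarrow> h \<in> carrier G \<Longrightarrow> \<rho> (g \<otimes>\<^bsub>G\<^esub> h) = \<rho> g * \<rho> h"
    and "\<rho> \<one>\<^bsub>G\<^esub> = 1\<^sub>m n"
  using assms unfolding mat_rep_def by auto

lemma mat_rep_entry:
  assumes "mat_rep G n \<rho>" "g \<in> carrier G" "h \<in> carrier G" "i < n" "j < n"
  shows "\<rho> (g \<otimes>\<^bsub>G\<^esub> h) $$ (i, j) = (\<Sum>k<n. \<rho> g $$ (i, k) * \<rho> h $$ (k, j))"
  using assms mat_repD[OF assms(1)] index_mult_mat_sum[of "\<rho> g" n n "\<rho> h" n] by simp

lemma (in group) hom_GL_iff: "\<rho> \<in> hom G (GL n) \<longleftrightarrow> mat_rep G n \<rho>"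
proof
  interpret M: monoid "ring_mat TYPE(complex) n ()"
    using ring_mat[where 'a = complex and n = n and b = "()"] by (simp add: ring_def)
  have one: "\<one>\<^bsub>GL n\<^esub> = 1\<^sub>m n" and mult: "\<And>x y. x \<otimes>\<^bsub>GL n\<^esub> y = x * y"
    by (auto simp: GL_def units_of_def ring_mat_simps)
  have car: "carrier (GL n) = Units (ring_mat TYPE(complex) n ())" by (simp add: GL_def units_of_def)
  {
    assume hom: "\<rho> \<in> hom G (GL n)"
    have "group (GL n)" unfolding GL_def by (rule M.units_group)
    then have "\<rho> \<one> = 1\<^sub>m n" using hom_one[OF hom is_group] one by simp
    moreover have "\<rho> g \<in> carrier_mat n n" if "g \<in> carrier G" for g
    proof -
      have "\<rho> g \<in> Units (ring_mat TYPE(complex) n ())"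
        using hom that unfolding hom_def car by auto
      then show ?thesis unfolding Units_def ring_mat_simps by auto
    qed
    ultimately show "mat_rep G n \<rho>" using hom unfolding mat_rep_def hom_def mult by auto
  }
  {
    assume rep: "mat_rep G n \<rho>"
    have "\<rho> g \<in> Units (ring_mat TYPE(complex) n ())" if "g \<in> carrier G" for g
      unfolding Units_def ring_mat_simps
      using mat_repD[OF rep] that mat_repD(2)[OF rep, of g "inv g", symmetric] mat_repD(2)[OF rep, of "inv g" g, symmetric]
      by (auto intro!: bexI[of _ "\<rho> (inv g)"])
    then show "\<rho> \<in> hom G (GL n)" using mat_repD(2)[OF rep] unfolding hom_def car mult by auto
  }
qed

lemma (in group) irreducible_rep_iff:
  "irreducible_rep G n \<rho> \<longleftrightarrow> n > 0 \<and> mat_rep G n \<rho> \<and>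
    (\<forall>W. lin_closed n W \<longrightarrow> (\<forall>g\<in>carrier G. \<forall>v\<in>W. \<rho> g *\<^sub>v v \<in> W) \<longrightarrow> W = {0\<^sub>v n} \<or> W = carrier_vec n)"
  unfolding irreducible_rep_def hom_GL_iff subspace_iff_lin_closed by auto

text \<open>Kernel and image of an intertwiner are invariant subspaces. As M is nonzero,
  irreducibility makes the kernel zero and the image everything; preimages of the unit vectors are
  then the columns of the inverse.\<close>

lemma (in group) schur_isomorphism:
  assumes irr: "irreducible_rep G n \<rho>" and irr': "irreducible_rep G n' \<rho>'"
    and M: "M \<in> carrier_mat n n'" and comm: "\<And>g. g \<in> carrier G \<Longrightarrow> \<rho> g * M = M * \<rho>' g"
    and nz: "M \<noteq> 0\<^sub>m n n'"
  shows "\<exists>R\<in>carrier_mat n' n. M * R = 1\<^sub>m n \<and> R * M = 1\<^sub>m n'"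
proof -
  have rep: "mat_rep G n \<rho>" and rep': "mat_rep G n' \<rho>'" using irr irr' irreducible_rep_iff by auto
  note car = mat_repD(1)[OF rep] and car' = mat_repD(1)[OF rep']
  have act: "\<rho> g *\<^sub>v (M *\<^sub>v v) = M *\<^sub>v (\<rho>' g *\<^sub>v v)" if "g \<in> carrier G" "v \<in> carrier_vec n'" for g v
    using comm[OF that(1)] assoc_mult_mat_vec[OF car[OF that(1)] M that(2)]
      assoc_mult_mat_vec[OF M car'[OF that(1)] that(2)] by simp
  define K where "K = {v \<in> carrier_vec n'. M *\<^sub>v v = 0\<^sub>v n}"
  have "lin_closed n' K" unfolding lin_closed_def
  proof (intro conjI ballI allI)
    show "K \<subseteq> carrier_vec n'" unfolding K_def by auto
    show "0\<^sub>v n' \<in> K" unfolding K_def using M by auto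
    show "v + w \<in> K" if "v \<in> K" "w \<in> K" for v w
      using that mult_add_distrib_mat_vec[OF M, of v w] unfolding K_def by simp
    show "c \<cdot>\<^sub>v v \<in> K" if "v \<in> K" for c v
      using that mult_mat_vec[OF M, of v c] unfolding K_def by (auto intro: eq_vecI)
  qed
  moreover have "\<rho>' g *\<^sub>v v \<in> K" if "g \<in> carrier G" "v \<in> K" for g v
  proof -
    have "M *\<^sub>v (\<rho>' g *\<^sub>v v) = \<rho> g *\<^sub>v 0\<^sub>v n" using act[OF that(1), of v] that(2) unfolding K_def by simp
    also have "\<dots> = 0\<^sub>v n" using car[OF that(1)] by (auto intro!: eq_vecI simp: scalar_prod_def)
    finally show ?thesis using that car'[OF that(1)] unfolding K_def by simp
  qed
  ultimately have "K = {0\<^sub>v n'} \<or> K = carrier_vec n'" using irr' irreducible_rep_iff by blast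
  moreover have "K \<noteq> carrier_vec n'"
  proof
    assume K: "K = carrier_vec n'"
    have "M = 0\<^sub>m n n'"
    proof (rule mat_eq_by_vec[OF M])
      fix v :: "complex vec" assume "v \<in> carrier_vec n'"
      then have "v \<in> K" "v \<in> carrier_vec n'" using K by auto
      then show "M *\<^sub>v v = 0\<^sub>m n n' *\<^sub>v v"
        unfolding K_def by (auto intro!: eq_vecI simp: scalar_prod_def)
    qed simp
    then show False using nz by simp
  qed
  ultimately have inj: "v = 0\<^sub>v n'" if "v \<in> carrier_vec n'" "M *\<^sub>v v = 0\<^sub>v n" for v
    using that unfolding K_def by auto
  define I where "I = (\<lambda>v. M *\<^sub>v v) ` carrier_vec n'"
  have "lin_closed n I" unfolding lin_closed_def
  proof (intro conjI ballI allI)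
    show "I \<subseteq> carrier_vec n" using M unfolding I_def by auto
    show "0\<^sub>v n \<in> I" unfolding I_def using M by (auto intro!: image_eqI[of _ _ "0\<^sub>v n'"])
    show "v + w \<in> I" if vw: "v \<in> I" "w \<in> I" for v w
    proof -
      obtain v' w' where "v = M *\<^sub>v v'" "w = M *\<^sub>v w'" "v' \<in> carrier_vec n'" "w' \<in> carrier_vec n'"
        using vw unfolding I_def by auto
      then show ?thesis unfolding I_def
        by (intro image_eqI[of _ _ "v' + w'"]) (auto simp: mult_add_distrib_mat_vec[OF M])
    qed
    show "c \<cdot>\<^sub>v v \<in> I" if v: "v \<in> I" for c v
    proof -
      obtain v' where "v = M *\<^sub>v v'" "v' \<in> carrier_vec n'" using v unfolding I_def by auto
      then show ?thesis unfolding I_def by (intro image_eqI[of _ _ "c \<cdot>\<^sub>v v'"]) (auto simp: mult_mat_vec[OF M])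
    qed
  qed
  moreover have "\<rho> g *\<^sub>v v \<in> I" if "g \<in> carrier G" "v \<in> I" for g v
    using that act mult_mat_vec_carrier[OF car'[OF that(1)]] unfolding I_def by auto
  ultimately have "I = {0\<^sub>v n} \<or> I = carrier_vec n" using irr irreducible_rep_iff by blast
  moreover have "I \<noteq> {0\<^sub>v n}"
  proof
    assume "I = {0\<^sub>v n}"
    then have "K = carrier_vec n'" unfolding I_def K_def by blast
    then show False using \<open>K \<noteq> carrier_vec n'\<close> by blast
  qed
  ultimately have "I = carrier_vec n" by blast
  then have "unit_vec n j \<in> I" for j by simp
  then have "\<exists>v. v \<in> carrier_vec n' \<and> M *\<^sub>v v = unit_vec n j" for j unfolding I_def by (metis imageE)
  then obtain w where w: "\<And>j. w j \<in> carrier_vec n'" "\<And>j. M *\<^sub>v w j = unit_vec n j" by metis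
  define R where "R = mat n' n (\<lambda>(i, j). w j $ i)"
  have R: "R \<in> carrier_mat n' n" unfolding R_def by simp
  have MR: "M * R = 1\<^sub>m n"
  proof (rule eq_matI)
    fix i j assume ij: "i < dim_row (1\<^sub>m n)" "j < dim_col (1\<^sub>m n)"
    have "(M * R) $$ (i, j) = (M *\<^sub>v w j) $ i"
      using ij index_mult_mat_sum[OF M R] index_mult_vec_sum[OF M w(1)] unfolding R_def by simp
    then show "(M * R) $$ (i, j) = 1\<^sub>m n $$ (i, j)" using w(2) ij by (auto simp: unit_vec_def)
  qed (use M R in auto)
  have "R * M = 1\<^sub>m n'"
  proof (rule mat_eq_by_vec)
    fix v :: "complex vec" assume v: "v \<in> carrier_vec n'"
    let ?u = "R *\<^sub>v (M *\<^sub>v v)"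
    have u: "?u \<in> carrier_vec n'" using R M v by simp
    have "M *\<^sub>v ?u = (M * R) *\<^sub>v (M *\<^sub>v v)" using assoc_mult_mat_vec[OF M R] M v by simp
    then have "M *\<^sub>v ?u = M *\<^sub>v v" using MR M v by simp
    then have "M *\<^sub>v (?u - v) = 0\<^sub>v n" using mult_minus_distrib_mat_vec[OF M u v] M v by simp
    then have "?u - v = 0\<^sub>v n'" using inj u v by simp
    then have "?u = v"
      using u v R by (intro eq_vecI) (auto dest!: arg_cong[of _ _ "\<lambda>x. x $ _"] simp: vec_eq_iff)
    then show "R * M *\<^sub>v v = 1\<^sub>m n' *\<^sub>v v" using assoc_mult_mat_vec[OF R M v] v by simp
  qed (use R M in auto)
  then show ?thesis using R MR by blast
qed

text \<open>For an eigenvalue c the intertwiner M - c has a nonzero kernel, so it is not invertible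
  and must vanish.\<close>

lemma (in group) schur_scalar:
  assumes irr: "irreducible_rep G n \<rho>"
    and M: "M \<in> carrier_mat n n" and comm: "\<And>g. g \<in> carrier G \<Longrightarrow> \<rho> g * M = M * \<rho> g"
  shows "\<exists>c. M = c \<cdot>\<^sub>m 1\<^sub>m n"
proof -
  have n: "n > 0" and rep: "mat_rep G n \<rho>" using irr irreducible_rep_iff by auto
  obtain c where "eigenvalue M c" using spectrum_non_empty[OF M n] unfolding spectrum_def by auto
  then obtain v where v: "v \<in> carrier_vec n" "v \<noteq> 0\<^sub>v n" "M *\<^sub>v v = c \<cdot>\<^sub>v v"
    using M unfolding eigenvalue_def eigenvector_def by auto
  define M' where "M' = M - c \<cdot>\<^sub>m 1\<^sub>m n"
  have M': "M' \<in> carrier_mat n n" unfolding M'_def using M by (intro minus_carrier_mat) auto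
  have "M' *\<^sub>v v = 0\<^sub>v n"
    unfolding M'_def using v M
    by (subst minus_mult_distrib_mat_vec[of _ n n]) (auto intro!: eq_vecI simp: scalar_prod_smult_left)
  have comm': "\<rho> g * M' = M' * \<rho> g" if "g \<in> carrier G" for g
  proof -
    note car = mat_repD(1)[OF rep that]
    have "\<rho> g * (c \<cdot>\<^sub>m 1\<^sub>m n) = c \<cdot>\<^sub>m 1\<^sub>m n * \<rho> g"
      using mult_smult_distrib[OF car one_carrier_mat] mult_smult_assoc_mat[OF one_carrier_mat car] car by simp
    then show ?thesis
      unfolding M'_def using M car comm[OF that]
      by (simp add: mult_minus_distrib_mat[of _ n n _ n] minus_mult_distrib_mat[of _ n n _ _ n])
  qed
  have "M' = 0\<^sub>m n n"
  proof (rule ccontr)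
    assume "M' \<noteq> 0\<^sub>m n n"
    then obtain R where R: "R \<in> carrier_mat n n" "R * M' = 1\<^sub>m n"
      using schur_isomorphism[OF irr irr M' comm'] by blast
    have "v = (R * M') *\<^sub>v v" using R v by simp
    also have "\<dots> = R *\<^sub>v 0\<^sub>v n" using assoc_mult_mat_vec[OF R(1) M' v(1)] \<open>M' *\<^sub>v v = 0\<^sub>v n\<close> by simp
    also have "\<dots> = 0\<^sub>v n" using R by (auto intro!: eq_vecI simp: scalar_prod_def)
    finally show False using v by simp
  qed
  then have "M = c \<cdot>\<^sub>m 1\<^sub>m n"
    using M unfolding M'_def by (intro eq_matI) (auto dest!: arg_cong[of _ _ "\<lambda>A. A $$ _"] simp: mat_eq_iff)
  then show ?thesis by blast
qed

locale fin_group = group G for G (structure) +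
  assumes fin: "finite (carrier G)"
begin

lemma sum_mult_left:
  assumes "a \<in> carrier G"
  shows "(\<Sum>g\<in>carrier G. f (a \<otimes> g)) = (\<Sum>g\<in>carrier G. f g)"
  by (rule sum.reindex_bij_witness[of _ "\<lambda>g. inv a \<otimes> g" "\<lambda>g. a \<otimes> g"])
    (use assms in \<open>auto simp: m_assoc[symmetric]\<close>)

lemma sum_inv: "(\<Sum>g\<in>carrier G. f (inv g)) = (\<Sum>g\<in>carrier G. f g)"
  by (rule sum.reindex_bij_witness[of _ "\<lambda>g. inv g" "\<lambda>g. inv g"]) auto

text \<open>The matrix averages to an intertwiner of \<open>\<rho>\<close> and \<open>\<rho>'\<close>: apply Schur's lemma to the
  average of an elementary matrix.\<close>

lemma intertwiner_average:
  assumes rep: "mat_rep G n \<rho>" and rep': "mat_rep G n' \<rho>'" and kl: "k < n" "l < n'" and h: "h \<in> carrier G"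
  defines "M \<equiv> mat n n' (\<lambda>(i, j). \<Sum>g\<in>carrier G. \<rho> g $$ (i, k) * \<rho>' (inv g) $$ (l, j))"
  shows "\<rho> h * M = M * \<rho>' h"
proof (rule eq_matI)
  have M: "M \<in> carrier_mat n n'" unfolding M_def by simp
  note car = mat_repD(1)[OF rep] and car' = mat_repD(1)[OF rep']
  show "dim_row (\<rho> h * M) = dim_row (M * \<rho>' h)" "dim_col (\<rho> h * M) = dim_col (M * \<rho>' h)"
    using car[OF h] car'[OF h] M by auto
  fix i j assume "i < dim_row (M * \<rho>' h)" "j < dim_col (M * \<rho>' h)"
  then have ij: "i < n" "j < n'" using car'[OF h] M by auto
  have "(\<rho> h * M) $$ (i, j) = (\<Sum>a<n. \<Sum>g\<in>carrier G. \<rho> h $$ (i, a) * \<rho> g $$ (a, k) * \<rho>' (inv g) $$ (l, j))"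
    using ij by (subst index_mult_mat_sum[OF car[OF h] M]) (auto simp: M_def sum_distrib_left mult.assoc)
  also have "\<dots> = (\<Sum>g\<in>carrier G. \<rho> (h \<otimes> g) $$ (i, k) * \<rho>' (inv g) $$ (l, j))"
    using ij kl h by (subst sum.swap) (simp add: mat_rep_entry[OF rep] sum_distrib_right)
  also have "\<dots> = (\<Sum>g\<in>carrier G. \<rho> (h \<otimes> g) $$ (i, k) * \<rho>' (inv (h \<otimes> g) \<otimes> h) $$ (l, j))"
    using h by (intro sum.cong) (auto simp: inv_mult_group m_assoc)
  also have "\<dots> = (\<Sum>g\<in>carrier G. \<rho> g $$ (i, k) * \<rho>' (inv g \<otimes> h) $$ (l, j))"
    by (rule sum_mult_left[OF h, of "\<lambda>g. \<rho> g $$ (i, k) * \<rho>' (inv g \<otimes> h) $$ (l, j)"])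
  also have "\<dots> = (\<Sum>b<n'. \<Sum>g\<in>carrier G. \<rho> g $$ (i, k) * \<rho>' (inv g) $$ (l, b) * \<rho>' h $$ (b, j))"
    using ij kl h by (subst sum.swap) (simp add: mat_rep_entry[OF rep'] sum_distrib_left mult.assoc)
  also have "\<dots> = (M * \<rho>' h) $$ (i, j)"
    using ij by (subst index_mult_mat_sum[OF M car'[OF h]]) (auto simp: M_def sum_distrib_right)
  finally show "(\<rho> h * M) $$ (i, j) = (M * \<rho>' h) $$ (i, j)" .
qed

lemma coefficient_orthogonality:
  assumes irr: "irreducible_rep G n \<rho>" and "i < n" "j < n" "k < n" "l < n"
  shows "(\<Sum>g\<in>carrier G. \<rho> g $$ (i, k) * \<rho> (inv g) $$ (l, j)) =
    (if i = j \<and> k = l then of_nat (card (carrier G)) / of_nat n else 0)"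
proof -
  have n: "n > 0" and rep: "mat_rep G n \<rho>" using irr irreducible_rep_iff by auto
  define M where "M = mat n n (\<lambda>(i, j). \<Sum>g\<in>carrier G. \<rho> g $$ (i, k) * \<rho> (inv g) $$ (l, j))"
  have M: "M \<in> carrier_mat n n" unfolding M_def by simp
  obtain c where c: "M = c \<cdot>\<^sub>m 1\<^sub>m n"
    using schur_scalar[OF irr M] intertwiner_average[OF rep rep, of k l] assms unfolding M_def by blast
  have entry: "(\<Sum>g\<in>carrier G. \<rho> g $$ (a, k) * \<rho> (inv g) $$ (l, b)) = (if a = b then c else 0)"
    if "a < n" "b < n" for a b
  proof -
    have "M $$ (a, b) = (if a = b then c else 0)" unfolding c using that by simp
    then show ?thesis unfolding M_def using that by simp
  qed
  \<comment> \<open>The scalar is determined by the trace of M: summing over the diagonal joins the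
    two coefficients into one coefficient of the matrix of the unit element.\<close>
  have "of_nat n * c = (\<Sum>a<n. \<Sum>g\<in>carrier G. \<rho> g $$ (a, k) * \<rho> (inv g) $$ (l, a))"
    using entry by simp
  also have "\<dots> = (\<Sum>g\<in>carrier G. \<rho> (inv g \<otimes> g) $$ (l, k))"
    using assms(2-)
    by (subst sum.swap) (intro sum.cong refl, subst mat_rep_entry[OF rep], auto simp: mult.commute)
  also have "\<dots> = (\<Sum>g\<in>carrier G. if k = l then 1 else 0)"
    using assms(2-) mat_repD(3)[OF rep] by (intro sum.cong) auto
  finally have "c = (if k = l then of_nat (card (carrier G)) / of_nat n else 0)"
    using n by (auto simp: field_simps split: if_splits)
  then show ?thesis using entry[of i j] assms by auto
qed

text \<open>A nonzero average would be an isomorphism of the two representations, and isomorphic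
  representations have equal characters. Hence distinct characters may stand for non-isomorphic
  representations.\<close>

lemma coefficient_orthogonality_distinct:
  assumes irr: "irreducible_rep G n \<rho>" and irr': "irreducible_rep G n' \<rho>'"
    and ijkl: "i < n" "j < n'" "k < n" "l < n'"
    and neq: "(\<lambda>g\<in>carrier G. mat_trace (\<rho> g)) \<noteq> (\<lambda>g\<in>carrier G. mat_trace (\<rho>' g))"
  shows "(\<Sum>g\<in>carrier G. \<rho> g $$ (i, k) * \<rho>' (inv g) $$ (l, j)) = 0"
proof -
  have rep: "mat_rep G n \<rho>" and rep': "mat_rep G n' \<rho>'" using irr irr' irreducible_rep_iff by auto
  define M where "M = mat n n' (\<lambda>(i, j). \<Sum>g\<in>carrier G. \<rho> g $$ (i, k) * \<rho>' (inv g) $$ (l, j))"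
  have M: "M \<in> carrier_mat n n'" unfolding M_def by simp
  have comm: "\<rho> g * M = M * \<rho>' g" if "g \<in> carrier G" for g
    unfolding M_def using intertwiner_average[OF rep rep' _ _ that, of k l] ijkl by blast
  have "M = 0\<^sub>m n n'"
  proof (rule ccontr)
    assume "M \<noteq> 0\<^sub>m n n'"
    then obtain R where R: "R \<in> carrier_mat n' n" "M * R = 1\<^sub>m n" "R * M = 1\<^sub>m n'"
      using schur_isomorphism[OF irr irr' M comm] by blast
    have "mat_trace (\<rho> g) = mat_trace (\<rho>' g)" if g: "g \<in> carrier G" for g
    proof -
      note cg = mat_repD(1)[OF rep g] and cg' = mat_repD(1)[OF rep' g]
      have "\<rho> g = \<rho> g * (M * R)" using R cg by simp
      also have "\<dots> = M * (\<rho>' g * R)"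
        using comm[OF g] assoc_mult_mat[OF cg M R(1)] assoc_mult_mat[OF M cg' R(1)] by simp
      finally have "mat_trace (\<rho> g) = mat_trace (\<rho>' g * R * M)"
        using mat_trace_comm[OF M, of "\<rho>' g * R"] cg' R by simp
      also have "\<rho>' g * R * M = \<rho>' g" using assoc_mult_mat[OF cg' R(1) M] R cg' by simp
      finally show ?thesis .
    qed
    then show False using neq by (auto simp: restrict_def)
  qed
  then have "M $$ (i, j) = 0" using ijkl by simp
  then show ?thesis unfolding M_def using ijkl by simp
qed

end

section \<open>The group algebra\<close>

text \<open>Elements of group algebras are functions on the whole type that vanish off a set, so
  that the algebra of a subgroup lies inside that of G. Characters, in contrast, are
  \<open>undefined\<close> off their group.\<close>

definition fn_on :: "'g set \<Rightarrow> ('g \<Rightarrow> complex) set" where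
  "fn_on K = {f. \<forall>x. x \<notin> K \<longrightarrow> f x = 0}"

lemma fn_onI: "(\<And>x. x \<notin> K \<Longrightarrow> f x = 0) \<Longrightarrow> f \<in> fn_on K"
  unfolding fn_on_def by blast

lemma fn_onD: "f \<in> fn_on K \<Longrightarrow> x \<notin> K \<Longrightarrow> f x = 0"
  unfolding fn_on_def by blast

lemma fn_on_mono: "f \<in> fn_on K \<Longrightarrow> K \<subseteq> L \<Longrightarrow> f \<in> fn_on L"
  unfolding fn_on_def by blast

lemma sum_fn_on:
  assumes "f \<in> fn_on K" "K \<subseteq> L" "finite L"
  shows "(\<Sum>x\<in>L. f x * h x) = (\<Sum>x\<in>K. f x * h x)"
  using assms by (intro sum.mono_neutral_right) (auto simp: fn_on_def)

text \<open>By \<open>char_deg_Irr\<close> the rounding is exact on irreducible characters.\<close>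

definition char_deg :: "('g, 'm) monoid_scheme \<Rightarrow> ('g \<Rightarrow> complex) \<Rightarrow> nat" where
  "char_deg G \<chi> = nat \<lfloor>Re (\<chi> \<one>\<^bsub>G\<^esub>)\<rfloor>"

lemma (in subgroup) restrict_fin_group:
  assumes "fin_group G"
  shows "fin_group (G\<lparr>carrier := H\<rparr>)"
proof -
  interpret fin_group G by fact
  show ?thesis
    using subgroup_imp_group[OF subgroup_axioms] finite_subset[OF subset fin]
    by (simp add: fin_group_def fin_group_axioms_def)
qed

context fin_group
begin

definition conv :: "('a \<Rightarrow> complex) \<Rightarrow> ('a \<Rightarrow> complex) \<Rightarrow> 'a \<Rightarrow> complex" (infixl \<open>\<star>\<close> 70) where
  "f \<star> h = (\<lambda>x. if x \<in> carrier G then \<Sum>y\<in>carrier G. f y * h (inv y \<otimes> x) else 0)"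

definition delta :: "'a \<Rightarrow> complex" where
  "delta = (\<lambda>x. if x = \<one> then 1 else 0)"

text \<open>The invariance is required on all of G, not only on K: these elements commute with the
  group algebra of K, see \<open>conv_commute\<close>.\<close>

definition conj_inv :: "'a set \<Rightarrow> ('a \<Rightarrow> complex) \<Rightarrow> bool" where
  "conj_inv K f \<longleftrightarrow> (\<forall>k\<in>K. \<forall>x\<in>carrier G. f (k \<otimes> x \<otimes> inv k) = f x)"

text \<open>The central primitive idempotent of the group algebra of K belonging to \<theta>. It is
  written with the value at the inverse rather than a complex conjugate, which fits the form of the
  orthogonality relations proved here.\<close>

definition idem :: "'a set \<Rightarrow> ('a \<Rightarrow> complex) \<Rightarrow> 'a \<Rightarrow> complex" where
  "idem K \<theta> = (\<lambda>x. if x \<in> K then \<theta> \<one> / of_nat (card K) * \<theta> (inv x) else 0)"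

abbreviation sub :: "'a set \<Rightarrow> ('a, 'b) monoid_scheme" where
  "sub K \<equiv> G\<lparr>carrier := K\<rparr>"

lemma finite_sub: "subgroup K G \<Longrightarrow> finite K"
  using fin subgroup.subset finite_subset by blast

lemma card_sub_pos: "subgroup K G \<Longrightarrow> card K > 0"
  using finite_sub subgroup.one_closed by (fastforce simp: card_gt_0_iff)

lemma sub_fin_group: "subgroup K G \<Longrightarrow> fin_group (sub K)"
  using subgroup.restrict_fin_group fin_group_axioms by blast

lemma conv_alt:
  assumes "x \<in> carrier G"
  shows "(f \<star> h) x = (\<Sum>z\<in>carrier G. f (x \<otimes> inv z) * h z)"
proof -
  have "(f \<star> h) x = (\<Sum>y\<in>carrier G. f y * h (inv y \<otimes> x))" using assms by (simp add: conv_def)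
  also have "\<dots> = (\<Sum>z\<in>carrier G. f (x \<otimes> inv z) * h z)"
    by (rule sum.reindex_bij_witness[of _ "\<lambda>z. x \<otimes> inv z" "\<lambda>y. inv y \<otimes> x"])
      (use assms in \<open>auto simp: inv_mult_group m_assoc, auto simp: m_assoc[symmetric]\<close>)
  finally show ?thesis .
qed

lemma conv_assoc: "(f \<star> h) \<star> k = f \<star> (h \<star> k)"
proof
  fix x
  show "((f \<star> h) \<star> k) x = (f \<star> (h \<star> k)) x"
  proof (cases "x \<in> carrier G")
    case x: True
    have "((f \<star> h) \<star> k) x = (\<Sum>y\<in>carrier G. \<Sum>z\<in>carrier G. f z * (h (inv z \<otimes> y) * k (inv y \<otimes> x)))"
      using x by (simp add: conv_def sum_distrib_right mult.assoc)
    also have "\<dots> = (\<Sum>z\<in>carrier G. \<Sum>y\<in>carrier G. f z * (h (inv z \<otimes> y) * k (inv y \<otimes> x)))"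
      by (rule sum.swap)
    also have "\<dots> = (\<Sum>z\<in>carrier G. f z * (h \<star> k) (inv z \<otimes> x))"
    proof (rule sum.cong[OF refl])
      fix z assume z: "z \<in> carrier G"
      have "(\<Sum>y\<in>carrier G. h (inv z \<otimes> y) * k (inv y \<otimes> x)) =
          (\<Sum>w\<in>carrier G. h (inv z \<otimes> (z \<otimes> w)) * k (inv (z \<otimes> w) \<otimes> x))"
        using sum_mult_left[OF z, of "\<lambda>y. h (inv z \<otimes> y) * k (inv y \<otimes> x)"] by simp
      also have "\<dots> = (\<Sum>w\<in>carrier G. h w * k (inv w \<otimes> (inv z \<otimes> x)))"
        using x z by (intro sum.cong) (auto simp: inv_mult_group m_assoc, auto simp: m_assoc[symmetric])
      finally show "(\<Sum>y\<in>carrier G. f z * (h (inv z \<otimes> y) * k (inv y \<otimes> x))) = f z * (h \<star> k) (inv z \<otimes> x)"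
        using x z by (simp add: conv_def sum_distrib_left[symmetric])
    qed
    finally show ?thesis using x by (simp add: conv_def)
  qed (simp add: conv_def)
qed

lemma conv_scale_left: "(\<lambda>x. c * f x) \<star> h = (\<lambda>x. c * (f \<star> h) x)"
  by (auto simp: conv_def sum_distrib_left mult.assoc)

lemma conv_scale_right: "f \<star> (\<lambda>x. c * h x) = (\<lambda>x. c * (f \<star> h) x)"
  by (auto simp: conv_def sum_distrib_left mult.assoc mult.left_commute)

lemma conv_sum_left: "(\<lambda>x. \<Sum>i\<in>I. F i x) \<star> h = (\<lambda>x. \<Sum>i\<in>I. (F i \<star> h) x)"
proof
  fix x
  show "((\<lambda>x. \<Sum>i\<in>I. F i x) \<star> h) x = (\<Sum>i\<in>I. (F i \<star> h) x)"
    unfolding conv_def by (auto simp: sum_distrib_right intro: sum.swap)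
qed

lemma conv_sum_right: "h \<star> (\<lambda>x. \<Sum>i\<in>I. F i x) = (\<lambda>x. \<Sum>i\<in>I. (h \<star> F i) x)"
proof
  fix x
  show "(h \<star> (\<lambda>x. \<Sum>i\<in>I. F i x)) x = (\<Sum>i\<in>I. (h \<star> F i) x)"
    unfolding conv_def by (auto simp: sum_distrib_left intro: sum.swap)
qed

lemma conv_diff_left: "(\<lambda>x. f x - f' x) \<star> h = (\<lambda>x. (f \<star> h) x - (f' \<star> h) x)"
  by (auto simp: conv_def sum_subtractf left_diff_distrib)

lemma conv_diff_right: "h \<star> (\<lambda>x. f x - f' x) = (\<lambda>x. (h \<star> f) x - (h \<star> f') x)"
  by (auto simp: conv_def sum_subtractf right_diff_distrib)

lemma conv_zero_left [simp]: "(\<lambda>_. 0) \<star> h = (\<lambda>_. 0)"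
  by (auto simp: conv_def)

lemma conv_zero_right [simp]: "h \<star> (\<lambda>_. 0) = (\<lambda>_. 0)"
  by (auto simp: conv_def)

lemma delta_conv: "f \<in> fn_on (carrier G) \<Longrightarrow> delta \<star> f = f"
proof
  fix x assume f: "f \<in> fn_on (carrier G)"
  have "(\<Sum>y\<in>carrier G. delta y * f (inv y \<otimes> x)) = (\<Sum>y\<in>carrier G. if y = \<one> then f (inv y \<otimes> x) else 0)"
    by (intro sum.cong) (auto simp: delta_def)
  then show "(delta \<star> f) x = f x"
    using f fin by (auto simp: conv_def fn_on_def)
qed

lemma conv_delta: "f \<in> fn_on (carrier G) \<Longrightarrow> f \<star> delta = f"
proof
  fix x assume f: "f \<in> fn_on (carrier G)"
  show "(f \<star> delta) x = f x"
  proof (cases "x \<in> carrier G")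
    case True
    have "(f \<star> delta) x = (\<Sum>y\<in>carrier G. if y = \<one> then f (x \<otimes> inv y) else 0)"
      unfolding conv_alt[OF True] by (intro sum.cong) (auto simp: delta_def)
    then show ?thesis using True fin by simp
  qed (use f in \<open>auto simp: conv_def fn_on_def\<close>)
qed

lemma conv_set_mult:
  assumes f: "f \<in> fn_on X" and h: "h \<in> fn_on Y" and X: "X \<subseteq> carrier G" and Y: "Y \<subseteq> carrier G"
  shows "f \<star> h \<in> fn_on (X <#> Y)"
proof (rule fn_onI)
  fix x assume x: "x \<notin> X <#> Y"
  have "f y * h (inv y \<otimes> x) = 0" if "x \<in> carrier G" "y \<in> carrier G" for y
  proof (rule ccontr)
    assume "f y * h (inv y \<otimes> x) \<noteq> 0"
    then have "y \<in> X" "inv y \<otimes> x \<in> Y" using fn_onD[OF f] fn_onD[OF h] by auto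
    moreover have "x = y \<otimes> (inv y \<otimes> x)" using that by (simp add: m_assoc[symmetric])
    ultimately show False using x unfolding set_mult_def by blast
  qed
  then show "(f \<star> h) x = 0" by (auto simp: conv_def intro: sum.neutral)
qed

lemma set_mult_subgroup: "subgroup K G \<Longrightarrow> K <#> K = K"
proof
  assume K: "subgroup K G"
  show "K <#> K \<subseteq> K" using subgroup.m_closed[OF K] unfolding set_mult_def by auto
  show "K \<subseteq> K <#> K"
  proof
    fix x assume x: "x \<in> K"
    then have "x = x \<otimes> \<one>" using subgroup.subset[OF K] by auto
    then show "x \<in> K <#> K" using x subgroup.one_closed[OF K] unfolding set_mult_def by blast
  qed
qed

lemma conv_sub_closed:
  assumes "subgroup K G" "f \<in> fn_on K" "h \<in> fn_on K"
  shows "f \<star> h \<in> fn_on K"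
  using conv_set_mult[OF assms(2,3)] set_mult_subgroup[OF assms(1)] subgroup.subset[OF assms(1)] by simp

lemma conv_sub:
  assumes "subgroup K G" "f \<in> fn_on K" "x \<in> carrier G"
  shows "(f \<star> h) x = (\<Sum>y\<in>K. f y * h (inv y \<otimes> x))"
  using assms sum_fn_on[of f K "carrier G"] fin subgroup.subset by (fastforce simp: conv_def)

lemma conv_commute:
  assumes K: "K \<subseteq> carrier G" and f: "conj_inv K f" and h: "h \<in> fn_on K"
  shows "f \<star> h = h \<star> f"
proof
  fix x
  show "(f \<star> h) x = (h \<star> f) x"
  proof (cases "x \<in> carrier G")
    case x: True
    have "f (x \<otimes> inv z) * h z = h z * f (inv z \<otimes> x)" if z: "z \<in> carrier G" for z
    proof (cases "z \<in> K")
      case True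
      have "f (inv z \<otimes> x) = f (z \<otimes> (inv z \<otimes> x) \<otimes> inv z)" using True f x z by (simp add: conj_inv_def)
      also have "z \<otimes> (inv z \<otimes> x) \<otimes> inv z = x \<otimes> inv z" using x z by (simp add: m_assoc[symmetric])
      finally show ?thesis by simp
    qed (simp add: fn_onD[OF h])
    then have "(\<Sum>z\<in>carrier G. f (x \<otimes> inv z) * h z) = (\<Sum>z\<in>carrier G. h z * f (inv z \<otimes> x))"
      by (intro sum.cong) auto
    then show ?thesis using conv_alt[OF x, of f h] x by (simp add: conv_def)
  qed (simp add: conv_def)
qed

lemma conj_inv_conv:
  assumes K: "subgroup K G" and f: "conj_inv K f" and h: "conj_inv K h"
  shows "conj_inv K (f \<star> h)"
  unfolding conj_inv_def
proof (intro ballI)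
  fix k x assume k: "k \<in> K" and x: "x \<in> carrier G"
  have kc: "k \<in> carrier G" using k subgroup.subset[OF K] by auto
  have "(f \<star> h) (k \<otimes> x \<otimes> inv k) = (\<Sum>y\<in>carrier G. f y * h (inv y \<otimes> (k \<otimes> x \<otimes> inv k)))"
    using kc x by (simp add: conv_def)
  also have "\<dots> = (\<Sum>y\<in>carrier G. f (k \<otimes> y \<otimes> inv k) * h (inv (k \<otimes> y \<otimes> inv k) \<otimes> (k \<otimes> x \<otimes> inv k)))"
    by (rule sum.reindex_bij_witness[of _ "\<lambda>y. k \<otimes> y \<otimes> inv k" "\<lambda>y. inv k \<otimes> y \<otimes> k"])
      (use kc x in \<open>auto simp: m_assoc, auto simp: m_assoc[symmetric]\<close>)
  also have "\<dots> = (\<Sum>y\<in>carrier G. f y * h (inv y \<otimes> x))"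
  proof (rule sum.cong[OF refl])
    fix y assume y: "y \<in> carrier G"
    have "inv (k \<otimes> y \<otimes> inv k) \<otimes> (k \<otimes> x \<otimes> inv k) = k \<otimes> (inv y \<otimes> x) \<otimes> inv k"
      using kc x y by (simp add: inv_mult_group m_assoc, simp add: m_assoc[symmetric])
    then show "f (k \<otimes> y \<otimes> inv k) * h (inv (k \<otimes> y \<otimes> inv k) \<otimes> (k \<otimes> x \<otimes> inv k)) = f y * h (inv y \<otimes> x)"
      using f h k x y by (simp add: conj_inv_def)
  qed
  finally show "(f \<star> h) (k \<otimes> x \<otimes> inv k) = (f \<star> h) x" using x by (simp add: conv_def)
qed

lemma conj_inv_mono: "conj_inv K f \<Longrightarrow> L \<subseteq> K \<Longrightarrow> conj_inv L f"
  unfolding conj_inv_def by blast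

text \<open>The linear extension of a representation to the group algebra of K, multiplicative by
  \<open>rep_fun_conv\<close>.\<close>

definition rep_fun :: "'a set \<Rightarrow> nat \<Rightarrow> ('a \<Rightarrow> complex mat) \<Rightarrow> ('a \<Rightarrow> complex) \<Rightarrow> complex mat" where
  "rep_fun K n \<rho> f = mat n n (\<lambda>(i, j). \<Sum>g\<in>K. f g * \<rho> g $$ (i, j))"

lemma rep_fun_carrier [simp]: "rep_fun K n \<rho> f \<in> carrier_mat n n"
  unfolding rep_fun_def by simp

lemma sum_sub_left:
  assumes "subgroup K G" "a \<in> K"
  shows "(\<Sum>g\<in>K. f (a \<otimes> g)) = (\<Sum>g\<in>K. f g)"
  using fin_group.sum_mult_left[OF sub_fin_group[OF assms(1)], of a f] assms by simp

lemma rep_fun_conv: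
  assumes K: "subgroup K G" and rep: "mat_rep (sub K) n \<rho>" and f: "f \<in> fn_on K" and h: "h \<in> fn_on K"
  shows "rep_fun K n \<rho> (f \<star> h) = rep_fun K n \<rho> f * rep_fun K n \<rho> h"
proof (rule eq_matI)
  interpret K: subgroup K G by fact
  fix i j assume "i < dim_row (rep_fun K n \<rho> f * rep_fun K n \<rho> h)" "j < dim_col (rep_fun K n \<rho> f * rep_fun K n \<rho> h)"
  then have ij: "i < n" "j < n" by (auto simp: rep_fun_def)
  have "rep_fun K n \<rho> (f \<star> h) $$ (i, j) = (\<Sum>x\<in>K. \<Sum>y\<in>K. f y * (h (inv y \<otimes> x) * \<rho> x $$ (i, j)))"
    using ij by (simp add: rep_fun_def conv_sub[OF K f] K.subset[THEN subsetD] sum_distrib_right mult.assoc)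
  also have "\<dots> = (\<Sum>y\<in>K. f y * (\<Sum>x\<in>K. h (inv y \<otimes> x) * \<rho> x $$ (i, j)))"
    by (subst sum.swap) (simp add: sum_distrib_left)
  also have "\<dots> = (\<Sum>y\<in>K. f y * (\<Sum>x\<in>K. h x * \<rho> (y \<otimes> x) $$ (i, j)))"
  proof (rule sum.cong[OF refl])
    fix y assume y: "y \<in> K"
    have "(\<Sum>x\<in>K. h (inv y \<otimes> x) * \<rho> x $$ (i, j)) =
        (\<Sum>x\<in>K. h (inv y \<otimes> (y \<otimes> x)) * \<rho> (y \<otimes> x) $$ (i, j))"
      using sum_sub_left[OF K y, of "\<lambda>x. h (inv y \<otimes> x) * \<rho> x $$ (i, j)"] by simp
    then show "f y * (\<Sum>x\<in>K. h (inv y \<otimes> x) * \<rho> x $$ (i, j)) = f y * (\<Sum>x\<in>K. h x * \<rho> (y \<otimes> x) $$ (i, j))"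
      using y by (simp add: m_assoc[symmetric])
  qed
  also have "\<dots> = (\<Sum>y\<in>K. \<Sum>x\<in>K. \<Sum>a<n. (f y * \<rho> y $$ (i, a)) * (h x * \<rho> x $$ (a, j)))"
    using ij mat_rep_entry[OF rep] by (simp add: sum_distrib_left mult_ac)
  also have "\<dots> = (\<Sum>y\<in>K. \<Sum>a<n. \<Sum>x\<in>K. (f y * \<rho> y $$ (i, a)) * (h x * \<rho> x $$ (a, j)))"
    by (intro sum.cong refl sum.swap)
  also have "\<dots> = (\<Sum>a<n. \<Sum>y\<in>K. \<Sum>x\<in>K. (f y * \<rho> y $$ (i, a)) * (h x * \<rho> x $$ (a, j)))"
    by (rule sum.swap)
  also have "\<dots> = (rep_fun K n \<rho> f * rep_fun K n \<rho> h) $$ (i, j)"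
    using ij by (subst index_mult_mat_sum[of _ n n _ n]) (auto simp: rep_fun_def sum_product)
  finally show "rep_fun K n \<rho> (f \<star> h) $$ (i, j) = (rep_fun K n \<rho> f * rep_fun K n \<rho> h) $$ (i, j)" .
qed (auto simp: rep_fun_def)

lemma trace_rep_fun:
  assumes "mat_rep (sub K) n \<rho>"
  shows "mat_trace (rep_fun K n \<rho> f) = (\<Sum>g\<in>K. f g * mat_trace (\<rho> g))"
proof -
  have "mat_trace (rep_fun K n \<rho> f) = (\<Sum>g\<in>K. \<Sum>i<n. f g * \<rho> g $$ (i, i))"
    by (subst sum.swap) (simp add: mat_trace_def rep_fun_def)
  also have "\<dots> = (\<Sum>g\<in>K. f g * mat_trace (\<rho> g))"
    using mat_repD(1)[OF assms] by (intro sum.cong) (auto simp: mat_trace_def sum_distrib_left)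
  finally show ?thesis .
qed

lemma Irr_obtain_rep:
  assumes K: "subgroup K G" and \<theta>: "\<theta> \<in> Irr (sub K)"
  obtains \<rho> where "irreducible_rep (sub K) (char_deg G \<theta>) \<rho>" "mat_rep (sub K) (char_deg G \<theta>) \<rho>"
    "\<theta> = (\<lambda>g\<in>K. mat_trace (\<rho> g))" "\<theta> \<one> = of_nat (char_deg G \<theta>)" "char_deg G \<theta> > 0"
proof -
  interpret S: fin_group "sub K" by (rule sub_fin_group[OF K])
  obtain n \<rho> where irr: "irreducible_rep (sub K) n \<rho>" and \<theta>_eq: "\<theta> = (\<lambda>g\<in>K. mat_trace (\<rho> g))"
    using \<theta> unfolding Irr_def by auto
  have rep: "mat_rep (sub K) n \<rho>" "n > 0" using irr S.irreducible_rep_iff by auto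
  have "\<theta> \<one> = of_nat n"
    using mat_repD(3)[OF rep(1)] subgroup.one_closed[OF K] by (simp add: \<theta>_eq mat_trace_def)
  then show ?thesis using that[of \<rho>] irr rep \<theta>_eq by (auto simp: char_deg_def)
qed

lemma char_deg_Irr:
  assumes "subgroup K G" "\<theta> \<in> Irr (sub K)"
  shows "\<theta> \<one> = of_nat (char_deg G \<theta>)" "char_deg G \<theta> > 0"
  using Irr_obtain_rep[OF assms] by metis+

lemma sub_orthogonality:
  assumes "subgroup K G" "irreducible_rep (sub K) n \<rho>" "i < n" "j < n" "k < n" "l < n"
  shows "(\<Sum>g\<in>K. \<rho> g $$ (i, k) * \<rho> (inv g) $$ (l, j)) =
    (if i = j \<and> k = l then of_nat (card K) / of_nat n else 0)"
proof -
  have "(\<Sum>g\<in>K. \<rho> g $$ (i, k) * \<rho> (inv g) $$ (l, j)) =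
      (\<Sum>g\<in>carrier (sub K). \<rho> g $$ (i, k) * \<rho> (inv\<^bsub>sub K\<^esub> g) $$ (l, j))"
    by (intro sum.cong) (auto simp: m_inv_consistent[OF assms(1)])
  then show ?thesis
    using fin_group.coefficient_orthogonality[OF sub_fin_group[OF assms(1)] assms(2-)] by simp
qed

lemma Irr_orthogonality:
  assumes K: "subgroup K G" and \<theta>: "\<theta> \<in> Irr (sub K)" and \<theta>': "\<theta>' \<in> Irr (sub K)"
  shows "(\<Sum>g\<in>K. \<theta> g * \<theta>' (inv g)) = (if \<theta> = \<theta>' then of_nat (card K) else 0)"
proof (cases "\<theta> = \<theta>'")
  case True
  obtain \<rho> where \<rho>: "irreducible_rep (sub K) (char_deg G \<theta>) \<rho>" "mat_rep (sub K) (char_deg G \<theta>) \<rho>"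
    "\<theta> = (\<lambda>g\<in>K. mat_trace (\<rho> g))" "char_deg G \<theta> > 0"
    using Irr_obtain_rep[OF K \<theta>] by metis
  let ?n = "char_deg G \<theta>"
  have val: "\<theta> g = (\<Sum>i<?n. \<rho> g $$ (i, i))" if "g \<in> K" for g
    using that mat_repD(1)[OF \<rho>(2), of g] by (subst \<rho>(3)) (simp add: mat_trace_def)
  have inv: "inv g \<in> K" if "g \<in> K" for g using subgroup.m_inv_closed[OF K that] .
  have "(\<Sum>g\<in>K. \<theta> g * \<theta> (inv g)) = (\<Sum>g\<in>K. \<Sum>i<?n. \<Sum>j<?n. \<rho> g $$ (i, i) * \<rho> (inv g) $$ (j, j))"
    by (intro sum.cong refl) (simp add: val inv sum_product)
  also have "\<dots> = (\<Sum>i<?n. \<Sum>j<?n. \<Sum>g\<in>K. \<rho> g $$ (i, i) * \<rho> (inv g) $$ (j, j))"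
    by (subst sum.swap) (intro sum.cong refl sum.swap)
  also have "\<dots> = (\<Sum>i<?n. \<Sum>j<?n. if i = j then of_nat (card K) / of_nat ?n else 0)"
    by (intro sum.cong refl) (simp add: sub_orthogonality[OF K \<rho>(1)])
  also have "\<dots> = of_nat (card K)" using \<rho>(4) by simp
  finally show ?thesis using True by simp
next
  case False
  obtain n \<rho> where \<rho>: "irreducible_rep (sub K) n \<rho>" "mat_rep (sub K) n \<rho>" "\<theta> = (\<lambda>g\<in>K. mat_trace (\<rho> g))"
    using Irr_obtain_rep[OF K \<theta>] by metis
  obtain n' \<rho>' where \<rho>': "irreducible_rep (sub K) n' \<rho>'" "mat_rep (sub K) n' \<rho>'" "\<theta>' = (\<lambda>g\<in>K. mat_trace (\<rho>' g))"
    using Irr_obtain_rep[OF K \<theta>'] by metis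
  have inv: "inv g \<in> K" if "g \<in> K" for g using subgroup.m_inv_closed[OF K that] .
  have "(\<Sum>g\<in>K. \<theta> g * \<theta>' (inv g)) = (\<Sum>g\<in>K. \<Sum>i<n. \<Sum>j<n'. \<rho> g $$ (i, i) * \<rho>' (inv g) $$ (j, j))"
    unfolding \<rho>(3) \<rho>'(3) using inv mat_repD(1)[OF \<rho>(2)] mat_repD(1)[OF \<rho>'(2)]
    by (intro sum.cong) (auto simp: mat_trace_def sum_product carrier_matD[of _ n n] carrier_matD[of _ n' n'])
  also have "\<dots> = (\<Sum>i<n. \<Sum>j<n'. \<Sum>g\<in>K. \<rho> g $$ (i, i) * \<rho>' (inv g) $$ (j, j))"
    by (subst sum.swap) (intro sum.cong refl sum.swap)
  also have "\<dots> = (\<Sum>i<n. \<Sum>j<n'. \<Sum>g\<in>carrier (sub K). \<rho> g $$ (i, i) * \<rho>' (inv\<^bsub>sub K\<^esub> g) $$ (j, j))"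
    by (intro sum.cong refl) (auto simp: m_inv_consistent[OF K])
  also have "\<dots> = 0"
    using fin_group.coefficient_orthogonality_distinct[OF sub_fin_group[OF K] \<rho>(1) \<rho>'(1)] False
    unfolding \<rho>(3) \<rho>'(3) by simp
  finally show ?thesis using False by simp
qed


section \<open>Values of irreducible characters: inverses, products, conjugates\<close>

lemma Irr_value:
  assumes "mat_rep (sub K) n \<rho>" "\<theta> = (\<lambda>g\<in>K. mat_trace (\<rho> g))" "g \<in> K"
  shows "\<theta> g = (\<Sum>i<n. \<rho> g $$ (i, i))"
  using assms mat_repD(1)[OF assms(1), of g] by (simp add: mat_trace_def)

text \<open>The inverse of x is a power of x, and raising to this power turns each eigenvalue of the
  matrix of x into its conjugate.\<close>

lemma Irr_cnj:
  assumes K: "subgroup K G" and \<theta>: "\<theta> \<in> Irr (sub K)" and x: "x \<in> K"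
  shows "\<theta> (inv x) = cnj (\<theta> x)"
proof -
  interpret S: fin_group "sub K" by (rule sub_fin_group[OF K])
  obtain \<rho> where rep: "mat_rep (sub K) (char_deg G \<theta>) \<rho>" and \<theta>_eq: "\<theta> = (\<lambda>g\<in>K. mat_trace (\<rho> g))"
    using Irr_obtain_rep[OF K \<theta>] by metis
  define n where "n = char_deg G \<theta>"
  note rep = rep[folded n_def]
  define k where "k = card K"
  have k: "k > 0" unfolding k_def by (rule card_sub_pos[OF K])
  have xs: "x \<in> carrier (sub K)" using x by simp
  have Ux: "\<rho> x \<in> carrier_mat n n" using mat_repD(1)[OF rep] x by simp
  have pow: "\<rho> (x [^]\<^bsub>sub K\<^esub> j) = \<rho> x ^\<^sub>m j" for j :: nat
  proof (induction j)
    case 0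
    then show ?case using mat_repD(3)[OF rep] Ux by simp
  next
    case (Suc j)
    then show ?case using mat_repD(2)[OF rep, of "x [^]\<^bsub>sub K\<^esub> j" x] S.nat_pow_closed[OF xs] x by simp
  qed
  have xk: "x [^]\<^bsub>sub K\<^esub> k = \<one>" using S.pow_order_eq_1[OF xs] by (simp add: Coset.order_def k_def)
  have U: "\<rho> x ^\<^sub>m Suc k = \<rho> x" using pow[of k] xk mat_repD(3)[OF rep] Ux by simp
  obtain z where z: "\<And>j. mat_trace (\<rho> x ^\<^sub>m j) = (\<Sum>i<n. z i ^ j)" "\<And>i. i < n \<Longrightarrow> z i ^ Suc k = z i"
    using trace_power_eigenvalues[OF Ux U] by blast
  \<comment> \<open>The exponent 2k - 1 is -1 modulo k and stays positive for k = 1. Positivity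
    matters for the eigenvalue 0, which \<open>trace_power_eigenvalues\<close> does not exclude and
    whose 0-th power would be 1.\<close>
  have zz: "z i ^ (2 * k - 1) = cnj (z i)" if i: "i < n" for i
  proof (cases "z i = 0")
    case False
    then have zk: "z i ^ k = 1" using z(2)[OF i] by simp
    then have "norm (z i) ^ k = 1" by (metis norm_one norm_power)
    then have "norm (z i) = 1" using k power_eq_imp_eq_base[of "norm (z i)" k 1] by simp
    then have "z i * cnj (z i) = 1" using complex_norm_square[of "z i"] by simp
    moreover have "z i * z i ^ (2 * k - 1) = 1"
    proof -
      have "z i * z i ^ (2 * k - 1) = z i ^ Suc (2 * k - 1)" by simp
      also have "Suc (2 * k - 1) = k * 2" using k by simp
      finally show ?thesis using zk by (simp add: power_mult)
    qed
    ultimately have "z i * z i ^ (2 * k - 1) = z i * cnj (z i)" by simp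
    then show ?thesis using False by (rule mult_left_cancel[THEN iffD1, rotated])
  qed (use k in \<open>simp add: power_0_left\<close>)
  have "x [^]\<^bsub>sub K\<^esub> (2 * k - 1) \<otimes>\<^bsub>sub K\<^esub> x = x [^]\<^bsub>sub K\<^esub> Suc (2 * k - 1)" by simp
  also have "Suc (2 * k - 1) = k * 2" using k by simp
  finally have "x [^]\<^bsub>sub K\<^esub> (2 * k - 1) \<otimes>\<^bsub>sub K\<^esub> x = \<one>\<^bsub>sub K\<^esub>"
    using xk S.nat_pow_pow[OF xs, of k 2, symmetric] S.nat_pow_one[of 2] by simp
  then have "inv\<^bsub>sub K\<^esub> x = x [^]\<^bsub>sub K\<^esub> (2 * k - 1)"
    using S.inv_equality[OF _ xs] S.nat_pow_closed[OF xs] by blast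
  then have "inv x = x [^]\<^bsub>sub K\<^esub> (2 * k - 1)" using m_inv_consistent[OF K x] by simp
  moreover have "inv x \<in> K" using subgroup.m_inv_closed[OF K x] .
  ultimately have "\<theta> (inv x) = (\<Sum>i<n. z i ^ (2 * k - 1))"
    using z(1)[of "2 * k - 1"] pow unfolding \<theta>_eq by simp
  also have "\<dots> = cnj (\<Sum>i<n. z i)" using zz by (simp add: cnj_sum)
  also have "(\<Sum>i<n. z i) = \<theta> x" using z(1)[of 1] Ux x unfolding \<theta>_eq by simp
  finally show ?thesis .
qed

text \<open>The average of the conjugates of the matrix of y is the scalar \<theta>(y) /
  \<theta>(1), here in the guise of coefficient orthogonality. Class invariance, the action of class
  functions and column orthogonality are all drawn from this identity.\<close>

lemma Irr_product:
  assumes K: "subgroup K G" and \<theta>: "\<theta> \<in> Irr (sub K)" and x: "x \<in> K" and y: "y \<in> K"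
  shows "\<theta> x * \<theta> y = \<theta> \<one> / of_nat (card K) * (\<Sum>g\<in>K. \<theta> (x \<otimes> g \<otimes> y \<otimes> inv g))"
proof -
  interpret K: subgroup K G by fact
  obtain \<rho> where irr: "irreducible_rep (sub K) (char_deg G \<theta>) \<rho>" and rep: "mat_rep (sub K) (char_deg G \<theta>) \<rho>"
    and \<theta>_eq: "\<theta> = (\<lambda>g\<in>K. mat_trace (\<rho> g))" and \<theta>1: "\<theta> \<one> = of_nat (char_deg G \<theta>)" "char_deg G \<theta> > 0"
    using Irr_obtain_rep[OF K \<theta>] by metis
  define n where "n = char_deg G \<theta>"
  note irr = irr[folded n_def] and rep = rep[folded n_def] and \<theta>1 = \<theta>1[folded n_def]
  note val = Irr_value[OF rep \<theta>_eq]
  have ent: "\<rho> (g \<otimes> h) $$ (i, j) = (\<Sum>k<n. \<rho> g $$ (i, k) * \<rho> h $$ (k, j))"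
    if "g \<in> K" "h \<in> K" "i < n" "j < n" for g h i j
    using mat_rep_entry[OF rep] that by simp
  let ?c = "of_nat (card K) / of_nat n :: complex"
  have inner: "(\<Sum>b<n. \<Sum>c<n. if a = i \<and> b = c then \<rho> x $$ (i, a) * \<rho> y $$ (b, c) * ?c else 0) =
      (if a = i then (\<Sum>b<n. \<rho> x $$ (i, i) * \<rho> y $$ (b, b) * ?c) else 0)" for i a
    by (cases "a = i") simp_all
  have "(\<Sum>g\<in>K. \<theta> (x \<otimes> g \<otimes> y \<otimes> inv g)) =
      (\<Sum>g\<in>K. \<Sum>i<n. \<rho> (x \<otimes> (g \<otimes> (y \<otimes> inv g))) $$ (i, i))"
    using x y by (intro sum.cong refl) (simp add: val m_assoc)
  also have "\<dots> = (\<Sum>g\<in>K. \<Sum>i<n. \<Sum>a<n. \<Sum>b<n. \<Sum>c<n.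
      \<rho> x $$ (i, a) * \<rho> y $$ (b, c) * (\<rho> g $$ (a, b) * \<rho> (inv g) $$ (c, i)))"
    using x y by (intro sum.cong refl) (simp add: ent sum_distrib_left mult_ac)
  also have "\<dots> = (\<Sum>i<n. \<Sum>g\<in>K. \<Sum>a<n. \<Sum>b<n. \<Sum>c<n.
      \<rho> x $$ (i, a) * \<rho> y $$ (b, c) * (\<rho> g $$ (a, b) * \<rho> (inv g) $$ (c, i)))"
    by (rule sum.swap)
  also have "\<dots> = (\<Sum>i<n. \<Sum>a<n. \<Sum>g\<in>K. \<Sum>b<n. \<Sum>c<n.
      \<rho> x $$ (i, a) * \<rho> y $$ (b, c) * (\<rho> g $$ (a, b) * \<rho> (inv g) $$ (c, i)))"
    by (intro sum.cong refl sum.swap)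
  also have "\<dots> = (\<Sum>i<n. \<Sum>a<n. \<Sum>b<n. \<Sum>g\<in>K. \<Sum>c<n.
      \<rho> x $$ (i, a) * \<rho> y $$ (b, c) * (\<rho> g $$ (a, b) * \<rho> (inv g) $$ (c, i)))"
    by (intro sum.cong refl sum.swap)
  also have "\<dots> = (\<Sum>i<n. \<Sum>a<n. \<Sum>b<n. \<Sum>c<n. \<Sum>g\<in>K.
      \<rho> x $$ (i, a) * \<rho> y $$ (b, c) * (\<rho> g $$ (a, b) * \<rho> (inv g) $$ (c, i)))"
    by (intro sum.cong refl sum.swap)
  also have "\<dots> = (\<Sum>i<n. \<Sum>a<n. \<Sum>b<n. \<Sum>c<n.
      if a = i \<and> b = c then \<rho> x $$ (i, a) * \<rho> y $$ (b, c) * ?c else 0)"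
    unfolding sum_distrib_left[symmetric] by (intro sum.cong refl) (simp add: sub_orthogonality[OF K irr])
  also have "\<dots> = (\<Sum>i<n. \<Sum>a<n. if a = i then (\<Sum>b<n. \<rho> x $$ (i, i) * \<rho> y $$ (b, b) * ?c) else 0)"
    unfolding inner ..
  also have "\<dots> = (\<Sum>i<n. \<Sum>b<n. \<rho> x $$ (i, i) * \<rho> y $$ (b, b) * ?c)"
    by simp
  also have "\<dots> = (\<Sum>i<n. \<rho> x $$ (i, i)) * (\<Sum>b<n. \<rho> y $$ (b, b)) * ?c"
    by (simp only: sum_product[symmetric] sum_distrib_right[symmetric])
  also have "\<dots> = \<theta> x * \<theta> y * ?c" by (simp add: val x y)
  finally show ?thesis using \<theta>1 card_sub_pos[OF K] by (simp add: field_simps)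
qed

text \<open>Put the unit for x in \<open>Irr_product\<close>: conjugating the other argument only
  reindexes the sum.\<close>

lemma Irr_class:
  assumes K: "subgroup K G" and \<theta>: "\<theta> \<in> Irr (sub K)" and x: "x \<in> K" and k: "k \<in> K"
  shows "\<theta> (k \<otimes> x \<otimes> inv k) = \<theta> x"
proof -
  interpret K: subgroup K G by fact
  have "\<theta> \<one> * \<theta> (k \<otimes> x \<otimes> inv k) =
      \<theta> \<one> / of_nat (card K) * (\<Sum>g\<in>K. \<theta> (\<one> \<otimes> g \<otimes> (k \<otimes> x \<otimes> inv k) \<otimes> inv g))"
    by (rule Irr_product[OF K \<theta>]) (use x k in auto)
  also have "(\<Sum>g\<in>K. \<theta> (\<one> \<otimes> g \<otimes> (k \<otimes> x \<otimes> inv k) \<otimes> inv g)) = (\<Sum>g\<in>K. \<theta> (\<one> \<otimes> g \<otimes> x \<otimes> inv g))"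
    by (rule sum.reindex_bij_witness[of _ "\<lambda>g. g \<otimes> inv k" "\<lambda>g. g \<otimes> k"])
      (use x k in \<open>auto simp: m_assoc inv_mult_group\<close>)
  also have "\<theta> \<one> / of_nat (card K) * \<dots> = \<theta> \<one> * \<theta> x"
    by (rule Irr_product[OF K \<theta>, symmetric]) (use x in auto)
  finally show ?thesis using char_deg_Irr[OF K \<theta>] by simp
qed

section \<open>Idempotents, matrix units and multiplicities\<close>

lemma idem_fn_on: "idem K \<theta> \<in> fn_on K"
  unfolding idem_def fn_on_def by simp

lemma conj_inv_idem:
  assumes K: "subgroup K G" and \<theta>: "\<theta> \<in> Irr (sub K)"
  shows "conj_inv K (idem K \<theta>)"
  unfolding conj_inv_def
proof (intro ballI)
  interpret K: subgroup K G by fact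
  fix k x assume k: "k \<in> K" and x: "x \<in> carrier G"
  show "idem K \<theta> (k \<otimes> x \<otimes> inv k) = idem K \<theta> x"
  proof (cases "x \<in> K")
    case True
    have "inv (k \<otimes> x \<otimes> inv k) = k \<otimes> inv x \<otimes> inv k" using k x by (simp add: inv_mult_group m_assoc)
    then show ?thesis using True k Irr_class[OF K \<theta> _ k, of "inv x"] by (simp add: idem_def)
  next
    case False
    have "x = inv k \<otimes> (k \<otimes> x \<otimes> inv k) \<otimes> k" using k x by (simp add: m_assoc, simp add: m_assoc[symmetric])
    then have "k \<otimes> x \<otimes> inv k \<notin> K" using False k by (metis K.m_closed K.m_inv_closed)
    then show ?thesis using False by (simp add: idem_def)
  qed
qed

text \<open>A class function acts on each isotypic component by the scalar below.\<close>

lemma class_conv_idem: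
  assumes K: "subgroup K G" and \<theta>: "\<theta> \<in> Irr (sub K)" and f: "f \<in> fn_on K" "conj_inv K f"
  shows "f \<star> idem K \<theta> = (\<lambda>x. (\<Sum>k\<in>K. f k * \<theta> k) / \<theta> \<one> * idem K \<theta> x)"
proof
  interpret K: subgroup K G by fact
  fix x
  let ?c = "\<theta> \<one> / of_nat (card K)"
  have \<theta>1: "\<theta> \<one> \<noteq> 0" using char_deg_Irr[OF K \<theta>] by simp
  have cK: "of_nat (card K) \<noteq> (0 :: complex)" using card_sub_pos[OF K] by simp
  show "(f \<star> idem K \<theta>) x = (\<Sum>k\<in>K. f k * \<theta> k) / \<theta> \<one> * idem K \<theta> x"
  proof (cases "x \<in> K")
    case x: True
    \<comment> \<open>Since f is invariant, the sum over y may be replaced by its conjugate under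
      any g. Averaging over g then produces the right side of \<open>Irr_product\<close>.\<close>
    have conjf: "(\<Sum>y\<in>K. f y * \<theta> (inv x \<otimes> y)) = (\<Sum>y\<in>K. f y * \<theta> (inv x \<otimes> g \<otimes> y \<otimes> inv g))"
      if g: "g \<in> K" for g
    proof -
      have "(\<Sum>y\<in>K. f y * \<theta> (inv x \<otimes> y)) =
          (\<Sum>y\<in>K. f (g \<otimes> y \<otimes> inv g) * \<theta> (inv x \<otimes> (g \<otimes> y \<otimes> inv g)))"
        by (rule sum.reindex_bij_witness[of _ "\<lambda>y. g \<otimes> y \<otimes> inv g" "\<lambda>y. inv g \<otimes> y \<otimes> g"])
          (use g in \<open>auto simp: m_assoc, auto simp: m_assoc[symmetric]\<close>)
      also have "\<dots> = (\<Sum>y\<in>K. f y * \<theta> (inv x \<otimes> g \<otimes> y \<otimes> inv g))"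
        using g x f(2) by (intro sum.cong) (auto simp: conj_inv_def m_assoc)
      finally show ?thesis .
    qed
    have "of_nat (card K) * (\<Sum>y\<in>K. f y * \<theta> (inv x \<otimes> y)) =
        (\<Sum>g\<in>K. \<Sum>y\<in>K. f y * \<theta> (inv x \<otimes> g \<otimes> y \<otimes> inv g))"
    proof -
      have "(\<Sum>g\<in>K. \<Sum>y\<in>K. f y * \<theta> (inv x \<otimes> g \<otimes> y \<otimes> inv g)) =
          (\<Sum>g\<in>K. \<Sum>y\<in>K. f y * \<theta> (inv x \<otimes> y))"
        by (rule sum.cong[OF refl conjf[symmetric]])
      then show ?thesis by simp
    qed
    also have "\<dots> = (\<Sum>y\<in>K. f y * (\<Sum>g\<in>K. \<theta> (inv x \<otimes> g \<otimes> y \<otimes> inv g)))"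
      by (subst sum.swap) (simp add: sum_distrib_left)
    also have "\<dots> = (\<Sum>y\<in>K. f y * (of_nat (card K) / \<theta> \<one> * (\<theta> (inv x) * \<theta> y)))"
      using x \<theta>1 cK by (intro sum.cong refl) (simp add: Irr_product[OF K \<theta>, of "inv x"])
    also have "\<dots> = of_nat (card K) * (\<theta> (inv x) * ((\<Sum>y\<in>K. f y * \<theta> y) / \<theta> \<one>))"
      by (simp add: sum_distrib_left sum_divide_distrib mult_ac)
    finally have main: "(\<Sum>y\<in>K. f y * \<theta> (inv x \<otimes> y)) = \<theta> (inv x) * ((\<Sum>y\<in>K. f y * \<theta> y) / \<theta> \<one>)"
      using cK by (metis mult_left_cancel)
    have "(f \<star> idem K \<theta>) x = (\<Sum>y\<in>K. f y * (?c * \<theta> (inv x \<otimes> y)))"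
      using x by (subst conv_sub[OF K f(1)]) (auto simp: idem_def inv_mult_group intro!: sum.cong)
    also have "\<dots> = ?c * (\<Sum>y\<in>K. f y * \<theta> (inv x \<otimes> y))" by (simp add: sum_distrib_left mult_ac)
    finally show ?thesis unfolding main using x by (simp add: idem_def)
  next
    case False
    then show ?thesis using conv_sub_closed[OF K f(1) idem_fn_on] by (simp add: fn_on_def idem_def)
  qed
qed

lemma idem_conv_idem:
  assumes K: "subgroup K G" and \<theta>: "\<theta> \<in> Irr (sub K)" and \<theta>': "\<theta>' \<in> Irr (sub K)"
  shows "idem K \<theta> \<star> idem K \<theta>' = (if \<theta> = \<theta>' then idem K \<theta> else (\<lambda>_. 0))"
proof -
  interpret K: subgroup K G by fact
  have "(\<Sum>k\<in>K. idem K \<theta> k * \<theta>' k) = \<theta> \<one> / of_nat (card K) * (\<Sum>k\<in>K. \<theta>' k * \<theta> (inv k))"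
    by (simp add: idem_def sum_distrib_left mult_ac)
  then have "(\<Sum>k\<in>K. idem K \<theta> k * \<theta>' k) / \<theta>' \<one> = (if \<theta> = \<theta>' then 1 else 0)"
    using Irr_orthogonality[OF K \<theta>' \<theta>] char_deg_Irr[OF K \<theta>'] card_sub_pos[OF K] by auto
  then show ?thesis
    using class_conv_idem[OF K \<theta>' idem_fn_on conj_inv_idem[OF K \<theta>]] by auto
qed

lemma idem_one: "subgroup K G \<Longrightarrow> idem K \<theta> \<one> = \<theta> \<one> ^ 2 / of_nat (card K)"
  using subgroup.one_closed[of K G] by (simp add: idem_def power2_eq_square)

text \<open>The simple summand of the group algebra of N belonging to \<theta> is a full matrix
  algebra. Its elementary matrices are the coefficient functions of a representation, taken at the
  inverse and scaled by \<theta>(1) / |N|; coefficient orthogonality is their multiplication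
  table.\<close>

lemma matrix_units:
  assumes N: "subgroup N G" and \<theta>: "\<theta> \<in> Irr (sub N)"
  shows "\<exists>\<epsilon>. (\<forall>i j. \<epsilon> i j \<in> fn_on N) \<and>
    (\<forall>i<char_deg G \<theta>. \<forall>j<char_deg G \<theta>. \<forall>l<char_deg G \<theta>. \<epsilon> i j \<star> \<epsilon> j l = \<epsilon> i l) \<and>
    idem N \<theta> = (\<lambda>x. \<Sum>i<char_deg G \<theta>. \<epsilon> i i x)"
proof -
  interpret N: subgroup N G by fact
  obtain \<rho> where irr: "irreducible_rep (sub N) (char_deg G \<theta>) \<rho>" and rep: "mat_rep (sub N) (char_deg G \<theta>) \<rho>"
    and \<theta>_eq: "\<theta> = (\<lambda>g\<in>N. mat_trace (\<rho> g))" and \<theta>1: "\<theta> \<one> = of_nat (char_deg G \<theta>)" "char_deg G \<theta> > 0"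
    using Irr_obtain_rep[OF N \<theta>] by metis
  define n where "n = char_deg G \<theta>"
  note irr = irr[folded n_def] and rep = rep[folded n_def] and \<theta>1 = \<theta>1[folded n_def]
  define c where "c = (of_nat n / of_nat (card N) :: complex)"
  define \<epsilon> where "\<epsilon> i j x = (if x \<in> N then c * \<rho> (inv x) $$ (j, i) else 0)" for i j x
  have on: "\<epsilon> i j \<in> fn_on N" for i j unfolding \<epsilon>_def by (rule fn_onI) simp
  have mult: "\<epsilon> i j \<star> \<epsilon> j l = \<epsilon> i l" if "i < n" "j < n" "l < n" for i j l
  proof
    fix x
    show "(\<epsilon> i j \<star> \<epsilon> j l) x = \<epsilon> i l x"
    proof (cases "x \<in> N")
      case x: True
      have "(\<epsilon> i j \<star> \<epsilon> j l) x = (\<Sum>y\<in>N. c * \<rho> (inv y) $$ (j, i) * (c * \<rho> (inv x \<otimes> y) $$ (l, j)))"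
        using x by (subst conv_sub[OF N on]) (auto simp: \<epsilon>_def inv_mult_group intro!: sum.cong)
      also have "\<dots> = (\<Sum>y\<in>N. \<Sum>a<n. c * c * \<rho> (inv x) $$ (l, a) * (\<rho> y $$ (a, j) * \<rho> (inv y) $$ (j, i)))"
        using that x by (intro sum.cong refl) (simp add: mat_rep_entry[OF rep, simplified] sum_distrib_left mult_ac)
      also have "\<dots> = (\<Sum>a<n. c * c * \<rho> (inv x) $$ (l, a) * (\<Sum>y\<in>N. \<rho> y $$ (a, j) * \<rho> (inv y) $$ (j, i)))"
        by (subst sum.swap) (simp add: sum_distrib_left)
      also have "\<dots> = (\<Sum>a<n. if a = i then c * c * \<rho> (inv x) $$ (l, i) * (of_nat (card N) / of_nat n) else 0)"
        using that by (intro sum.cong refl) (simp add: sub_orthogonality[OF N irr])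
      also have "\<dots> = c * \<rho> (inv x) $$ (l, i)"
        using that \<theta>1 card_sub_pos[OF N] by (simp add: c_def)
      finally show ?thesis using x by (simp add: \<epsilon>_def)
    next
      case False
      then show ?thesis using conv_sub_closed[OF N on on] on by (simp add: fn_on_def)
    qed
  qed
  have sum: "idem N \<theta> = (\<lambda>x. \<Sum>i<n. \<epsilon> i i x)"
    using \<theta>1 by (auto simp: idem_def \<epsilon>_def Irr_value[OF rep \<theta>_eq] c_def sum_distrib_left intro!: ext)
  show ?thesis
    using on mult sum unfolding n_def by blast
qed

text \<open>If \<open>u\<close> commutes with \<open>N\<close> and is carried by the \<open>\<theta>\<close>-component, then its trace on a
  \<open>K\<close>-module is \<open>\<theta>(1)\<close> times the trace of \<open>u\<close> times a diagonal matrix unit of \<open>\<theta>\<close>.\<close>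

lemma trace_multiplicity:
  assumes K: "subgroup K G" and N: "subgroup N G" and NK: "N \<subseteq> K"
    and \<chi>: "\<chi> \<in> Irr (sub K)" and \<theta>: "\<theta> \<in> Irr (sub N)"
    and u: "u \<in> fn_on K" "conj_inv N u" "u \<star> idem N \<theta> = u"
    and per: "((\<lambda>w. w \<star> u) ^^ k) u = u"
  obtains n V where "V \<in> carrier_mat n n" "V ^\<^sub>m Suc k = V" "(\<Sum>g\<in>K. u g * \<chi> g) = \<theta> \<one> * mat_trace V"
proof -
  interpret K: subgroup K G by fact
  interpret N: subgroup N G by fact
  obtain n \<rho> where rep: "mat_rep (sub K) n \<rho>" and \<chi>_eq: "\<chi> = (\<lambda>g\<in>K. mat_trace (\<rho> g))"
    using Irr_obtain_rep[OF K \<chi>] by metis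
  obtain \<epsilon> where \<epsilon>: "\<And>i j. \<epsilon> i j \<in> fn_on N"
    "\<And>i j l. i < char_deg G \<theta> \<Longrightarrow> j < char_deg G \<theta> \<Longrightarrow> l < char_deg G \<theta> \<Longrightarrow> \<epsilon> i j \<star> \<epsilon> j l = \<epsilon> i l"
    "idem N \<theta> = (\<lambda>x. \<Sum>i<char_deg G \<theta>. \<epsilon> i i x)"
    using matrix_units[OF N \<theta>] by blast
  define d where "d = char_deg G \<theta>"
  note \<epsilon> = \<epsilon>[folded d_def]
  have d: "d > 0" "\<theta> \<one> = of_nat d" unfolding d_def using char_deg_Irr[OF N \<theta>] by auto
  let ?R = "rep_fun K n \<rho>"
  define \<Phi> where "\<Phi> f = (\<Sum>g\<in>K. f g * \<chi> g)" for f
  have \<Phi>_trace: "\<Phi> f = mat_trace (?R f)" for f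
    unfolding \<Phi>_def trace_rep_fun[OF rep] by (simp add: \<chi>_eq)
  have \<Phi>_comm: "\<Phi> (f \<star> h) = \<Phi> (h \<star> f)" if "f \<in> fn_on K" "h \<in> fn_on K" for f h
    unfolding \<Phi>_trace using that by (simp add: rep_fun_conv[OF K rep] mat_trace_comm[of _ n n])
  have \<epsilon>K: "\<epsilon> i j \<in> fn_on K" for i j using \<epsilon>(1) NK fn_on_mono by blast
  have comm: "u \<star> \<epsilon> i j = \<epsilon> i j \<star> u" for i j
    using conv_commute[OF N.subset u(2) \<epsilon>(1)] .
  define E where "E = \<epsilon> 0 0"
  have EE: "E \<star> E = E" unfolding E_def using \<epsilon>(2) d by simp
  \<comment> \<open>Cyclicity of the trace, together with the commutation of u with all matrix
    units, moves one diagonal unit to another. So all diagonal units contribute equally.\<close>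
  have diag: "\<Phi> (u \<star> \<epsilon> i i) = \<Phi> (u \<star> E)" if i: "i < d" for i
  proof -
    have "\<Phi> (u \<star> \<epsilon> i i) = \<Phi> ((u \<star> \<epsilon> i 0) \<star> \<epsilon> 0 i)" using \<epsilon>(2)[of i 0 i] i d by (simp add: conv_assoc)
    also have "\<dots> = \<Phi> (\<epsilon> 0 i \<star> (u \<star> \<epsilon> i 0))"
      by (rule \<Phi>_comm) (use conv_sub_closed[OF K u(1)] \<epsilon>K in auto)
    also have "\<epsilon> 0 i \<star> (u \<star> \<epsilon> i 0) = u \<star> (\<epsilon> 0 i \<star> \<epsilon> i 0)"
      using comm[of 0 i] by (metis conv_assoc)
    finally show ?thesis using \<epsilon>(2)[of 0 i 0] i d by (simp add: E_def)
  qed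
  have "\<Phi> u = \<Phi> (u \<star> idem N \<theta>)" using u(3) by simp
  also have "\<dots> = (\<Sum>i<d. \<Phi> (u \<star> \<epsilon> i i))"
    unfolding \<epsilon>(3) conv_sum_right \<Phi>_def sum_distrib_right by (rule sum.swap)
  also have "\<dots> = of_nat d * \<Phi> (u \<star> E)" using diag by simp
  finally have trace: "(\<Sum>g\<in>K. u g * \<chi> g) = \<theta> \<one> * mat_trace (?R (u \<star> E))"
    using d \<Phi>_def[of u] \<Phi>_trace[of "u \<star> E"] by simp
  let ?w = "\<lambda>j. ((\<lambda>w. w \<star> u) ^^ j) u"
  have EK: "E \<in> fn_on K" unfolding E_def by (rule \<epsilon>K)
  have wK: "?w j \<in> fn_on K" for j by (induction j) (auto intro: u(1) conv_sub_closed[OF K])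
  \<comment> \<open>The idempotent E commutes with u, so powers of the product are powers of u times
    E. In this way the periodicity \<open>per\<close> passes from u to the matrix.\<close>
  have pow: "?R (u \<star> E) ^\<^sub>m Suc j = ?R (?w j \<star> E)" for j
  proof (induction j)
    case (Suc j)
    have "?R (u \<star> E) ^\<^sub>m Suc (Suc j) = ?R (?w j \<star> E) * ?R (u \<star> E)" using Suc by simp
    also have "\<dots> = ?R ((?w j \<star> E) \<star> (u \<star> E))"
      using rep_fun_conv[OF K rep conv_sub_closed[OF K wK EK] conv_sub_closed[OF K u(1) EK]] by simp
    also have "(?w j \<star> E) \<star> (u \<star> E) = (?w j \<star> u) \<star> E"
    proof -
      have "E \<star> (u \<star> E) = (u \<star> E) \<star> E" using comm[of 0 0] unfolding E_def by (metis conv_assoc)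
      then show ?thesis by (simp add: conv_assoc EE)
    qed
    finally show ?case by simp
  qed simp
  have "?R (u \<star> E) ^\<^sub>m Suc k = ?R (u \<star> E)" using pow[of k] unfolding per .
  from that[OF rep_fun_carrier this trace] show ?thesis .
qed

text \<open>The rounding only serves to get a natural number: the inner product is one, see
  \<open>of_nat_cmult\<close> below.\<close>

definition cmult :: "'a set \<Rightarrow> ('a \<Rightarrow> complex) \<Rightarrow> ('a \<Rightarrow> complex) \<Rightarrow> nat" where
  "cmult N \<chi> \<theta> = nat \<lfloor>Re ((\<Sum>x\<in>N. \<chi> x * \<theta> (inv x)) / of_nat (card N))\<rfloor>"

text \<open>The idempotent of \<theta> acts on the module of \<chi> with trace \<theta>(1) times the
  inner product, and \<open>trace_multiplicity\<close> identifies the second factor with the trace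
  of an idempotent matrix. This yields integrality before any decomposition into irreducibles is
  available.\<close>

lemma of_nat_cmult:
  assumes K: "subgroup K G" and N: "subgroup N G" and NK: "N \<subseteq> K"
    and \<chi>: "\<chi> \<in> Irr (sub K)" and \<theta>: "\<theta> \<in> Irr (sub N)"
  shows "of_nat (cmult N \<chi> \<theta>) = (\<Sum>x\<in>N. \<chi> x * \<theta> (inv x)) / of_nat (card N)"
proof -
  have "((\<lambda>w. w \<star> idem N \<theta>) ^^ 1) (idem N \<theta>) = idem N \<theta>"
    using idem_conv_idem[OF N \<theta> \<theta>] by simp
  then obtain n V where V: "V \<in> carrier_mat n n" "V ^\<^sub>m Suc 1 = V"
    "(\<Sum>g\<in>K. idem N \<theta> g * \<chi> g) = \<theta> \<one> * mat_trace V"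
    using trace_multiplicity[OF K N NK \<chi> \<theta> fn_on_mono[OF idem_fn_on NK] conj_inv_idem[OF N \<theta>]]
      idem_conv_idem[OF N \<theta> \<theta>] by metis
  have "V * V = V" using V by simp
  then obtain m :: nat where m: "mat_trace V = of_nat m" using mat_trace_idempotent[OF V(1)] by blast
  have "(\<Sum>g\<in>K. idem N \<theta> g * \<chi> g) = (\<Sum>g\<in>N. idem N \<theta> g * \<chi> g)"
    by (rule sum_fn_on[OF idem_fn_on NK finite_sub[OF K]])
  also have "\<dots> = \<theta> \<one> * ((\<Sum>x\<in>N. \<chi> x * \<theta> (inv x)) / of_nat (card N))"
    by (simp add: idem_def sum_distrib_left sum_divide_distrib mult_ac)
  finally have "(\<Sum>x\<in>N. \<chi> x * \<theta> (inv x)) / of_nat (card N) = of_nat m"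
    using V(3) m char_deg_Irr[OF N \<theta>] by (metis less_irrefl mult_left_cancel of_nat_eq_0_iff)
  then show ?thesis unfolding cmult_def by simp
qed

end

section \<open>Completeness of the irreducible characters\<close>

lemma mat_assoc_dim:
  fixes A B C :: "complex mat"
  shows "dim_col A = dim_row B \<Longrightarrow> dim_col B = dim_row C \<Longrightarrow> A * B * C = A * (B * C)"
  by (rule assoc_mult_mat[of A "dim_row A" "dim_col A" B "dim_col B" C "dim_col C"]) auto

lemma trace_one_mat: "mat_trace (1\<^sub>m n) = of_nat n"
  by (simp add: mat_trace_def)

lemma trace_minus:
  assumes "A \<in> carrier_mat n n" "B \<in> carrier_mat n n"
  shows "mat_trace (A - B) = mat_trace A - mat_trace B"
  using assms by (simp add: mat_trace_def sum_subtractf)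

text \<open>P * L is the projection onto the column space of P, and D is the complementary
  projection onto the kernel of L.\<close>

lemma complement_idempotent:
  fixes P :: "complex mat"
  assumes P: "P \<in> carrier_mat n k" and L: "L \<in> carrier_mat k n" and LP: "L * P = 1\<^sub>m k"
  defines "D \<equiv> 1\<^sub>m n - P * L"
  shows "D \<in> carrier_mat n n" "D * D = D" "L * D = 0\<^sub>m k n" "D * P = 0\<^sub>m n k"
    "mat_trace D = of_nat n - of_nat k"
proof -
  have PL: "P * L \<in> carrier_mat n n" using P L by simp
  show D: "D \<in> carrier_mat n n" unfolding D_def using PL by (intro minus_carrier_mat)
  have "L * (P * L) = L" using assoc_mult_mat[OF L P L] LP L by simp
  then show LD: "L * D = 0\<^sub>m k n"
    unfolding D_def using mult_minus_distrib_mat[OF L one_carrier_mat PL] L by simp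
  have "(P * L) * P = P" using assoc_mult_mat[OF P L P] LP P by simp
  then show "D * P = 0\<^sub>m n k"
    unfolding D_def using minus_mult_distrib_mat[OF one_carrier_mat PL P] P by simp
  have "D * D = D - P * L * D"
    using minus_mult_distrib_mat[OF one_carrier_mat PL D] left_mult_one_mat[OF D] unfolding D_def by simp
  also have "P * L * D = 0\<^sub>m n n" using assoc_mult_mat[OF P L D] LD P by simp
  finally show "D * D = D" using D by (auto intro!: eq_matI)
  have "mat_trace D = of_nat n - mat_trace (P * L)"
    unfolding D_def using trace_minus[OF one_carrier_mat PL] by (simp add: trace_one_mat)
  also have "mat_trace (P * L) = of_nat k" using mat_trace_comm[OF P L] LP by (simp add: trace_one_mat)
  finally show "mat_trace D = of_nat n - of_nat k" .
qed

text \<open>The complementary idempotent has trace n - k, which must be a natural number.\<close>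

lemma left_inverse_dim_le:
  fixes P :: "complex mat"
  assumes "P \<in> carrier_mat n k" "L \<in> carrier_mat k n" "L * P = 1\<^sub>m k"
  shows "k \<le> n"
proof -
  note D = complement_idempotent[OF assms]
  obtain m :: nat where m: "mat_trace (1\<^sub>m n - P * L) = of_nat m"
    using mat_trace_idempotent[OF D(1,2)] by blast
  have "(of_nat n :: complex) = of_nat (m + k)" using m D(5) by (simp add: algebra_simps)
  then have "n = m + k" using of_nat_eq_iff by blast
  then show ?thesis by simp
qed

text \<open>A subspace is represented as the column space of a matrix with a chosen left inverse.
  The possible k are bounded by n; for the largest one the columns span W, since otherwise a further
  column could be added.\<close>

lemma lin_closed_parametrization:
  assumes W: "lin_closed n W"
  obtains k P L where "P \<in> carrier_mat n k" "L \<in> carrier_mat k n" "L * P = 1\<^sub>m k"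
    "W = (\<lambda>v. P *\<^sub>v v) ` carrier_vec k"
proof -
  define good where "good k \<longleftrightarrow> (\<exists>P L. P \<in> carrier_mat n k \<and> L \<in> carrier_mat k n \<and> L * P = 1\<^sub>m k \<and>
    (\<forall>v\<in>carrier_vec k. P *\<^sub>v v \<in> W))" for k
  note WD = W[unfolded lin_closed_def]
  have "good 0" unfolding good_def
  proof (intro exI conjI ballI)
    show "0\<^sub>m n 0 *\<^sub>v v \<in> W" if "v \<in> carrier_vec 0" for v :: "complex vec"
    proof -
      have "0\<^sub>m n 0 *\<^sub>v v = 0\<^sub>v n" using that by (intro eq_vecI) (auto simp: scalar_prod_def)
      then show ?thesis using WD by simp
    qed
    show "0\<^sub>m 0 n * 0\<^sub>m n 0 = 1\<^sub>m 0" by (intro eq_matI) auto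
  qed auto
  moreover have "k \<le> n" if "good k" for k using that left_inverse_dim_le unfolding good_def by blast
  ultimately obtain k where k: "good k" and maxk: "\<And>l. good l \<Longrightarrow> l \<le> k"
    using GreatestI_nat[of good 0 n] Greatest_le_nat[of good _ n] by blast
  then obtain P L where P: "P \<in> carrier_mat n k" and L: "L \<in> carrier_mat k n" and LP: "L * P = 1\<^sub>m k"
    and im: "\<And>v. v \<in> carrier_vec k \<Longrightarrow> P *\<^sub>v v \<in> W" unfolding good_def by blast
  define D where "D = 1\<^sub>m n - P * L"
  note D = complement_idempotent[OF P L LP, folded D_def]
  have PL: "P * L \<in> carrier_mat n n" using P L by simp
  have "W \<subseteq> (\<lambda>v. P *\<^sub>v v) ` carrier_vec k"
  proof
    fix w assume w: "w \<in> W"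
    then have wc: "w \<in> carrier_vec n" using WD by auto
    define w' where "w' = D *\<^sub>v w"
    have w'c: "w' \<in> carrier_vec n" unfolding w'_def using D(1) wc by simp
    have Lw: "L *\<^sub>v w \<in> carrier_vec k" using L wc by simp
    have w'_eq: "w' = w - P *\<^sub>v (L *\<^sub>v w)"
      unfolding w'_def D_def using minus_mult_distrib_mat_vec[OF one_carrier_mat PL wc] wc
        assoc_mult_mat_vec[OF P L wc] by simp
    show "w \<in> (\<lambda>v. P *\<^sub>v v) ` carrier_vec k"
    proof (cases "w' = 0\<^sub>v n")
      case True
      then have "w = P *\<^sub>v (L *\<^sub>v w)" using w'_eq wc P
        by (intro eq_vecI) (auto dest!: arg_cong[of _ _ "\<lambda>x. x $ _"] simp: vec_eq_iff)
      then show ?thesis using Lw by blast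
    next
      case False
      then obtain i0 where i0: "i0 < n" "w' $ i0 \<noteq> 0"
        using w'c by (auto simp: vec_eq_iff)
      define P' where "P' = mat n (Suc k) (\<lambda>(i, j). if j < k then P $$ (i, j) else w' $ i)"
      \<comment> \<open>The new row is coordinate i0 of D, rescaled. It vanishes on the old columns
        because D * P = 0, and it is 1 on the new column because D fixes it; the old rows vanish on
        the new column because L * D = 0.\<close>
      define L' where "L' = mat (Suc k) n (\<lambda>(i, j). if i < k then L $$ (i, j) else D $$ (i0, j) / w' $ i0)"
      have P': "P' \<in> carrier_mat n (Suc k)" and L': "L' \<in> carrier_mat (Suc k) n"
        unfolding P'_def L'_def by auto
      have Lw': "L *\<^sub>v w' = 0\<^sub>v k"
      proof -
        have "L *\<^sub>v w' = 0\<^sub>m k n *\<^sub>v w"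
          using assoc_mult_mat_vec[OF L D(1) wc] D(3) unfolding w'_def by simp
        then show ?thesis using wc by (auto intro!: eq_vecI simp: scalar_prod_def)
      qed
      have Dw': "D *\<^sub>v w' = w'" unfolding w'_def using assoc_mult_mat_vec[OF D(1) D(1) wc] D(2) by simp
      have "L' * P' = 1\<^sub>m (Suc k)"
      proof (rule eq_matI)
        fix a b assume "a < dim_row (1\<^sub>m (Suc k))" "b < dim_col (1\<^sub>m (Suc k))"
        then have ab: "a < Suc k" "b < Suc k" by auto
        have entry: "(L' * P') $$ (a, b) = (\<Sum>i<n. L' $$ (a, i) * P' $$ (i, b))"
          by (rule index_mult_mat_sum[OF L' P' ab])
        consider "a < k" "b < k" | "a < k" "b = k" | "a = k" "b < k" | "a = k" "b = k" using ab by linarith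
        then show "(L' * P') $$ (a, b) = 1\<^sub>m (Suc k) $$ (a, b)"
        proof cases
          case 1
          then have "(L' * P') $$ (a, b) = (L * P) $$ (a, b)"
            unfolding entry index_mult_mat_sum[OF L P 1] using ab by (simp add: L'_def P'_def)
          then show ?thesis using LP 1 by simp
        next
          case 2
          then have "(L' * P') $$ (a, b) = (L *\<^sub>v w') $ a"
            unfolding entry index_mult_vec_sum[OF L w'c 2(1)] using ab by (simp add: L'_def P'_def)
          then show ?thesis using Lw' 2 by simp
        next
          case 3
          then have "(L' * P') $$ (a, b) = (D * P) $$ (i0, b) / w' $ i0"
            unfolding entry index_mult_mat_sum[OF D(1) P i0(1) 3(2)] using ab
            by (simp add: L'_def P'_def sum_divide_distrib)
          then show ?thesis using D(4) 3 i0 by simp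
        next
          case 4
          then have "(L' * P') $$ (a, b) = (D *\<^sub>v w') $ i0 / w' $ i0"
            unfolding entry index_mult_vec_sum[OF D(1) w'c i0(1)] using ab
            by (simp add: L'_def P'_def sum_divide_distrib)
          then show ?thesis using Dw' 4 i0 by simp
        qed
      qed (use P' L' in auto)
      moreover have "P' *\<^sub>v v \<in> W" if v: "v \<in> carrier_vec (Suc k)" for v
      proof -
        define u where "u = vec k (\<lambda>i. v $ i)"
        have u: "u \<in> carrier_vec k" unfolding u_def by simp
        have "P' *\<^sub>v v = P *\<^sub>v u + v $ k \<cdot>\<^sub>v w'"
        proof (rule eq_vecI)
          fix i assume "i < dim_vec (P *\<^sub>v u + v $ k \<cdot>\<^sub>v w')"
          then have i: "i < n" using w'c by simp
          show "(P' *\<^sub>v v) $ i = (P *\<^sub>v u + v $ k \<cdot>\<^sub>v w') $ i"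
            using i w'c P index_mult_vec_sum[OF P' v i] index_mult_vec_sum[OF P u i]
            by (simp add: P'_def u_def mult.commute)
        qed (use P' w'c in auto)
        moreover have "w' = w + (- 1) \<cdot>\<^sub>v (P *\<^sub>v (L *\<^sub>v w))"
          unfolding w'_eq using wc P by (intro eq_vecI) auto
        then have "w' \<in> W" using WD w im[OF Lw] by auto
        ultimately show ?thesis using WD im[OF u] by auto
      qed
      ultimately have "good (Suc k)" unfolding good_def using P' L' by blast
      then show ?thesis using maxk by fastforce
    qed
  qed
  then show ?thesis using that P L LP im by blast
qed

context fin_group
begin

lemma rep_fun_compress:
  assumes L: "L \<in> carrier_mat k n" and P: "P \<in> carrier_mat n k" and rep: "mat_rep (sub K) n \<rho>"
  shows "rep_fun K k (\<lambda>g. L * \<rho> g * P) f = L * rep_fun K n \<rho> f * P"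
proof (rule eq_matI)
  fix i j assume "i < dim_row (L * rep_fun K n \<rho> f * P)" "j < dim_col (L * rep_fun K n \<rho> f * P)"
  then have ij: "i < k" "j < k" using L P by auto
  have entry: "(L * A * P) $$ (i, j) = (\<Sum>b<n. \<Sum>a<n. L $$ (i, a) * A $$ (a, b) * P $$ (b, j))"
    if A: "A \<in> carrier_mat n n" for A
    using ij by (simp add: index_mult_mat_sum[OF mult_carrier_mat[OF L A] P] index_mult_mat_sum[OF L A] sum_distrib_right)
  have "rep_fun K k (\<lambda>g. L * \<rho> g * P) f $$ (i, j) =
      (\<Sum>g\<in>K. \<Sum>b<n. \<Sum>a<n. L $$ (i, a) * (f g * \<rho> g $$ (a, b)) * P $$ (b, j))"
    using ij mat_repD(1)[OF rep] by (simp add: rep_fun_def entry sum_distrib_left mult_ac)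
  also have "\<dots> = (\<Sum>b<n. \<Sum>g\<in>K. \<Sum>a<n. L $$ (i, a) * (f g * \<rho> g $$ (a, b)) * P $$ (b, j))"
    by (rule sum.swap)
  also have "\<dots> = (\<Sum>b<n. \<Sum>a<n. \<Sum>g\<in>K. L $$ (i, a) * (f g * \<rho> g $$ (a, b)) * P $$ (b, j))"
    by (intro sum.cong refl sum.swap)
  also have "\<dots> = (L * rep_fun K n \<rho> f * P) $$ (i, j)"
    by (simp add: entry[OF rep_fun_carrier]) (simp add: rep_fun_def sum_distrib_left sum_distrib_right)
  finally show "rep_fun K k (\<lambda>g. L * \<rho> g * P) f $$ (i, j) = (L * rep_fun K n \<rho> f * P) $$ (i, j)" .
qed (use L P in \<open>auto simp: rep_fun_def\<close>)

text \<open>The hypothesis \<open>abs\<close> holds if the column space of P is invariant, and also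
  if the kernel of L is. Thus one lemma gives both the submodule and the quotient module.\<close>

lemma mat_rep_compress:
  assumes L: "L \<in> carrier_mat k n" and P: "P \<in> carrier_mat n k" and LP: "L * P = 1\<^sub>m k"
    and rep: "mat_rep (sub K) n \<rho>"
    and abs: "\<And>g h. g \<in> K \<Longrightarrow> h \<in> K \<Longrightarrow> L * \<rho> g * (P * L) * \<rho> h * P = L * \<rho> g * \<rho> h * P"
  shows "mat_rep (sub K) k (\<lambda>g. L * \<rho> g * P)"
  unfolding mat_rep_def
proof (intro conjI ballI)
  note car = mat_repD(1)[OF rep]
  show "L * \<rho> g * P \<in> carrier_mat k k" if "g \<in> carrier (sub K)" for g
    using L P car[OF that] by simp
  show "L * \<rho> (g \<otimes>\<^bsub>sub K\<^esub> h) * P = L * \<rho> g * P * (L * \<rho> h * P)"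
    if g: "g \<in> carrier (sub K)" and h: "h \<in> carrier (sub K)" for g h
  proof -
    note cg = car[OF g] and ch = car[OF h]
    have "L * \<rho> g * P * (L * \<rho> h * P) = L * \<rho> g * (P * L) * \<rho> h * P"
      by (simp add: mat_assoc_dim carrier_matD[OF L] carrier_matD[OF P] carrier_matD[OF cg] carrier_matD[OF ch])
    then show ?thesis
      using abs g h mat_repD(2)[OF rep g h] assoc_mult_mat[OF L cg ch] by simp
  qed
  show "L * \<rho> \<one>\<^bsub>sub K\<^esub> * P = 1\<^sub>m k" using mat_repD(3)[OF rep] L LP by simp
qed

text \<open>A representation of least degree on which the idempotent \<open>f\<close> acts nontrivially is
  irreducible: on a proper submodule and on its quotient \<open>f\<close> would vanish, so it would be nilpotent.\<close>

lemma least_rep_irreducible: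
  assumes K: "subgroup K G" and f: "f \<in> fn_on K" "f \<star> f = f"
    and rep: "mat_rep (sub K) n \<rho>" and nz: "rep_fun K n \<rho> f \<noteq> 0\<^sub>m n n"
    and least: "\<And>k \<sigma>. k < n \<Longrightarrow> mat_rep (sub K) k \<sigma> \<Longrightarrow> rep_fun K k \<sigma> f = 0\<^sub>m k k"
  shows "irreducible_rep (sub K) n \<rho>"
proof -
  interpret S: fin_group "sub K" by (rule sub_fin_group[OF K])
  define F where "F = rep_fun K n \<rho> f"
  have F: "F \<in> carrier_mat n n" unfolding F_def by simp
  have FF: "F * F = F" unfolding F_def using rep_fun_conv[OF K rep f(1) f(1)] f(2) by simp
  have "n > 0"
  proof (rule ccontr)
    assume "\<not> n > 0"
    then have "rep_fun K n \<rho> f = 0\<^sub>m n n" by (intro eq_matI) (auto simp: rep_fun_def)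
    then show False using nz by simp
  qed
  moreover have "W = {0\<^sub>v n} \<or> W = carrier_vec n"
    if W: "lin_closed n W" and inv: "\<forall>g\<in>K. \<forall>v\<in>W. \<rho> g *\<^sub>v v \<in> W" for W
  proof (rule ccontr)
    assume contra: "\<not> (W = {0\<^sub>v n} \<or> W = carrier_vec n)"
    note car = mat_repD(1)[OF rep, simplified]
    obtain k P L where P: "P \<in> carrier_mat n k" and L: "L \<in> carrier_mat k n" and LP: "L * P = 1\<^sub>m k"
      and im: "W = (\<lambda>v. P *\<^sub>v v) ` carrier_vec k"
      using lin_closed_parametrization[OF W] by metis
    define D where "D = 1\<^sub>m n - P * L"
    note D = complement_idempotent[OF P L LP, folded D_def]
    have PL: "P * L \<in> carrier_mat n n" using P L by simp
    have k0: "k > 0"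
    proof (rule ccontr)
      assume "\<not> k > 0"
      then have "P *\<^sub>v v = 0\<^sub>v n" if "v \<in> carrier_vec k" for v
        using that P by (intro eq_vecI) (auto simp: scalar_prod_def)
      then have "W \<subseteq> {0\<^sub>v n}" unfolding im by auto
      then show False using contra W unfolding lin_closed_def by auto
    qed
    have kn: "k < n"
    proof (rule ccontr)
      assume "\<not> k < n"
      then have "k = n" using left_inverse_dim_le[OF P L LP] by simp
      then have "P * L = 1\<^sub>m n" using mat_mult_left_right_inverse[of L n P] P L LP by simp
      then have "v \<in> W" if "v \<in> carrier_vec n" for v
        using that assoc_mult_mat_vec[OF P L that] \<open>k = n\<close> L unfolding im
        by (intro image_eqI[of _ _ "L *\<^sub>v v"]) auto
      then show False using contra W unfolding lin_closed_def by auto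
    qed
    have absorb: "P * L * (\<rho> g * P) = \<rho> g * P" if g: "g \<in> K" for g
    proof (rule mat_eq_by_vec)
      fix v :: "complex vec" assume v: "v \<in> carrier_vec k"
      have gP: "\<rho> g * P \<in> carrier_mat n k" using car[OF g] P by simp
      have "(\<rho> g * P) *\<^sub>v v \<in> W"
        using inv g v P assoc_mult_mat_vec[OF car[OF g] P v] unfolding im by auto
      then obtain w where w: "w \<in> carrier_vec k" "(\<rho> g * P) *\<^sub>v v = P *\<^sub>v w" unfolding im by auto
      have "P * L * (\<rho> g * P) *\<^sub>v v = P *\<^sub>v (L *\<^sub>v (P *\<^sub>v w))"
        using assoc_mult_mat_vec[OF PL gP v] w assoc_mult_mat_vec[OF P L, of "P *\<^sub>v w"] P by simp
      also have "L *\<^sub>v (P *\<^sub>v w) = w" using assoc_mult_mat_vec[OF L P w(1)] LP w(1) by simp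
      finally show "P * L * (\<rho> g * P) *\<^sub>v v = (\<rho> g * P) *\<^sub>v v" using w(2) by simp
    qed (use car[OF g] P L in auto)
    have "mat_rep (sub K) k (\<lambda>g. L * \<rho> g * P)"
    proof (rule mat_rep_compress[OF L P LP rep])
      fix g h assume g: "g \<in> K" and h: "h \<in> K"
      have "L * \<rho> g * (P * L) * \<rho> h * P = (L * \<rho> g) * (P * L * (\<rho> h * P))"
        by (simp add: mat_assoc_dim carrier_matD[OF L] carrier_matD[OF P] carrier_matD[OF car[OF g]] carrier_matD[OF car[OF h]])
      also have "\<dots> = L * \<rho> g * \<rho> h * P"
        unfolding absorb[OF h]
        by (simp add: mat_assoc_dim carrier_matD[OF L] carrier_matD[OF P] carrier_matD[OF car[OF g]] carrier_matD[OF car[OF h]])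
      finally show "L * \<rho> g * (P * L) * \<rho> h * P = L * \<rho> g * \<rho> h * P" .
    qed
    from least[OF kn this] have LFP: "L * F * P = 0\<^sub>m k k"
      unfolding F_def rep_fun_compress[OF L P rep] .
    have FP_entry: "P * L * (F * P) = F * P"
    proof -
      have lin: "rep_fun K n \<rho> f * P = mat n k (\<lambda>(i, j). \<Sum>g\<in>K. f g * (\<rho> g * P) $$ (i, j))"
      proof (rule eq_matI)
        fix i j assume "i < dim_row (mat n k (\<lambda>(i, j). \<Sum>g\<in>K. f g * (\<rho> g * P) $$ (i, j)))"
          "j < dim_col (mat n k (\<lambda>(i, j). \<Sum>g\<in>K. f g * (\<rho> g * P) $$ (i, j)))"
        then have ij: "i < n" "j < k" by auto
        have "(rep_fun K n \<rho> f * P) $$ (i, j) = (\<Sum>a<n. \<Sum>g\<in>K. f g * \<rho> g $$ (i, a) * P $$ (a, j))"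
          using ij by (simp add: index_mult_mat_sum[OF rep_fun_carrier P]) (simp add: rep_fun_def sum_distrib_right)
        also have "\<dots> = (\<Sum>g\<in>K. \<Sum>a<n. f g * \<rho> g $$ (i, a) * P $$ (a, j))" by (rule sum.swap)
        also have "\<dots> = (\<Sum>g\<in>K. f g * (\<rho> g * P) $$ (i, j))"
          using ij by (intro sum.cong refl) (simp add: index_mult_mat_sum[OF car P] sum_distrib_left mult.assoc)
        finally show "(rep_fun K n \<rho> f * P) $$ (i, j) = mat n k (\<lambda>(i, j). \<Sum>g\<in>K. f g * (\<rho> g * P) $$ (i, j)) $$ (i, j)"
          using ij by simp
      qed (use P in \<open>auto simp: rep_fun_def\<close>)
      show ?thesis
      proof (rule eq_matI)
        fix i j assume "i < dim_row (F * P)" "j < dim_col (F * P)"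
        then have ij: "i < n" "j < k" using F P by auto
        have FPc: "F * P \<in> carrier_mat n k" using F P by simp
        have "(P * L * (F * P)) $$ (i, j) = (\<Sum>a<n. \<Sum>g\<in>K. f g * ((P * L) $$ (i, a) * (\<rho> g * P) $$ (a, j)))"
          using ij by (simp add: index_mult_mat_sum[OF PL FPc])
            (simp add: F_def lin sum_distrib_left mult_ac)
        also have "\<dots> = (\<Sum>g\<in>K. \<Sum>a<n. f g * ((P * L) $$ (i, a) * (\<rho> g * P) $$ (a, j)))" by (rule sum.swap)
        also have "\<dots> = (\<Sum>g\<in>K. f g * (P * L * (\<rho> g * P)) $$ (i, j))"
          by (intro sum.cong refl)
            (simp only: index_mult_mat_sum[OF PL mult_carrier_mat[OF car P] ij] sum_distrib_left)
        also have "\<dots> = (F * P) $$ (i, j)" using ij by (simp add: absorb F_def lin)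
        finally show "(P * L * (F * P)) $$ (i, j) = (F * P) $$ (i, j)" .
      qed (use F P L in auto)
    qed
    have FP: "F * P = 0\<^sub>m n k"
    proof -
      have "F * P = P * (L * F * P)"
        using FP_entry by (simp add: mat_assoc_dim carrier_matD[OF L] carrier_matD[OF P] carrier_matD[OF F])
      then show ?thesis using LFP P by simp
    qed
    define W' where "W' = (\<lambda>v. D *\<^sub>v v) ` carrier_vec n"
    have "lin_closed n W'" unfolding lin_closed_def
    proof (intro conjI ballI allI)
      show "W' \<subseteq> carrier_vec n" unfolding W'_def using D(1) by auto
      show "0\<^sub>v n \<in> W'" unfolding W'_def using D(1) by (auto intro!: image_eqI[of _ _ "0\<^sub>v n"])
      show "v + w \<in> W'" if vw: "v \<in> W'" "w \<in> W'" for v w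
      proof -
        obtain v' w' where "v = D *\<^sub>v v'" "w = D *\<^sub>v w'" "v' \<in> carrier_vec n" "w' \<in> carrier_vec n"
          using vw unfolding W'_def by auto
        then show ?thesis unfolding W'_def
          by (intro image_eqI[of _ _ "v' + w'"]) (auto simp: mult_add_distrib_mat_vec[OF D(1)])
      qed
      show "c \<cdot>\<^sub>v v \<in> W'" if v: "v \<in> W'" for c v
      proof -
        obtain v' where "v = D *\<^sub>v v'" "v' \<in> carrier_vec n" using v unfolding W'_def by auto
        then show ?thesis unfolding W'_def by (intro image_eqI[of _ _ "c \<cdot>\<^sub>v v'"]) (auto simp: mult_mat_vec[OF D(1)])
      qed
    qed
    then obtain k' P' L' where P': "P' \<in> carrier_mat n k'" and L': "L' \<in> carrier_mat k' n" and LP': "L' * P' = 1\<^sub>m k'"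
      and im': "W' = (\<lambda>v. P' *\<^sub>v v) ` carrier_vec k'"
      using lin_closed_parametrization by metis
    \<comment> \<open>The kernel of L'' is W, and P' identifies the new coordinates with the image
      of D, a complement of W. Compressing with this pair gives the quotient representation.\<close>
    define L'' where "L'' = L' * D"
    have L'': "L'' \<in> carrier_mat k' n" unfolding L''_def using L' D(1) by simp
    have DP': "D * P' = P'"
    proof (rule mat_eq_by_vec)
      fix v :: "complex vec" assume v: "v \<in> carrier_vec k'"
      then have "P' *\<^sub>v v \<in> W'" unfolding im' by auto
      then obtain u where u: "u \<in> carrier_vec n" "P' *\<^sub>v v = D *\<^sub>v u" unfolding W'_def by auto
      have "D * P' *\<^sub>v v = D *\<^sub>v (D *\<^sub>v u)" using assoc_mult_mat_vec[OF D(1) P' v] u by simp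
      also have "\<dots> = D *\<^sub>v u" using assoc_mult_mat_vec[OF D(1) D(1) u(1)] D(2) by simp
      finally show "D * P' *\<^sub>v v = P' *\<^sub>v v" using u by simp
    qed (use D(1) P' in auto)
    have LP'': "L'' * P' = 1\<^sub>m k'"
      unfolding L''_def using assoc_mult_mat[OF L' D(1) P'] DP' LP' by simp
    have PL'': "P' * L'' = D"
    proof (rule mat_eq_by_vec)
      fix v :: "complex vec" assume v: "v \<in> carrier_vec n"
      then have "D *\<^sub>v v \<in> W'" unfolding W'_def by auto
      then obtain u where u: "u \<in> carrier_vec k'" "D *\<^sub>v v = P' *\<^sub>v u" unfolding im' by auto
      have "P' * L'' *\<^sub>v v = P' *\<^sub>v (L' *\<^sub>v (D *\<^sub>v v))"
        unfolding L''_def using assoc_mult_mat_vec[OF P' L''[unfolded L''_def] v] assoc_mult_mat_vec[OF L' D(1) v] by simp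
      also have "L' *\<^sub>v (D *\<^sub>v v) = u"
        unfolding u(2) using assoc_mult_mat_vec[OF L' P' u(1)] LP' u(1) by simp
      finally show "P' * L'' *\<^sub>v v = D *\<^sub>v v" using u by simp
    qed (use P' L'' D(1) in auto)
    have LP0: "L'' * P = 0\<^sub>m k' k" unfolding L''_def using assoc_mult_mat[OF L' D(1) P] D(4) L' by simp
    have k'n: "k' < n"
    proof -
      have "(of_nat k' :: complex) = of_nat n - of_nat k"
        using mat_trace_comm[OF P' L''] LP'' PL'' D(5) by (simp add: trace_one_mat)
      then have "(of_nat (k' + k) :: complex) = of_nat n" by simp
      then have "k' + k = n" using of_nat_eq_iff by blast
      then show ?thesis using k0 by simp
    qed
    have "mat_rep (sub K) k' (\<lambda>g. L'' * \<rho> g * P')"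
    proof (rule mat_rep_compress[OF L'' P' LP'' rep])
      fix g h assume g: "g \<in> K" and h: "h \<in> K"
      note cg = car[OF g] and ch = car[OF h]
      have Lg: "L'' * \<rho> g \<in> carrier_mat k' n" using L'' cg by simp
      have "L'' * \<rho> g * (P * L) = L'' * (\<rho> g * P) * L"
        by (simp add: mat_assoc_dim carrier_matD[OF L] carrier_matD[OF P] carrier_matD[OF L''] carrier_matD[OF cg])
      also have "L'' * (\<rho> g * P) = L'' * P * (L * (\<rho> g * P))"
        using absorb[OF g]
        by (simp add: mat_assoc_dim carrier_matD[OF L] carrier_matD[OF P] carrier_matD[OF L''] carrier_matD[OF cg])
      also have "\<dots> = 0\<^sub>m k' k" unfolding LP0 using L cg P by simp
      finally have zero: "L'' * \<rho> g * (P * L) = 0\<^sub>m k' n" using L by simp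
      have "L'' * \<rho> g * D = L'' * \<rho> g - L'' * \<rho> g * (P * L)"
        unfolding D_def mult_minus_distrib_mat[OF Lg one_carrier_mat PL] right_mult_one_mat[OF Lg] ..
      also have "\<dots> = L'' * \<rho> g" unfolding zero using carrier_matD[OF L''] carrier_matD[OF cg] by (intro eq_matI) auto
      finally show "L'' * \<rho> g * (P' * L'') * \<rho> h * P' = L'' * \<rho> g * \<rho> h * P'" unfolding PL'' by simp
    qed
    from least[OF k'n this] have LFP': "L'' * F * P' = 0\<^sub>m k' k'"
      unfolding F_def rep_fun_compress[OF L'' P' rep] .
    \<comment> \<open>F kills W, hence F = F * D; it also vanishes on the quotient, hence D * F * D
      = 0. Together D * F = 0 and F = F * F = F * D * F = 0.\<close>
    have FD: "F * D = F"
    proof -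
      have "F * (P * L) = 0\<^sub>m n n" using assoc_mult_mat[OF F P L] FP L by simp
      moreover have "F * D = F - F * (P * L)"
        unfolding D_def using mult_minus_distrib_mat[OF F one_carrier_mat PL] F by simp
      ultimately show ?thesis using F by (auto intro!: eq_matI)
    qed
    have "D * F * D = P' * (L'' * F * P') * L''"
      unfolding PL''[symmetric]
      by (simp add: mat_assoc_dim carrier_matD[OF P'] carrier_matD[OF L''] carrier_matD[OF F])
    also have "\<dots> = 0\<^sub>m n n" unfolding LFP' using P' L'' by simp
    finally have "D * F = 0\<^sub>m n n" using assoc_mult_mat[OF D(1) F D(1)] FD by simp
    moreover have "F = F * D * F" using FD FF by simp
    ultimately have "F = 0\<^sub>m n n" using assoc_mult_mat[OF F D(1) F] F by simp
    then show False using nz unfolding F_def by simp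
  qed
  ultimately show ?thesis using rep unfolding S.irreducible_rep_iff by simp
qed

end

lemma Irr_pullback:
  assumes Q: "group Q" and Q': "group Q'" and \<tau>: "\<tau> \<in> iso Q' Q" and \<theta>: "\<theta> \<in> Irr Q"
  shows "(\<lambda>x\<in>carrier Q'. \<theta> (\<tau> x)) \<in> Irr Q'"
proof -
  interpret Q: group Q by fact
  interpret Q': group Q' by fact
  have hom: "\<tau> \<in> hom Q' Q" and im: "\<tau> ` carrier Q' = carrier Q"
    using \<tau> unfolding iso_def bij_betw_def by auto
  then have cl: "\<tau> x \<in> carrier Q" if "x \<in> carrier Q'" for x using that by auto
  obtain n \<rho> where irr: "irreducible_rep Q n \<rho>" and \<theta>_eq: "\<theta> = (\<lambda>g\<in>carrier Q. mat_trace (\<rho> g))"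
    using \<theta> unfolding Irr_def by auto
  have n: "n > 0" and rep: "mat_rep Q n \<rho>" using irr Q.irreducible_rep_iff by auto
  have "\<tau> \<one>\<^bsub>Q'\<^esub> = \<one>\<^bsub>Q\<^esub>" using hom_one[OF hom Q' Q] .
  then have "mat_rep Q' n (\<lambda>x. \<rho> (\<tau> x))"
    using rep cl hom unfolding mat_rep_def by (auto simp: hom_mult)
  moreover have "W = {0\<^sub>v n} \<or> W = carrier_vec n"
    if W: "lin_closed n W" and inv: "\<forall>g\<in>carrier Q'. \<forall>v\<in>W. \<rho> (\<tau> g) *\<^sub>v v \<in> W" for W
  proof -
    have "\<forall>g\<in>carrier Q. \<forall>v\<in>W. \<rho> g *\<^sub>v v \<in> W" using inv unfolding im[symmetric] by blast
    then show ?thesis using irr W unfolding Q.irreducible_rep_iff by blast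
  qed
  ultimately have "irreducible_rep Q' n (\<lambda>x. \<rho> (\<tau> x))" using n unfolding Q'.irreducible_rep_iff by blast
  then show ?thesis
    unfolding Irr_def using \<theta>_eq cl
    by (intro CollectI exI[of _ n] exI[of _ "\<lambda>x. \<rho> (\<tau> x)"]) (auto intro!: restrict_ext)
qed

section \<open>The regular representation, Bessel's inequality and completeness\<close>

context fin_group
begin

text \<open>In the regular representation the coefficient of f at x reappears as the entry in the
  row of x and the column of the unit, so a nonzero f acts nontrivially.\<close>

lemma regular_rep:
  assumes K: "subgroup K G" and f: "f \<in> fn_on K" "f x \<noteq> 0"
  shows "\<exists>\<rho>. mat_rep (sub K) (card K) \<rho> \<and> rep_fun K (card K) \<rho> f \<noteq> 0\<^sub>m (card K) (card K)"
proof -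
  interpret K: subgroup K G by fact
  define n where "n = card K"
  obtain e where e: "bij_betw e {0..<n} K"
    unfolding n_def using ex_bij_betw_nat_finite[OF finite_sub[OF K]] by blast
  have eK: "e i \<in> K" if "i < n" for i using e that unfolding bij_betw_def by auto
  have surj: "\<exists>i<n. e i = g" if "g \<in> K" for g using e that unfolding bij_betw_def by force
  have inj: "i = j" if "i < n" "j < n" "e i = e j" for i j
    using e that unfolding bij_betw_def inj_on_def by simp
  define \<rho> where "\<rho> g = mat n n (\<lambda>(i, j). if e i = g \<otimes> e j then 1 else 0 :: complex)" for g
  have car: "\<rho> g \<in> carrier_mat n n" for g unfolding \<rho>_def by simp
  have "\<rho> (g \<otimes> h) = \<rho> g * \<rho> h" if g: "g \<in> K" and h: "h \<in> K" for g h
  proof (rule eq_matI)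
    fix i j assume "i < dim_row (\<rho> g * \<rho> h)" "j < dim_col (\<rho> g * \<rho> h)"
    then have ij: "i < n" "j < n" by (auto simp: \<rho>_def)
    obtain k0 where k0: "k0 < n" "e k0 = h \<otimes> e j" using surj[of "h \<otimes> e j"] h eK[OF ij(2)] by auto
    have "(\<rho> g * \<rho> h) $$ (i, j) = (\<Sum>k<n. (if e i = g \<otimes> e k then 1 else 0) * (if e k = h \<otimes> e j then 1 else 0))"
      using ij by (simp add: index_mult_mat_sum[OF car car]) (simp add: \<rho>_def)
    also have "\<dots> = (\<Sum>k<n. if k = k0 then (if e i = g \<otimes> (h \<otimes> e j) then 1 else 0) else 0)"
      using k0 inj by (intro sum.cong) auto
    also have "\<dots> = (if e i = g \<otimes> (h \<otimes> e j) then 1 else 0)" using k0 by simp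
    finally show "\<rho> (g \<otimes> h) $$ (i, j) = (\<rho> g * \<rho> h) $$ (i, j)"
      using ij g h eK by (simp add: \<rho>_def m_assoc)
  qed (auto simp: \<rho>_def)
  moreover have "\<rho> \<one> = 1\<^sub>m n"
    using eK inj by (intro eq_matI) (auto simp: \<rho>_def)
  ultimately have rep: "mat_rep (sub K) n \<rho>" using car unfolding mat_rep_def by simp
  have x: "x \<in> K" using f(2) fn_onD[OF f(1), of x] by auto
  obtain i where i: "i < n" "e i = x" using surj[OF x] by blast
  obtain j where j: "j < n" "e j = \<one>" using surj[OF K.one_closed] by blast
  have "rep_fun K n \<rho> f $$ (i, j) = (\<Sum>g\<in>K. if g = x then f x else 0)"
    using i j by (simp add: rep_fun_def) (intro sum.cong, auto simp: \<rho>_def)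
  also have "\<dots> = f x" using x finite_sub[OF K] by simp
  finally have "rep_fun K n \<rho> f \<noteq> 0\<^sub>m n n" using f(2) i j by auto
  then show ?thesis using rep unfolding n_def by blast
qed

lemma delta_fn_on: "subgroup K G \<Longrightarrow> delta \<in> fn_on K"
  using subgroup.one_closed by (auto simp: delta_def fn_on_def)

lemma idem_complement:
  assumes K: "subgroup K G" and F: "finite F" "F \<subseteq> Irr (sub K)"
  defines "f \<equiv> \<lambda>x. delta x - (\<Sum>\<theta>\<in>F. idem K \<theta> x)"
  shows "f \<in> fn_on K" "f \<star> f = f" "\<And>\<theta>. \<theta> \<in> F \<Longrightarrow> f \<star> idem K \<theta> = (\<lambda>_. 0)"
proof -
  interpret K: subgroup K G by fact
  have idG: "idem K \<theta> \<in> fn_on (carrier G)" for \<theta> using idem_fn_on K.subset fn_on_mono by blast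
  show fK: "f \<in> fn_on K" unfolding f_def
    using delta_fn_on[OF K] idem_fn_on by (auto simp: fn_on_def)
  then have fG: "f \<in> fn_on (carrier G)" using K.subset fn_on_mono by blast
  show kill: "f \<star> idem K \<theta> = (\<lambda>_. 0)" if \<theta>: "\<theta> \<in> F" for \<theta>
  proof
    fix x
    have "(\<Sum>\<eta>\<in>F. (idem K \<eta> \<star> idem K \<theta>) x) = (\<Sum>\<eta>\<in>F. if \<eta> = \<theta> then idem K \<theta> x else 0)"
      using \<theta> by (intro sum.cong refl) (auto simp: idem_conv_idem[OF K subsetD[OF F(2)] subsetD[OF F(2)]])
    then show "(f \<star> idem K \<theta>) x = 0"
      unfolding f_def conv_diff_left conv_sum_left delta_conv[OF idG] using \<theta> F(1) by simp
  qed
  have "f \<star> f = (\<lambda>x. (f \<star> delta) x - (\<Sum>\<theta>\<in>F. (f \<star> idem K \<theta>) x))"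
    by (subst (2) f_def) (simp add: conv_diff_right conv_sum_right)
  then show "f \<star> f = f" using kill conv_delta[OF fG] by simp
qed

text \<open>Bessel's inequality: for a finite set of irreducible characters the complementary
  idempotent f is self-adjoint, so f(1) is a sum of squared absolute values. As f(1) is 1 minus the
  sum of the squared degrees divided by |K|, there are at most |K| characters.\<close>

lemma finite_Irr:
  assumes K: "subgroup K G"
  shows "finite (Irr (sub K))"
proof (rule finite_if_finite_subsets_card_bdd[of _ "card K", THEN conjunct1])
  interpret K: subgroup K G by fact
  fix F assume F: "F \<subseteq> Irr (sub K)" "finite F"
  define f where "f = (\<lambda>x. delta x - (\<Sum>\<theta>\<in>F. idem K \<theta> x))"
  note f = idem_complement[OF K F(2,1), folded f_def]
  have star: "f (inv y) = cnj (f y)" if y: "y \<in> K" for y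
  proof -
    have "idem K \<theta> (inv y) = cnj (idem K \<theta> y)" if "\<theta> \<in> F" for \<theta>
      using that F y char_deg_Irr[OF K, of \<theta>] Irr_cnj[OF K _ y, of \<theta>] by (auto simp: idem_def subsetD)
    moreover have "delta (inv y) = delta y"
      using y by (simp add: delta_def)
    ultimately show ?thesis by (simp add: f_def delta_def)
  qed
  have "f \<one> = (f \<star> f) \<one>" using f(2) by simp
  also have "\<dots> = (\<Sum>y\<in>K. f y * f (inv y))"
    using conv_sub[OF K f(1) one_closed, of f] by (simp add: K.subset[THEN subsetD])
  also have "\<dots> = of_real (\<Sum>y\<in>K. (norm (f y))\<^sup>2)"
    by (simp add: star complex_norm_square[symmetric])
  finally have "Re (f \<one>) \<ge> 0" by (simp add: sum_nonneg)
  moreover have "f \<one> = 1 - (\<Sum>\<theta>\<in>F. \<theta> \<one> ^ 2) / of_nat (card K)"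
    by (simp add: f_def delta_def idem_one[OF K] sum_divide_distrib)
  moreover have "(\<Sum>\<theta>\<in>F. \<theta> \<one> ^ 2) = of_nat (\<Sum>\<theta>\<in>F. char_deg G \<theta> ^ 2)"
    using F char_deg_Irr[OF K] by (simp add: subsetD)
  ultimately have "real (\<Sum>\<theta>\<in>F. char_deg G \<theta> ^ 2) / real (card K) \<le> 1"
    by (simp del: of_nat_sum of_nat_power)
  then have "real (\<Sum>\<theta>\<in>F. char_deg G \<theta> ^ 2) \<le> real (card K)"
    using card_sub_pos[OF K] by (simp add: divide_le_eq_1 del: of_nat_sum of_nat_power)
  then have "(\<Sum>\<theta>\<in>F. char_deg G \<theta> ^ 2) \<le> card K" using of_nat_le_iff by blast
  moreover have "card F \<le> (\<Sum>\<theta>\<in>F. char_deg G \<theta> ^ 2)"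
  proof -
    have "(\<Sum>\<theta>\<in>F. 1) \<le> (\<Sum>\<theta>\<in>F. char_deg G \<theta> ^ 2)"
      using F char_deg_Irr(2)[OF K] by (intro sum_mono) (auto simp: Suc_le_eq)
    then show ?thesis by simp
  qed
  ultimately show "card F \<le> card K" by simp
qed

text \<open>If the complementary idempotent were nonzero, some representation would see it, by
  \<open>regular_rep\<close>. One of least degree is irreducible, and the idempotent of its own
  character acts on it as the identity, although f annihilates that idempotent.\<close>

lemma sum_idem:
  assumes K: "subgroup K G"
  shows "(\<Sum>\<theta>\<in>Irr (sub K). idem K \<theta> x) = delta x"
proof (rule ccontr)
  interpret K: subgroup K G by fact
  assume neq: "(\<Sum>\<theta>\<in>Irr (sub K). idem K \<theta> x) \<noteq> delta x"
  define f where "f = (\<lambda>x. delta x - (\<Sum>\<theta>\<in>Irr (sub K). idem K \<theta> x))"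
  note f = idem_complement[OF K finite_Irr[OF K] subset_refl, folded f_def]
  have "f x \<noteq> 0" using neq unfolding f_def by simp
  define Q where "Q n \<longleftrightarrow> (\<exists>\<rho>. mat_rep (sub K) n \<rho> \<and> rep_fun K n \<rho> f \<noteq> 0\<^sub>m n n)" for n
  define n where "n = (LEAST n. Q n)"
  have "Q (card K)" unfolding Q_def using regular_rep[OF K f(1) \<open>f x \<noteq> 0\<close>] .
  then have "Q n" and least: "\<And>k. k < n \<Longrightarrow> \<not> Q k"
    unfolding n_def by (auto intro: LeastI dest: not_less_Least)
  then obtain \<rho> where rep: "mat_rep (sub K) n \<rho>" and nz: "rep_fun K n \<rho> f \<noteq> 0\<^sub>m n n"
    unfolding Q_def by blast
  have irr: "irreducible_rep (sub K) n \<rho>"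
    by (rule least_rep_irreducible[OF K f(1,2) rep nz]) (use least in \<open>auto simp: Q_def\<close>)
  define \<theta> where "\<theta> = (\<lambda>g\<in>K. mat_trace (\<rho> g))"
  have \<theta>: "\<theta> \<in> Irr (sub K)" unfolding Irr_def \<theta>_def using irr by auto
  have n: "n > 0" using irr unfolding irreducible_rep_def by simp
  have \<theta>1: "\<theta> \<one> = of_nat n"
    using mat_repD(3)[OF rep] by (simp add: \<theta>_def trace_one_mat)
  have "rep_fun K n \<rho> (idem K \<theta>) = 1\<^sub>m n"
  proof (rule eq_matI)
    fix i j assume "i < dim_row (1\<^sub>m n)" "j < dim_col (1\<^sub>m n)"
    then have ij: "i < n" "j < n" by auto
    have "rep_fun K n \<rho> (idem K \<theta>) $$ (i, j) =
        (\<Sum>g\<in>K. \<Sum>a<n. of_nat n / of_nat (card K) * (\<rho> g $$ (i, j) * \<rho> (inv g) $$ (a, a)))"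
      using ij by (simp add: rep_fun_def idem_def \<theta>1 Irr_value[OF rep \<theta>_def] sum_distrib_left mult_ac)
    also have "\<dots> = (\<Sum>a<n. of_nat n / of_nat (card K) * (\<Sum>g\<in>K. \<rho> g $$ (i, j) * \<rho> (inv g) $$ (a, a)))"
      by (subst sum.swap) (simp add: sum_distrib_left)
    also have "\<dots> = (\<Sum>a<n. if a = i then (if i = j then 1 else 0) else 0)"
      using ij n card_sub_pos[OF K] by (intro sum.cong refl) (simp add: sub_orthogonality[OF K irr])
    also have "\<dots> = 1\<^sub>m n $$ (i, j)" using ij by simp
    finally show "rep_fun K n \<rho> (idem K \<theta>) $$ (i, j) = 1\<^sub>m n $$ (i, j)" .
  qed (auto simp: rep_fun_def)
  then have "rep_fun K n \<rho> f = rep_fun K n \<rho> (f \<star> idem K \<theta>)"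
    unfolding rep_fun_conv[OF K rep f(1) idem_fn_on] by (simp add: right_mult_one_mat[OF rep_fun_carrier])
  also have "\<dots> = 0\<^sub>m n n" unfolding f(3)[OF \<theta>] by (intro eq_matI) (auto simp: rep_fun_def)
  finally show False using nz by simp
qed

lemma sum_degree_Irr:
  assumes K: "subgroup K G" and x: "x \<in> K"
  shows "(\<Sum>\<theta>\<in>Irr (sub K). \<theta> \<one> * \<theta> x) = (if x = \<one> then of_nat (card K) else 0)"
proof -
  interpret K: subgroup K G by fact
  have "(\<Sum>\<theta>\<in>Irr (sub K). \<theta> \<one> * \<theta> x) = of_nat (card K) * (\<Sum>\<theta>\<in>Irr (sub K). idem K \<theta> (inv x))"
    using x card_sub_pos[OF K] by (simp add: idem_def sum_distrib_left)
  then show ?thesis using x unfolding sum_idem[OF K] by (simp add: delta_def)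
qed

text \<open>The right side counts the elements conjugating y to the inverse of x, in place of
  conjugacy classes and centralizers. Mackey's formula in \<open>cmult_overlap_dvd\<close> starts
  from this count.\<close>

lemma column_orthogonality:
  assumes K: "subgroup K G" and x: "x \<in> K" and y: "y \<in> K"
  shows "(\<Sum>\<theta>\<in>Irr (sub K). \<theta> x * \<theta> y) = (\<Sum>g\<in>K. if x \<otimes> g \<otimes> y \<otimes> inv g = \<one> then 1 else 0)"
proof -
  interpret K: subgroup K G by fact
  have "(\<Sum>\<theta>\<in>Irr (sub K). \<theta> x * \<theta> y) =
      (\<Sum>\<theta>\<in>Irr (sub K). \<Sum>g\<in>K. \<theta> \<one> * \<theta> (x \<otimes> g \<otimes> y \<otimes> inv g) / of_nat (card K))"
    using Irr_product[OF K _ x y] by (simp add: sum_distrib_left sum_divide_distrib)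
  also have "\<dots> = (\<Sum>g\<in>K. (\<Sum>\<theta>\<in>Irr (sub K). \<theta> \<one> * \<theta> (x \<otimes> g \<otimes> y \<otimes> inv g)) / of_nat (card K))"
    by (subst sum.swap) (simp add: sum_divide_distrib)
  also have "\<dots> = (\<Sum>g\<in>K. if x \<otimes> g \<otimes> y \<otimes> inv g = \<one> then 1 else 0)"
    using x y card_sub_pos[OF K] by (intro sum.cong refl) (simp add: sum_degree_Irr[OF K])
  finally show ?thesis .
qed

lemma class_function_expansion:
  assumes K: "subgroup K G" and f: "\<And>k x. k \<in> K \<Longrightarrow> x \<in> K \<Longrightarrow> f (k \<otimes> x \<otimes> inv k) = f x" and x: "x \<in> K"
  shows "f x = (\<Sum>\<theta>\<in>Irr (sub K). (\<Sum>y\<in>K. f y * \<theta> (inv y)) / of_nat (card K) * \<theta> x)"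
proof -
  interpret K: subgroup K G by fact
  have "(\<Sum>\<theta>\<in>Irr (sub K). (\<Sum>y\<in>K. f y * \<theta> (inv y)) / of_nat (card K) * \<theta> x) =
      (\<Sum>\<theta>\<in>Irr (sub K). \<Sum>y\<in>K. f y * (\<theta> x * \<theta> (inv y)) / of_nat (card K))"
    by (simp add: sum_divide_distrib sum_distrib_right sum_distrib_left mult_ac)
  also have "\<dots> = (\<Sum>y\<in>K. f y * (\<Sum>\<theta>\<in>Irr (sub K). \<theta> x * \<theta> (inv y)) / of_nat (card K))"
    by (subst sum.swap) (simp add: sum_divide_distrib sum_distrib_left)
  also have "\<dots> = (\<Sum>y\<in>K. \<Sum>g\<in>K. f y * (if x \<otimes> g \<otimes> inv y \<otimes> inv g = \<one> then 1 else 0) / of_nat (card K))"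
    using x by (simp add: column_orthogonality[OF K] sum_divide_distrib sum_distrib_left)
  also have "\<dots> = (\<Sum>g\<in>K. \<Sum>y\<in>K. f y * (if x \<otimes> g \<otimes> inv y \<otimes> inv g = \<one> then 1 else 0) / of_nat (card K))"
    by (rule sum.swap)
  also have "\<dots> = (\<Sum>g\<in>K. f x / of_nat (card K))"
  proof (rule sum.cong[OF refl])
    fix g assume g: "g \<in> K"
    have "(\<Sum>y\<in>K. f y * (if x \<otimes> g \<otimes> inv y \<otimes> inv g = \<one> then 1 else 0) / of_nat (card K)) =
        (\<Sum>y\<in>K. if y = inv g \<otimes> x \<otimes> g then f x / of_nat (card K) else 0)"
    proof (rule sum.cong[OF refl])
      fix y assume y: "y \<in> K"
      have "x \<otimes> g \<otimes> inv y \<otimes> inv g = \<one> \<longleftrightarrow> y = inv g \<otimes> x \<otimes> g"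
      proof
        assume "x \<otimes> g \<otimes> inv y \<otimes> inv g = \<one>"
        then have "x \<otimes> g \<otimes> inv y = g" using x g y inv_equality[of "x \<otimes> g \<otimes> inv y" "inv g"] by simp
        then have "x \<otimes> g = g \<otimes> y" using x g y
          by (metis K.mem_carrier K.m_closed inv_solve_right)
        then show "y = inv g \<otimes> x \<otimes> g" using x g y by (simp add: m_assoc) (simp add: m_assoc[symmetric])
      next
        assume "y = inv g \<otimes> x \<otimes> g"
        then show "x \<otimes> g \<otimes> inv y \<otimes> inv g = \<one>"
          using x g by (simp add: inv_mult_group m_assoc) (simp add: m_assoc[symmetric])
      qed
      moreover have "f (inv g \<otimes> x \<otimes> g) = f x" using f[of "inv g" x] g x by simp
      ultimately show "f y * (if x \<otimes> g \<otimes> inv y \<otimes> inv g = \<one> then 1 else 0) / of_nat (card K) =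
        (if y = inv g \<otimes> x \<otimes> g then f x / of_nat (card K) else 0)" by auto
    qed
    also have "\<dots> = f x / of_nat (card K)" using finite_sub[OF K] g x by simp
    finally show "(\<Sum>y\<in>K. f y * (if x \<otimes> g \<otimes> inv y \<otimes> inv g = \<one> then 1 else 0) / of_nat (card K)) = f x / of_nat (card K)" .
  qed
  also have "\<dots> = f x" using card_sub_pos[OF K] by simp
  finally show ?thesis by simp
qed

lemma restrict_decompose:
  assumes K: "subgroup K G" and N: "subgroup N G" and NK: "N \<subseteq> K" and \<chi>: "\<chi> \<in> Irr (sub K)" and x: "x \<in> N"
  shows "\<chi> x = (\<Sum>\<theta>\<in>Irr (sub N). of_nat (cmult N \<chi> \<theta>) * \<theta> x)"
proof -
  have "\<chi> x = (\<Sum>\<theta>\<in>Irr (sub N). (\<Sum>y\<in>N. \<chi> y * \<theta> (inv y)) / of_nat (card N) * \<theta> x)"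
    by (rule class_function_expansion[OF N _ x]) (use NK Irr_class[OF K \<chi>] in \<open>auto simp: subsetD\<close>)
  also have "\<dots> = (\<Sum>\<theta>\<in>Irr (sub N). of_nat (cmult N \<chi> \<theta>) * \<theta> x)"
    by (intro sum.cong refl) (simp add: of_nat_cmult[OF K N NK \<chi>])
  finally show ?thesis .
qed

lemma cmult_trans:
  assumes K: "subgroup K G" and H: "subgroup H G" and N: "subgroup N G" and "N \<subseteq> H" "H \<subseteq> K"
    and \<chi>: "\<chi> \<in> Irr (sub K)" and \<theta>: "\<theta> \<in> Irr (sub N)"
  shows "cmult N \<chi> \<theta> = (\<Sum>\<psi>\<in>Irr (sub H). cmult H \<chi> \<psi> * cmult N \<psi> \<theta>)"
proof -
  have "(of_nat (cmult N \<chi> \<theta>) :: complex) = (\<Sum>x\<in>N. \<chi> x * \<theta> (inv x)) / of_nat (card N)"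
    using of_nat_cmult[OF K N _ \<chi> \<theta>] assms by auto
  also have "\<dots> = (\<Sum>x\<in>N. (\<Sum>\<psi>\<in>Irr (sub H). of_nat (cmult H \<chi> \<psi>) * \<psi> x) * \<theta> (inv x)) / of_nat (card N)"
    using restrict_decompose[OF K H \<open>H \<subseteq> K\<close> \<chi>] \<open>N \<subseteq> H\<close> by (simp add: subsetD)
  also have "\<dots> = (\<Sum>\<psi>\<in>Irr (sub H). of_nat (cmult H \<chi> \<psi>) * ((\<Sum>x\<in>N. \<psi> x * \<theta> (inv x)) / of_nat (card N)))"
    unfolding sum_distrib_right sum_divide_distrib sum_distrib_left
    by (subst sum.swap) (simp add: mult.assoc)
  also have "\<dots> = (\<Sum>\<psi>\<in>Irr (sub H). of_nat (cmult H \<chi> \<psi>) * of_nat (cmult N \<psi> \<theta>))"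
    by (intro sum.cong refl) (simp add: of_nat_cmult[OF H N \<open>N \<subseteq> H\<close> _ \<theta>])
  finally have "(of_nat (cmult N \<chi> \<theta>) :: complex) = of_nat (\<Sum>\<psi>\<in>Irr (sub H). cmult H \<chi> \<psi> * cmult N \<psi> \<theta>)"
    by simp
  then show ?thesis by (simp only: of_nat_eq_iff)
qed

end

section \<open>Clifford theory\<close>

locale fin_normal = fin_group G + normal N G for N and G (structure)
begin

lemma subgroup_N: "subgroup N G"
  by (rule subgroup_axioms)

lemma N_conj [simp]: "x \<in> carrier G \<Longrightarrow> n \<in> N \<Longrightarrow> x \<otimes> n \<otimes> inv x \<in> N"
  "x \<in> carrier G \<Longrightarrow> n \<in> N \<Longrightarrow> inv x \<otimes> n \<otimes> x \<in> N"
  using inv_op_closed1 inv_op_closed2 by auto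

text \<open>With this side of the conjugation G acts from the right, see
  \<open>conj_char_mult\<close>.\<close>

definition conj_char :: "'a \<Rightarrow> ('a \<Rightarrow> complex) \<Rightarrow> 'a \<Rightarrow> complex" where
  "conj_char x \<theta> = (\<lambda>n\<in>N. \<theta> (x \<otimes> n \<otimes> inv x))"

lemma conj_iso:
  assumes x: "x \<in> carrier G"
  shows "(\<lambda>n. x \<otimes> n \<otimes> inv x) \<in> iso (sub N) (sub N)"
  unfolding iso_def hom_def
proof (intro CollectI conjI)
  show "bij_betw (\<lambda>n. x \<otimes> n \<otimes> inv x) (carrier (sub N)) (carrier (sub N))"
    by (rule bij_betw_byWitness[of _ "\<lambda>n. inv x \<otimes> n \<otimes> x"])
      (use x in \<open>auto simp: m_assoc, auto simp: m_assoc[symmetric]\<close>)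
  show "(\<lambda>n. x \<otimes> n \<otimes> inv x) \<in> carrier (sub N) \<rightarrow> carrier (sub N)" using x by auto
  show "\<forall>n\<in>carrier (sub N). \<forall>m\<in>carrier (sub N).
      x \<otimes> (n \<otimes>\<^bsub>sub N\<^esub> m) \<otimes> inv x = (x \<otimes> n \<otimes> inv x) \<otimes>\<^bsub>sub N\<^esub> (x \<otimes> m \<otimes> inv x)"
  proof (intro ballI)
    fix n m assume "n \<in> carrier (sub N)" "m \<in> carrier (sub N)"
    then have nm: "n \<in> carrier G" "m \<in> carrier G" by auto
    have "inv x \<otimes> (x \<otimes> (m \<otimes> inv x)) = m \<otimes> inv x" using x nm by (simp add: m_assoc[symmetric])
    then show "x \<otimes> (n \<otimes>\<^bsub>sub N\<^esub> m) \<otimes> inv x = (x \<otimes> n \<otimes> inv x) \<otimes>\<^bsub>sub N\<^esub> (x \<otimes> m \<otimes> inv x)"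
      using x nm by (simp add: m_assoc)
  qed
qed

lemma conj_char_Irr:
  assumes "x \<in> carrier G" "\<theta> \<in> Irr (sub N)"
  shows "conj_char x \<theta> \<in> Irr (sub N)"
proof -
  have "group (sub N)" using sub_fin_group[OF subgroup_N] fin_group.axioms(1) by blast
  then show ?thesis
    using Irr_pullback[OF _ _ conj_iso[OF assms(1)] assms(2)] unfolding conj_char_def by simp
qed

lemma conj_char_mult:
  assumes "x \<in> carrier G" "y \<in> carrier G"
  shows "conj_char x (conj_char y \<theta>) = conj_char (y \<otimes> x) \<theta>"
proof
  fix n
  show "conj_char x (conj_char y \<theta>) n = conj_char (y \<otimes> x) \<theta> n"
  proof (cases "n \<in> N")
    case True
    have "y \<otimes> (x \<otimes> n \<otimes> inv x) \<otimes> inv y = y \<otimes> x \<otimes> n \<otimes> inv (y \<otimes> x)"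
      using assms True by (simp add: inv_mult_group m_assoc)
    then show ?thesis using True N_conj(1)[OF assms(1) True] by (simp add: conj_char_def)
  qed (simp add: conj_char_def)
qed

lemma Irr_ext: "\<theta> \<in> Irr (sub N) \<Longrightarrow> x \<notin> N \<Longrightarrow> \<theta> x = undefined"
  unfolding Irr_def by auto

lemma conj_char_N:
  assumes "n \<in> N" "\<theta> \<in> Irr (sub N)"
  shows "conj_char n \<theta> = \<theta>"
  using assms Irr_class[OF subgroup_N assms(2) _ assms(1)] Irr_ext[OF assms(2)]
  by (auto simp: conj_char_def fun_eq_iff)

lemma idem_conj_char:
  assumes "x \<in> carrier G" "g \<in> carrier G"
  shows "idem N (conj_char x \<theta>) g = idem N \<theta> (x \<otimes> g \<otimes> inv x)"
proof (cases "g \<in> N")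
  case True
  then have "inv (x \<otimes> g \<otimes> inv x) = x \<otimes> inv g \<otimes> inv x" using assms by (simp add: inv_mult_group m_assoc)
  then show ?thesis using True assms by (simp add: idem_def conj_char_def)
next
  case False
  have "g = inv x \<otimes> (x \<otimes> g \<otimes> inv x) \<otimes> x" using assms by (simp add: m_assoc) (simp add: m_assoc[symmetric])
  then have "x \<otimes> g \<otimes> inv x \<notin> N" using False assms N_conj(2) by metis
  then show ?thesis using False by (simp add: idem_def)
qed

lemma sum_idem_mult:
  assumes K: "subgroup K G" and NK: "N \<subseteq> K" and \<chi>: "\<chi> \<in> Irr (sub K)" and \<theta>: "\<theta> \<in> Irr (sub N)"
  shows "(\<Sum>k\<in>K. idem N \<theta> k * \<chi> k) = \<theta> \<one> * of_nat (cmult N \<chi> \<theta>)"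
proof -
  have "(\<Sum>k\<in>K. idem N \<theta> k * \<chi> k) = (\<Sum>k\<in>N. idem N \<theta> k * \<chi> k)"
    by (rule sum_fn_on[OF idem_fn_on NK finite_sub[OF K]])
  then show ?thesis
    unfolding of_nat_cmult[OF K subgroup_N NK \<chi> \<theta>]
    by (simp add: idem_def sum_distrib_left sum_divide_distrib mult_ac)
qed

text \<open>Evaluation at 1 is what turns identities in the group algebra into equations between
  multiplicities.\<close>

lemma idem_conv_idem_one:
  assumes K: "subgroup K G" and NK: "N \<subseteq> K" and \<chi>: "\<chi> \<in> Irr (sub K)" and \<theta>: "\<theta> \<in> Irr (sub N)"
  shows "(idem N \<theta> \<star> idem K \<chi>) \<one> = \<chi> \<one> * \<theta> \<one> * of_nat (cmult N \<chi> \<theta>) / of_nat (card K)"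
proof -
  have "(idem N \<theta> \<star> idem K \<chi>) \<one> = (\<Sum>y\<in>K. idem N \<theta> y * (\<chi> \<one> / of_nat (card K) * \<chi> y))"
    using subgroup.subset[OF K] subgroup.m_inv_closed[OF K]
    by (subst conv_sub[OF K fn_on_mono[OF idem_fn_on NK]]) (auto simp: idem_def subsetD intro!: sum.cong)
  also have "\<dots> = \<chi> \<one> / of_nat (card K) * (\<Sum>k\<in>K. idem N \<theta> k * \<chi> k)"
    by (simp add: sum_distrib_left mult_ac)
  finally show ?thesis unfolding sum_idem_mult[OF assms] by simp
qed

lemma cmult_conj_char:
  assumes K: "subgroup K G" and NK: "N \<subseteq> K" and \<chi>: "\<chi> \<in> Irr (sub K)" and x: "x \<in> K"
  shows "cmult N \<chi> (conj_char x \<theta>) = cmult N \<chi> \<theta>"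
proof -
  have xG: "x \<in> carrier G" using x subgroup.subset[OF K] by auto
  have "(\<Sum>n\<in>N. \<chi> n * conj_char x \<theta> (inv n)) = (\<Sum>n\<in>N. \<chi> n * \<theta> (inv n))"
  proof (rule sum.reindex_bij_witness[of _ "\<lambda>n. inv x \<otimes> n \<otimes> x" "\<lambda>n. x \<otimes> n \<otimes> inv x"])
    fix n assume n: "n \<in> N"
    then have nG: "n \<in> carrier G" and nK: "n \<in> K" using NK by auto
    show "inv x \<otimes> (x \<otimes> n \<otimes> inv x) \<otimes> x = n" "x \<otimes> (inv x \<otimes> n \<otimes> x) \<otimes> inv x = n"
      using nG xG by (simp_all add: m_assoc) (simp_all add: m_assoc[symmetric])
    have "inv (x \<otimes> n \<otimes> inv x) = x \<otimes> inv n \<otimes> inv x" using nG xG by (simp add: inv_mult_group m_assoc)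
    then show "\<chi> (x \<otimes> n \<otimes> inv x) * \<theta> (inv (x \<otimes> n \<otimes> inv x)) = \<chi> n * conj_char x \<theta> (inv n)"
      using n Irr_class[OF K \<chi> nK x] by (simp add: conj_char_def)
  qed (use xG in auto)
  then show ?thesis unfolding cmult_def by simp
qed

text \<open>Otherwise the sum of the conjugates of the idempotent of \<open>\<theta>\<close>, which acts on \<open>\<chi>\<close> by a
  nonzero scalar, would annihilate the idempotent of \<open>\<theta>'\<close>.\<close>

lemma clifford_conjugate:
  assumes K: "subgroup K G" and NK: "N \<subseteq> K" and \<chi>: "\<chi> \<in> Irr (sub K)"
    and \<theta>: "\<theta> \<in> Irr (sub N)" "cmult N \<chi> \<theta> \<noteq> 0" and \<theta>': "\<theta>' \<in> Irr (sub N)" "cmult N \<chi> \<theta>' \<noteq> 0"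
  shows "\<exists>x\<in>K. \<theta>' = conj_char x \<theta>"
proof (rule ccontr)
  interpret K: subgroup K G by fact
  assume contra: "\<not> (\<exists>x\<in>K. \<theta>' = conj_char x \<theta>)"
  have KG: "x \<in> carrier G" if "x \<in> K" for x using that by simp
  define z where "z = (\<lambda>g. \<Sum>x\<in>K. idem N (conj_char x \<theta>) g)"
  have zK: "z \<in> fn_on K" unfolding z_def
    by (rule fn_onI, rule sum.neutral, rule ballI, rule fn_onD[OF idem_fn_on]) (use NK in blast)
  have zinv: "conj_inv K z" unfolding conj_inv_def
  proof (intro ballI)
    fix k g assume k: "k \<in> K" and g: "g \<in> carrier G"
    have "z (k \<otimes> g \<otimes> inv k) = (\<Sum>x\<in>K. idem N \<theta> (x \<otimes> (k \<otimes> g \<otimes> inv k) \<otimes> inv x))"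
      unfolding z_def using k g by (intro sum.cong refl) (simp add: idem_conj_char)
    also have "\<dots> = (\<Sum>x\<in>K. idem N \<theta> (x \<otimes> g \<otimes> inv x))"
      by (rule sum.reindex_bij_witness[of _ "\<lambda>x. x \<otimes> inv k" "\<lambda>x. x \<otimes> k"])
        (use k g in \<open>auto simp: m_assoc inv_mult_group\<close>)
    also have "\<dots> = z g" unfolding z_def using g by (intro sum.cong refl) (simp add: idem_conj_char)
    finally show "z (k \<otimes> g \<otimes> inv k) = z g" .
  qed
  have "(\<Sum>k\<in>K. z k * \<chi> k) = (\<Sum>x\<in>K. \<Sum>k\<in>K. idem N (conj_char x \<theta>) k * \<chi> k)"
    unfolding z_def sum_distrib_right by (rule sum.swap)
  also have "\<dots> = (\<Sum>x\<in>K. conj_char x \<theta> \<one> * of_nat (cmult N \<chi> \<theta>))"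
    using sum_idem_mult[OF K NK \<chi> conj_char_Irr[OF _ \<theta>(1)]] cmult_conj_char[OF K NK \<chi>]
    by (intro sum.cong refl) simp
  also have "\<dots> = of_nat (card K) * (\<theta> \<one> * of_nat (cmult N \<chi> \<theta>))"
    by (simp add: conj_char_def)
  finally have "(\<Sum>k\<in>K. z k * \<chi> k) \<noteq> 0"
    using card_sub_pos[OF K] \<theta> char_deg_Irr[OF subgroup_N \<theta>(1)] by simp
  then obtain \<omega> where \<omega>: "z \<star> idem K \<chi> = (\<lambda>x. \<omega> * idem K \<chi> x)" "\<omega> \<noteq> 0"
    using class_conv_idem[OF K \<chi> zK zinv] char_deg_Irr[OF K \<chi>] by fastforce
  have "idem N \<theta>' \<star> z = (\<lambda>_. 0)"
    unfolding z_def conv_sum_right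
    using contra by (intro ext sum.neutral ballI) (auto simp: idem_conv_idem[OF subgroup_N \<theta>'(1) conj_char_Irr[OF _ \<theta>(1)]])
  then have "(\<lambda>x. \<omega> * (idem N \<theta>' \<star> idem K \<chi>) x) = (\<lambda>_. 0)"
    using \<omega>(1) conv_assoc[of "idem N \<theta>'" z "idem K \<chi>"] by (simp add: conv_scale_right)
  then have "(idem N \<theta>' \<star> idem K \<chi>) \<one> = 0" using \<omega>(2) by (metis mult_eq_0_iff)
  then show False
    unfolding idem_conv_idem_one[OF K NK \<chi> \<theta>'(1)]
    using \<theta>' char_deg_Irr[OF subgroup_N \<theta>'(1)] char_deg_Irr[OF K \<chi>] card_sub_pos[OF K] by simp
qed

definition constituents :: "('a \<Rightarrow> complex) \<Rightarrow> ('a \<Rightarrow> complex) set" where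
  "constituents \<chi> = {\<theta> \<in> Irr (sub N). cmult N \<chi> \<theta> \<noteq> 0}"

lemma finite_constituents: "finite (constituents \<chi>)"
  unfolding constituents_def using finite_Irr[OF subgroup_N] by simp

lemma constituents_orbit:
  assumes K: "subgroup K G" and NK: "N \<subseteq> K" and \<chi>: "\<chi> \<in> Irr (sub K)" and \<theta>: "\<theta> \<in> constituents \<chi>"
  shows "constituents \<chi> = (\<lambda>x. conj_char x \<theta>) ` K"
proof
  show "constituents \<chi> \<subseteq> (\<lambda>x. conj_char x \<theta>) ` K"
    using clifford_conjugate[OF K NK \<chi>] \<theta> unfolding constituents_def by blast
  show "(\<lambda>x. conj_char x \<theta>) ` K \<subseteq> constituents \<chi>"
    using \<theta> conj_char_Irr cmult_conj_char[OF K NK \<chi>] subgroup.subset[OF K] unfolding constituents_def by auto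
qed

lemma constituents_nonempty:
  assumes K: "subgroup K G" and NK: "N \<subseteq> K" and \<chi>: "\<chi> \<in> Irr (sub K)"
  shows "constituents \<chi> \<noteq> {}"
proof
  assume "constituents \<chi> = {}"
  then have "cmult N \<chi> \<theta> = 0" if "\<theta> \<in> Irr (sub N)" for \<theta> using that unfolding constituents_def by auto
  then have "\<chi> \<one> = 0" using restrict_decompose[OF K subgroup_N NK \<chi> one_closed] by simp
  then show False using char_deg_Irr[OF K \<chi>] by simp
qed

lemma card_subgroup_dvd:
  assumes S: "subgroup S G" and K: "subgroup K G" and SK: "S \<subseteq> K"
  shows "card S dvd card K"
proof -
  have "subgroup S (sub K)" using subgroup_incl[OF S K SK] .
  then have "card (rcosets\<^bsub>sub K\<^esub> S) * card S = card K"
    using group.lagrange[of "sub K" S] sub_fin_group[OF K] fin_group.axioms(1)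
    by (fastforce simp: Coset.order_def)
  then show ?thesis by (metis dvd_triv_right)
qed

text \<open>The constituents form one orbit of K, and the stabilizer of a constituent contains N; so
  the length of the orbit divides the index of N.\<close>

lemma card_constituents_dvd:
  assumes K: "subgroup K G" and NK: "N \<subseteq> K" and \<chi>: "\<chi> \<in> Irr (sub K)"
  shows "card (constituents \<chi>) dvd card K div card N"
proof -
  interpret K: subgroup K G by fact
  obtain \<theta> where \<theta>: "\<theta> \<in> constituents \<chi>" using constituents_nonempty[OF assms] by blast
  then have \<theta>I: "\<theta> \<in> Irr (sub N)" unfolding constituents_def by simp
  define S where "S = {x \<in> K. conj_char x \<theta> = \<theta>}"
  have S: "subgroup S G"
  proof
    show "S \<subseteq> carrier G" unfolding S_def by auto
    show "\<one> \<in> S" unfolding S_def using conj_char_N[OF one_closed \<theta>I] by simp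
    show "x \<otimes> y \<in> S" if "x \<in> S" "y \<in> S" for x y
      using that conj_char_mult[of y x \<theta>] unfolding S_def by simp
    show "inv x \<in> S" if x: "x \<in> S" for x
    proof -
      have "conj_char (inv x) \<theta> = conj_char (inv x) (conj_char x \<theta>)" using x unfolding S_def by simp
      also have "\<dots> = conj_char \<one> \<theta>" using x conj_char_mult[of "inv x" x \<theta>] unfolding S_def by simp
      also have "\<dots> = \<theta>" by (rule conj_char_N[OF one_closed \<theta>I])
      finally show ?thesis using x unfolding S_def by simp
    qed
  qed
  have NS: "N \<subseteq> S" unfolding S_def using NK conj_char_N[OF _ \<theta>I] by auto
  have fibre: "card {x \<in> K. conj_char x \<theta> = \<eta>} = card S" if \<eta>: "\<eta> \<in> constituents \<chi>" for \<eta>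
  proof -
    obtain y where y: "y \<in> K" "\<eta> = conj_char y \<theta>" using \<eta> constituents_orbit[OF K NK \<chi> \<theta>] by auto
    have "bij_betw (\<lambda>s. s \<otimes> y) S {x \<in> K. conj_char x \<theta> = \<eta>}"
    proof (rule bij_betw_byWitness[of _ "\<lambda>x. x \<otimes> inv y"])
      show "(\<lambda>s. s \<otimes> y) ` S \<subseteq> {x \<in> K. conj_char x \<theta> = \<eta>}"
        using y conj_char_mult[of y _ \<theta>, symmetric] unfolding S_def by auto
      show "(\<lambda>x. x \<otimes> inv y) ` {x \<in> K. conj_char x \<theta> = \<eta>} \<subseteq> S"
      proof (intro subsetI)
        fix s assume "s \<in> (\<lambda>x. x \<otimes> inv y) ` {x \<in> K. conj_char x \<theta> = \<eta>}"
        then obtain x where x: "x \<in> K" "conj_char x \<theta> = conj_char y \<theta>" "s = x \<otimes> inv y" using y by auto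
        have "conj_char s \<theta> = conj_char (inv y) (conj_char y \<theta>)"
          using x y conj_char_mult[of "inv y" x \<theta>] by simp
        also have "\<dots> = \<theta>" using y conj_char_mult[of "inv y" y \<theta>] conj_char_N[OF one_closed \<theta>I] by simp
        finally show "s \<in> S" using x y unfolding S_def by simp
      qed
    qed (use y in \<open>auto simp: S_def m_assoc\<close>)
    then show ?thesis using bij_betw_same_card by fastforce
  qed
  have "card K = (\<Sum>\<eta>\<in>constituents \<chi>. card {x \<in> K. conj_char x \<theta> = \<eta>})"
  proof -
    have "K = (\<Union>\<eta>\<in>constituents \<chi>. {x \<in> K. conj_char x \<theta> = \<eta>})"
      using constituents_orbit[OF K NK \<chi> \<theta>] by auto
    then show ?thesis
      using card_UN_disjoint[OF finite_constituents, of \<chi> "\<lambda>\<eta>. {x \<in> K. conj_char x \<theta> = \<eta>}"] finite_sub[OF K]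
      by auto
  qed
  then have cK: "card K = card (constituents \<chi>) * card S" using fibre by simp
  obtain s where "card S = card N * s" using card_subgroup_dvd[OF subgroup_N S NS] by (auto elim: dvdE)
  then have "card K div card N = card (constituents \<chi>) * s"
    using cK card_sub_pos[OF subgroup_N] by simp
  then show ?thesis by simp
qed

lemma clifford_degree:
  assumes K: "subgroup K G" and NK: "N \<subseteq> K" and \<chi>: "\<chi> \<in> Irr (sub K)" and \<theta>: "\<theta> \<in> constituents \<chi>"
  shows "char_deg G \<chi> = cmult N \<chi> \<theta> * card (constituents \<chi>) * char_deg G \<theta>"
proof -
  have \<theta>I: "\<theta> \<in> Irr (sub N)" using \<theta> unfolding constituents_def by simp
  have eq: "of_nat (cmult N \<chi> \<eta>) * \<eta> \<one> = of_nat (cmult N \<chi> \<theta>) * \<theta> \<one>" if \<eta>: "\<eta> \<in> constituents \<chi>" for \<eta>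
  proof -
    obtain y where y: "y \<in> K" "\<eta> = conj_char y \<theta>" using \<eta> constituents_orbit[OF K NK \<chi> \<theta>] by auto
    then show ?thesis
      using cmult_conj_char[OF K NK \<chi> y(1)] subgroup.subset[OF K] by (auto simp: conj_char_def)
  qed
  have "of_nat (char_deg G \<chi>) = (\<Sum>\<eta>\<in>Irr (sub N). of_nat (cmult N \<chi> \<eta>) * \<eta> \<one>)"
    using restrict_decompose[OF K subgroup_N NK \<chi> one_closed] char_deg_Irr[OF K \<chi>] by simp
  also have "\<dots> = (\<Sum>\<eta>\<in>constituents \<chi>. of_nat (cmult N \<chi> \<eta>) * \<eta> \<one>)"
    unfolding constituents_def by (rule sum.mono_neutral_right) (auto simp: finite_Irr[OF subgroup_N])
  also have "\<dots> = of_nat (cmult N \<chi> \<theta> * card (constituents \<chi>) * char_deg G \<theta>)"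
    using eq char_deg_Irr[OF subgroup_N \<theta>I] by simp
  finally show ?thesis by (simp only: of_nat_eq_iff)
qed

end

section \<open>The graded algebra over a character of a normal subgroup\<close>

lemma complex_root_exists:
  assumes "m > 0"
  shows "\<exists>w :: complex. w ^ m = z"
proof -
  have "rcis (root m (cmod z)) (Arg z / real m) ^ m = rcis (cmod z) (Arg z)"
    using assms by (simp add: DeMoivre2)
  then show ?thesis using rcis_cmod_Arg by metis
qed

context fin_normal
begin

lemma quot_group: "group (G Mod N)"
  by (rule factorgroup_is_group)

lemma quot_carrier: "carrier (G Mod N) = rcosets N"
  by (simp add: FactGroup_def)

lemma rcosets_sub_carrier: "X \<in> rcosets N \<Longrightarrow> X \<subseteq> carrier G"
  using rcosets_carrier[OF is_group] by auto

text \<open>N acts trivially on G/N by conjugation. Hence cutting an N-invariant function down to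
  one coset keeps it N-invariant.\<close>

lemma rcosets_conj:
  assumes X: "X \<in> rcosets N" and n: "n \<in> N" and g: "g \<in> carrier G"
  shows "n \<otimes> g \<otimes> inv n \<in> X \<longleftrightarrow> g \<in> X"
proof -
  obtain a where a: "a \<in> carrier G" "X = N #> a" using X unfolding RCOSETS_def by auto
  have mem: "n \<otimes> g \<otimes> inv n \<in> X" if g: "g \<in> X" and n: "n \<in> N" for g n
  proof -
    obtain k where k: "k \<in> N" "g = k \<otimes> a" using g a unfolding r_coset_def by auto
    have "n \<otimes> g \<otimes> inv n = (n \<otimes> k \<otimes> (a \<otimes> inv n \<otimes> inv a)) \<otimes> a"
      using n k a by (simp add: m_assoc)
    moreover have "n \<otimes> k \<otimes> (a \<otimes> inv n \<otimes> inv a) \<in> N" using n k a by auto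
    ultimately show ?thesis unfolding a(2) r_coset_def by blast
  qed
  have "g = inv n \<otimes> (n \<otimes> g \<otimes> inv n) \<otimes> inv (inv n)"
    using n g by (simp add: m_assoc) (simp add: m_assoc[symmetric])
  then show ?thesis using mem[of g n] mem[of "n \<otimes> g \<otimes> inv n" "inv n"] n by auto
qed

text \<open>The adjoint: the product of f with \<open>star f\<close> has the sum of |f(y)|^2 as its
  value at 1. This positivity makes homogeneous elements invertible.\<close>

definition star :: "('a \<Rightarrow> complex) \<Rightarrow> 'a \<Rightarrow> complex" where
  "star f = (\<lambda>x. if x \<in> carrier G then cnj (f (inv x)) else 0)"

lemma star_conv: "star (f \<star> h) = star h \<star> star f"
proof
  fix x
  show "star (f \<star> h) x = (star h \<star> star f) x"
  proof (cases "x \<in> carrier G")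
    case x: True
    have "(star h \<star> star f) x = (\<Sum>z\<in>carrier G. star h (x \<otimes> inv z) * star f z)" by (rule conv_alt[OF x])
    also have "\<dots> = (\<Sum>z\<in>carrier G. star h (x \<otimes> inv (inv z)) * star f (inv z))"
      by (rule sum_inv[symmetric])
    also have "\<dots> = cnj (\<Sum>z\<in>carrier G. f z * h (inv z \<otimes> inv x))"
      unfolding cnj_sum using x by (intro sum.cong refl) (simp add: star_def inv_mult_group mult.commute)
    finally show ?thesis using x by (simp add: star_def conv_def)
  qed (simp add: star_def conv_def)
qed

text \<open>The homogeneous part of degree X of the algebra of elements that commute with N and are
  absorbed by the idempotent of \<theta>; the grading is by G/N. By \<open>comp_unique\<close> each
  part has dimension at most one.\<close>

definition comp :: "('a \<Rightarrow> complex) \<Rightarrow> 'a set \<Rightarrow> ('a \<Rightarrow> complex) set" where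
  "comp \<theta> X = {f \<in> fn_on X. conj_inv N f \<and> f \<star> idem N \<theta> = f}"

definition res :: "'a set \<Rightarrow> ('a \<Rightarrow> complex) \<Rightarrow> 'a \<Rightarrow> complex" where
  "res X f = (\<lambda>x. if x \<in> X then f x else 0)"

context
  fixes \<theta>
  assumes \<theta>: "\<theta> \<in> Irr (sub N)"
begin

abbreviation e where "e \<equiv> idem N \<theta>"

lemma e_idem: "e \<star> e = e"
  using idem_conv_idem[OF subgroup_N \<theta> \<theta>] by simp

lemma e_one: "e \<one> = \<theta> \<one> ^ 2 / of_nat (card N)" "e \<one> \<noteq> 0"
  using idem_one[OF subgroup_N] char_deg_Irr[OF subgroup_N \<theta>] card_sub_pos[OF subgroup_N] by simp_all

lemma e_nonzero: "e \<noteq> (\<lambda>_. 0)"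
  using e_one(2) by auto

lemma star_e: "star e = e"
proof
  fix x
  show "star e x = e x"
  proof (cases "x \<in> N")
    case True
    then show ?thesis
      using Irr_cnj[OF subgroup_N \<theta> True] char_deg_Irr[OF subgroup_N \<theta>] by (simp add: star_def idem_def)
  next
    case False
    then have "inv x \<notin> N" if "x \<in> carrier G" using that m_inv_closed[of "inv x"] by auto
    then show ?thesis using False by (simp add: star_def idem_def)
  qed
qed

lemma compD: "f \<in> comp \<theta> X \<Longrightarrow> f \<in> fn_on X" "f \<in> comp \<theta> X \<Longrightarrow> conj_inv N f"
  "f \<in> comp \<theta> X \<Longrightarrow> f \<star> e = f" "f \<in> comp \<theta> X \<Longrightarrow> e \<star> f = f"
  unfolding comp_def using conv_commute[OF subset _ idem_fn_on] by auto

lemma comp_e: "e \<in> comp \<theta> N"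
  unfolding comp_def using idem_fn_on conj_inv_idem[OF subgroup_N \<theta>] e_idem by simp

lemma comp_scale: "f \<in> comp \<theta> X \<Longrightarrow> (\<lambda>x. c * f x) \<in> comp \<theta> X"
  unfolding comp_def by (auto simp: fn_on_def conj_inv_def conv_scale_left)

lemma comp_conv:
  assumes "f \<in> comp \<theta> X" "h \<in> comp \<theta> Y" "X \<in> rcosets N" "Y \<in> rcosets N"
  shows "f \<star> h \<in> comp \<theta> (X <#> Y)"
  using assms conv_set_mult[OF compD(1)[OF assms(1)] compD(1)[OF assms(2)]]
    conj_inv_conv[OF subgroup_N compD(2)[OF assms(1)] compD(2)[OF assms(2)]] compD(3)[OF assms(2)]
    rcosets_sub_carrier
  unfolding comp_def by (simp add: conv_assoc)

lemma comp_N: "f \<in> comp \<theta> N \<Longrightarrow> \<exists>c. f = (\<lambda>x. c * e x)"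
  using class_conv_idem[OF subgroup_N \<theta>] compD by metis

text \<open>The product of f with its adjoint has degree N, so it is c times e. Its value at 1 is a
  positive sum of squares, so c is nonzero and the rescaled adjoint is an inverse.\<close>

lemma comp_invertible:
  assumes f: "f \<in> comp \<theta> X" "f \<noteq> (\<lambda>_. 0)" and X: "X \<in> rcosets N"
  shows "\<exists>h\<in>comp \<theta> (set_inv X). f \<star> h = e"
proof -
  interpret Q: group "G Mod N" by (rule quot_group)
  have XG: "X \<subseteq> carrier G" using rcosets_sub_carrier[OF X] .
  have Xi: "set_inv X \<in> rcosets N" "X <#> set_inv X = N"
    using Q.inv_closed[of X] Q.r_inv[of X] inv_FactGroup[of X] X by (simp_all add: quot_carrier)
  have "star f \<in> comp \<theta> (set_inv X)"
    unfolding comp_def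
  proof (intro CollectI conjI)
    show "star f \<in> fn_on (set_inv X)"
    proof (rule fn_onI)
      fix x assume x: "x \<notin> set_inv X"
      have "inv x \<notin> X" if "x \<in> carrier G"
      proof
        assume "inv x \<in> X"
        then have "inv (inv x) \<in> set_inv X" unfolding SET_INV_def by blast
        then show False using x that by simp
      qed
      then show "star f x = 0" using fn_onD[OF compD(1)[OF f(1)]] by (auto simp: star_def)
    qed
    show "conj_inv N (star f)" unfolding conj_inv_def
    proof (intro ballI)
      fix k x assume k: "k \<in> N" and x: "x \<in> carrier G"
      have "inv (k \<otimes> x \<otimes> inv k) = k \<otimes> inv x \<otimes> inv k" using k x by (simp add: inv_mult_group m_assoc)
      then show "star f (k \<otimes> x \<otimes> inv k) = star f x"
        using k x compD(2)[OF f(1)] by (simp add: star_def conj_inv_def)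
    qed
    then show "star f \<star> e = star f"
      using conv_commute[OF subset _ idem_fn_on, of "star f" \<theta>] star_conv[of f e] compD(3)[OF f(1)] star_e
      by simp
  qed
  then have s: "f \<star> star f \<in> comp \<theta> N" "star f \<in> comp \<theta> (set_inv X)" using comp_conv[OF f(1) _ X Xi(1)] Xi(2) by auto
  then obtain c where c: "f \<star> star f = (\<lambda>x. c * e x)" using comp_N by blast
  have "(f \<star> star f) \<one> = (\<Sum>y\<in>carrier G. f y * cnj (f y))"
    by (simp add: conv_def star_def)
  also have "\<dots> = of_real (\<Sum>y\<in>carrier G. (norm (f y))\<^sup>2)" by (simp add: complex_norm_square[symmetric])
  finally have val: "c * e \<one> = of_real (\<Sum>y\<in>carrier G. (norm (f y))\<^sup>2)" using c by simp
  obtain y where y: "f y \<noteq> 0" using f(2) by auto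
  then have "y \<in> carrier G" using fn_onD[OF compD(1)[OF f(1)]] XG by auto
  then have "(\<Sum>y\<in>carrier G. (norm (f y))\<^sup>2) \<noteq> 0"
    using y sum_nonneg_eq_0_iff[OF fin, of "\<lambda>y. (norm (f y))\<^sup>2"] by auto
  then have "c \<noteq> 0" using val by (metis mult_zero_left of_real_eq_0_iff)
  then have "f \<star> (\<lambda>x. 1 / c * star f x) = e" unfolding conv_scale_right c by simp
  then show ?thesis using comp_scale[OF s(2)] by blast
qed

text \<open>Multiplication by an inverse of u moves f to degree N, where only the multiples of e
  exist.\<close>

lemma comp_unique:
  assumes f: "f \<in> comp \<theta> X" and u: "u \<in> comp \<theta> X" "u \<noteq> (\<lambda>_. 0)" and X: "X \<in> rcosets N"
  shows "\<exists>c. f = (\<lambda>x. c * u x)"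
proof -
  interpret Q: group "G Mod N" by (rule quot_group)
  have Xi: "set_inv X \<in> rcosets N" "X <#> set_inv X = N"
    using Q.inv_closed[of X] Q.r_inv[of X] inv_FactGroup[of X] X by (simp_all add: quot_carrier)
  obtain h where h: "h \<in> comp \<theta> (set_inv X)" "u \<star> h = e" using comp_invertible[OF u X] by blast
  then have "h \<noteq> (\<lambda>_. 0)" using e_nonzero by auto
  \<comment> \<open>The right inverse h of u has a right inverse itself, which can only be u. So h
    is a two-sided inverse.\<close>
  then obtain k where k: "k \<in> comp \<theta> (set_inv (set_inv X))" "h \<star> k = e"
    using comp_invertible[OF h(1) _ Xi(1)] by blast
  have "u = u \<star> (h \<star> k)" using k(2) compD(3)[OF u(1)] by simp
  also have "\<dots> = e \<star> k" using h(2) by (simp add: conv_assoc[symmetric])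
  finally have hu: "h \<star> u = e" using compD(4)[OF k(1)] k(2) by simp
  obtain c where c: "f \<star> h = (\<lambda>x. c * e x)" using comp_N comp_conv[OF f h(1) X Xi(1)] Xi(2) by auto
  have "f = f \<star> (h \<star> u)" using hu compD(3)[OF f] by simp
  also have "\<dots> = (\<lambda>x. c * u x)"
    using c compD(4)[OF u(1)] by (simp add: conv_assoc[symmetric] conv_scale_left)
  finally show ?thesis by blast
qed

text \<open>The support of the grading. With parts of dimension one and products of nonzero
  homogeneous elements nonzero, the algebra is a twisted group algebra of this subgroup of
  G/N.\<close>

definition grading :: "'a set set" where
  "grading = {X \<in> rcosets N. \<exists>f\<in>comp \<theta> X. f \<noteq> (\<lambda>_. 0)}"

lemma grading_mult_nonzero:
  assumes "f \<in> comp \<theta> X" "f \<noteq> (\<lambda>_. 0)" "h \<in> comp \<theta> Y" "h \<noteq> (\<lambda>_. 0)" "Y \<in> rcosets N"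
  shows "f \<star> h \<noteq> (\<lambda>_. 0)"
proof
  assume "f \<star> h = (\<lambda>_. 0)"
  moreover obtain k where "h \<star> k = e" using comp_invertible[OF assms(3-5)] by blast
  ultimately have "f \<star> e = (\<lambda>_. 0)" using conv_assoc[of f h k] by simp
  then show False using compD(3)[OF assms(1)] assms(2) by simp
qed

lemma grading_subgroup: "subgroup grading (G Mod N)"
proof -
  interpret Q: group "G Mod N" by (rule quot_group)
  show ?thesis
  proof (rule Q.subgroupI)
    show "grading \<subseteq> carrier (G Mod N)" unfolding grading_def quot_carrier by auto
    show "grading \<noteq> {}"
      unfolding grading_def using comp_e e_nonzero Q.one_closed by (auto simp: quot_carrier)
    fix X assume X: "X \<in> grading"
    then obtain f where f: "f \<in> comp \<theta> X" "f \<noteq> (\<lambda>_. 0)" and XR: "X \<in> rcosets N" unfolding grading_def by auto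
    obtain h where h: "h \<in> comp \<theta> (set_inv X)" "f \<star> h = e" using comp_invertible[OF f XR] by blast
    then have "h \<noteq> (\<lambda>_. 0)" using e_nonzero by auto
    then show "inv\<^bsub>G Mod N\<^esub> X \<in> grading"
      using h Q.inv_closed[of X] inv_FactGroup[of X] XR unfolding grading_def quot_carrier by auto
    fix Y assume Y: "Y \<in> grading"
    then obtain h where h: "h \<in> comp \<theta> Y" "h \<noteq> (\<lambda>_. 0)" and YR: "Y \<in> rcosets N" unfolding grading_def by auto
    have "f \<star> h \<in> comp \<theta> (X <#> Y)" "f \<star> h \<noteq> (\<lambda>_. 0)"
      using comp_conv[OF f(1) h(1) XR YR] grading_mult_nonzero[OF f h YR] by auto
    then show "X \<otimes>\<^bsub>G Mod N\<^esub> Y \<in> grading"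
      using Q.m_closed[of X Y] XR YR unfolding grading_def quot_carrier by auto
  qed
qed

text \<open>Dividing a basis by \<open>m\<close>-th roots of the products of the rows of its cocycle, where \<open>m\<close> is the
  order of the grading group, makes all cocycle values \<open>m\<close>-th roots of unity.\<close>

lemma twisted_basis:
  "\<exists>v m. m > 0 \<and> (\<forall>X\<in>grading. v X \<in> comp \<theta> X \<and> v X \<noteq> (\<lambda>_. 0)) \<and>
    (\<forall>X\<in>grading. \<forall>Y\<in>grading. \<exists>c. c ^ m = 1 \<and> v X \<star> v Y = (\<lambda>x. c * v (X <#> Y) x))"
proof -
  interpret Q: group "G Mod N" by (rule quot_group)
  interpret T: subgroup grading "G Mod N" by (rule grading_subgroup)
  have TR: "X \<in> rcosets N" if "X \<in> grading" for X using that unfolding grading_def by simp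
  have Tm: "X <#> Y \<in> grading" if "X \<in> grading" "Y \<in> grading" for X Y using T.m_closed[OF that] by simp
  have finT: "finite grading"
    using finite_subset[of grading "Pow (carrier G)"] fin TR rcosets_sub_carrier by auto
  define m where "m = card grading"
  have m: "m > 0" unfolding m_def using finT T.one_closed by (auto simp: card_gt_0_iff)
  have "\<forall>X\<in>grading. \<exists>f. f \<in> comp \<theta> X \<and> f \<noteq> (\<lambda>_. 0)" unfolding grading_def by auto
  then obtain u where u: "\<And>X. X \<in> grading \<Longrightarrow> u X \<in> comp \<theta> X" "\<And>X. X \<in> grading \<Longrightarrow> u X \<noteq> (\<lambda>_. 0)"
    by metis
  have "\<exists>c. u X \<star> u Y = (\<lambda>x. c * u (X <#> Y) x)" if "X \<in> grading" "Y \<in> grading" for X Y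
    using comp_unique[OF comp_conv[OF u(1)[OF that(1)] u(1)[OF that(2)] TR[OF that(1)] TR[OF that(2)]]
        u(1)[OF Tm[OF that]] u(2)[OF Tm[OF that]] TR[OF Tm[OF that]]] .
  then obtain c where c: "\<And>X Y. X \<in> grading \<Longrightarrow> Y \<in> grading \<Longrightarrow> u X \<star> u Y = (\<lambda>x. c X Y * u (X <#> Y) x)"
    by metis
  have c0: "c X Y \<noteq> 0" if "X \<in> grading" "Y \<in> grading" for X Y
    using grading_mult_nonzero[OF u(1)[OF that(1)] u(2)[OF that(1)] u(1)[OF that(2)] u(2)[OF that(2)] TR[OF that(2)]]
      c[OF that] by auto
  have cocycle: "c X Y * c (X <#> Y) Z = c Y Z * c X (Y <#> Z)"
    if XYZ: "X \<in> grading" "Y \<in> grading" "Z \<in> grading" for X Y Z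
  proof -
    let ?W = "X <#> Y <#> Z"
    have W: "?W = X <#> (Y <#> Z)" using Q.m_assoc[of X Y Z] that TR by (simp add: quot_carrier)
    have "(u X \<star> u Y) \<star> u Z = (\<lambda>x. c X Y * c (X <#> Y) Z * u ?W x)"
      using that Tm by (simp add: c conv_scale_left mult.assoc)
    moreover have "u X \<star> (u Y \<star> u Z) = (\<lambda>x. c Y Z * c X (Y <#> Z) * u ?W x)"
      using that Tm W by (simp add: c conv_scale_right mult.assoc)
    moreover obtain x where "u ?W x \<noteq> 0" using u(2)[OF Tm[OF Tm[OF XYZ(1,2)] XYZ(3)]] by auto
    ultimately show ?thesis using conv_assoc[of "u X" "u Y" "u Z"] by (metis mult_right_cancel)
  qed
  define F where "F X = (\<Prod>Z\<in>grading. c X Z)" for X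
  \<comment> \<open>The product of the cocycle identity over all Z: the m-th power of c is the
    coboundary of F, so m-th roots of F correct c to m-th roots of unity.\<close>
  have F: "c X Y ^ m * F (X <#> Y) = F X * F Y" if X: "X \<in> grading" and Y: "Y \<in> grading" for X Y
  proof -
    have "c X Y ^ m * F (X <#> Y) = (\<Prod>Z\<in>grading. c X Y * c (X <#> Y) Z)"
      by (simp add: F_def m_def prod.distrib)
    also have "\<dots> = (\<Prod>Z\<in>grading. c Y Z * c X (Y <#> Z))" using cocycle[OF X Y] by (rule prod.cong[OF refl])
    also have "\<dots> = F Y * (\<Prod>Z\<in>grading. c X (Y <#> Z))" by (simp add: F_def prod.distrib)
    also have "(\<Prod>Z\<in>grading. c X (Y <#> Z)) = F X" unfolding F_def
    proof (rule prod.reindex_bij_witness[of _ "\<lambda>Z. inv\<^bsub>G Mod N\<^esub> Y <#> Z" "\<lambda>Z. Y <#> Z"])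
      fix Z assume Z: "Z \<in> grading"
      have YZ: "Y \<in> carrier (G Mod N)" "Z \<in> carrier (G Mod N)" using Y Z TR by (auto simp: quot_carrier)
      show "inv\<^bsub>G Mod N\<^esub> Y <#> (Y <#> Z) = Z" "Y <#> (inv\<^bsub>G Mod N\<^esub> Y <#> Z) = Z"
        using Q.m_assoc[of "inv\<^bsub>G Mod N\<^esub> Y" Y Z] Q.m_assoc[of Y "inv\<^bsub>G Mod N\<^esub> Y" Z] YZ
          Q.inv_closed[OF YZ(1)] Q.l_inv[OF YZ(1)] Q.r_inv[OF YZ(1)] Q.l_one[OF YZ(2)]
        by auto
      show "Y <#> Z \<in> grading" "inv\<^bsub>G Mod N\<^esub> Y <#> Z \<in> grading"
        using Tm[OF Y Z] Tm[OF T.m_inv_closed[OF Y] Z] by auto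
    qed simp
    finally show ?thesis by (simp add: mult.commute)
  qed
  have F0: "F X \<noteq> 0" if "X \<in> grading" for X using c0 that finT unfolding F_def by simp
  have "\<forall>X. \<exists>w. w ^ m = F X" using complex_root_exists[OF m] by blast
  then obtain g where g: "\<And>X. g X ^ m = F X" by metis
  have g0: "g X \<noteq> 0" if "X \<in> grading" for X using g[of X] F0[OF that] m by (auto simp: power_0_left)
  define v where "v X = (\<lambda>x. 1 / g X * u X x)" for X
  show ?thesis
  proof (intro exI[of _ v] exI[of _ m] conjI ballI)
    show "m > 0" by (rule m)
    show "v X \<in> comp \<theta> X" if "X \<in> grading" for X unfolding v_def by (rule comp_scale[OF u(1)[OF that]])
    show "v X \<noteq> (\<lambda>_. 0)" if "X \<in> grading" for X
    proof
      assume v0: "v X = (\<lambda>_. 0)"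
      have "u X x = 0" for x using fun_cong[OF v0, of x] g0[OF that] unfolding v_def by simp
      then show False using u(2)[OF that] by auto
    qed
    show "\<exists>d. d ^ m = 1 \<and> v X \<star> v Y = (\<lambda>x. d * v (X <#> Y) x)" if X: "X \<in> grading" and Y: "Y \<in> grading" for X Y
    proof (intro exI conjI)
      let ?d = "c X Y * g (X <#> Y) / (g X * g Y)"
      show "?d ^ m = 1"
        using F[OF X Y] F0[OF X] F0[OF Y] by (simp add: power_mult_distrib power_divide g)
      show "v X \<star> v Y = (\<lambda>x. ?d * v (X <#> Y) x)"
      proof -
        have "v X \<star> v Y = (\<lambda>x. 1 / g X * (1 / g Y * (u X \<star> u Y) x))"
          unfolding v_def conv_scale_left conv_scale_right ..
        then show ?thesis using g0[OF Tm[OF X Y]] by (simp add: c[OF X Y] v_def)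
      qed
    qed
  qed
qed

lemma res_comp:
  assumes K: "subgroup K G" and NK: "N \<subseteq> K" and \<chi>: "\<chi> \<in> Irr (sub K)" and X: "X \<in> rcosets N"
  shows "res X (idem K \<chi>) \<star> e \<in> comp \<theta> X"
proof -
  interpret Q: group "G Mod N" by (rule quot_group)
  have XN: "X <#> N = X" using Q.r_one[of X] X by (simp add: quot_carrier)
  have "res X (idem K \<chi>) \<in> fn_on X" unfolding res_def fn_on_def by simp
  then have "res X (idem K \<chi>) \<star> e \<in> fn_on X"
    using conv_set_mult[OF _ idem_fn_on rcosets_sub_carrier[OF X] subset] XN by metis
  moreover have "conj_inv N (res X (idem K \<chi>))"
    using conj_inv_mono[OF conj_inv_idem[OF K \<chi>] NK] rcosets_conj[OF X]
    unfolding conj_inv_def res_def by simp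
  then have "conj_inv N (res X (idem K \<chi>) \<star> e)"
    using conj_inv_conv[OF subgroup_N _ compD(2)[OF comp_e]] by blast
  ultimately show ?thesis unfolding comp_def by (simp add: conv_assoc e_idem)
qed

lemma conv_power_scale: "((\<lambda>w. w \<star> u) ^^ k) (\<lambda>x. c * f x) = (\<lambda>x. c * ((\<lambda>w. w \<star> u) ^^ k) f x)"
  by (induction k) (simp_all add: conv_scale_left)

text \<open>A finite family of homogeneous elements spanning the component algebra of \<open>\<theta>\<close>, closed under
  products up to roots of unity, with integral coordinates for all central idempotents.\<close>

lemma integral_basis:
  "\<exists>V. (\<forall>v\<in>V. \<forall>w\<in>V. \<exists>c\<in>unity_sums. \<exists>u\<in>V. v \<star> w = (\<lambda>x. c * u x)) \<and>
    (\<forall>v\<in>V. \<exists>r\<in>unity_sums. v \<one> = r * e \<one>) \<and>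
    (\<forall>K \<chi> X. subgroup K G \<and> N \<subseteq> K \<and> \<chi> \<in> Irr (sub K) \<and> X \<in> rcosets N \<and> X \<subseteq> K \<longrightarrow>
      (\<exists>v\<in>V. \<exists>a. \<exists>\<kappa>\<in>unity_sums. res X (idem K \<chi>) \<star> e = (\<lambda>x. a * v x) \<and>
        a * (\<theta> \<one> * of_nat (card K)) = \<chi> \<one> * of_nat (card N) * \<kappa>))"
proof -
  interpret Q: group "G Mod N" by (rule quot_group)
  interpret T: subgroup grading "G Mod N" by (rule grading_subgroup)
  obtain v m where m: "m > 0" and v: "\<And>X. X \<in> grading \<Longrightarrow> v X \<in> comp \<theta> X"
    "\<And>X. X \<in> grading \<Longrightarrow> v X \<noteq> (\<lambda>_. 0)"
    and vm: "\<And>X Y. X \<in> grading \<Longrightarrow> Y \<in> grading \<Longrightarrow> \<exists>c. c ^ m = 1 \<and> v X \<star> v Y = (\<lambda>x. c * v (X <#> Y) x)"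
    using twisted_basis by blast
  have TR: "X \<in> rcosets N" if "X \<in> grading" for X using that unfolding grading_def by simp
  have Tm: "X <#> Y \<in> grading" if "X \<in> grading" "Y \<in> grading" for X Y using T.m_closed[OF that] by simp
  have NT: "N \<in> grading" using T.one_closed by simp
  obtain \<zeta> where \<zeta>: "v N = (\<lambda>x. \<zeta> * e x)" using comp_N[OF v(1)[OF NT]] by blast
  \<comment> \<open>The normalization has fixed the basis element of degree N only up to a factor.
    Its square is a root of unity times itself, so the factor is a root of unity as well.\<close>
  have \<zeta>m: "\<zeta> ^ m = 1"
  proof -
    obtain c where c: "c ^ m = 1" "v N \<star> v N = (\<lambda>x. c * v (N <#> N) x)" using vm[OF NT NT] by blast
    have "\<zeta> \<noteq> 0" using v(2)[OF NT] \<zeta> by auto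
    have "(\<lambda>x. \<zeta> * (\<zeta> * e x)) = (\<lambda>x. c * (\<zeta> * e x))"
      using c(2) Q.l_one[OF Q.one_closed] by (simp add: \<zeta> conv_scale_left conv_scale_right e_idem)
    then have "\<zeta> * (\<zeta> * e \<one>) = c * (\<zeta> * e \<one>)" by metis
    then show ?thesis using c(1) \<open>\<zeta> \<noteq> 0\<close> e_one(2) by simp
  qed
  show ?thesis
  proof (intro exI[of _ "v ` grading"] conjI ballI allI impI)
    fix x y assume "x \<in> v ` grading" "y \<in> v ` grading"
    then obtain X Y where XY: "X \<in> grading" "Y \<in> grading" "x = v X" "y = v Y" by auto
    obtain c where "c ^ m = 1" "v X \<star> v Y = (\<lambda>x. c * v (X <#> Y) x)" using vm[OF XY(1,2)] by blast
    then show "\<exists>c\<in>unity_sums. \<exists>u\<in>v ` grading. x \<star> y = (\<lambda>x. c * u x)"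
      using unity_sums_root[OF _ m] Tm[OF XY(1,2)] XY by blast
  next
    fix x assume "x \<in> v ` grading"
    then obtain X where X: "X \<in> grading" "x = v X" by auto
    show "\<exists>r\<in>unity_sums. x \<one> = r * e \<one>"
    proof (cases "X = N")
      case True
      then show ?thesis using X \<zeta> unity_sums_root[OF \<zeta>m m] by auto
    next
      case False
      have "\<one> \<notin> X"
      proof
        assume "\<one> \<in> X"
        then have "N \<inter> X \<noteq> {}" using subgroup.one_closed[OF subgroup_N] by blast
        moreover have "N \<in> rcosets N" using subgroup_in_rcosets[OF is_group] .
        ultimately show False using rcos_disjoint[OF subgroup_N] TR[OF X(1)] False
          unfolding pairwise_def disjnt_def by auto
      qed
      then have "x \<one> = 0" using X fn_onD[OF compD(1)[OF v(1)[OF X(1)]]] by auto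
      then show ?thesis using unity_sums.zero by (intro bexI[of _ 0]) auto
    qed
  next
    fix K \<chi> X
    assume "subgroup K G \<and> N \<subseteq> K \<and> \<chi> \<in> Irr (sub K) \<and> X \<in> rcosets N \<and> X \<subseteq> K"
    then have K: "subgroup K G" and NK: "N \<subseteq> K" and \<chi>: "\<chi> \<in> Irr (sub K)" and X: "X \<in> rcosets N" and XK: "X \<subseteq> K"
      by auto
    note f = res_comp[OF K NK \<chi> X]
    show "\<exists>v\<in>v ` grading. \<exists>a. \<exists>\<kappa>\<in>unity_sums. res X (idem K \<chi>) \<star> e = (\<lambda>x. a * v x) \<and>
        a * (\<theta> \<one> * of_nat (card K)) = \<chi> \<one> * of_nat (card N) * \<kappa>"
    proof (cases "X \<in> grading")
      case False
      then have "res X (idem K \<chi>) \<star> e = (\<lambda>_. 0)" using f X unfolding grading_def by auto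
      then show ?thesis using NT unity_sums.zero
        by (intro bexI[of _ "v N"] exI[of _ 0] bexI[of _ 0]) auto
    next
      case XT: True
      obtain a where a: "res X (idem K \<chi>) \<star> e = (\<lambda>x. a * v X x)"
        using comp_unique[OF f v(1)[OF XT] v(2)[OF XT] X] by blast
      \<comment> \<open>The coordinate in degree X is read off by multiplying with the basis element
        of the inverse coset and evaluating at 1.\<close>
      define Y where "Y = set_inv X"
      have Y: "Y \<in> grading" "X <#> Y = N"
        using T.m_inv_closed[OF XT] Q.r_inv[of X] inv_FactGroup[of X] X unfolding Y_def by (simp_all add: quot_carrier)
      obtain c where c: "c ^ m = 1" "v X \<star> v Y = (\<lambda>x. c * v N x)" using vm[OF XT Y(1)] Y(2) by auto
      have Yinv: "inv y \<in> Y \<longleftrightarrow> y \<in> X" if y: "y \<in> carrier G" for y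
      proof
        assume "inv y \<in> Y"
        then have "\<exists>x\<in>X. inv y = inv x" unfolding Y_def SET_INV_def by (simp only: UN_iff singleton_iff)
        then obtain x where x: "x \<in> X" "inv y = inv x" by (rule bexE)
        have xG: "x \<in> carrier G" by (rule subsetD[OF rcosets_sub_carrier[OF X] x(1)])
        have "y = inv (inv y)" by (rule inv_inv[OF y, symmetric])
        also have "\<dots> = inv (inv x)" by (rule arg_cong[OF x(2)])
        also have "\<dots> = x" by (rule inv_inv[OF xG])
        finally show "y \<in> X" using x(1) by (rule ssubst)
      qed (auto simp: Y_def SET_INV_def)
      have YK: "Y \<subseteq> K" using XK subgroup.m_inv_closed[OF K] unfolding Y_def SET_INV_def by auto
      have vY: "v Y \<in> fn_on Y" "conj_inv N (v Y)" "v Y \<star> e = v Y" using compD v(1)[OF Y(1)] by auto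
      \<comment> \<open>Powers of \<open>v Y\<close> are the basis elements of the powers of Y, up
        to m-th roots of unity. After q steps the coset is Y again, and after q * m steps the
        accumulated root of unity is 1, as \<open>trace_multiplicity\<close> demands.\<close>
      have per: "\<exists>d. d ^ m = 1 \<and> ((\<lambda>w. w \<star> v Y) ^^ j) (v Y) = (\<lambda>x. d * v (Y [^]\<^bsub>G Mod N\<^esub> Suc j) x)" for j
      proof (induction j)
        case 0
        show ?case using Q.l_one[of Y] TR[OF Y(1)] by (intro exI[of _ 1]) (simp add: quot_carrier)
      next
        case (Suc j)
        then obtain d where d: "d ^ m = 1" "((\<lambda>w. w \<star> v Y) ^^ j) (v Y) = (\<lambda>x. d * v (Y [^]\<^bsub>G Mod N\<^esub> Suc j) x)" by blast
        have pT: "Y [^]\<^bsub>G Mod N\<^esub> k \<in> grading" for k :: nat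
          by (induction k) (use NT Tm Y(1) in auto)
        obtain d' where d': "d' ^ m = 1" "v (Y [^]\<^bsub>G Mod N\<^esub> Suc j) \<star> v Y = (\<lambda>x. d' * v (Y [^]\<^bsub>G Mod N\<^esub> Suc j <#> Y) x)"
          using vm[OF pT Y(1)] by blast
        have "((\<lambda>w. w \<star> v Y) ^^ Suc j) (v Y) = (\<lambda>x. d * d' * v (Y [^]\<^bsub>G Mod N\<^esub> Suc (Suc j)) x)"
          using d(2) d'(2) by (simp add: conv_scale_left mult.assoc)
        then show ?case using d(1) d'(1) by (intro exI[of _ "d * d'"]) (simp add: power_mult_distrib)
      qed
      define q where "q = Coset.order (G Mod N)"
      have finQ: "finite (carrier (G Mod N))"
        using finite_subset[of "rcosets N" "Pow (carrier G)"] fin rcosets_sub_carrier by (auto simp: quot_carrier)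
      have q: "q > 0" unfolding q_def using Q.order_gt_0_iff_finite finQ by blast
      have YQ: "Y \<in> carrier (G Mod N)" using TR[OF Y(1)] by (simp add: quot_carrier)
      have "Y [^]\<^bsub>G Mod N\<^esub> Suc q = Y"
        using Q.pow_order_eq_1[OF YQ] Q.l_one[OF YQ] by (simp add: q_def)
      then obtain d where d: "d ^ m = 1" "((\<lambda>w. w \<star> v Y) ^^ q) (v Y) = (\<lambda>x. d * v Y x)" using per[of q] by metis
      have "((\<lambda>w. w \<star> v Y) ^^ (q * i)) (v Y) = (\<lambda>x. d ^ i * v Y x)" for i
      proof (induction i)
        case (Suc i)
        have "((\<lambda>w. w \<star> v Y) ^^ (q * Suc i)) (v Y) = ((\<lambda>w. w \<star> v Y) ^^ q) (((\<lambda>w. w \<star> v Y) ^^ (q * i)) (v Y))"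
          by (simp add: funpow_add)
        then show ?case unfolding Suc conv_power_scale d(2) by (simp add: mult_ac)
      qed simp
      from this[of m] have per': "((\<lambda>w. w \<star> v Y) ^^ (q * m)) (v Y) = v Y" using d(1) by simp
      obtain n M where M: "M \<in> carrier_mat n n" "M ^\<^sub>m Suc (q * m) = M" "(\<Sum>g\<in>K. v Y g * \<chi> g) = \<theta> \<one> * mat_trace M"
        by (rule trace_multiplicity[OF K subgroup_N NK \<chi> \<theta> fn_on_mono[OF vY(1) YK] vY(2,3) per'])
      have \<kappa>: "mat_trace M \<in> unity_sums" using mat_trace_unity_sums[OF M(1,2)] q m by simp
      \<comment> \<open>The same value at 1 is computed in two ways: by the product rule of the
        basis, and as \<chi>(1) / |K| times the sum of \<open>v Y\<close> against \<chi>, which is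
        \<theta>(1) times the trace of M.\<close>
      have "a * (c * \<zeta> * e \<one>) = (res X (idem K \<chi>) \<star> (e \<star> v Y)) \<one>"
        using a c(2) \<zeta> by (simp add: conv_assoc[symmetric] conv_scale_left mult.assoc)
      also have "\<dots> = (res X (idem K \<chi>) \<star> v Y) \<one>" using compD(4)[OF v(1)[OF Y(1)]] by simp
      also have "\<dots> = (\<Sum>y\<in>K. res X (idem K \<chi>) y * v Y (inv y))"
        using XK subgroup.m_inv_closed[OF K] subgroup.subset[OF K]
        by (subst conv_sub[OF K]) (auto simp: res_def fn_on_def subsetD intro!: sum.cong)
      also have "\<dots> = (\<Sum>y\<in>K. \<chi> \<one> / of_nat (card K) * (v Y (inv y) * \<chi> (inv y)))"
      proof (rule sum.cong[OF refl])
        fix y assume y: "y \<in> K"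
        then have yG: "y \<in> carrier G" using subgroup.subset[OF K] by auto
        have "v Y (inv y) = 0" if "y \<notin> X" using fn_onD[OF vY(1)] Yinv[OF yG] that by simp
        then show "res X (idem K \<chi>) y * v Y (inv y) = \<chi> \<one> / of_nat (card K) * (v Y (inv y) * \<chi> (inv y))"
          using y by (auto simp: res_def idem_def)
      qed
      also have "\<dots> = \<chi> \<one> / of_nat (card K) * (\<Sum>y\<in>K. v Y (inv y) * \<chi> (inv y))" by (simp add: sum_distrib_left)
      also have "(\<Sum>y\<in>K. v Y (inv y) * \<chi> (inv y)) = (\<Sum>y\<in>K. v Y y * \<chi> y)"
        by (rule sum.reindex_bij_witness[of _ "\<lambda>y. inv y" "\<lambda>y. inv y"])
          (use subgroup.m_inv_closed[OF K] subgroup.subset[OF K] in auto)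
      finally have "a * (c * \<zeta> * e \<one>) = \<chi> \<one> / of_nat (card K) * (\<theta> \<one> * mat_trace M)" unfolding M(3) .
      then have key: "(c * \<zeta>) * (a * (\<theta> \<one> * of_nat (card K))) = \<chi> \<one> * of_nat (card N) * mat_trace M"
        using char_deg_Irr[OF subgroup_N \<theta>] card_sub_pos[OF subgroup_N] card_sub_pos[OF K]
        unfolding e_one(1) by (simp add: field_simps power2_eq_square)
      \<comment> \<open>The inverse of the root of unity c * \<zeta>, as a power of it.\<close>
      define z where "z = (c * \<zeta>) ^ (m - 1)"
      have "(c * \<zeta>) ^ m = 1" using c(1) \<zeta>m by (simp add: power_mult_distrib)
      then have z: "z * (c * \<zeta>) = 1" unfolding z_def using m by (metis mult.commute power_minus_mult)
      then have "a * (\<theta> \<one> * of_nat (card K)) = z * (\<chi> \<one> * of_nat (card N) * mat_trace M)"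
        unfolding key[symmetric] by (simp add: mult.assoc[symmetric])
      then have "a * (\<theta> \<one> * of_nat (card K)) = \<chi> \<one> * of_nat (card N) * (z * mat_trace M)" by (simp add: mult_ac)
      moreover have "z * mat_trace M \<in> unity_sums"
      proof (rule unity_sums_mult_root[OF \<kappa> _ m])
        have "z ^ m = ((c * \<zeta>) ^ m) ^ (m - 1)" unfolding z_def by (simp add: mult.commute flip: power_mult)
        then show "z ^ m = 1" using \<open>(c * \<zeta>) ^ m = 1\<close> by simp
      qed
      ultimately show ?thesis using a XT by blast
    qed
  qed
qed

end

end

section \<open>Sums over orbits of p-groups; lattices over the p-integral numbers\<close>

lemma (in group) p_group_orbit_sum:
  assumes p: "prime p" and card: "card (carrier G) = p ^ k"
    and \<Omega>: "finite \<Omega>" and closed: "\<And>b \<omega>. b \<in> carrier G \<Longrightarrow> \<omega> \<in> \<Omega> \<Longrightarrow> act b \<omega> \<in> \<Omega>"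
    and act_one: "\<And>\<omega>. \<omega> \<in> \<Omega> \<Longrightarrow> act \<one> \<omega> = \<omega>"
    and act_mult: "\<And>b c \<omega>. b \<in> carrier G \<Longrightarrow> c \<in> carrier G \<Longrightarrow> \<omega> \<in> \<Omega> \<Longrightarrow> act (b \<otimes> c) \<omega> = act b (act c \<omega>)"
    and f_inv: "\<And>b \<omega>. b \<in> carrier G \<Longrightarrow> \<omega> \<in> \<Omega> \<Longrightarrow> f (act b \<omega>) = f \<omega>"
    and f_int: "\<And>\<omega>. \<omega> \<in> \<Omega> \<Longrightarrow> f \<omega> \<in> p_integral p"
  shows "\<exists>s\<in>p_integral p. (\<Sum>\<omega>\<in>{\<omega>\<in>\<Omega>. \<exists>b\<in>carrier G. act b \<omega> \<noteq> \<omega>}. f \<omega>) = of_nat p * s"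
proof -
  have finG: "finite (carrier G)" using card p card_gt_0_iff[of "carrier G"] prime_gt_0_nat[OF p] by simp
  define \<Omega>' where "\<Omega>' = {\<omega>\<in>\<Omega>. \<exists>b\<in>carrier G. act b \<omega> \<noteq> \<omega>}"
  define orb where "orb \<omega> = (\<lambda>b. act b \<omega>) ` carrier G" for \<omega>
  have act_inv: "act (inv b) (act b \<omega>) = \<omega>" if "b \<in> carrier G" "\<omega> \<in> \<Omega>" for b \<omega>
    using that act_mult[of "inv b" b \<omega>] act_one by simp
  have orb_self: "\<omega> \<in> orb \<omega>" if "\<omega> \<in> \<Omega>" for \<omega>
    unfolding orb_def using act_one[OF that] by (intro image_eqI[of _ _ \<one>]) auto
  have orb_act: "orb (act b \<omega>) = orb \<omega>" if b: "b \<in> carrier G" and \<omega>: "\<omega> \<in> \<Omega>" for b \<omega>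
  proof -
    have "act c (act b \<omega>) \<in> orb \<omega>" if "c \<in> carrier G" for c
      using act_mult[OF that b \<omega>, symmetric] that b unfolding orb_def by auto
    moreover have "act c \<omega> \<in> orb (act b \<omega>)" if c: "c \<in> carrier G" for c
    proof -
      have "act c \<omega> = act (c \<otimes> inv b) (act b \<omega>)"
        using act_mult[of c "inv b" "act b \<omega>"] c b closed[OF b \<omega>] act_inv[OF b \<omega>] by simp
      then show ?thesis unfolding orb_def using c b by blast
    qed
    ultimately show ?thesis unfolding orb_def by blast
  qed
  \<comment> \<open>The length of an orbit divides the order of the p-group, and it is not 1 because
    some element moves \<omega>.\<close>
  have card_orb: "p dvd card (orb \<omega>)" if \<omega>': "\<omega> \<in> \<Omega>'" for \<omega>
  proof -
    have \<omega>: "\<omega> \<in> \<Omega>" using \<omega>' unfolding \<Omega>'_def by simp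
    define S where "S = {b\<in>carrier G. act b \<omega> = \<omega>}"
    have fibre: "card {b\<in>carrier G. act b \<omega> = \<eta>} = card S" if \<eta>: "\<eta> \<in> orb \<omega>" for \<eta>
    proof -
      obtain c where c: "c \<in> carrier G" "\<eta> = act c \<omega>" using \<eta> unfolding orb_def by auto
      have "bij_betw (\<lambda>b. c \<otimes> b) S {b\<in>carrier G. act b \<omega> = \<eta>}"
        by (rule bij_betw_byWitness[of _ "\<lambda>b. inv c \<otimes> b"])
          (use c \<omega> act_mult act_inv in \<open>auto simp: S_def m_assoc[symmetric]\<close>)
      then show ?thesis using bij_betw_same_card by fastforce
    qed
    have "card (carrier G) = (\<Sum>\<eta>\<in>orb \<omega>. card {b\<in>carrier G. act b \<omega> = \<eta>})"
    proof -
      have "carrier G = (\<Union>\<eta>\<in>orb \<omega>. {b\<in>carrier G. act b \<omega> = \<eta>})" unfolding orb_def by auto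
      moreover have "card (\<Union>\<eta>\<in>orb \<omega>. {b\<in>carrier G. act b \<omega> = \<eta>}) = (\<Sum>\<eta>\<in>orb \<omega>. card {b\<in>carrier G. act b \<omega> = \<eta>})"
        by (rule card_UN_disjoint) (use finG in \<open>auto simp: orb_def\<close>)
      ultimately show ?thesis by (simp only:)
    qed
    then have "p ^ k = card (orb \<omega>) * card S" using fibre card by simp
    then have "card (orb \<omega>) dvd p ^ k" by simp
    then obtain i where i: "card (orb \<omega>) = p ^ i" using divides_primepow_nat[OF p] by blast
    have "i \<noteq> 0"
    proof
      assume "i = 0"
      then obtain \<eta> where "orb \<omega> = {\<eta>}" using i card_1_singletonE by auto
      moreover have "act b \<omega> \<in> orb \<omega>" if "b \<in> carrier G" for b using that unfolding orb_def by blast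
      ultimately have "act b \<omega> = \<omega>" if "b \<in> carrier G" for b
        using orb_self[OF \<omega>] that by (metis singletonD)
      then show False using \<omega>' unfolding \<Omega>'_def by blast
    qed
    then show ?thesis using i by (simp add: dvd_power)
  qed
  have orb_sub: "{\<eta>\<in>\<Omega>'. orb \<eta> = orb \<omega>} = orb \<omega>" if \<omega>': "\<omega> \<in> \<Omega>'" for \<omega>
  proof
    have \<omega>: "\<omega> \<in> \<Omega>" using \<omega>' unfolding \<Omega>'_def by simp
    show "{\<eta>\<in>\<Omega>'. orb \<eta> = orb \<omega>} \<subseteq> orb \<omega>" using orb_self unfolding \<Omega>'_def by blast
    show "orb \<omega> \<subseteq> {\<eta>\<in>\<Omega>'. orb \<eta> = orb \<omega>}"
    proof
      fix \<eta> assume "\<eta> \<in> orb \<omega>"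
      then obtain c where c: "c \<in> carrier G" "\<eta> = act c \<omega>" unfolding orb_def by auto
      have \<eta>: "\<eta> \<in> \<Omega>" "orb \<eta> = orb \<omega>" using c closed \<omega> orb_act by auto
      have "\<exists>b\<in>carrier G. act b \<eta> \<noteq> \<eta>"
      proof (rule ccontr)
        assume "\<not> ?thesis"
        then have "orb \<eta> = {\<eta>}" unfolding orb_def using one_closed by auto
        then have "card (orb \<omega>) = 1" using \<eta>(2) by simp
        then show False using card_orb[OF \<omega>'] p by simp
      qed
      then show "\<eta> \<in> {\<eta>\<in>\<Omega>'. orb \<eta> = orb \<omega>}" using \<eta> unfolding \<Omega>'_def by simp
    qed
  qed
  have fin': "finite \<Omega>'" unfolding \<Omega>'_def using \<Omega> by simp
  have "(\<Sum>\<omega>\<in>\<Omega>'. f \<omega>) = (\<Sum>Y\<in>orb ` \<Omega>'. \<Sum>\<eta>\<in>{\<eta>\<in>\<Omega>'. orb \<eta> = Y}. f \<eta>)"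
    using sum.group[OF fin' finite_imageI[OF fin'] subset_refl, where g = orb and h = f] by simp
  \<comment> \<open>As f is constant on each orbit, any representative will do, and the length of
    the orbit supplies the factor p.\<close>
  also have "\<dots> = (\<Sum>Y\<in>orb ` \<Omega>'. of_nat p * (of_nat (card Y div p) * f (SOME \<omega>. \<omega> \<in> \<Omega>' \<and> orb \<omega> = Y)))"
  proof (rule sum.cong[OF refl])
    fix Y assume "Y \<in> orb ` \<Omega>'"
    then have ex: "\<exists>\<omega>. \<omega> \<in> \<Omega>' \<and> orb \<omega> = Y" by auto
    define \<omega> where "\<omega> = (SOME \<omega>. \<omega> \<in> \<Omega>' \<and> orb \<omega> = Y)"
    have \<omega>: "\<omega> \<in> \<Omega>'" "orb \<omega> = Y" using someI_ex[OF ex] unfolding \<omega>_def by auto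
    have "(\<Sum>\<eta>\<in>{\<eta>\<in>\<Omega>'. orb \<eta> = Y}. f \<eta>) = (\<Sum>\<eta>\<in>Y. f \<eta>)" using orb_sub[OF \<omega>(1)] \<omega>(2) by simp
    also have "\<dots> = (\<Sum>\<eta>\<in>Y. f \<omega>)"
    proof (rule sum.cong[OF refl])
      fix \<eta> assume "\<eta> \<in> Y"
      then obtain b where "b \<in> carrier G" "\<eta> = act b \<omega>" using \<omega>(2) unfolding orb_def by auto
      then show "f \<eta> = f \<omega>" using f_inv \<omega>(1) unfolding \<Omega>'_def by auto
    qed
    also have "\<dots> = of_nat p * (of_nat (card Y div p) * f \<omega>)"
    proof -
      have "card Y = p * (card Y div p)" using card_orb[OF \<omega>(1)] \<omega>(2) by simp
      then have "(of_nat (card Y) :: complex) = of_nat p * of_nat (card Y div p)" by (metis of_nat_mult)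
      then show ?thesis by simp
    qed
    finally show "(\<Sum>\<eta>\<in>{\<eta>\<in>\<Omega>'. orb \<eta> = Y}. f \<eta>) =
        of_nat p * (of_nat (card Y div p) * f (SOME \<omega>. \<omega> \<in> \<Omega>' \<and> orb \<omega> = Y))"
      unfolding \<omega>_def .
  qed
  also have "\<dots> = of_nat p * (\<Sum>Y\<in>orb ` \<Omega>'. of_nat (card Y div p) * f (SOME \<omega>. \<omega> \<in> \<Omega>' \<and> orb \<omega> = Y))"
    by (simp add: sum_distrib_left)
  finally have eq: "(\<Sum>\<omega>\<in>\<Omega>'. f \<omega>) = of_nat p * (\<Sum>Y\<in>orb ` \<Omega>'. of_nat (card Y div p) * f (SOME \<omega>. \<omega> \<in> \<Omega>' \<and> orb \<omega> = Y))" .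
  have "(\<Sum>Y\<in>orb ` \<Omega>'. of_nat (card Y div p) * f (SOME \<omega>. \<omega> \<in> \<Omega>' \<and> orb \<omega> = Y)) \<in> p_integral p"
  proof (rule p_integral_sum[OF p])
    fix Y assume "Y \<in> orb ` \<Omega>'"
    then have ex: "\<exists>\<omega>. \<omega> \<in> \<Omega>' \<and> orb \<omega> = Y" by auto
    then have "(SOME \<omega>. \<omega> \<in> \<Omega>' \<and> orb \<omega> = Y) \<in> \<Omega>" using someI_ex[OF ex] unfolding \<Omega>'_def by simp
    then show "of_nat (card Y div p) * f (SOME \<omega>. \<omega> \<in> \<Omega>' \<and> orb \<omega> = Y) \<in> p_integral p"
      by (intro p_integral_mult[OF p] p_integral_of_nat[OF p] f_int)
  qed
  then show ?thesis using eq unfolding \<Omega>'_def by blast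
qed

text \<open>The span of V over the p-integral numbers, generated one summand at a time, so that its
  properties follow by induction without a choice of coordinates.\<close>

inductive_set lattice :: "nat \<Rightarrow> ('g \<Rightarrow> complex) set \<Rightarrow> ('g \<Rightarrow> complex) set" for p V where
  zero: "(\<lambda>_. 0) \<in> lattice p V"
| add: "f \<in> lattice p V \<Longrightarrow> a \<in> p_integral p \<Longrightarrow> v \<in> V \<Longrightarrow> (\<lambda>x. f x + a * v x) \<in> lattice p V"

lemma lattice_add:
  assumes "f \<in> lattice p V" "h \<in> lattice p V"
  shows "(\<lambda>x. f x + h x) \<in> lattice p V"
  using assms(2)
proof (induction h rule: lattice.induct)
  case (add h a v)
  then show ?case using lattice.add[of "\<lambda>x. f x + h x" p V a v] by (simp add: add.assoc)
qed (simp add: assms)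

lemma lattice_scale:
  assumes p: "prime p" and "f \<in> lattice p V" "c \<in> p_integral p"
  shows "(\<lambda>x. c * f x) \<in> lattice p V"
  using assms(2)
proof (induction f rule: lattice.induct)
  case (add f a v)
  then show ?case
    using lattice.add[of "\<lambda>x. c * f x" p V "c * a" v] p_integral_mult[OF p assms(3)]
    by (simp add: distrib_left mult.assoc)
qed (simp add: lattice.zero)

lemma lattice_generator:
  assumes p: "prime p" and "v \<in> V" "c \<in> p_integral p"
  shows "(\<lambda>x. c * v x) \<in> lattice p V"
  using lattice.add[OF lattice.zero assms(3,2)] by simp

lemma lattice_sum:
  assumes "\<And>i. i \<in> I \<Longrightarrow> F i \<in> lattice p V"
  shows "(\<lambda>x. \<Sum>i\<in>I. F i x) \<in> lattice p V"
  using assms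
proof (induction I rule: infinite_finite_induct)
  case (insert i I)
  then show ?case using lattice_add[of "F i" p V "\<lambda>x. \<Sum>i\<in>I. F i x"] by simp
qed (simp_all add: lattice.zero)

text \<open>Applied at the unit element with c = e(1): there all lattice elements take p-integral
  multiples of one common number.\<close>

lemma lattice_value:
  assumes p: "prime p" and V: "\<And>v. v \<in> V \<Longrightarrow> \<exists>r\<in>unity_sums. v x = r * c" and f: "f \<in> lattice p V"
  shows "\<exists>r\<in>p_integral p. f x = r * c"
  using f
proof (induction f rule: lattice.induct)
  case zero
  show ?case using p_integral_of_nat[OF p, of 0] by (intro bexI[of _ 0]) auto
next
  case (add f a v)
  then obtain r s where rs: "r \<in> p_integral p" "f x = r * c" "s \<in> unity_sums" "v x = s * c"
    using V by blast
  have "r + a * s \<in> p_integral p"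
    using p_integral_add[OF p rs(1) p_integral_mult[OF p add(2) unity_sums_p_integral[OF p rs(3)]]] .
  then show ?case using rs(2,4) by (intro bexI[of _ "r + a * s"]) (simp_all add: algebra_simps)
qed

context fin_group
begin

lemma conv_add_left: "(\<lambda>x. f x + f' x) \<star> h = (\<lambda>x. (f \<star> h) x + (f' \<star> h) x)"
  by (auto simp: conv_def sum.distrib distrib_right)

lemma conv_add_right: "h \<star> (\<lambda>x. f x + f' x) = (\<lambda>x. (h \<star> f) x + (h \<star> f') x)"
  by (auto simp: conv_def sum.distrib distrib_left)

lemma lattice_conv:
  assumes p: "prime p" and V: "\<And>v w. v \<in> V \<Longrightarrow> w \<in> V \<Longrightarrow> \<exists>c\<in>unity_sums. \<exists>u\<in>V. v \<star> w = (\<lambda>x. c * u x)"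
    and f: "f \<in> lattice p V" and h: "h \<in> lattice p V"
  shows "f \<star> h \<in> lattice p V"
  using f
proof (induction f rule: lattice.induct)
  case zero
  show ?case by (simp add: lattice.zero)
next
  case (add f a v)
  have "v \<star> h \<in> lattice p V" using h
  proof (induction h rule: lattice.induct)
    case zero
    show ?case by (simp add: lattice.zero)
  next
    case (add h b w)
    obtain c u where cu: "c \<in> unity_sums" "u \<in> V" "v \<star> w = (\<lambda>x. c * u x)"
      using V[OF \<open>v \<in> V\<close> \<open>w \<in> V\<close>] by blast
    have "v \<star> (\<lambda>x. h x + b * w x) = (\<lambda>x. (v \<star> h) x + (b * c) * u x)"
      unfolding conv_add_right conv_scale_right cu(3) by (simp add: mult.assoc)
    then show ?case
      using lattice.add[OF add.IH p_integral_mult[OF p \<open>b \<in> p_integral p\<close> unity_sums_p_integral[OF p cu(1)]] cu(2)]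
      by simp
  qed
  from lattice_scale[OF p this \<open>a \<in> p_integral p\<close>] show ?case
    unfolding conv_add_left conv_scale_left by (rule lattice_add[OF add.IH])
qed

end

section \<open>Coordinates of idempotents, and multiplicities over N\<close>

context fin_normal
begin

lemma card_index:
  assumes K: "subgroup K G" and NK: "N \<subseteq> K"
  shows "card K = card N * (card K div card N)" "card K div card N > 0"
  using card_subgroup_dvd[OF subgroup_N K NK] card_sub_pos[OF K] card_sub_pos[OF subgroup_N]
  by (auto simp: dvd_imp_le div_greater_zero_iff)

lemma rcoset_of_subgroup:
  assumes K: "subgroup K G" and NK: "N \<subseteq> K" and Y: "Y \<in> rcosets N" and y: "y \<in> Y" "y \<in> K"
  shows "Y \<subseteq> K"
proof -
  interpret K: subgroup K G by fact
  obtain a where a: "a \<in> carrier G" "Y = N #> a" using Y unfolding RCOSETS_def by auto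
  obtain n where n: "n \<in> N" "y = n \<otimes> a" using y a unfolding r_coset_def by auto
  have "a = inv n \<otimes> y" using n a by (simp add: m_assoc[symmetric])
  then have aK: "a \<in> K" using n y NK K.m_closed K.m_inv_closed by blast
  show ?thesis unfolding a(2) r_coset_def using aK NK K.m_closed by auto
qed

lemma finite_rcosets: "finite (rcosets N)"
  using finite_subset[of "rcosets N" "Pow (carrier G)"] fin rcosets_sub_carrier by auto

lemma sum_res:
  assumes R: "R \<subseteq> rcosets N"
  shows "(\<lambda>x. \<Sum>Y\<in>R. res Y f x) = res (\<Union>R) f"
proof
  fix x
  have finR: "finite R" using finite_rcosets R finite_subset by blast
  show "(\<Sum>Y\<in>R. res Y f x) = res (\<Union>R) f x"
  proof (cases "x \<in> \<Union>R")
    case True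
    then obtain Y where Y: "Y \<in> R" "x \<in> Y" by auto
    have uniq: "x \<in> Z \<longleftrightarrow> Z = Y" if "Z \<in> R" for Z
      using rcos_disjoint[OF subgroup_N] that Y R unfolding pairwise_def disjnt_def by blast
    then have "(\<Sum>Z\<in>R. res Z f x) = (\<Sum>Z\<in>R. if Z = Y then f x else 0)"
      by (intro sum.cong refl) (simp add: res_def)
    then show ?thesis using Y finR True by (simp add: res_def)
  next
    case False
    then have "(\<Sum>Y\<in>R. res Y f x) = 0" by (intro sum.neutral) (auto simp: res_def)
    then show ?thesis using False by (simp add: res_def)
  qed
qed

lemma Union_rcosets_sub:
  assumes K: "subgroup K G" and NK: "N \<subseteq> K"
  shows "\<Union>{Y \<in> rcosets N. Y \<subseteq> K} = K" "\<Union>{Y \<in> rcosets N. \<not> Y \<subseteq> K} = carrier G - K"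
proof -
  have ex: "\<exists>Y\<in>rcosets N. x \<in> Y" if "x \<in> carrier G" for x
    by (intro bexI[of _ "N #> x"] rcos_self[OF that subgroup_N] rcosetsI[OF subset that])
  have sub: "Y \<subseteq> K" if "Y \<in> rcosets N" "x \<in> Y" "x \<in> K" for x Y
    by (rule rcoset_of_subgroup[OF K NK that])
  show "\<Union>{Y \<in> rcosets N. Y \<subseteq> K} = K"
  proof (intro equalityI subsetI)
    fix x assume x: "x \<in> K"
    then obtain Y where "Y \<in> rcosets N" "x \<in> Y" using ex subgroup.subset[OF K] by auto
    then show "x \<in> \<Union>{Y \<in> rcosets N. Y \<subseteq> K}" using sub x by auto
  qed auto
  show "\<Union>{Y \<in> rcosets N. \<not> Y \<subseteq> K} = carrier G - K"
  proof (intro equalityI subsetI)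
    fix x assume "x \<in> \<Union>{Y \<in> rcosets N. \<not> Y \<subseteq> K}"
    then obtain Y where Y: "Y \<in> rcosets N" "x \<in> Y" "\<not> Y \<subseteq> K" by auto
    then show "x \<in> carrier G - K" using sub[OF Y(1,2)] subsetD[OF rcosets_sub_carrier[OF Y(1)] Y(2)] by auto
  next
    fix x assume x: "x \<in> carrier G - K"
    then obtain Y where "Y \<in> rcosets N" "x \<in> Y" using ex by auto
    then show "x \<in> \<Union>{Y \<in> rcosets N. \<not> Y \<subseteq> K}" using x by auto
  qed
qed

text \<open>By Clifford's degree formula \<chi>(1) / \<theta>(1) is the multiplicity times the
  number of constituents, while |K| / |N| is prime to p. So the coordinate is p-integral and even
  contains the multiplicity as a factor, which \<open>cmult_not_dvd\<close> exploits.\<close>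

lemma res_lattice:
  assumes p: "prime p" and K: "subgroup K G" and NK: "N \<subseteq> K" and \<chi>: "\<chi> \<in> Irr (sub K)"
    and \<theta>: "\<theta> \<in> constituents \<chi>" and pK: "\<not> p dvd card K div card N"
    and V: "v \<in> V" "\<kappa> \<in> unity_sums" "f = (\<lambda>x. a * v x)"
      "a * (\<theta> \<one> * of_nat (card K)) = \<chi> \<one> * of_nat (card N) * \<kappa>"
  shows "\<exists>h\<in>lattice p V. f = (\<lambda>x. of_nat (cmult N \<chi> \<theta>) * h x)"
proof -
  have \<theta>I: "\<theta> \<in> Irr (sub N)" using \<theta> unfolding constituents_def by simp
  let ?q = "card K div card N" and ?t = "card (constituents \<chi>)"
  have \<theta>1: "\<theta> \<one> \<noteq> 0" using char_deg_Irr[OF subgroup_N \<theta>I] by simp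
  have \<chi>1: "\<chi> \<one> = of_nat (cmult N \<chi> \<theta>) * of_nat ?t * \<theta> \<one>"
    using clifford_degree[OF K NK \<chi> \<theta>] char_deg_Irr[OF K \<chi>] char_deg_Irr[OF subgroup_N \<theta>I] by simp
  have q: "(of_nat (card K) :: complex) = of_nat (card N) * of_nat ?q" "?q > 0"
    using card_index[OF K NK] by (metis of_nat_mult)+
  have n0: "(of_nat (card N) :: complex) \<noteq> 0" using card_sub_pos[OF subgroup_N] by simp
  have "(\<theta> \<one> * of_nat (card N)) * (a * of_nat ?q) = (\<theta> \<one> * of_nat (card N)) * (of_nat (cmult N \<chi> \<theta>) * of_nat ?t * \<kappa>)"
    using V(4) unfolding \<chi>1 q(1) by (simp add: mult_ac)
  then have "a * of_nat ?q = of_nat (cmult N \<chi> \<theta>) * of_nat ?t * \<kappa>" using \<theta>1 n0 by (simp only: mult_cancel_left) simp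
  then have a: "a = of_nat (cmult N \<chi> \<theta>) * (of_nat ?t * \<kappa> / of_nat ?q)" using q(2) by (simp add: field_simps)
  have "of_nat ?t * \<kappa> / of_nat ?q \<in> p_integral p"
    by (intro p_integral_divide_nat[OF p _ pK] p_integral_mult[OF p] p_integral_of_nat[OF p] unity_sums_p_integral[OF p] V(2))
  from lattice_generator[OF p V(1) this] show ?thesis
    by (intro bexI[of _ "\<lambda>x. of_nat ?t * \<kappa> / of_nat ?q * v x"]) (simp_all add: V(3) a mult.assoc)
qed

text \<open>If \<open>p\<close> divided the multiplicity, then the idempotent \<open>idem K \<chi> \<star> idem N \<theta>\<close> would lie in
  \<open>p\<close> times the lattice, hence in \<open>p ^ j\<close> times the lattice for all \<open>j\<close>.\<close>

lemma cmult_not_dvd: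
  assumes p: "prime p" and K: "subgroup K G" and NK: "N \<subseteq> K" and \<chi>: "\<chi> \<in> Irr (sub K)"
    and \<theta>: "\<theta> \<in> constituents \<chi>" and pK: "\<not> p dvd card K div card N"
  shows "\<not> p dvd cmult N \<chi> \<theta>"
proof
  assume dvd: "p dvd cmult N \<chi> \<theta>"
  have \<theta>I: "\<theta> \<in> Irr (sub N)" and mult0: "cmult N \<chi> \<theta> > 0" using \<theta> unfolding constituents_def by auto
  let ?e = "idem N \<theta>" and ?q = "card K div card N" and ?t = "card (constituents \<chi>)" and ?m = "cmult N \<chi> \<theta>"
  obtain V where V: "\<forall>v\<in>V. \<forall>w\<in>V. \<exists>c\<in>unity_sums. \<exists>u\<in>V. v \<star> w = (\<lambda>x. c * u x)"
    "\<forall>v\<in>V. \<exists>r\<in>unity_sums. v \<one> = r * ?e \<one>"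
    and Vres: "\<forall>K \<chi> X. subgroup K G \<and> N \<subseteq> K \<and> \<chi> \<in> Irr (sub K) \<and> X \<in> rcosets N \<and> X \<subseteq> K \<longrightarrow>
      (\<exists>v\<in>V. \<exists>a. \<exists>\<kappa>\<in>unity_sums. res X (idem K \<chi>) \<star> ?e = (\<lambda>x. a * v x) \<and>
        a * (\<theta> \<one> * of_nat (card K)) = \<chi> \<one> * of_nat (card N) * \<kappa>)"
    using integral_basis[OF \<theta>I] by auto
  define b where "b = idem K \<chi> \<star> ?e"
  have comm: "idem K \<chi> \<star> ?e = ?e \<star> idem K \<chi>"
    by (rule conv_commute[OF subset conj_inv_mono[OF conj_inv_idem[OF K \<chi>] NK] idem_fn_on])
  have bb: "b \<star> b = b"
  proof -
    have "b \<star> b = idem K \<chi> \<star> (?e \<star> idem K \<chi>) \<star> ?e" unfolding b_def by (simp add: conv_assoc)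
    also have "\<dots> = (idem K \<chi> \<star> idem K \<chi>) \<star> (?e \<star> ?e)" unfolding comm[symmetric] by (simp add: conv_assoc)
    finally show ?thesis
      using idem_conv_idem[OF K \<chi> \<chi>] idem_conv_idem[OF subgroup_N \<theta>I \<theta>I] by (simp add: b_def)
  qed
  have bsum: "b = (\<lambda>x. \<Sum>Y\<in>{Y \<in> rcosets N. Y \<subseteq> K}. (res Y (idem K \<chi>) \<star> ?e) x)"
  proof -
    have "idem K \<chi> = res K (idem K \<chi>)" by (auto simp: res_def idem_def)
    also have "\<dots> = (\<lambda>x. \<Sum>Y\<in>{Y \<in> rcosets N. Y \<subseteq> K}. res Y (idem K \<chi>) x)"
      using sum_res[of "{Y \<in> rcosets N. Y \<subseteq> K}" "idem K \<chi>"] Union_rcosets_sub(1)[OF K NK] by auto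
    finally show ?thesis unfolding b_def using conv_sum_left by metis
  qed
  have "\<exists>h\<in>lattice p V. res Y (idem K \<chi>) \<star> ?e = (\<lambda>x. of_nat ?m * h x)"
    if Y: "Y \<in> rcosets N" "Y \<subseteq> K" for Y
  proof -
    obtain v a \<kappa> where "v \<in> V" "\<kappa> \<in> unity_sums" "res Y (idem K \<chi>) \<star> ?e = (\<lambda>x. a * v x)"
      "a * (\<theta> \<one> * of_nat (card K)) = \<chi> \<one> * of_nat (card N) * \<kappa>"
      using Vres K NK \<chi> Y by blast
    from res_lattice[OF p K NK \<chi> \<theta> pK this] show ?thesis .
  qed
  then obtain h where h: "\<And>Y. Y \<in> rcosets N \<Longrightarrow> Y \<subseteq> K \<Longrightarrow> h Y \<in> lattice p V"
    "\<And>Y. Y \<in> rcosets N \<Longrightarrow> Y \<subseteq> K \<Longrightarrow> res Y (idem K \<chi>) \<star> ?e = (\<lambda>x. of_nat ?m * h Y x)"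
    by metis
  define b1 where "b1 = (\<lambda>x. of_nat (?m div p) * (\<Sum>Y\<in>{Y \<in> rcosets N. Y \<subseteq> K}. h Y x))"
  have b1: "b1 \<in> lattice p V"
    unfolding b1_def by (intro lattice_scale[OF p] lattice_sum p_integral_of_nat[OF p]) (auto intro: h)
  have "of_nat ?m = of_nat p * (of_nat (?m div p) :: complex)"
    using dvd by (metis dvd_mult_div_cancel of_nat_mult)
  then have b_eq: "b = (\<lambda>x. of_nat p * b1 x)"
    unfolding bsum b1_def using h(2) by (auto simp: sum_distrib_left mult.assoc)
  \<comment> \<open>Each use of b = b \<star> b multiplies the power of p found so far by the factor
    p from \<open>b_eq\<close>; the lattice is closed under products.\<close>
  have pow: "\<exists>f\<in>lattice p V. b = (\<lambda>x. of_nat p ^ Suc j * f x)" for j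
  proof (induction j)
    case 0
    show ?case using b1 b_eq by auto
  next
    case (Suc j)
    then obtain f where f: "f \<in> lattice p V" "b = (\<lambda>x. of_nat p ^ Suc j * f x)" by blast
    have "b = (\<lambda>x. of_nat p ^ Suc j * f x) \<star> (\<lambda>x. of_nat p * b1 x)" using bb f(2) b_eq by metis
    also have "\<dots> = (\<lambda>x. of_nat p ^ Suc (Suc j) * (f \<star> b1) x)"
      unfolding conv_scale_left conv_scale_right by (simp add: mult_ac)
    finally have "b = (\<lambda>x. of_nat p ^ Suc (Suc j) * (f \<star> b1) x)" .
    moreover have "f \<star> b1 \<in> lattice p V" by (rule lattice_conv[OF p _ f(1) b1]) (use V(1) in blast)
    ultimately show ?case by blast
  qed
  have val: "\<exists>r\<in>p_integral p. f \<one> = r * ?e \<one>" if "f \<in> lattice p V" for f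
    by (rule lattice_value[OF p _ that]) (use V(2) in blast)
  have q: "(of_nat (card K) :: complex) = of_nat (card N) * of_nat ?q" "?q > 0"
    using card_index[OF K NK] by (metis of_nat_mult)+
  have \<chi>1: "\<chi> \<one> = of_nat ?m * of_nat ?t * \<theta> \<one>"
    using clifford_degree[OF K NK \<chi> \<theta>] char_deg_Irr[OF K \<chi>] char_deg_Irr[OF subgroup_N \<theta>I] by simp
  have t: "?t > 0" using \<theta> finite_constituents card_gt_0_iff by blast
  show False
  proof (rule not_p_divisible[OF p])
    \<comment> \<open>Write m for the multiplicity, t for the number of constituents and q for the
      index. Then b(1) / e(1) = m^2 t / q, so m^2 t would be divisible by every power of p.\<close>
    show "0 < ?m * ?m * ?t" using mult0 t by simp
    fix j
    obtain f where f: "f \<in> lattice p V" "b = (\<lambda>x. of_nat p ^ Suc j * f x)" using pow by blast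
    obtain r where r: "r \<in> p_integral p" "f \<one> = r * ?e \<one>" using val[OF f(1)] by blast
    have "of_nat p ^ Suc j * (r * ?e \<one>) = \<chi> \<one> * \<theta> \<one> * of_nat ?m / of_nat (card K)"
      using idem_conv_idem_one[OF K NK \<chi> \<theta>I] comm f(2) r(2) unfolding b_def by metis
    then have "of_nat (?m * ?m * ?t) = of_nat p ^ j * (of_nat p * r * of_nat ?q)"
      using char_deg_Irr[OF subgroup_N \<theta>I] card_sub_pos[OF subgroup_N] q(2)
      unfolding idem_one[OF subgroup_N] \<chi>1 q(1) by (simp add: field_simps power2_eq_square)
    then show "\<exists>x\<in>p_integral p. of_nat (?m * ?m * ?t) = of_nat p ^ j * x"
      using p_integral_mult[OF p p_integral_mult[OF p p_integral_of_nat[OF p] r(1)] p_integral_of_nat[OF p]] by blast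
  qed
qed

end

section \<open>Characters invariant under a \<open>p\<close>-group\<close>

text \<open>The subgroup B is a parameter of its own because the same action of X is used for
  several subgroups: the given p-group, larger p-subgroups, and X itself in
  \<open>whole_action\<close>.\<close>

locale aut_action = fin_normal N G + X: group X
  for N and G (structure) and X :: "('x, 'c) monoid_scheme" +
  fixes \<sigma> :: "'x \<Rightarrow> 'a \<Rightarrow> 'a" and B :: "'x set"
  assumes hom_aut: "\<sigma> \<in> hom X (AutoGroup G)"
    and subgroup_B: "subgroup B X"
    and N_inv: "\<And>b. b \<in> B \<Longrightarrow> \<sigma> b ` N = N"
begin

lemma B_carrier [simp]: "b \<in> B \<Longrightarrow> b \<in> carrier X"
  using subgroup.subset[OF subgroup_B] by auto

lemma B_inv [simp]: "b \<in> B \<Longrightarrow> inv\<^bsub>X\<^esub> b \<in> B"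
  by (rule subgroup.m_inv_closed[OF subgroup_B])

lemma \<sigma>_auto:
  assumes "b \<in> carrier X"
  shows "\<sigma> b \<in> hom G G" "\<sigma> b \<in> Bij (carrier G)"
  using hom_aut assms unfolding hom_def[of X] AutoGroup_def auto_def by auto

lemma \<sigma>_closed [simp]: "b \<in> carrier X \<Longrightarrow> g \<in> carrier G \<Longrightarrow> \<sigma> b g \<in> carrier G"
  using \<sigma>_auto(1) unfolding hom_def by auto

lemma \<sigma>_mult: "b \<in> carrier X \<Longrightarrow> g \<in> carrier G \<Longrightarrow> h \<in> carrier G \<Longrightarrow> \<sigma> b (g \<otimes> h) = \<sigma> b g \<otimes> \<sigma> b h"
  using \<sigma>_auto(1) unfolding hom_def by auto

lemma \<sigma>_comp: "b \<in> carrier X \<Longrightarrow> c \<in> carrier X \<Longrightarrow> g \<in> carrier G \<Longrightarrow> \<sigma> (b \<otimes>\<^bsub>X\<^esub> c) g = \<sigma> b (\<sigma> c g)"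
  using hom_mult[OF hom_aut, of b c] \<sigma>_auto(2) by (simp add: AutoGroup_def BijGroup_def compose_def)

lemma \<sigma>_one: "g \<in> carrier G \<Longrightarrow> \<sigma> \<one>\<^bsub>X\<^esub> g = g"
  using hom_one[OF hom_aut X.is_group AutoGroup] by (simp add: AutoGroup_def BijGroup_def)

lemma \<sigma>_inv_cancel [simp]:
  assumes "b \<in> carrier X" "g \<in> carrier G"
  shows "\<sigma> (inv\<^bsub>X\<^esub> b) (\<sigma> b g) = g" "\<sigma> b (\<sigma> (inv\<^bsub>X\<^esub> b) g) = g"
  using assms \<sigma>_comp[of "inv\<^bsub>X\<^esub> b" b g] \<sigma>_comp[of b "inv\<^bsub>X\<^esub> b" g] \<sigma>_one by simp_all

lemma \<sigma>_one_G [simp]: "b \<in> carrier X \<Longrightarrow> \<sigma> b \<one> = \<one>"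
  using hom_one[OF \<sigma>_auto(1) is_group is_group] .

lemma \<sigma>_inv_G: "b \<in> carrier X \<Longrightarrow> g \<in> carrier G \<Longrightarrow> \<sigma> b (inv g) = inv (\<sigma> b g)"
  using group_hom.hom_inv[of G G "\<sigma> b" g] \<sigma>_auto(1) is_group
  by (simp add: group_hom_def group_hom_axioms_def)

definition invset :: "'a set \<Rightarrow> bool" where
  "invset K \<longleftrightarrow> subgroup K G \<and> (\<forall>b\<in>B. \<sigma> b ` K = K)"

lemma invset_subgroup: "invset K \<Longrightarrow> subgroup K G"
  unfolding invset_def by simp

lemma invset_mem:
  assumes "invset K" "b \<in> B" "g \<in> carrier G"
  shows "\<sigma> b g \<in> K \<longleftrightarrow> g \<in> K"
proof
  assume "\<sigma> b g \<in> K"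
  moreover have "\<sigma> (inv\<^bsub>X\<^esub> b) ` K = K" using assms B_inv unfolding invset_def by blast
  ultimately have "\<sigma> (inv\<^bsub>X\<^esub> b) (\<sigma> b g) \<in> K" by blast
  then show "g \<in> K" using assms by simp
next
  assume "g \<in> K"
  then show "\<sigma> b g \<in> K" using assms unfolding invset_def by blast
qed

lemma invset_N: "invset N"
  unfolding invset_def using subgroup_N N_inv by simp

lemma invset_G: "invset (carrier G)"
  unfolding invset_def
proof (intro conjI ballI subgroup_self equalityI subsetI)
  fix b g assume b: "b \<in> B" and g: "g \<in> carrier G"
  show "g \<in> \<sigma> b ` carrier G" by (rule image_eqI[of _ _ "\<sigma> (inv\<^bsub>X\<^esub> b) g"]) (use b g in auto)
qed auto

abbreviation chact where "chact K b \<theta> \<equiv> char_act X \<sigma> (sub K) b \<theta>"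

lemma chact_apply: "g \<in> K \<Longrightarrow> chact K b \<theta> g = \<theta> (\<sigma> (inv\<^bsub>X\<^esub> b) g)"
  by (simp add: char_act_def)

lemma chact_Irr:
  assumes K: "invset K" and b: "b \<in> B" and \<theta>: "\<theta> \<in> Irr (sub K)"
  shows "chact K b \<theta> \<in> Irr (sub K)"
proof -
  note KG = subgroup.mem_carrier[OF invset_subgroup[OF K]]
  have iso: "\<sigma> (inv\<^bsub>X\<^esub> b) \<in> iso (sub K) (sub K)"
    unfolding iso_def hom_def
  proof (intro CollectI conjI)
    show "\<sigma> (inv\<^bsub>X\<^esub> b) \<in> carrier (sub K) \<rightarrow> carrier (sub K)" using invset_mem[OF K B_inv[OF b]] KG by auto
    show "bij_betw (\<sigma> (inv\<^bsub>X\<^esub> b)) (carrier (sub K)) (carrier (sub K))"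
      by (rule bij_betw_byWitness[of _ "\<sigma> b"]) (use b KG invset_mem[OF K b] invset_mem[OF K B_inv[OF b]] in auto)
  qed (use b KG \<sigma>_mult in auto)
  have grp: "group (sub K)" using sub_fin_group[OF invset_subgroup[OF K]] fin_group.axioms(1) by blast
  show ?thesis using Irr_pullback[OF grp grp iso \<theta>] unfolding char_act_def by simp
qed

lemma chact_mult:
  assumes K: "invset K" and b: "b \<in> B" and c: "c \<in> B"
  shows "chact K (b \<otimes>\<^bsub>X\<^esub> c) \<theta> = chact K b (chact K c \<theta>)"
proof
  fix g
  show "chact K (b \<otimes>\<^bsub>X\<^esub> c) \<theta> g = chact K b (chact K c \<theta>) g"
    using subgroup.mem_carrier[OF invset_subgroup[OF K], of g] b c invset_mem[OF K B_inv[OF b], of g]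
    by (cases "g \<in> K") (simp_all add: char_act_def X.inv_mult_group \<sigma>_comp)
qed

lemma chact_one:
  assumes K: "invset K" and \<theta>: "\<theta> \<in> Irr (sub K)"
  shows "chact K \<one>\<^bsub>X\<^esub> \<theta> = \<theta>"
proof
  fix g
  have "\<theta> g = undefined" if "g \<notin> K" using \<theta> that unfolding Irr_def by auto
  then show "chact K \<one>\<^bsub>X\<^esub> \<theta> g = \<theta> g"
    using subgroup.mem_carrier[OF invset_subgroup[OF K], of g] by (cases "g \<in> K") (simp_all add: char_act_def \<sigma>_one)
qed

abbreviation IrrB where "IrrB K \<equiv> Irr_inv X \<sigma> B (sub K)"

lemma IrrB_sub: "\<theta> \<in> IrrB K \<Longrightarrow> \<theta> \<in> Irr (sub K)"
  unfolding Irr_inv_def by simp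

lemma IrrB_fixed: "\<theta> \<in> IrrB K \<Longrightarrow> b \<in> B \<Longrightarrow> chact K b \<theta> = \<theta>"
  unfolding Irr_inv_def by simp

lemma IrrB_value:
  assumes K: "invset K" and \<theta>: "\<theta> \<in> IrrB K" and b: "b \<in> B" and g: "g \<in> K"
  shows "\<theta> (\<sigma> b g) = \<theta> g"
proof -
  have gG: "g \<in> carrier G" using subgroup.mem_carrier[OF invset_subgroup[OF K] g] .
  then have "\<theta> (\<sigma> b g) = chact K b \<theta> (\<sigma> b g)" using IrrB_fixed[OF \<theta> b] by simp
  then show ?thesis using invset_mem[OF K b gG] g gG b by (simp add: chact_apply)
qed

lemma cmult_chact:
  assumes K: "invset K" and L: "invset L" and LK: "L \<subseteq> K" and b: "b \<in> B"
  shows "cmult L (chact K b \<chi>) (chact L b \<theta>) = cmult L \<chi> \<theta>"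
proof -
  note LG = subgroup.mem_carrier[OF invset_subgroup[OF L]]
  have "(\<Sum>x\<in>L. chact K b \<chi> x * chact L b \<theta> (inv x)) = (\<Sum>x\<in>L. \<chi> x * \<theta> (inv x))"
  proof (rule sum.reindex_bij_witness[of _ "\<sigma> b" "\<sigma> (inv\<^bsub>X\<^esub> b)"])
    fix x assume x: "x \<in> L"
    show "\<chi> (\<sigma> (inv\<^bsub>X\<^esub> b) x) * \<theta> (inv (\<sigma> (inv\<^bsub>X\<^esub> b) x)) = chact K b \<chi> x * chact L b \<theta> (inv x)"
      using x LG[OF x] LK b subgroup.m_inv_closed[OF invset_subgroup[OF L] x]
      by (simp add: chact_apply subsetD \<sigma>_inv_G)
  qed (use b LG invset_mem[OF L b] invset_mem[OF L B_inv[OF b]] in auto)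
  then show ?thesis unfolding cmult_def by simp
qed

lemma B_group: "group (X\<lparr>carrier := B\<rparr>)"
  using X.subgroup_imp_group[OF subgroup_B] .

end

locale p_action = aut_action N G X \<sigma> B
  for N and G (structure) and X :: "('x, 'c) monoid_scheme" and \<sigma> :: "'x \<Rightarrow> 'a \<Rightarrow> 'a" and B +
  fixes p :: nat
  assumes p: "prime p"
    and card_B: "\<exists>k. card B = p ^ k"
    and p_index: "\<not> p dvd card (carrier G) div card N"
begin

text \<open>The form in which the p-group acts on sums: modulo p times a p-integral number, only
  fixed points contribute.\<close>

lemma B_orbit_sum:
  assumes \<Omega>: "finite \<Omega>" and closed: "\<And>b \<omega>. b \<in> B \<Longrightarrow> \<omega> \<in> \<Omega> \<Longrightarrow> act b \<omega> \<in> \<Omega>"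
    and act_one: "\<And>\<omega>. \<omega> \<in> \<Omega> \<Longrightarrow> act \<one>\<^bsub>X\<^esub> \<omega> = \<omega>"
    and act_mult: "\<And>b c \<omega>. b \<in> B \<Longrightarrow> c \<in> B \<Longrightarrow> \<omega> \<in> \<Omega> \<Longrightarrow> act (b \<otimes>\<^bsub>X\<^esub> c) \<omega> = act b (act c \<omega>)"
    and f_inv: "\<And>b \<omega>. b \<in> B \<Longrightarrow> \<omega> \<in> \<Omega> \<Longrightarrow> f (act b \<omega>) = f \<omega>"
    and f_int: "\<And>\<omega>. \<omega> \<in> \<Omega> \<Longrightarrow> f \<omega> \<in> p_integral p"
  shows "\<exists>s\<in>p_integral p. (\<Sum>\<omega>\<in>\<Omega>. f \<omega>) = (\<Sum>\<omega>\<in>{\<omega>\<in>\<Omega>. \<forall>b\<in>B. act b \<omega> = \<omega>}. f \<omega>) + of_nat p * s"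
proof -
  interpret BG: group "X\<lparr>carrier := B\<rparr>" by (rule B_group)
  obtain k where k: "card (carrier (X\<lparr>carrier := B\<rparr>)) = p ^ k" using card_B by auto
  obtain s where s: "s \<in> p_integral p"
    "(\<Sum>\<omega>\<in>{\<omega>\<in>\<Omega>. \<exists>b\<in>carrier (X\<lparr>carrier := B\<rparr>). act b \<omega> \<noteq> \<omega>}. f \<omega>) = of_nat p * s"
    using BG.p_group_orbit_sum[OF p k \<Omega>, of act f] closed act_one act_mult f_inv f_int by auto
  have "\<Omega> = {\<omega>\<in>\<Omega>. \<forall>b\<in>B. act b \<omega> = \<omega>} \<union> {\<omega>\<in>\<Omega>. \<exists>b\<in>B. act b \<omega> \<noteq> \<omega>}" by auto
  then have "(\<Sum>\<omega>\<in>\<Omega>. f \<omega>) = (\<Sum>\<omega>\<in>{\<omega>\<in>\<Omega>. \<forall>b\<in>B. act b \<omega> = \<omega>}. f \<omega>) + (\<Sum>\<omega>\<in>{\<omega>\<in>\<Omega>. \<exists>b\<in>B. act b \<omega> \<noteq> \<omega>}. f \<omega>)"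
    using sum.union_disjoint[of "{\<omega>\<in>\<Omega>. \<forall>b\<in>B. act b \<omega> = \<omega>}" "{\<omega>\<in>\<Omega>. \<exists>b\<in>B. act b \<omega> \<noteq> \<omega>}" f] \<Omega> by auto
  also have "(\<Sum>\<omega>\<in>{\<omega>\<in>\<Omega>. \<exists>b\<in>B. act b \<omega> \<noteq> \<omega>}. f \<omega>) = of_nat p * s" using s(2) by simp
  finally show ?thesis using s(1) by (rule bexI)
qed

lemma Irr_orbit_sum:
  assumes K: "invset K" and f_inv: "\<And>b \<theta>. b \<in> B \<Longrightarrow> \<theta> \<in> Irr (sub K) \<Longrightarrow> f (chact K b \<theta>) = f \<theta>"
    and f_int: "\<And>\<theta>. \<theta> \<in> Irr (sub K) \<Longrightarrow> f \<theta> \<in> p_integral p"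
  shows "\<exists>s\<in>p_integral p. (\<Sum>\<theta>\<in>Irr (sub K). f \<theta>) = (\<Sum>\<theta>\<in>IrrB K. f \<theta>) + of_nat p * s"
proof -
  have "IrrB K = {\<theta>\<in>Irr (sub K). \<forall>b\<in>B. chact K b \<theta> = \<theta>}" unfolding Irr_inv_def by simp
  then show ?thesis
    using B_orbit_sum[OF finite_Irr[OF invset_subgroup[OF K]], of "chact K" f]
      chact_Irr[OF K] chact_one[OF K] chact_mult[OF K] f_inv f_int by simp
qed

lemma index_not_dvd:
  assumes K: "subgroup K G" and NK: "N \<subseteq> K"
  shows "\<not> p dvd card K div card N"
proof -
  have "card K dvd card (carrier G)" by (rule card_subgroup_dvd[OF K subgroup_self subgroup.subset[OF K]])
  then obtain l where "card (carrier G) = card K * l" by (auto elim: dvdE)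
  then have "card (carrier G) div card N = (card K div card N) * l"
    using card_index(1)[OF K NK] card_sub_pos[OF subgroup_N]
    by (metis mult.assoc nonzero_mult_div_cancel_left not_less_zero)
  then show ?thesis using p_index by auto
qed

text \<open>The number of constituents divides |K : N| and is therefore prime to p. As B permutes
  them, it fixes one.\<close>

lemma fixed_constituent:
  assumes K: "invset K" and NK: "N \<subseteq> K" and \<psi>: "\<psi> \<in> IrrB K"
  shows "\<exists>\<theta>\<in>constituents \<psi>. \<theta> \<in> IrrB N"
proof (rule ccontr)
  assume none: "\<not> ?thesis"
  note K' = invset_subgroup[OF K]
  have inv: "cmult N \<psi> (chact N b \<theta>) = cmult N \<psi> \<theta>" if "b \<in> B" for b \<theta>
    using cmult_chact[OF K invset_N NK that, of \<psi> \<theta>] IrrB_fixed[OF \<psi> that] by simp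
  obtain s where s: "s \<in> p_integral p" "(\<Sum>\<theta>\<in>constituents \<psi>. 1) =
      (\<Sum>\<theta>\<in>{\<theta>\<in>constituents \<psi>. \<forall>b\<in>B. chact N b \<theta> = \<theta>}. 1) + of_nat p * s"
    using B_orbit_sum[OF finite_constituents, of "\<psi>" "chact N" "\<lambda>_. 1"] chact_Irr[OF invset_N] chact_one[OF invset_N]
      chact_mult[OF invset_N] inv p_integral_of_nat[OF p, of 1] unfolding constituents_def by auto
  have empty: "{\<theta>\<in>constituents \<psi>. \<forall>b\<in>B. chact N b \<theta> = \<theta>} = {}"
    using none unfolding Irr_inv_def constituents_def by auto
  have "of_nat (card (constituents \<psi>)) = of_nat p * s" using s(2) unfolding empty by simp
  then have "p dvd card (constituents \<psi>)" using p_dvd_if_p_integral[OF p _ s(1)] by blast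
  then show False
    using card_constituents_dvd[OF K' NK IrrB_sub[OF \<psi>]] index_not_dvd[OF K' NK] dvd_trans by blast
qed

lemma rcoset_act:
  assumes Y: "Y \<in> rcosets N" and b: "b \<in> B"
  shows "\<sigma> b ` Y \<in> rcosets N"
proof -
  obtain a where a: "a \<in> carrier G" "Y = N #> a" using Y unfolding RCOSETS_def by auto
  have "\<sigma> b ` Y = (\<sigma> b ` N) #> \<sigma> b a"
    unfolding a(2) r_coset_def using a(1) b \<sigma>_mult by (auto simp: image_UN)
  then show ?thesis using N_inv[OF b] rcosetsI[OF subset \<sigma>_closed[OF B_carrier[OF b] a(1)]] by simp
qed

text \<open>The automorphism of the group algebra induced by b. Unlike \<open>chact\<close>, it
  yields functions vanishing off G.\<close>

definition tr :: "'x \<Rightarrow> ('a \<Rightarrow> complex) \<Rightarrow> 'a \<Rightarrow> complex" where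
  "tr b f = (\<lambda>x. if x \<in> carrier G then f (\<sigma> (inv\<^bsub>X\<^esub> b) x) else 0)"

lemma tr_conv:
  assumes b: "b \<in> B"
  shows "tr b (f \<star> h) = tr b f \<star> tr b h"
proof
  fix x
  show "tr b (f \<star> h) x = (tr b f \<star> tr b h) x"
  proof (cases "x \<in> carrier G")
    case x: True
    have "tr b (f \<star> h) x = (\<Sum>y\<in>carrier G. f y * h (inv y \<otimes> \<sigma> (inv\<^bsub>X\<^esub> b) x))"
      using x b by (simp add: tr_def conv_def)
    also have "\<dots> = (\<Sum>y\<in>carrier G. tr b f y * tr b h (inv y \<otimes> x))"
      by (rule sum.reindex_bij_witness[of _ "\<sigma> (inv\<^bsub>X\<^esub> b)" "\<sigma> b"])
        (use b x in \<open>auto simp: tr_def \<sigma>_mult \<sigma>_inv_G\<close>)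
    finally show ?thesis using x by (simp add: conv_def)
  qed (simp add: tr_def conv_def)
qed

lemma tr_one: "b \<in> B \<Longrightarrow> tr b f \<one> = f \<one>"
  by (simp add: tr_def)

lemma tr_idem:
  assumes K: "invset K" and \<theta>: "\<theta> \<in> IrrB K" and b: "b \<in> B"
  shows "tr b (idem K \<theta>) = idem K \<theta>"
proof
  fix x
  note K' = invset_subgroup[OF K]
  show "tr b (idem K \<theta>) x = idem K \<theta> x"
  proof (cases "x \<in> carrier G")
    case x: True
    have "x \<in> K \<Longrightarrow> \<theta> (\<sigma> (inv\<^bsub>X\<^esub> b) (inv x)) = \<theta> (inv x)"
      using IrrB_value[OF K \<theta> B_inv[OF b]] subgroup.m_inv_closed[OF K'] by blast
    then show ?thesis
      using x invset_mem[OF K B_inv[OF b] x] b \<sigma>_inv_G[of "inv\<^bsub>X\<^esub> b" x] by (auto simp: tr_def idem_def)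
  next
    case False
    then show ?thesis using subgroup.mem_carrier[OF K', of x] by (auto simp: tr_def idem_def)
  qed
qed

lemma tr_res:
  assumes b: "b \<in> B" and Y: "Y \<in> rcosets N"
  shows "tr b (res Y f) = res (\<sigma> b ` Y) (tr b f)"
proof
  fix x
  show "tr b (res Y f) x = res (\<sigma> b ` Y) (tr b f) x"
  proof (cases "x \<in> carrier G")
    case x: True
    have YG: "Y \<subseteq> carrier G" using rcosets_sub_carrier[OF Y] .
    have "\<sigma> (inv\<^bsub>X\<^esub> b) x \<in> Y \<longleftrightarrow> x \<in> \<sigma> b ` Y"
    proof
      assume "\<sigma> (inv\<^bsub>X\<^esub> b) x \<in> Y"
      then show "x \<in> \<sigma> b ` Y" using x b by (intro image_eqI[of _ _ "\<sigma> (inv\<^bsub>X\<^esub> b) x"]) auto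
    next
      assume "x \<in> \<sigma> b ` Y"
      then show "\<sigma> (inv\<^bsub>X\<^esub> b) x \<in> Y" using YG b by auto
    qed
    then show ?thesis using x by (simp add: tr_def res_def)
  qed (simp add: tr_def res_def)
qed

end

text \<open>The condition \<open>fixed_cosets\<close> says that the centralizer of B in G/N is
  contained in H/N. Stated for cosets, it passes at once to larger groups in place of B.\<close>

locale p_action_fixed = p_action N G X \<sigma> B p
  for N and G (structure) and X :: "('x, 'c) monoid_scheme" and \<sigma> :: "'x \<Rightarrow> 'a \<Rightarrow> 'a" and B p +
  fixes H
  assumes H_inv: "invset H" and NH: "N \<subseteq> H"
    and fixed_cosets: "\<And>Y. Y \<in> rcosets N \<Longrightarrow> (\<And>b. b \<in> B \<Longrightarrow> \<sigma> b ` Y = Y) \<Longrightarrow> Y \<subseteq> H"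
begin

lemma subgroup_H: "subgroup H G"
  by (rule invset_subgroup[OF H_inv])

definition outer :: "'a set set" where
  "outer = {Y \<in> rcosets N. \<not> Y \<subseteq> H}"

lemma outer_rcosets: "Y \<in> outer \<Longrightarrow> Y \<in> rcosets N"
  unfolding outer_def by simp

lemma finite_outer: "finite outer"
  unfolding outer_def using finite_rcosets by simp

lemma outer_act:
  assumes Y: "Y \<in> outer" and b: "b \<in> B"
  shows "\<sigma> b ` Y \<in> outer"
proof -
  have "Y \<subseteq> H" if "\<sigma> b ` Y \<subseteq> H"
    using that invset_mem[OF H_inv b] rcosets_sub_carrier[OF outer_rcosets[OF Y]] by blast
  then show ?thesis using Y rcoset_act[OF _ b] unfolding outer_def by blast
qed

lemma \<sigma>_image_comp:
  assumes "b \<in> B" "c \<in> B" "Y \<in> rcosets N"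
  shows "\<sigma> (b \<otimes>\<^bsub>X\<^esub> c) ` Y = \<sigma> b ` \<sigma> c ` Y"
  unfolding image_image
  by (rule image_cong[OF refl], rule \<sigma>_comp)
    (use assms rcosets_sub_carrier[OF assms(3)] in \<open>auto intro: subsetD\<close>)

lemma \<sigma>_image_one: "Y \<in> rcosets N \<Longrightarrow> \<sigma> \<one>\<^bsub>X\<^esub> ` Y = Y"
proof -
  assume Y: "Y \<in> rcosets N"
  have "\<sigma> \<one>\<^bsub>X\<^esub> ` Y = (\<lambda>y. y) ` Y"
    by (rule image_cong[OF refl], rule \<sigma>_one, rule subsetD[OF rcosets_sub_carrier[OF Y]])
  then show ?thesis by simp
qed

lemma outer_not_fixed: "Y \<in> outer \<Longrightarrow> \<not> (\<forall>b\<in>B. \<sigma> b ` Y = Y)"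
  using fixed_cosets[of Y] unfolding outer_def by auto

lemma outer_sum:
  assumes "\<And>b Y. b \<in> B \<Longrightarrow> Y \<in> outer \<Longrightarrow> f (\<sigma> b ` Y) = f Y" "\<And>Y. Y \<in> outer \<Longrightarrow> f Y \<in> p_integral p"
  shows "\<exists>s\<in>p_integral p. (\<Sum>Y\<in>outer. f Y) = of_nat p * s"
proof -
  have empty: "{Y\<in>outer. \<forall>b\<in>B. \<sigma> b ` Y = Y} = {}" using outer_not_fixed by blast
  have "\<exists>s\<in>p_integral p. (\<Sum>Y\<in>outer. f Y) = (\<Sum>Y\<in>{Y\<in>outer. \<forall>b\<in>B. \<sigma> b ` Y = Y}. f Y) + of_nat p * s"
    by (rule B_orbit_sum[OF finite_outer])
      (simp_all only: outer_act \<sigma>_image_comp \<sigma>_image_one outer_rcosets assms)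
  then show ?thesis unfolding empty by simp
qed

text \<open>A pair of cosets is fixed only if both members are, so no pair is. Pairs arise from
  products of two elements supported off H.\<close>

lemma outer_pair_sum:
  assumes "\<And>b Y Z. b \<in> B \<Longrightarrow> Y \<in> outer \<Longrightarrow> Z \<in> outer \<Longrightarrow> f (\<sigma> b ` Y) (\<sigma> b ` Z) = f Y Z"
    "\<And>Y Z. Y \<in> outer \<Longrightarrow> Z \<in> outer \<Longrightarrow> f Y Z \<in> p_integral p"
  shows "\<exists>s\<in>p_integral p. (\<Sum>Y\<in>outer. \<Sum>Z\<in>outer. f Y Z) = of_nat p * s"
proof -
  define act where "act b = (\<lambda>P. (\<sigma> b ` fst P, \<sigma> b ` snd P))" for b
  have empty: "{P\<in>outer \<times> outer. \<forall>b\<in>B. act b P = P} = {}" using outer_not_fixed unfolding act_def by fastforce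
  have "\<exists>s\<in>p_integral p. (\<Sum>P\<in>outer \<times> outer. f (fst P) (snd P)) =
      (\<Sum>P\<in>{P\<in>outer \<times> outer. \<forall>b\<in>B. act b P = P}. f (fst P) (snd P)) + of_nat p * s"
  proof (rule B_orbit_sum)
    show "act \<one>\<^bsub>X\<^esub> P = P" if "P \<in> outer \<times> outer" for P
      using that by (cases P) (simp add: act_def \<sigma>_image_one outer_rcosets del: image_image)
    show "act (b \<otimes>\<^bsub>X\<^esub> c) P = act b (act c P)" if "b \<in> B" "c \<in> B" "P \<in> outer \<times> outer" for b c P
      using that by (cases P) (simp add: act_def \<sigma>_image_comp outer_rcosets)
  qed (use assms outer_act finite_outer in \<open>auto simp: act_def\<close>)
  then show ?thesis unfolding empty by (simp add: sum.cartesian_product case_prod_beta)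
qed

end

section \<open>Supports on and off a subgroup; quotients of degrees\<close>

context fin_normal
begin

lemma conj_inv_res_rcoset:
  assumes "Y \<in> rcosets N" "conj_inv N f"
  shows "conj_inv N (res Y f)"
  using assms rcosets_conj[OF assms(1)] unfolding conj_inv_def res_def by simp

lemma conj_inv_res_subgroup:
  assumes H: "subgroup H G" and f: "conj_inv H f"
  shows "conj_inv H (res H f)"
  unfolding conj_inv_def
proof (intro ballI)
  interpret H: subgroup H G by fact
  fix k x assume k: "k \<in> H" and x: "x \<in> carrier G"
  have "x = inv k \<otimes> (k \<otimes> x \<otimes> inv k) \<otimes> k" using k x by (simp add: m_assoc) (simp add: m_assoc[symmetric])
  then have "k \<otimes> x \<otimes> inv k \<in> H \<longleftrightarrow> x \<in> H" using k by (metis H.m_closed H.m_inv_closed)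
  then show "res H f (k \<otimes> x \<otimes> inv k) = res H f x" using f k x by (simp add: res_def conj_inv_def)
qed

lemma outside_mult:
  assumes H: "subgroup H G"
  shows "H <#> (carrier G - H) \<subseteq> carrier G - H" "(carrier G - H) <#> H \<subseteq> carrier G - H"
proof -
  interpret H: subgroup H G by fact
  have left: "x \<in> H" if "h \<otimes> x \<in> H" "h \<in> H" "x \<in> carrier G" for h x
  proof -
    have "x = inv h \<otimes> (h \<otimes> x)" using that by (simp add: m_assoc[symmetric])
    then show ?thesis using that by (metis H.m_closed H.m_inv_closed)
  qed
  show "H <#> (carrier G - H) \<subseteq> carrier G - H"
  proof
    fix y assume "y \<in> H <#> (carrier G - H)"
    then obtain h x where "h \<in> H" "x \<in> carrier G" "x \<notin> H" "y = h \<otimes> x" unfolding set_mult_def by blast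
    then show "y \<in> carrier G - H" using left[of h x] by auto
  qed
  have right: "x \<in> H" if "x \<otimes> h \<in> H" "h \<in> H" "x \<in> carrier G" for h x
  proof -
    have "x = (x \<otimes> h) \<otimes> inv h" using that by (simp add: m_assoc)
    then show ?thesis using that by (metis H.m_closed H.m_inv_closed)
  qed
  show "(carrier G - H) <#> H \<subseteq> carrier G - H"
  proof
    fix y assume "y \<in> (carrier G - H) <#> H"
    then obtain x h where "h \<in> H" "x \<in> carrier G" "x \<notin> H" "y = x \<otimes> h" unfolding set_mult_def by blast
    then show "y \<in> carrier G - H" using right[of x h] by auto
  qed
qed

lemma conv_outside_one:
  assumes H: "subgroup H G" and f: "f \<in> fn_on (carrier G - H)" and k: "k \<in> fn_on H"
  shows "(f \<star> k) \<one> = 0"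
proof -
  have "f \<star> k \<in> fn_on (carrier G - H)"
    using fn_on_mono[OF conv_set_mult[OF f k _ subgroup.subset[OF H]] outside_mult(2)[OF H]] by auto
  then show ?thesis using subgroup.one_closed[OF H] fn_onD by fastforce
qed

text \<open>The quotient is the multiplicity times the number of constituents. The first factor is
  prime to p by \<open>cmult_not_dvd\<close>, the second because it divides the index.\<close>

lemma degree_ratio:
  assumes p: "prime p" and K: "subgroup K G" and NK: "N \<subseteq> K" and \<chi>: "\<chi> \<in> Irr (sub K)"
    and \<theta>: "\<theta> \<in> constituents \<chi>" and pK: "\<not> p dvd card K div card N"
  shows "\<exists>A. \<not> p dvd A \<and> \<chi> \<one> = of_nat A * \<theta> \<one>"
proof (intro exI conjI)
  let ?A = "cmult N \<chi> \<theta> * card (constituents \<chi>)"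
  have "\<theta> \<in> Irr (sub N)" using \<theta> unfolding constituents_def by simp
  then show "\<chi> \<one> = of_nat ?A * \<theta> \<one>"
    using clifford_degree[OF K NK \<chi> \<theta>] char_deg_Irr[OF K \<chi>] char_deg_Irr[OF subgroup_N] by simp
  show "\<not> p dvd ?A"
    using cmult_not_dvd[OF p K NK \<chi> \<theta> pK] card_constituents_dvd[OF K NK \<chi>] pK p prime_dvd_mult_iff dvd_trans
    by blast
qed

lemma constituents_trans:
  assumes K: "subgroup K G" and H: "subgroup H G" and NH: "N \<subseteq> H" and HK: "H \<subseteq> K"
    and \<chi>: "\<chi> \<in> Irr (sub K)" and \<psi>: "\<psi> \<in> Irr (sub H)" and m: "cmult H \<chi> \<psi> \<noteq> 0" and \<theta>: "\<theta> \<in> constituents \<psi>"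
  shows "\<theta> \<in> constituents \<chi>"
proof -
  have \<theta>I: "\<theta> \<in> Irr (sub N)" "cmult N \<psi> \<theta> \<noteq> 0" using \<theta> unfolding constituents_def by auto
  have "cmult H \<chi> \<psi> * cmult N \<psi> \<theta> \<le> (\<Sum>\<eta>\<in>Irr (sub H). cmult H \<chi> \<eta> * cmult N \<eta> \<theta>)"
    by (rule member_le_sum[OF \<psi>]) (auto simp: finite_Irr[OF H])
  then have "cmult N \<chi> \<theta> \<noteq> 0"
    using cmult_trans[OF K H subgroup_N NH HK \<chi> \<theta>I(1)] m \<theta>I(2) by (metis le_0_eq mult_eq_0_iff)
  then show ?thesis using \<theta>I(1) unfolding constituents_def by simp
qed

end

section \<open>Congruences for the multiplicities between G and H\<close>

context p_action_fixed
begin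

lemma subgroup_G: "subgroup (carrier G) G"
  by (rule subgroup_self)

lemma NG: "N \<subseteq> carrier G"
  by (rule subset)

lemma HG: "H \<subseteq> carrier G"
  by (rule subgroup.subset[OF subgroup_H])

lemma idem_outer_sum: "res (carrier G - H) f = (\<lambda>x. \<Sum>Y\<in>outer. res Y f x)"
  using sum_res[of outer f] Union_rcosets_sub(2)[OF subgroup_H NH] unfolding outer_def by auto

text \<open>The part of \<open>idem \<chi> \<star> idem \<chi>' = 0\<close> supported off \<open>H\<close> is divisible by \<open>p\<close>, because \<open>B\<close> has no fixed
  points on the pairs of cosets contributing to it. What remains is, up to a unit, the
  product of the two multiplicities.\<close>

lemma cmult_product_dvd:
  assumes \<chi>: "\<chi> \<in> IrrB (carrier G)" and \<chi>': "\<chi>' \<in> IrrB (carrier G)" and neq: "\<chi> \<noteq> \<chi>'" and \<psi>: "\<psi> \<in> IrrB H"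
  shows "p dvd cmult H \<chi> \<psi> * cmult H \<chi>' \<psi>"
proof (cases "cmult H \<chi> \<psi> = 0 \<or> cmult H \<chi>' \<psi> = 0")
  case True
  then show ?thesis by auto
next
  case False
  let ?m = "cmult H \<chi> \<psi>" and ?m' = "cmult H \<chi>' \<psi>"
  note \<chi>I = IrrB_sub[OF \<chi>] and \<chi>'I = IrrB_sub[OF \<chi>'] and \<psi>I = IrrB_sub[OF \<psi>]
  obtain \<theta> where \<theta>: "\<theta> \<in> constituents \<psi>" "\<theta> \<in> IrrB N" using fixed_constituent[OF H_inv NH \<psi>] by blast
  note \<theta>I = IrrB_sub[OF \<theta>(2)]
  have \<theta>\<chi>: "\<theta> \<in> constituents \<chi>" "\<theta> \<in> constituents \<chi>'"
    using constituents_trans[OF subgroup_G subgroup_H NH HG _ \<psi>I _ \<theta>(1)] \<chi>I \<chi>'I False by auto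
  note pG = index_not_dvd[OF subgroup_G NG] and pH = index_not_dvd[OF subgroup_H NH]
  let ?e = "idem N \<theta>" and ?a = "idem (carrier G) \<chi>" and ?a' = "idem (carrier G) \<chi>'" and ?i = "idem H \<psi>"
  \<comment> \<open>Cutting the idempotent of \<psi> down by e puts it into the lattice over
    \<theta>. Its value at 1 is e(1) times a quotient of integers prime to p, so nothing is lost
    modulo p.\<close>
  define k where "k = ?i \<star> ?e"
  have e\<psi>: "?e \<star> ?i = ?i \<star> ?e"
    by (rule conv_commute[OF subset conj_inv_mono[OF conj_inv_idem[OF subgroup_H \<psi>I] NH] idem_fn_on, symmetric])
  have ee: "?e \<star> ?e = ?e" using idem_conv_idem[OF subgroup_N \<theta>I \<theta>I] by simp
  have kH: "k \<in> fn_on H" unfolding k_def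
    by (rule conv_sub_closed[OF subgroup_H idem_fn_on fn_on_mono[OF idem_fn_on NH]])
  have ek: "?e \<star> k = k" unfolding k_def conv_assoc[symmetric] e\<psi> by (simp add: conv_assoc ee)

  \<comment> \<open>The part on H of a central idempotent of G is invariant under H. It therefore
    acts on the summand of \<psi> by a scalar, and this scalar contains the multiplicity.\<close>
  have scalar: "res H (idem (carrier G) \<eta>) \<star> ?i = (\<lambda>x. \<eta> \<one> * of_nat (card H) * of_nat (cmult H \<eta> \<psi>) /
      (of_nat (card (carrier G)) * \<psi> \<one>) * ?i x)" if \<eta>: "\<eta> \<in> Irr (sub (carrier G))" for \<eta>
  proof -
    have "(\<Sum>h\<in>H. res H (idem (carrier G) \<eta>) h * \<psi> h) =
        \<eta> \<one> / of_nat (card (carrier G)) * (\<Sum>h\<in>H. \<eta> (inv h) * \<psi> h)"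
      using HG by (simp add: res_def idem_def subsetD sum_distrib_left mult_ac)
    also have "(\<Sum>h\<in>H. \<eta> (inv h) * \<psi> h) = (\<Sum>h\<in>H. \<eta> h * \<psi> (inv h))"
      by (rule sum.reindex_bij_witness[of _ "\<lambda>h. inv h" "\<lambda>h. inv h"])
        (use HG subgroup.m_inv_closed[OF subgroup_H] in \<open>auto simp: subsetD\<close>)
    also have "\<dots> = of_nat (card H) * of_nat (cmult H \<eta> \<psi>)"
      using of_nat_cmult[OF subgroup_G subgroup_H HG \<eta> \<psi>I] card_sub_pos[OF subgroup_H] by simp
    finally have "(\<Sum>h\<in>H. res H (idem (carrier G) \<eta>) h * \<psi> h) / \<psi> \<one> =
        \<eta> \<one> * of_nat (card H) * of_nat (cmult H \<eta> \<psi>) / (of_nat (card (carrier G)) * \<psi> \<one>)" by simp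
    moreover have "res H (idem (carrier G) \<eta>) \<in> fn_on H" by (rule fn_onI) (simp add: res_def)
    ultimately show ?thesis
      using class_conv_idem[OF subgroup_H \<psi>I _ conj_inv_res_subgroup[OF subgroup_H
          conj_inv_mono[OF conj_inv_idem[OF subgroup_G \<eta>] HG]]] by metis
  qed
  define c where "c = \<chi> \<one> * of_nat (card H) * of_nat ?m / (of_nat (card (carrier G)) * \<psi> \<one>)"
  define c' where "c' = \<chi>' \<one> * of_nat (card H) * of_nat ?m' / (of_nat (card (carrier G)) * \<psi> \<one>)"
  have aH: "res H ?a \<star> k = (\<lambda>x. c * k x)" and aH': "res H ?a' \<star> k = (\<lambda>x. c' * k x)"
    unfolding k_def conv_assoc[symmetric] scalar[OF \<chi>I] scalar[OF \<chi>'I] c_def c'_def by (simp_all only: conv_scale_left)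
  define u where "u = res (carrier G - H) ?a"
  define u' where "u' = res (carrier G - H) ?a'"
  have split: "f = (\<lambda>x. res H f x + res (carrier G - H) f x)" if "f \<in> fn_on (carrier G)" for f
    using that HG by (auto simp: res_def fn_on_def fun_eq_iff)
  \<comment> \<open>Both idempotents are split into their parts on and off H. After multiplication
    by k and evaluation at 1, the mixed products vanish and the product of the two parts on H
    becomes the product of their scalars.\<close>
  have "0 = ((?a \<star> ?a') \<star> k) \<one>" using idem_conv_idem[OF subgroup_G \<chi>I \<chi>'I] neq by simp
  also have "\<dots> = (((\<lambda>x. res H ?a x + u x) \<star> (\<lambda>x. res H ?a' x + u' x)) \<star> k) \<one>"
    unfolding u_def u'_def using split[OF idem_fn_on, of \<chi>] split[OF idem_fn_on, of \<chi>'] by metis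
  also have "\<dots> = ((res H ?a \<star> res H ?a') \<star> k) \<one> + ((u \<star> res H ?a') \<star> k) \<one> +
      (((res H ?a \<star> u') \<star> k) \<one> + ((u \<star> u') \<star> k) \<one>)"
    by (simp only: conv_add_left conv_add_right add_ac)
  also have "((res H ?a \<star> res H ?a') \<star> k) \<one> = c * (c' * k \<one>)"
    by (simp add: conv_assoc aH aH' conv_scale_right)
  also have "((u \<star> res H ?a') \<star> k) \<one> = 0"
  proof (rule conv_outside_one[OF subgroup_H _ kH])
    have "u \<star> res H ?a' \<in> fn_on ((carrier G - H) <#> H)"
      by (rule conv_set_mult) (use HG in \<open>auto simp: u_def res_def fn_on_def\<close>)
    then show "u \<star> res H ?a' \<in> fn_on (carrier G - H)" using outside_mult(2)[OF subgroup_H] fn_on_mono by blast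
  qed
  also have "((res H ?a \<star> u') \<star> k) \<one> = 0"
  proof (rule conv_outside_one[OF subgroup_H _ kH])
    have "res H ?a \<star> u' \<in> fn_on (H <#> (carrier G - H))"
      by (rule conv_set_mult) (use HG in \<open>auto simp: u'_def res_def fn_on_def\<close>)
    then show "res H ?a \<star> u' \<in> fn_on (carrier G - H)" using outside_mult(1)[OF subgroup_H] fn_on_mono by blast
  qed
  also have "((u \<star> u') \<star> k) \<one> = (\<Sum>Y\<in>outer. \<Sum>Z\<in>outer. ((res Y ?a \<star> res Z ?a') \<star> k) \<one>)"
    unfolding u_def u'_def idem_outer_sum conv_sum_left conv_sum_right ..
  finally have total: "c * (c' * k \<one>) + (\<Sum>Y\<in>outer. \<Sum>Z\<in>outer. ((res Y ?a \<star> res Z ?a') \<star> k) \<one>) = 0" by simp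

  have e1: "?e \<one> = \<theta> \<one> ^ 2 / of_nat (card N)" by (rule idem_one[OF subgroup_N])
  have \<theta>1: "\<theta> \<one> \<noteq> 0" using char_deg_Irr[OF subgroup_N \<theta>I] by simp
  have n0: "(of_nat (card N) :: complex) \<noteq> 0" using card_sub_pos[OF subgroup_N] by simp
  have e10: "?e \<one> \<noteq> 0" using e1 \<theta>1 n0 by simp
  obtain V where V: "\<forall>v\<in>V. \<forall>w\<in>V. \<exists>c\<in>unity_sums. \<exists>u\<in>V. v \<star> w = (\<lambda>x. c * u x)"
    "\<forall>v\<in>V. \<exists>r\<in>unity_sums. v \<one> = r * ?e \<one>"
    and Vres: "\<forall>K \<chi> X. subgroup K G \<and> N \<subseteq> K \<and> \<chi> \<in> Irr (sub K) \<and> X \<in> rcosets N \<and> X \<subseteq> K \<longrightarrow>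
      (\<exists>v\<in>V. \<exists>a. \<exists>\<kappa>\<in>unity_sums. res X (idem K \<chi>) \<star> ?e = (\<lambda>x. a * v x) \<and>
        a * (\<theta> \<one> * of_nat (card K)) = \<chi> \<one> * of_nat (card N) * \<kappa>)"
    using integral_basis[OF \<theta>I] by auto
  have lat: "res Y (idem K \<eta>) \<star> ?e \<in> lattice p V"
    if K: "subgroup K G" and NK: "N \<subseteq> K" and \<eta>: "\<eta> \<in> Irr (sub K)" and \<theta>\<eta>: "\<theta> \<in> constituents \<eta>"
      and Y: "Y \<in> rcosets N" "Y \<subseteq> K" for K \<eta> Y
  proof -
    obtain v a \<kappa> where "v \<in> V" "\<kappa> \<in> unity_sums" "res Y (idem K \<eta>) \<star> ?e = (\<lambda>x. a * v x)"
      "a * (\<theta> \<one> * of_nat (card K)) = \<eta> \<one> * of_nat (card N) * \<kappa>"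
      using Vres K NK \<eta> Y by blast
    from res_lattice[OF p K NK \<eta> \<theta>\<eta> index_not_dvd[OF K NK] this]
    show ?thesis using lattice_scale[OF p _ p_integral_of_nat[OF p]] by force
  qed
  have k_lat: "k \<in> lattice p V"
  proof -
    have "?i = res H ?i" by (auto simp: res_def idem_def)
    also have "\<dots> = (\<lambda>x. \<Sum>Y\<in>{Y \<in> rcosets N. Y \<subseteq> H}. res Y ?i x)"
      using sum_res[of "{Y \<in> rcosets N. Y \<subseteq> H}" ?i] Union_rcosets_sub(1)[OF subgroup_H NH] by auto
    finally have "k = (\<lambda>x. \<Sum>Y\<in>{Y \<in> rcosets N. Y \<subseteq> H}. (res Y ?i \<star> ?e) x)" unfolding k_def using conv_sum_left by metis
    then show ?thesis using lattice_sum[of "{Y \<in> rcosets N. Y \<subseteq> H}" "\<lambda>Y. res Y ?i \<star> ?e" p V]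
        lat[OF subgroup_H NH \<psi>I \<theta>(1)] by auto
  qed
  \<comment> \<open>The idempotent e may be inserted behind both coset parts: it is absorbed by k
    and commutes with the part on Z. Each of the three factors then lies in the lattice.\<close>
  have term_int: "\<exists>r\<in>p_integral p. ((res Y ?a \<star> res Z ?a') \<star> k) \<one> = r * ?e \<one>"
    if Y: "Y \<in> outer" and Z: "Z \<in> outer" for Y Z
  proof -
    note YR = outer_rcosets[OF Y] and ZR = outer_rcosets[OF Z]
    have comm: "?e \<star> res Z ?a' = res Z ?a' \<star> ?e"
      by (rule conv_commute[OF subset conj_inv_res_rcoset[OF ZR conj_inv_mono[OF conj_inv_idem[OF subgroup_G \<chi>'I] NG]]
          idem_fn_on, symmetric])
    have t: "(res Z ?a' \<star> ?e) \<star> k = res Z ?a' \<star> k" by (simp add: conv_assoc ek)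
    have "?e \<star> (res Z ?a' \<star> k) = res Z ?a' \<star> k" unfolding conv_assoc[symmetric] comm by (rule t)
    then have "(res Y ?a \<star> res Z ?a') \<star> k = (res Y ?a \<star> ?e) \<star> ((res Z ?a' \<star> ?e) \<star> k)"
      unfolding t by (simp add: conv_assoc)
    moreover have "(res Y ?a \<star> ?e) \<star> ((res Z ?a' \<star> ?e) \<star> k) \<in> lattice p V"
      by (intro lattice_conv[OF p] lat[OF subgroup_G NG \<chi>I \<theta>\<chi>(1) YR] lat[OF subgroup_G NG \<chi>'I \<theta>\<chi>(2) ZR] k_lat
          rcosets_sub_carrier[OF YR] rcosets_sub_carrier[OF ZR]) (use V(1) in blast)+
    ultimately show ?thesis using lattice_value[OF p, of V \<one> "?e \<one>"] V(2) by simp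
  qed
  have tr_k: "tr b k = k" if "b \<in> B" for b
    unfolding k_def using that by (simp add: tr_conv tr_idem[OF H_inv \<psi>] tr_idem[OF invset_N \<theta>(2)])
  have term_inv: "((res (\<sigma> b ` Y) ?a \<star> res (\<sigma> b ` Z) ?a') \<star> k) \<one> = ((res Y ?a \<star> res Z ?a') \<star> k) \<one>"
    if b: "b \<in> B" and Y: "Y \<in> outer" and Z: "Z \<in> outer" for b Y Z
  proof -
    have "tr b ((res Y ?a \<star> res Z ?a') \<star> k) = (res (\<sigma> b ` Y) ?a \<star> res (\<sigma> b ` Z) ?a') \<star> k"
      using b by (simp add: tr_conv tr_k tr_res outer_rcosets[OF Y] outer_rcosets[OF Z]
          tr_idem[OF invset_G \<chi>] tr_idem[OF invset_G \<chi>'])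
    then show ?thesis using tr_one[OF b] by metis
  qed
  have "\<exists>s\<in>p_integral p. (\<Sum>Y\<in>outer. \<Sum>Z\<in>outer. ((res Y ?a \<star> res Z ?a') \<star> k) \<one> / ?e \<one>) = of_nat p * s"
  proof (rule outer_pair_sum)
    show "((res Y ?a \<star> res Z ?a') \<star> k) \<one> / ?e \<one> \<in> p_integral p" if "Y \<in> outer" "Z \<in> outer" for Y Z
      using term_int[OF that] e10 by force
  qed (simp add: term_inv)
  then obtain s where s: "s \<in> p_integral p"
    "(\<Sum>Y\<in>outer. \<Sum>Z\<in>outer. ((res Y ?a \<star> res Z ?a') \<star> k) \<one> / ?e \<one>) = of_nat p * s" by blast
  have "(\<Sum>Y\<in>outer. \<Sum>Z\<in>outer. ((res Y ?a \<star> res Z ?a') \<star> k) \<one>) = of_nat p * s * ?e \<one>"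
    using s(2) e10 by (simp add: sum_divide_distrib[symmetric] field_simps)
  then have eq: "c * c' * k \<one> = - (of_nat p * s * ?e \<one>)"
    using total by (simp add: mult.assoc add_eq_0_iff2)
  have k1: "k \<one> = \<psi> \<one> * \<theta> \<one> * of_nat (cmult N \<psi> \<theta>) / of_nat (card H)"
    using idem_conv_idem_one[OF subgroup_H NH \<psi>I \<theta>I] unfolding k_def e\<psi> by simp
  obtain A where A: "\<not> p dvd A" "\<chi> \<one> = of_nat A * \<theta> \<one>"
    using degree_ratio[OF p subgroup_G NG \<chi>I \<theta>\<chi>(1) pG] by blast
  obtain A' where A': "\<not> p dvd A'" "\<chi>' \<one> = of_nat A' * \<theta> \<one>"
    using degree_ratio[OF p subgroup_G NG \<chi>'I \<theta>\<chi>(2) pG] by blast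
  obtain Q where Q: "\<not> p dvd Q" "\<psi> \<one> = of_nat Q * \<theta> \<one>"
    using degree_ratio[OF p subgroup_H NH \<psi>I \<theta>(1) pH] by blast
  let ?g = "card (carrier G) div card N" and ?h = "card H div card N" and ?f = "cmult N \<psi> \<theta>"
  have gh: "(of_nat (card (carrier G)) :: complex) = of_nat (card N) * of_nat ?g"
    "(of_nat (card H) :: complex) = of_nat (card N) * of_nat ?h" "?g > 0" "?h > 0"
    using card_index[OF subgroup_G NG] card_index[OF subgroup_H NH] by (metis of_nat_mult)+
  have Q0: "(of_nat Q :: complex) \<noteq> 0" using Q(1) by (metis dvd_0_right of_nat_eq_0_iff)
  have c_eq: "c = of_nat A * of_nat ?h * of_nat ?m / (of_nat ?g * of_nat Q)"
    "c' = of_nat A' * of_nat ?h * of_nat ?m' / (of_nat ?g * of_nat Q)"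
    unfolding c_def c'_def A(2) A'(2) Q(2) gh using \<theta>1 n0 gh(3) Q0 by (simp_all add: field_simps)
  have k_eq: "k \<one> = of_nat Q * of_nat ?f / of_nat ?h * ?e \<one>"
    unfolding k1 e1 Q(2) gh using n0 gh(4) by (simp add: field_simps power2_eq_square)
  have "c * c' * (of_nat Q * of_nat ?f / of_nat ?h) * ?e \<one> = - (of_nat p * s) * ?e \<one>"
    using eq unfolding k_eq by (simp add: mult_ac)
  then have "c * c' * (of_nat Q * of_nat ?f / of_nat ?h) = - (of_nat p * s)" using e10 by (simp only: mult_cancel_right) simp
  \<comment> \<open>Clearing denominators leaves the product of the two multiplicities, multiplied
    only by integers prime to p.\<close>
  then have "of_nat (A * A' * ?h * ?f * (?m * ?m')) = of_nat p * (- s * of_nat (?g * ?g * Q))"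
    unfolding c_eq using gh(3,4) Q0 by (simp add: field_simps)
  moreover have "- s * of_nat (?g * ?g * Q) \<in> p_integral p"
    by (intro p_integral_mult[OF p] p_integral_uminus[OF p] s p_integral_of_nat[OF p])
  ultimately have "p dvd A * A' * ?h * ?f * (?m * ?m')" using p_dvd_if_p_integral[OF p] by blast
  moreover have "\<not> p dvd ?f" by (rule cmult_not_dvd[OF p subgroup_H NH \<psi>I \<theta>(1) pH])
  ultimately show ?thesis using A(1) A'(1) pH p by (simp add: prime_dvd_mult_iff)
qed

text \<open>Over all \<chi>, the sum of the multiplicities weighted by \<chi>(1) / \<psi>(1) is |G :
  H|, the degree of the induced character divided by \<psi>(1). The weights are p-integral where the
  multiplicity is nonzero. So if p divided it for all invariant \<chi>, it would divide an index
  prime to p.\<close>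

lemma exists_character_over:
  assumes \<psi>: "\<psi> \<in> IrrB H"
  shows "\<exists>\<chi>\<in>IrrB (carrier G). \<not> p dvd cmult H \<chi> \<psi>"
proof (rule ccontr)
  assume none: "\<not> ?thesis"
  note \<psi>I = IrrB_sub[OF \<psi>]
  let ?G = "carrier G"
  define f where "f \<chi> = \<chi> \<one> * of_nat (cmult H \<chi> \<psi>) / \<psi> \<one>" for \<chi>
  have \<psi>1: "\<psi> \<one> \<noteq> 0" using char_deg_Irr[OF subgroup_H \<psi>I] by simp
  obtain \<theta> where \<theta>: "\<theta> \<in> constituents \<psi>" using constituents_nonempty[OF subgroup_H NH \<psi>I] by blast
  have \<theta>1: "\<theta> \<one> \<noteq> 0" using \<theta> char_deg_Irr[OF subgroup_N, of \<theta>] unfolding constituents_def by simp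
  obtain Q where Q: "\<not> p dvd Q" "\<psi> \<one> = of_nat Q * \<theta> \<one>"
    using degree_ratio[OF p subgroup_H NH \<psi>I \<theta> index_not_dvd[OF subgroup_H NH]] by blast
  have f_mult: "\<exists>r\<in>p_integral p. f \<chi> = of_nat (cmult H \<chi> \<psi>) * r" if \<chi>: "\<chi> \<in> Irr (sub ?G)" for \<chi>
  proof (cases "cmult H \<chi> \<psi> = 0")
    case True
    then show ?thesis using p_integral_of_nat[OF p, of 0] by (intro bexI[of _ 0]) (auto simp: f_def)
  next
    case False
    have "\<theta> \<in> constituents \<chi>" by (rule constituents_trans[OF subgroup_G subgroup_H NH HG \<chi> \<psi>I False \<theta>])
    then obtain A where A: "\<chi> \<one> = of_nat A * \<theta> \<one>"
      using degree_ratio[OF p subgroup_G NG \<chi> _ index_not_dvd[OF subgroup_G NG]] by blast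
    have "of_nat A / of_nat Q \<in> p_integral p" by (intro p_integral_divide_nat[OF p _ Q(1)] p_integral_of_nat[OF p])
    moreover have "f \<chi> = of_nat (cmult H \<chi> \<psi>) * (of_nat A / of_nat Q)"
      unfolding f_def A Q(2) using \<theta>1 by simp
    ultimately show ?thesis by blast
  qed
  have "\<exists>s\<in>p_integral p. (\<Sum>\<chi>\<in>Irr (sub ?G). f \<chi>) = (\<Sum>\<chi>\<in>IrrB ?G. f \<chi>) + of_nat p * s"
  proof (rule Irr_orbit_sum[OF invset_G])
    fix b \<chi> assume b: "b \<in> B" and "\<chi> \<in> Irr (sub ?G)"
    have "chact ?G b \<chi> \<one> = \<chi> \<one>" using b by (simp add: char_act_def)
    then show "f (chact ?G b \<chi>) = f \<chi>"
      using cmult_chact[OF invset_G H_inv HG b, of \<chi> \<psi>] IrrB_fixed[OF \<psi> b] unfolding f_def by simp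
  next
    fix \<chi> assume "\<chi> \<in> Irr (sub ?G)"
    then show "f \<chi> \<in> p_integral p" using f_mult p_integral_mult[OF p p_integral_of_nat[OF p]] by fastforce
  qed
  then obtain s where s: "s \<in> p_integral p" "(\<Sum>\<chi>\<in>Irr (sub ?G). f \<chi>) = (\<Sum>\<chi>\<in>IrrB ?G. f \<chi>) + of_nat p * s" by blast
  have "\<exists>r\<in>p_integral p. f \<chi> = of_nat p * r" if \<chi>: "\<chi> \<in> IrrB ?G" for \<chi>
  proof -
    obtain r where r: "r \<in> p_integral p" "f \<chi> = of_nat (cmult H \<chi> \<psi>) * r" using f_mult[OF IrrB_sub[OF \<chi>]] by blast
    obtain l where "cmult H \<chi> \<psi> = p * l" using none \<chi> by (auto elim: dvdE)
    then have "f \<chi> = of_nat p * (of_nat l * r)" using r(2) by simp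
    then show ?thesis using p_integral_mult[OF p p_integral_of_nat[OF p] r(1)] by blast
  qed
  then obtain r where r: "\<And>\<chi>. \<chi> \<in> IrrB ?G \<Longrightarrow> r \<chi> \<in> p_integral p" "\<And>\<chi>. \<chi> \<in> IrrB ?G \<Longrightarrow> f \<chi> = of_nat p * r \<chi>" by metis
  have rs: "(\<Sum>\<chi>\<in>IrrB ?G. r \<chi>) + s \<in> p_integral p"
    by (intro p_integral_add[OF p] p_integral_sum[OF p] r s)
  have "(\<Sum>\<chi>\<in>Irr (sub ?G). f \<chi>) = of_nat p * ((\<Sum>\<chi>\<in>IrrB ?G. r \<chi>) + s)"
    unfolding s(2) using r(2) by (simp add: distrib_left sum_distrib_left)
  moreover have "(\<Sum>\<chi>\<in>Irr (sub ?G). f \<chi>) = of_nat (card ?G) / of_nat (card H)"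
  proof -
    have "(\<Sum>\<chi>\<in>Irr (sub ?G). \<chi> \<one> * of_nat (cmult H \<chi> \<psi>)) =
        (\<Sum>\<chi>\<in>Irr (sub ?G). \<Sum>h\<in>H. \<chi> \<one> * (\<chi> h * \<psi> (inv h)) / of_nat (card H))"
      by (intro sum.cong refl) (simp add: of_nat_cmult[OF subgroup_G subgroup_H HG _ \<psi>I] sum_distrib_left sum_divide_distrib)
    also have "\<dots> = (\<Sum>h\<in>H. (\<Sum>\<chi>\<in>Irr (sub ?G). \<chi> \<one> * \<chi> h) * \<psi> (inv h) / of_nat (card H))"
      by (subst sum.swap) (simp add: sum_distrib_right sum_divide_distrib mult.assoc)
    also have "\<dots> = (\<Sum>h\<in>H. if h = \<one> then of_nat (card ?G) * \<psi> \<one> / of_nat (card H) else 0)"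
      by (intro sum.cong refl, subst sum_degree_Irr[OF subgroup_G subsetD[OF HG]])
        (auto simp: subgroup.one_closed[OF subgroup_H])
    also have "\<dots> = of_nat (card ?G) * \<psi> \<one> / of_nat (card H)"
      using subgroup.one_closed[OF subgroup_H] finite_sub[OF subgroup_H] by simp
    finally show ?thesis unfolding f_def using \<psi>1 by (simp add: sum_divide_distrib[symmetric])
  qed
  moreover obtain i where i: "card ?G = card H * i"
    using card_subgroup_dvd[OF subgroup_H subgroup_G HG] by (auto elim: dvdE)
  ultimately have "of_nat i = of_nat p * ((\<Sum>\<chi>\<in>IrrB ?G. r \<chi>) + s)" using card_sub_pos[OF subgroup_H] by simp
  then have "p dvd i" using p_dvd_if_p_integral[OF p _ rs] by blast
  moreover have "card ?G div card N = card H div card N * i"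
    using i card_index(1)[OF subgroup_H NH] card_sub_pos[OF subgroup_N]
    by (metis mult.assoc nonzero_mult_div_cancel_left not_less_zero)
  ultimately show False using p_index by auto
qed

text \<open>A B-invariant \<theta> on N has multiplicity prime to p in \<chi>. Passing through H
  writes it as a sum over \<psi>, of which modulo p only the B-invariant \<psi> remain.\<close>

lemma exists_character_under:
  assumes \<chi>: "\<chi> \<in> IrrB (carrier G)"
  shows "\<exists>\<psi>\<in>IrrB H. \<not> p dvd cmult H \<chi> \<psi>"
proof (rule ccontr)
  assume none: "\<not> ?thesis"
  note \<chi>I = IrrB_sub[OF \<chi>]
  obtain \<theta> where \<theta>: "\<theta> \<in> constituents \<chi>" "\<theta> \<in> IrrB N" using fixed_constituent[OF invset_G NG \<chi>] by blast
  define f where "f \<psi> = (of_nat (cmult H \<chi> \<psi> * cmult N \<psi> \<theta>) :: complex)" for \<psi>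
  have "\<exists>s\<in>p_integral p. (\<Sum>\<psi>\<in>Irr (sub H). f \<psi>) = (\<Sum>\<psi>\<in>IrrB H. f \<psi>) + of_nat p * s"
  proof (rule Irr_orbit_sum[OF H_inv])
    fix b \<psi> assume b: "b \<in> B" and "\<psi> \<in> Irr (sub H)"
    show "f (chact H b \<psi>) = f \<psi>"
      using cmult_chact[OF invset_G H_inv HG b, of \<chi> \<psi>] cmult_chact[OF H_inv invset_N NH b, of \<psi> \<theta>]
        IrrB_fixed[OF \<chi> b] IrrB_fixed[OF \<theta>(2) b] unfolding f_def by simp
  qed (simp add: f_def p_integral_of_nat[OF p] del: of_nat_mult)
  then obtain s where s: "s \<in> p_integral p" "(\<Sum>\<psi>\<in>Irr (sub H). f \<psi>) = (\<Sum>\<psi>\<in>IrrB H. f \<psi>) + of_nat p * s" by blast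
  have "p dvd (\<Sum>\<psi>\<in>IrrB H. cmult H \<chi> \<psi> * cmult N \<psi> \<theta>)" using none by (intro dvd_sum) auto
  then obtain l where l: "(\<Sum>\<psi>\<in>IrrB H. cmult H \<chi> \<psi> * cmult N \<psi> \<theta>) = p * l" by (auto elim: dvdE)
  have "of_nat (cmult N \<chi> \<theta>) = (\<Sum>\<psi>\<in>Irr (sub H). f \<psi>)"
    using cmult_trans[OF subgroup_G subgroup_H subgroup_N NH HG \<chi>I IrrB_sub[OF \<theta>(2)]] unfolding f_def by simp
  also have "(\<Sum>\<psi>\<in>IrrB H. f \<psi>) = of_nat p * of_nat l" unfolding f_def of_nat_sum[symmetric] l by simp
  then have "(\<Sum>\<psi>\<in>Irr (sub H). f \<psi>) = of_nat p * (of_nat l + s)" unfolding s(2) by (simp add: distrib_left)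
  finally have "p dvd cmult N \<chi> \<theta>"
    using p_dvd_if_p_integral[OF p] p_integral_add[OF p p_integral_of_nat[OF p] s(1)] by blast
  then show False
    using cmult_not_dvd[OF p subgroup_G NG \<chi>I \<theta>(1) index_not_dvd[OF subgroup_G NG]] by simp
qed

end

section \<open>The correspondence\<close>

context fin_group
begin

lemma inv_cancel [simp]:
  assumes "x \<in> carrier G" "y \<in> carrier G"
  shows "inv x \<otimes> (x \<otimes> y) = y" "x \<otimes> (inv x \<otimes> y) = y"
  using assms by (simp_all add: m_assoc[symmetric])

text \<open>A term of Mackey's formula, where L is the intersection of H with its conjugate by g.
  Transporting \<psi>' to this conjugate and decomposing its restriction to L turns the sum into |L|
  times products of multiplicities.\<close>

lemma sum_conjugate_product:
  assumes H: "subgroup H G" and \<psi>: "\<psi> \<in> Irr (sub H)" and \<psi>': "\<psi>' \<in> Irr (sub H)" and g: "g \<in> carrier G"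
  defines "L \<equiv> {h \<in> H. inv g \<otimes> h \<otimes> g \<in> H}"
  shows "subgroup L G" "\<exists>n::nat. (\<Sum>h\<in>L. \<psi> (inv h) * \<psi>' (inv g \<otimes> h \<otimes> g)) = of_nat (card L * n)"
proof -
  interpret H: subgroup H G by fact
  define \<tau> where "\<tau> x = inv g \<otimes> x \<otimes> g" for x
  define M where "M = {x \<in> carrier G. \<tau> x \<in> H}"
  have \<tau>_mult: "\<tau> (x \<otimes> y) = \<tau> x \<otimes> \<tau> y" if "x \<in> carrier G" "y \<in> carrier G" for x y
    unfolding \<tau>_def using that g by (simp add: m_assoc)
  have \<tau>_closed: "\<tau> x \<in> carrier G" if "x \<in> carrier G" for x unfolding \<tau>_def using that g by simp
  have \<tau>_inv: "\<tau> (inv x) = inv (\<tau> x)" if "x \<in> carrier G" for x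
    unfolding \<tau>_def using that g by (simp add: inv_mult_group m_assoc)
  have M: "subgroup M G"
    by (rule subgroupI) (use g \<tau>_mult \<tau>_inv in \<open>auto simp: M_def\<close>, auto simp: \<tau>_def intro!: exI[of _ \<one>])
  have LHM: "L = H \<inter> M" unfolding L_def M_def \<tau>_def by auto
  show L: "subgroup L G" unfolding LHM by (rule subgroups_Inter_pair[OF H M])
  have "\<tau> \<in> iso (sub M) (sub H)"
    unfolding iso_def hom_def
  proof (intro CollectI conjI)
    show "bij_betw \<tau> (carrier (sub M)) (carrier (sub H))"
    proof (rule bij_betw_byWitness[of _ "\<lambda>y. g \<otimes> y \<otimes> inv g"])
      have "\<tau> (g \<otimes> y \<otimes> inv g) = y" if "y \<in> carrier G" for y
        unfolding \<tau>_def using that g by (simp add: m_assoc)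
      then show "(\<lambda>y. g \<otimes> y \<otimes> inv g) ` carrier (sub H) \<subseteq> carrier (sub M)"
        "\<forall>y\<in>carrier (sub H). \<tau> (g \<otimes> y \<otimes> inv g) = y" unfolding M_def using g by auto
      show "\<forall>x\<in>carrier (sub M). g \<otimes> \<tau> x \<otimes> inv g = x"
        unfolding \<tau>_def M_def using g by (auto simp: m_assoc)
    qed (auto simp: M_def)
  qed (use \<tau>_mult in \<open>auto simp: M_def\<close>)
  moreover have "group (sub M)" "group (sub H)"
    using sub_fin_group[OF M] sub_fin_group[OF H] fin_group.axioms(1) by blast+
  ultimately have "(\<lambda>x\<in>carrier (sub M). \<psi>' (\<tau> x)) \<in> Irr (sub M)" using Irr_pullback \<psi>' by metis
  then obtain \<xi> where \<xi>: "\<xi> \<in> Irr (sub M)" "\<And>x. x \<in> M \<Longrightarrow> \<xi> x = \<psi>' (\<tau> x)" by force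
  have LH: "L \<subseteq> H" and LM: "L \<subseteq> M" unfolding LHM by auto
  have cL: "(of_nat (card L) :: complex) \<noteq> 0" using card_sub_pos[OF L] by simp
  have inner: "(\<Sum>h\<in>L. \<psi> (inv h) * \<eta> h) = of_nat (card L) * of_nat (cmult L \<psi> \<eta>)" if \<eta>: "\<eta> \<in> Irr (sub L)" for \<eta>
  proof -
    have "(\<Sum>h\<in>L. \<psi> (inv h) * \<eta> h) = (\<Sum>h\<in>L. \<psi> h * \<eta> (inv h))"
      by (rule sum.reindex_bij_witness[of _ "\<lambda>h. inv h" "\<lambda>h. inv h"])
        (use LH subgroup.m_inv_closed[OF L] in \<open>auto simp: subsetD\<close>)
    then show ?thesis using of_nat_cmult[OF H L LH \<psi> \<eta>] cL by simp
  qed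
  have "(\<Sum>h\<in>L. \<psi> (inv h) * \<psi>' (inv g \<otimes> h \<otimes> g)) =
      (\<Sum>h\<in>L. \<Sum>\<eta>\<in>Irr (sub L). of_nat (cmult L \<xi> \<eta>) * (\<psi> (inv h) * \<eta> h))"
  proof (rule sum.cong[OF refl])
    fix h assume h: "h \<in> L"
    have "\<psi>' (inv g \<otimes> h \<otimes> g) = \<xi> h" using \<xi>(2) h LM unfolding \<tau>_def by auto
    then show "\<psi> (inv h) * \<psi>' (inv g \<otimes> h \<otimes> g) =
        (\<Sum>\<eta>\<in>Irr (sub L). of_nat (cmult L \<xi> \<eta>) * (\<psi> (inv h) * \<eta> h))"
      unfolding restrict_decompose[OF M L LM \<xi>(1) h] by (simp add: sum_distrib_left mult_ac)
  qed
  also have "\<dots> = (\<Sum>\<eta>\<in>Irr (sub L). of_nat (cmult L \<xi> \<eta>) * (\<Sum>h\<in>L. \<psi> (inv h) * \<eta> h))"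
    by (subst sum.swap) (simp add: sum_distrib_left)
  also have "\<dots> = (\<Sum>\<eta>\<in>Irr (sub L). of_nat (cmult L \<xi> \<eta>) * (of_nat (card L) * of_nat (cmult L \<psi> \<eta>)))"
    by (intro sum.cong refl) (simp only: inner)
  also have "\<dots> = of_nat (card L * (\<Sum>\<eta>\<in>Irr (sub L). cmult L \<xi> \<eta> * cmult L \<psi> \<eta>))"
    by (simp add: sum_distrib_left mult_ac)
  finally show "\<exists>n::nat. (\<Sum>h\<in>L. \<psi> (inv h) * \<psi>' (inv g \<otimes> h \<otimes> g)) = of_nat (card L * n)" by blast
qed

end

context p_action_fixed
begin

text \<open>Mackey's formula for the inner product of the induced characters; the term of a coset outside
  \<open>H\<close> only depends on its \<open>B\<close>-orbit.\<close>

lemma cmult_overlap_dvd: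
  assumes \<psi>: "\<psi> \<in> IrrB H" and \<psi>': "\<psi>' \<in> IrrB H" and neq: "\<psi> \<noteq> \<psi>'"
  shows "p dvd (\<Sum>\<chi>\<in>IrrB (carrier G). cmult H \<chi> \<psi> * cmult H \<chi> \<psi>')"
proof -
  interpret H: subgroup H G by (rule subgroup_H)
  let ?G = "carrier G"
  note \<psi>I = IrrB_sub[OF \<psi>] and \<psi>'I = IrrB_sub[OF \<psi>']
  define L where "L g = {h \<in> H. inv g \<otimes> h \<otimes> g \<in> H}" for g
  define F where "F g = (\<Sum>h\<in>L g. \<psi> (inv h) * \<psi>' (inv g \<otimes> h \<otimes> g))" for g
  have finH: "finite H" by (rule finite_sub[OF subgroup_H])
  let ?S = "\<Sum>\<chi>\<in>Irr (sub ?G). cmult H \<chi> \<psi> * cmult H \<chi> \<psi>'"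
  have cH: "(of_nat (card H) :: complex) \<noteq> 0" using card_sub_pos[OF subgroup_H] by simp
  have "of_nat (card H) * of_nat (card H) * of_nat ?S =
      (\<Sum>\<chi>\<in>Irr (sub ?G). (\<Sum>h\<in>H. \<chi> h * \<psi> (inv h)) * (\<Sum>k\<in>H. \<chi> k * \<psi>' (inv k)))"
  proof -
    have key: "of_nat (card H) * of_nat (cmult H \<chi> \<eta>) = (\<Sum>h\<in>H. \<chi> h * \<eta> (inv h))"
      if "\<chi> \<in> Irr (sub ?G)" "\<eta> \<in> Irr (sub H)" for \<chi> \<eta>
      using of_nat_cmult[OF subgroup_G subgroup_H HG that] cH by simp
    have "(\<Sum>\<chi>\<in>Irr (sub ?G). (\<Sum>h\<in>H. \<chi> h * \<psi> (inv h)) * (\<Sum>k\<in>H. \<chi> k * \<psi>' (inv k))) =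
      (\<Sum>\<chi>\<in>Irr (sub ?G). (of_nat (card H) * of_nat (cmult H \<chi> \<psi>)) * (of_nat (card H) * of_nat (cmult H \<chi> \<psi>')))"
      by (intro sum.cong refl) (simp only: key[OF _ \<psi>I] key[OF _ \<psi>'I])
    also have "\<dots> = of_nat (card H) * of_nat (card H) * of_nat ?S" by (simp add: sum_distrib_left mult_ac)
    finally show ?thesis by (rule sym)
  qed
  also have "\<dots> = (\<Sum>\<chi>\<in>Irr (sub ?G). \<Sum>h\<in>H. \<Sum>k\<in>H. \<psi> (inv h) * \<psi>' (inv k) * (\<chi> h * \<chi> k))"
    by (simp add: sum_product mult_ac)
  also have "\<dots> = (\<Sum>h\<in>H. \<Sum>\<chi>\<in>Irr (sub ?G). \<Sum>k\<in>H. \<psi> (inv h) * \<psi>' (inv k) * (\<chi> h * \<chi> k))"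
    by (rule sum.swap)
  also have "\<dots> = (\<Sum>h\<in>H. \<Sum>k\<in>H. \<Sum>\<chi>\<in>Irr (sub ?G). \<psi> (inv h) * \<psi>' (inv k) * (\<chi> h * \<chi> k))"
    by (intro sum.cong refl sum.swap)
  \<comment> \<open>Column orthogonality eliminates the characters of G. The result is Mackey's
    formula summed over elements g instead of double cosets.\<close>
  also have "\<dots> = (\<Sum>h\<in>H. \<Sum>k\<in>H. \<Sum>g\<in>?G. \<psi> (inv h) * \<psi>' (inv k) * (if h \<otimes> g \<otimes> k \<otimes> inv g = \<one> then 1 else 0))"
    unfolding sum_distrib_left[symmetric]
    by (intro sum.cong refl arg_cong2[of _ _ _ _ "(*)"] column_orthogonality[OF subgroup_G]) auto
  also have "\<dots> = (\<Sum>h\<in>H. \<Sum>g\<in>?G. \<Sum>k\<in>H. \<psi> (inv h) * \<psi>' (inv k) * (if h \<otimes> g \<otimes> k \<otimes> inv g = \<one> then 1 else 0))"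
    by (intro sum.cong refl sum.swap)
  also have "\<dots> = (\<Sum>h\<in>H. \<Sum>g\<in>?G. if inv g \<otimes> h \<otimes> g \<in> H then \<psi> (inv h) * \<psi>' (inv g \<otimes> h \<otimes> g) else 0)"
  proof (intro sum.cong refl)
    fix h g assume h: "h \<in> H" and g: "g \<in> ?G"
    have eqv: "h \<otimes> g \<otimes> k \<otimes> inv g = \<one> \<longleftrightarrow> inv k = inv g \<otimes> h \<otimes> g" if k: "k \<in> H" for k
    proof
      assume "h \<otimes> g \<otimes> k \<otimes> inv g = \<one>"
      then have "h \<otimes> g \<otimes> k = g" using h g k inv_equality[of "h \<otimes> g \<otimes> k" "inv g"] by simp
      then have "(inv g \<otimes> h \<otimes> g) \<otimes> k = \<one>" using h g k by (simp add: m_assoc)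
      then show "inv k = inv g \<otimes> h \<otimes> g" using inv_equality h g k by simp
    next
      assume "inv k = inv g \<otimes> h \<otimes> g"
      then have "k = inv (inv g \<otimes> h \<otimes> g)" using k by (metis H.mem_carrier inv_inv)
      then show "h \<otimes> g \<otimes> k \<otimes> inv g = \<one>"
        using h g by (simp add: inv_mult_group m_assoc)
    qed
    have "(\<Sum>k\<in>H. \<psi> (inv h) * \<psi>' (inv k) * (if h \<otimes> g \<otimes> k \<otimes> inv g = \<one> then 1 else 0)) =
        (\<Sum>k\<in>H. if inv k = inv g \<otimes> h \<otimes> g then \<psi> (inv h) * \<psi>' (inv g \<otimes> h \<otimes> g) else 0)"
      using eqv by (intro sum.cong refl) simp
    also have "\<dots> = (\<Sum>k\<in>H. if k = inv g \<otimes> h \<otimes> g then \<psi> (inv h) * \<psi>' (inv g \<otimes> h \<otimes> g) else 0)"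
      by (rule sum.reindex_bij_witness[of _ "\<lambda>k. inv k" "\<lambda>k. inv k"]) auto
    also have "\<dots> = (if inv g \<otimes> h \<otimes> g \<in> H then \<psi> (inv h) * \<psi>' (inv g \<otimes> h \<otimes> g) else 0)"
      using finH by (rule sum.delta)
    finally show "(\<Sum>k\<in>H. \<psi> (inv h) * \<psi>' (inv k) * (if h \<otimes> g \<otimes> k \<otimes> inv g = \<one> then 1 else 0)) =
        (if inv g \<otimes> h \<otimes> g \<in> H then \<psi> (inv h) * \<psi>' (inv g \<otimes> h \<otimes> g) else 0)" .
  qed
  also have "\<dots> = (\<Sum>g\<in>?G. F g)"
    unfolding F_def L_def using finH by (subst sum.swap) (simp add: sum.inter_filter)
  also have "\<dots> = (\<Sum>g\<in>H. F g) + (\<Sum>g\<in>?G - H. F g)"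
    using sum.subset_diff[OF HG fin, of F] by simp
  \<comment> \<open>Each g in H contributes the orthogonality sum of two distinct characters of
    H.\<close>
  also have "(\<Sum>g\<in>H. F g) = 0"
  proof (rule sum.neutral, rule ballI)
    fix g assume g: "g \<in> H"
    have "L g = H" unfolding L_def using g by auto
    moreover have "\<psi>' (inv g \<otimes> h \<otimes> g) = \<psi>' h" if "h \<in> H" for h
      using Irr_class[OF subgroup_H \<psi>'I that H.m_inv_closed[OF g]] g by simp
    ultimately have "F g = (\<Sum>h\<in>H. \<psi>' h * \<psi> (inv h))" unfolding F_def by (simp add: mult.commute)
    then show "F g = 0" using Irr_orthogonality[OF subgroup_H \<psi>'I \<psi>I] neq by simp
  qed
  also have "(\<Sum>g\<in>?G - H. F g) = (\<Sum>Y\<in>outer. \<Sum>g\<in>Y. F g)"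
  proof -
    have U: "\<Union>outer = ?G - H" unfolding outer_def by (rule Union_rcosets_sub(2)[OF subgroup_H NH])
    have "sum F (\<Union>outer) = (sum \<circ> sum) F outer"
    proof (rule sum.Union_disjoint)
      show "\<forall>Y\<in>outer. finite Y" using rcosets_sub_carrier[OF outer_rcosets] fin finite_subset by blast
      show "\<forall>Y\<in>outer. \<forall>Z\<in>outer. Y \<noteq> Z \<longrightarrow> Y \<inter> Z = {}"
        using rcos_disjoint[OF subgroup_N] outer_rcosets unfolding pairwise_def disjnt_def by blast
    qed
    then show ?thesis unfolding U by simp
  qed
  finally have total: "of_nat (card H) * of_nat (card H) * of_nat ?S = (\<Sum>Y\<in>outer. \<Sum>g\<in>Y. F g)" by simp

  let ?n = "of_nat (card N) :: complex"
  have n0: "?n \<noteq> 0" using card_sub_pos[OF subgroup_N] by simp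
  have F_coset: "F (n \<otimes> g) = F g" if n: "n \<in> N" and g: "g \<in> ?G" for n g
    unfolding F_def
  proof (rule sum.reindex_bij_witness[of _ "\<lambda>h. n \<otimes> h \<otimes> inv n" "\<lambda>h. inv n \<otimes> h \<otimes> n"])
    have nH: "n \<in> H" using n NH by auto
    have shift: "inv (n \<otimes> g) \<otimes> h \<otimes> (n \<otimes> g) = inv g \<otimes> (inv n \<otimes> h \<otimes> n) \<otimes> g" if "h \<in> H" for h
      using that n g by (simp add: inv_mult_group m_assoc)
    fix h assume h: "h \<in> L (n \<otimes> g)"
    then have hH: "h \<in> H" unfolding L_def by simp
    show "n \<otimes> (inv n \<otimes> h \<otimes> n) \<otimes> inv n = h"
      using hH nH by (simp add: m_assoc)
    show "inv n \<otimes> h \<otimes> n \<in> L g" using h hH nH shift[OF hH] unfolding L_def by simp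
    have "inv (inv n \<otimes> h \<otimes> n) = inv n \<otimes> inv h \<otimes> inv (inv n)" using hH nH by (simp add: inv_mult_group m_assoc)
    then show "\<psi> (inv (inv n \<otimes> h \<otimes> n)) * \<psi>' (inv g \<otimes> (inv n \<otimes> h \<otimes> n) \<otimes> g) =
        \<psi> (inv h) * \<psi>' (inv (n \<otimes> g) \<otimes> h \<otimes> (n \<otimes> g))"
      unfolding shift[OF hH] using Irr_class[OF subgroup_H \<psi>I H.m_inv_closed[OF hH] H.m_inv_closed[OF nH]] by simp
  next
    fix h assume h: "h \<in> L g"
    have nH: "n \<in> H" using n NH by auto
    have hH: "h \<in> H" using h unfolding L_def by simp
    show e: "inv n \<otimes> (n \<otimes> h \<otimes> inv n) \<otimes> n = h"
      using hH nH by (simp add: m_assoc)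
    have "inv (n \<otimes> g) \<otimes> (n \<otimes> h \<otimes> inv n) \<otimes> (n \<otimes> g) = inv g \<otimes> (inv n \<otimes> (n \<otimes> h \<otimes> inv n) \<otimes> n) \<otimes> g"
      using hH nH g by (simp add: inv_mult_group m_assoc)
    then show "n \<otimes> h \<otimes> inv n \<in> L (n \<otimes> g)" using h hH nH unfolding L_def e by simp
  qed
  \<comment> \<open>One factor |N| comes from the order of L, which contains N; the sum over a
    coset, on which F is constant, adds a second one. Dividing by |N|^2 also turns each |H| on the
    left side of \<open>total\<close> into an index prime to p.\<close>
  have F_nat: "\<exists>m::nat. F g = ?n * of_nat m" if g: "g \<in> ?G" for g
  proof -
    note SL = sum_conjugate_product[OF subgroup_H \<psi>I \<psi>'I g, folded L_def]
    have "N \<subseteq> L g" unfolding L_def using NH g by auto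
    then obtain l where "card (L g) = card N * l" using card_subgroup_dvd[OF subgroup_N SL(1)] by (auto elim: dvdE)
    then show ?thesis using SL(2) unfolding F_def by (metis mult.assoc of_nat_mult)
  qed
  have F_act: "F (\<sigma> b g) = F g" if b: "b \<in> B" and g: "g \<in> ?G" for b g
    unfolding F_def
  proof (rule sum.reindex_bij_witness[of _ "\<sigma> b" "\<sigma> (inv\<^bsub>X\<^esub> b)"])
    have shift: "\<sigma> b (inv g \<otimes> h \<otimes> g) = inv (\<sigma> b g) \<otimes> \<sigma> b h \<otimes> \<sigma> b g" if "h \<in> ?G" for h
      using that b g by (simp add: \<sigma>_mult \<sigma>_inv_G)
    {
      fix h assume h: "h \<in> L g"
      then have hG: "h \<in> ?G" unfolding L_def by auto
      show "\<sigma> (inv\<^bsub>X\<^esub> b) (\<sigma> b h) = h" using b hG by simp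
      show "\<sigma> b h \<in> L (\<sigma> b g)" 
        using h hG b g invset_mem[OF H_inv b hG] invset_mem[OF H_inv b, of "inv g \<otimes> h \<otimes> g"] shift[OF hG]
        unfolding L_def by simp
    }
    fix h assume h: "h \<in> L (\<sigma> b g)"
    then have hG: "h \<in> ?G" unfolding L_def by auto
    define k where "k = \<sigma> (inv\<^bsub>X\<^esub> b) h"
    have kG: "k \<in> ?G" and hk: "h = \<sigma> b k" unfolding k_def using b hG by simp_all
    show "\<sigma> b (\<sigma> (inv\<^bsub>X\<^esub> b) h) = h" using b hG by simp
    have kL: "k \<in> L g"
      using h kG b g invset_mem[OF H_inv b kG] invset_mem[OF H_inv b, of "inv g \<otimes> k \<otimes> g"] shift[OF kG]
      unfolding hk L_def by simp
    then show "\<sigma> (inv\<^bsub>X\<^esub> b) h \<in> L g" unfolding k_def .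
    show "\<psi> (inv (\<sigma> (inv\<^bsub>X\<^esub> b) h)) * \<psi>' (inv g \<otimes> \<sigma> (inv\<^bsub>X\<^esub> b) h \<otimes> g) =
        \<psi> (inv h) * \<psi>' (inv (\<sigma> b g) \<otimes> h \<otimes> \<sigma> b g)"
    proof -
      have "\<psi> (inv h) = \<psi> (inv k)"
        using IrrB_value[OF H_inv \<psi> b, of "inv k"] kL b kG \<sigma>_inv_G[of b k] unfolding hk L_def by simp
      moreover have "\<psi>' (inv (\<sigma> b g) \<otimes> h \<otimes> \<sigma> b g) = \<psi>' (inv g \<otimes> k \<otimes> g)"
        using IrrB_value[OF H_inv \<psi>' b, of "inv g \<otimes> k \<otimes> g"] kL shift[OF kG] unfolding hk L_def by simp
      ultimately show ?thesis unfolding k_def by simp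
    qed
  qed
  have "\<exists>s\<in>p_integral p. (\<Sum>Y\<in>outer. (\<Sum>g\<in>Y. F g) / (?n * ?n)) = of_nat p * s"
  proof (rule outer_sum)
    fix b Y assume b: "b \<in> B" and Y: "Y \<in> outer"
    have YG: "Y \<subseteq> ?G" by (rule rcosets_sub_carrier[OF outer_rcosets[OF Y]])
    have "inj_on (\<sigma> b) Y" by (rule inj_on_inverseI[of _ "\<sigma> (inv\<^bsub>X\<^esub> b)"]) (use YG b in auto)
    then have "(\<Sum>g\<in>\<sigma> b ` Y. F g) = (\<Sum>g\<in>Y. F (\<sigma> b g))" by (simp add: sum.reindex)
    also have "\<dots> = (\<Sum>g\<in>Y. F g)" using YG F_act[OF b] by (intro sum.cong refl) auto
    finally show "(\<Sum>g\<in>\<sigma> b ` Y. F g) / (?n * ?n) = (\<Sum>g\<in>Y. F g) / (?n * ?n)" by simp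
  next
    fix Y assume Y: "Y \<in> outer"
    note YR = outer_rcosets[OF Y]
    obtain a where a: "a \<in> ?G" "Y = N #> a" using YR unfolding RCOSETS_def by auto
    have "F g = F a" if "g \<in> Y" for g using that F_coset[OF _ a(1)] unfolding a(2) r_coset_def by auto
    then have "(\<Sum>g\<in>Y. F g) = of_nat (card Y) * F a" by simp
    also have "card Y = card N" using card_rcosets_equal[OF YR subset] by simp
    finally obtain m :: nat where "(\<Sum>g\<in>Y. F g) = ?n * (?n * of_nat m)" using F_nat[OF a(1)] by metis
    then have "(\<Sum>g\<in>Y. F g) / (?n * ?n) = of_nat m" using n0 by simp
    then show "(\<Sum>g\<in>Y. F g) / (?n * ?n) \<in> p_integral p" using p_integral_of_nat[OF p] by simp
  qed
  then obtain s where s: "s \<in> p_integral p" "(\<Sum>Y\<in>outer. (\<Sum>g\<in>Y. F g) / (?n * ?n)) = of_nat p * s" by blast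
  let ?h = "card H div card N"
  have h: "(of_nat (card H) :: complex) = ?n * of_nat ?h" using card_index(1)[OF subgroup_H NH] by (metis of_nat_mult)
  have "?n * ?n * of_nat (?h * ?h * ?S) = ?n * ?n * (of_nat p * s)"
    using total n0 unfolding s(2)[symmetric] h by (simp add: sum_divide_distrib[symmetric] mult_ac)
  then have "of_nat (?h * ?h * ?S) = of_nat p * s" using n0 by (simp only: mult_cancel_left) simp
  then have "p dvd ?h * ?h * ?S" using p_dvd_if_p_integral[OF p _ s(1)] by blast
  then have "p dvd ?S" using index_not_dvd[OF subgroup_H NH] p by (simp add: prime_dvd_mult_iff)
  then obtain l where l: "?S = p * l" by (auto elim: dvdE)
  \<comment> \<open>So far the sum runs over all irreducible characters of G. Restricting it to the
    B-invariant ones changes it by a multiple of p.\<close>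
  define f where "f \<chi> = (of_nat (cmult H \<chi> \<psi> * cmult H \<chi> \<psi>') :: complex)" for \<chi>
  have "\<exists>s\<in>p_integral p. (\<Sum>\<chi>\<in>Irr (sub ?G). f \<chi>) = (\<Sum>\<chi>\<in>IrrB ?G. f \<chi>) + of_nat p * s"
  proof (rule Irr_orbit_sum[OF invset_G])
    fix b \<chi> assume b: "b \<in> B" and "\<chi> \<in> Irr (sub ?G)"
    show "f (chact ?G b \<chi>) = f \<chi>"
      using cmult_chact[OF invset_G H_inv HG b, of \<chi> \<psi>] cmult_chact[OF invset_G H_inv HG b, of \<chi> \<psi>']
        IrrB_fixed[OF \<psi> b] IrrB_fixed[OF \<psi>' b] unfolding f_def by simp
  qed (simp add: f_def p_integral_of_nat[OF p] del: of_nat_mult)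
  then obtain s' where s': "s' \<in> p_integral p" "(\<Sum>\<chi>\<in>Irr (sub ?G). f \<chi>) = (\<Sum>\<chi>\<in>IrrB ?G. f \<chi>) + of_nat p * s'" by blast
  have "(\<Sum>\<chi>\<in>Irr (sub ?G). f \<chi>) = of_nat p * of_nat l" unfolding f_def of_nat_sum[symmetric] l by simp
  then have "(\<Sum>\<chi>\<in>IrrB ?G. f \<chi>) = of_nat p * (of_nat l - s')" using s'(2) by (simp add: algebra_simps)
  then have "of_nat (\<Sum>\<chi>\<in>IrrB ?G. cmult H \<chi> \<psi> * cmult H \<chi> \<psi>') = of_nat p * (of_nat l - s')" unfolding f_def by simp
  then show ?thesis
    using p_dvd_if_p_integral[OF p] p_integral_diff[OF p p_integral_of_nat[OF p] s'(1)] by blast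
qed

lemma finite_IrrB: "subgroup K G \<Longrightarrow> finite (IrrB K)"
  using finite_Irr unfolding Irr_inv_def by simp

lemma unique_over:
  assumes "\<psi> \<in> IrrB H" "\<chi> \<in> IrrB (carrier G)" "\<chi>' \<in> IrrB (carrier G)"
    "\<not> p dvd cmult H \<chi> \<psi>" "\<not> p dvd cmult H \<chi>' \<psi>"
  shows "\<chi> = \<chi>'"
  using cmult_product_dvd[OF assms(2,3) _ assms(1)] assms(4,5) p by (auto simp: prime_dvd_mult_iff)

text \<open>By \<open>unique_over\<close>, every invariant character other than \<chi> contributes a
  multiple of p to the sum in \<open>cmult_overlap_dvd\<close>. So p would divide the term of \<chi>
  itself.\<close>

lemma unique_under:
  assumes \<chi>: "\<chi> \<in> IrrB (carrier G)" and \<psi>: "\<psi> \<in> IrrB H" "\<psi>' \<in> IrrB H"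
    and m: "\<not> p dvd cmult H \<chi> \<psi>" "\<not> p dvd cmult H \<chi> \<psi>'"
  shows "\<psi> = \<psi>'"
proof (rule ccontr)
  assume neq: "\<psi> \<noteq> \<psi>'"
  let ?f = "\<lambda>\<chi>. cmult H \<chi> \<psi> * cmult H \<chi> \<psi>'"
  have "p dvd sum ?f (IrrB (carrier G) - {\<chi>})"
  proof (rule dvd_sum)
    fix \<eta> assume "\<eta> \<in> IrrB (carrier G) - {\<chi>}"
    then have "p dvd cmult H \<eta> \<psi>" using unique_over[OF \<psi>(1) _ \<chi> _ m(1)] by blast
    then show "p dvd ?f \<eta>" by simp
  qed
  moreover have total: "sum ?f (IrrB (carrier G)) = ?f \<chi> + sum ?f (IrrB (carrier G) - {\<chi>})"
    by (rule sum.remove[OF finite_IrrB[OF subgroup_G] \<chi>])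
  ultimately have "p dvd ?f \<chi>" using cmult_overlap_dvd[OF \<psi> neq] unfolding total by (simp only: dvd_add_left_iff)
  then show False using m p by (simp add: prime_dvd_mult_iff)
qed

lemma char_inner_restrict:
  assumes \<chi>: "\<chi> \<in> Irr (sub (carrier G))" and \<psi>: "\<psi> \<in> Irr (sub H)"
  shows "char_inner (sub H) (restrict \<chi> H) \<psi> = of_nat (cmult H \<chi> \<psi>)"
proof -
  have "(\<Sum>g\<in>H. restrict \<chi> H g * cnj (\<psi> g)) = (\<Sum>g\<in>H. \<chi> g * \<psi> (inv g))"
    by (intro sum.cong refl) (simp add: Irr_cnj[OF subgroup_H \<psi>])
  then show ?thesis unfolding char_inner_def of_nat_cmult[OF subgroup_G subgroup_H HG \<chi> \<psi>] by simp
qed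

lemma f_corr_eqI:
  assumes \<chi>: "\<chi> \<in> IrrB (carrier G)" and \<psi>: "\<psi> \<in> IrrB H" "\<not> p dvd cmult H \<chi> \<psi>"
  shows "f_corr p X \<sigma> B G H \<chi> = \<psi>"
  unfolding f_corr_def
proof (rule the_equality)
  show "\<psi> \<in> IrrB H \<and> (\<exists>m::nat. char_inner (sub H) (restrict \<chi> H) \<psi> = of_nat m \<and> \<not> p dvd m)"
    using \<psi> char_inner_restrict[OF IrrB_sub[OF \<chi>] IrrB_sub[OF \<psi>(1)]] by blast
next
  fix \<eta> assume "\<eta> \<in> IrrB H \<and> (\<exists>m::nat. char_inner (sub H) (restrict \<chi> H) \<eta> = of_nat m \<and> \<not> p dvd m)"
  then have \<eta>: "\<eta> \<in> IrrB H" "\<not> p dvd cmult H \<chi> \<eta>"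
    using char_inner_restrict[OF IrrB_sub[OF \<chi>], of \<eta>] IrrB_sub by auto
  then show "\<eta> = \<psi>" using unique_under[OF \<chi> _ \<psi>(1) _ \<psi>(2)] by blast
qed

lemma f_corr_props:
  assumes \<chi>: "\<chi> \<in> IrrB (carrier G)"
  shows "f_corr p X \<sigma> B G H \<chi> \<in> IrrB H" "\<not> p dvd cmult H \<chi> (f_corr p X \<sigma> B G H \<chi>)"
  using exists_character_under[OF \<chi>] f_corr_eqI[OF \<chi>] by auto

end

section \<open>Subnormal \<open>p\<close>-subgroups\<close>

definition p_power :: "nat \<Rightarrow> 'a set \<Rightarrow> bool" where
  "p_power p P \<longleftrightarrow> (\<exists>k. card P = p ^ k)"

context fin_group
begin

text \<open>Count pairs by their product: each fibre is a copy of the intersection, which acts by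
  moving a factor from one component to the other.\<close>

lemma card_set_mult:
  assumes P: "subgroup P G" and Q: "subgroup Q G"
  shows "card P * card Q = card (P <#> Q) * card (P \<inter> Q)"
proof -
  interpret P: subgroup P G by fact
  interpret Q: subgroup Q G by fact
  have finite: "finite P" "finite Q" using finite_sub P Q by blast+
  define F where "F y = {(a, b). a \<in> P \<and> b \<in> Q \<and> a \<otimes> b = y}" for y
  have fibre: "card (F y) = card (P \<inter> Q)" if y: "y \<in> P <#> Q" for y
  proof -
    obtain a b where ab: "a \<in> P" "b \<in> Q" "y = a \<otimes> b" using y unfolding set_mult_def by blast
    have "bij_betw (\<lambda>c. (a \<otimes> c, inv c \<otimes> b)) (P \<inter> Q) (F y)"
    proof (rule bij_betw_byWitness[of _ "\<lambda>(a', b'). inv a \<otimes> a'"])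
      show "\<forall>c\<in>P \<inter> Q. (\<lambda>(a', b'). inv a \<otimes> a') (a \<otimes> c, inv c \<otimes> b) = c"
        using ab by (simp add: m_assoc[symmetric])
      have key: "inv a \<otimes> a' = b \<otimes> inv b'" if "a' \<in> P" "b' \<in> Q" "a' \<otimes> b' = y" for a' b'
      proof -
        have "a' = a \<otimes> b \<otimes> inv b'" using that ab by (metis P.mem_carrier Q.mem_carrier m_closed inv_solve_right)
        then show ?thesis using that ab by (simp add: m_assoc[symmetric])
      qed
      show "\<forall>x\<in>F y. (\<lambda>c. (a \<otimes> c, inv c \<otimes> b)) ((\<lambda>(a', b'). inv a \<otimes> a') x) = x"
      proof
        fix x assume x: "x \<in> F y"
        obtain a' b' where x': "x = (a', b')" "a' \<in> P" "b' \<in> Q" "a' \<otimes> b' = y" using x unfolding F_def by blast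
        have "a \<otimes> (inv a \<otimes> a') = a'" using x' ab by (simp add: m_assoc[symmetric])
        moreover have "inv (inv a \<otimes> a') \<otimes> b = b'" unfolding key[OF x'(2-)] using x' ab
          by (simp add: inv_mult_group m_assoc)
        ultimately show "(\<lambda>c. (a \<otimes> c, inv c \<otimes> b)) ((\<lambda>(a', b'). inv a \<otimes> a') x) = x" using x'(1) by simp
      qed
      have "a \<otimes> c \<otimes> (inv c \<otimes> b) = a \<otimes> b" if "c \<in> P" for c
      proof -
        have "a \<otimes> c \<otimes> (inv c \<otimes> b) = a \<otimes> (c \<otimes> inv c) \<otimes> b" using that ab by (simp add: m_assoc del: r_inv)
        then show ?thesis using that ab by simp
      qed
      then show "(\<lambda>c. (a \<otimes> c, inv c \<otimes> b)) ` (P \<inter> Q) \<subseteq> F y" unfolding F_def using ab by auto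
      show "(\<lambda>(a', b'). inv a \<otimes> a') ` F y \<subseteq> P \<inter> Q"
      proof
        fix c assume "c \<in> (\<lambda>(a', b'). inv a \<otimes> a') ` F y"
        then obtain a' b' where x': "c = inv a \<otimes> a'" "a' \<in> P" "b' \<in> Q" "a' \<otimes> b' = y" unfolding F_def by auto
        have "inv a \<otimes> a' \<in> P" using x' ab by simp
        moreover have "inv a \<otimes> a' \<in> Q" unfolding key[OF x'(2-)] using x' ab by simp
        ultimately show "c \<in> P \<inter> Q" using x'(1) by simp
      qed
    qed
    then show ?thesis by (simp add: bij_betw_same_card)
  qed
  have "P \<times> Q = (\<Union>y\<in>P <#> Q. F y)" unfolding F_def set_mult_def by auto
  then have "card (P \<times> Q) = (\<Sum>y\<in>P <#> Q. card (F y))"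
  proof (simp only:, intro card_UN_disjoint ballI impI)
    show "finite (P <#> Q)" using finite unfolding set_mult_def by simp
    fix y show "finite (F y)" by (rule finite_subset[of _ "P \<times> Q"]) (use finite in \<open>auto simp: F_def\<close>)
  qed (auto simp: F_def)
  then show ?thesis using fibre by (simp add: card_cartesian_product)
qed

lemma p_power_set_mult:
  assumes p: "prime p" and P: "subgroup P G" "p_power p P" and Q: "subgroup Q G" "p_power p Q"
  shows "p_power p (P <#> Q)"
proof -
  have "card (P <#> Q) dvd card P * card Q" using card_set_mult[OF P(1) Q(1)] by simp
  moreover obtain k l where "card P = p ^ k" "card Q = p ^ l" using P(2) Q(2) unfolding p_power_def by blast
  ultimately have "card (P <#> Q) dvd p ^ (k + l)" by (simp add: power_add)
  then show ?thesis unfolding p_power_def using p by (auto simp: divides_primepow_nat)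
qed

lemma normal_set_mult:
  assumes P: "P \<lhd> G" and Q: "Q \<lhd> G"
  shows "P <#> Q \<lhd> G"
proof (rule normal_invI)
  interpret second_isomorphism_grp P G Q
    unfolding second_isomorphism_grp_def second_isomorphism_grp_axioms_def
    using P normal_imp_subgroup[OF Q] by simp
  show "subgroup (P <#> Q) G" by (rule normal_set_mult_subgroup)
  note PG = subgroup.mem_carrier[OF normal_imp_subgroup[OF P]] and QG = subgroup.mem_carrier[OF normal_imp_subgroup[OF Q]]
  fix x h assume x: "x \<in> carrier G" and "h \<in> P <#> Q"
  then obtain a b where ab: "a \<in> P" "b \<in> Q" "h = a \<otimes> b" unfolding set_mult_def by blast
  have "(x \<otimes> a \<otimes> inv x) \<otimes> (x \<otimes> b \<otimes> inv x) = x \<otimes> a \<otimes> (inv x \<otimes> x) \<otimes> b \<otimes> inv x"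
    using ab x PG QG by (simp add: m_assoc del: l_inv r_inv)
  then have eq: "(x \<otimes> a \<otimes> inv x) \<otimes> (x \<otimes> b \<otimes> inv x) = x \<otimes> h \<otimes> inv x"
    using ab x PG QG by (simp add: m_assoc)
  have PQ: "x \<otimes> a \<otimes> inv x \<in> P" "x \<otimes> b \<otimes> inv x \<in> Q"
    using normal_invE(2)[OF P x ab(1)] normal_invE(2)[OF Q x ab(2)] .
  show "x \<otimes> h \<otimes> inv x \<in> P <#> Q"
    unfolding set_mult_def by (rule UN_I[OF PQ(1)], rule UN_I[OF PQ(2)]) (simp only: eq singleton_iff)
qed

lemma conj_subgroup:
  assumes K: "subgroup K G" and x: "x \<in> carrier G"
  shows "subgroup ((\<lambda>y. x \<otimes> y \<otimes> inv x) ` K) G"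
proof -
  interpret K: subgroup K G by fact
  have K0: "K \<noteq> {}" using K.one_closed by (metis empty_iff)
  show ?thesis
  proof (rule subgroupI)
    fix a assume "a \<in> (\<lambda>y. x \<otimes> y \<otimes> inv x) ` K"
    then obtain y where y: "y \<in> K" "a = x \<otimes> y \<otimes> inv x" by blast
    then have "inv a = x \<otimes> inv y \<otimes> inv x" using x by (simp add: inv_mult_group m_assoc)
    then show "inv a \<in> (\<lambda>y. x \<otimes> y \<otimes> inv x) ` K" using y(1) by simp
    fix b assume "b \<in> (\<lambda>y. x \<otimes> y \<otimes> inv x) ` K"
    then obtain z where z: "z \<in> K" "b = x \<otimes> z \<otimes> inv x" by blast
    have "a \<otimes> b = x \<otimes> y \<otimes> (inv x \<otimes> x) \<otimes> z \<otimes> inv x"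
      unfolding y(2) z(2) using y(1) z(1) x by (simp add: m_assoc del: l_inv r_inv)
    then have "a \<otimes> b = x \<otimes> (y \<otimes> z) \<otimes> inv x" using y(1) z(1) x by (simp add: m_assoc)
    then show "a \<otimes> b \<in> (\<lambda>y. x \<otimes> y \<otimes> inv x) ` K" using y(1) z(1) by simp
  qed (use x K0 in auto)
qed

lemma inj_conj: "x \<in> carrier G \<Longrightarrow> K \<subseteq> carrier G \<Longrightarrow> inj_on (\<lambda>y. x \<otimes> y \<otimes> inv x) K"
  by (rule inj_on_inverseI[of _ "\<lambda>z. inv x \<otimes> z \<otimes> x"]) (auto simp: m_assoc subset_iff)

lemma normal_self: "subgroup K G \<Longrightarrow> K \<lhd> sub K"
  using group.normal_invI[OF subgroup_imp_group, of K K] group.subgroup_self[OF subgroup_imp_group, of K]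
    subgroup.m_closed[of K G] subgroup.m_inv_closed[of K G] by (simp add: m_inv_consistent)

text \<open>A largest normal \<open>p\<close>-subgroup of \<open>L\<close> absorbs all others, in particular its own conjugates.\<close>

lemma normal_p_subgroup_step:
  assumes p: "prime p" and L: "L \<lhd> G" and Q: "Q \<lhd> sub L" "p_power p Q"
  shows "\<exists>P. P \<lhd> G \<and> Q \<subseteq> P \<and> p_power p P"
proof -
  note LS = normal_imp_subgroup[OF L]
  interpret L: subgroup L G by fact
  interpret SL: fin_group "sub L" by (rule sub_fin_group[OF LS])
  define S where "S = {M. M \<lhd> sub L \<and> p_power p M}"
  have SL: "M \<subseteq> L" if "M \<in> S" for M
    using that subgroup.subset[OF normal_imp_subgroup, of M "sub L"] unfolding S_def by simp
  have SG: "subgroup M G" if "M \<in> S" for M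
    using that normal_imp_subgroup incl_subgroup[OF LS] unfolding S_def by blast
  have finS: "finite S" by (rule finite_subset[of _ "Pow L"]) (use SL finite_sub[OF LS] in auto)
  have QS: "Q \<in> S" unfolding S_def using Q by simp
  have "Max (card ` S) \<in> card ` S" using finS QS by (intro Max_in) auto
  then obtain M where M: "M \<in> S" "card M = Max (card ` S)" by auto
  have maxM: "card M' \<le> card M" if "M' \<in> S" for M' unfolding M(2) using finS that by simp
  have absorb: "M' \<subseteq> M" if M': "M' \<in> S" for M'
  proof -
    have "M <#> M' \<in> S"
      using SL.normal_set_mult[of M M'] SL.p_power_set_mult[OF p, of M M'] M(1) M' normal_imp_subgroup
      unfolding S_def set_mult_def by auto
    moreover have "M \<subseteq> M <#> M'"
      unfolding set_mult_def using subgroup.one_closed[OF SG[OF M']] subgroup.mem_carrier[OF SG[OF M(1)]] by force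
    moreover have "finite (M <#> M')" using SG[OF M(1)] SG[OF M'] finite_sub unfolding set_mult_def by auto
    ultimately have "M = M <#> M'" using maxM by (simp add: card_seteq)
    moreover have "M' \<subseteq> M <#> M'"
      unfolding set_mult_def using subgroup.one_closed[OF SG[OF M(1)]] subgroup.mem_carrier[OF SG[OF M']] by force
    ultimately show ?thesis by simp
  qed
  have "M \<lhd> G"
  proof (rule normal_invI[OF SG[OF M(1)]])
    fix x h assume x: "x \<in> carrier G" and h: "h \<in> M"
    let ?M = "(\<lambda>y. x \<otimes> y \<otimes> inv x) ` M"
    have sub: "?M \<subseteq> L" using normal_invE(2)[OF L x] SL[OF M(1)] by blast
    have "?M \<lhd> sub L"
    proof (rule SL.normal_invI)
      show "subgroup ?M (sub L)" by (rule subgroup_incl[OF conj_subgroup[OF SG[OF M(1)] x] LS sub])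
      fix y z assume y: "y \<in> carrier (sub L)" and z: "z \<in> ?M"
      then obtain m where m: "m \<in> M" "z = x \<otimes> m \<otimes> inv x" by blast
      have mG: "m \<in> carrier G" using subgroup.mem_carrier[OF SG[OF M(1)] m(1)] .
      have yL: "y \<in> L" using y by simp
      \<comment> \<open>Conjugation by y after conjugation by x is conjugation by y' before it, and
        y' lies in L again because L is normal in G.\<close>
      define y' where "y' = inv x \<otimes> y \<otimes> x"
      have y': "y' \<in> L" unfolding y'_def using normal_invE(2)[OF L inv_closed[OF x] yL] x by simp
      have "y' \<otimes> m \<otimes> inv y' \<in> M"
        using SL.normal_invE(2)[of M y' m] M(1) m(1) y' unfolding S_def by (simp add: m_inv_consistent[OF LS])
      moreover have "x \<otimes> (y' \<otimes> m \<otimes> inv y') \<otimes> inv x = y \<otimes> z \<otimes> inv y"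
      proof -
        have "x \<otimes> y' = y \<otimes> x" unfolding y'_def using x yL by (simp add: m_assoc[symmetric])
        moreover from this have "inv y' \<otimes> inv x = inv x \<otimes> inv y"
          using x yL L.mem_carrier[OF y'] by (metis inv_mult_group L.mem_carrier)
        moreover have "x \<otimes> (y' \<otimes> m \<otimes> inv y') \<otimes> inv x = (x \<otimes> y') \<otimes> m \<otimes> (inv y' \<otimes> inv x)"
          using x mG L.mem_carrier[OF y'] by (simp add: m_assoc)
        ultimately show ?thesis unfolding m(2) using x yL mG by (simp add: m_assoc)
      qed
      ultimately show "y \<otimes>\<^bsub>sub L\<^esub> z \<otimes>\<^bsub>sub L\<^esub> inv\<^bsub>sub L\<^esub> y \<in> ?M"
        using m_inv_consistent[OF LS yL] by (metis (no_types, lifting) image_eqI monoid.simps(1) partial_object.update_convs(1) partial_object.surjective monoid.surjective)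
    qed
    moreover have "card ?M = card M" by (rule card_image[OF inj_conj[OF x subgroup.subset[OF SG[OF M(1)]]]])
    ultimately have "?M \<in> S" using M(1) unfolding S_def p_power_def by simp
    then show "x \<otimes> h \<otimes> inv x \<in> M" using absorb h by blast
  qed
  then show ?thesis using absorb[OF QS] M(1) unfolding S_def by blast
qed

lemma subnormal_subgroup: "subnormal G K \<Longrightarrow> subgroup K G"
proof (induction rule: subnormal.induct)
  case whole show ?case by (rule subgroup_self)
next
  case (step K L)
  show ?case by (rule incl_subgroup[OF step.IH normal_imp_subgroup[OF step.hyps(2)]])
qed

text \<open>One step of the chain replaces Q by a larger p-subgroup that is normal one level higher,
  so the induction has to run over all Q. It is applied with K and Q both equal to the given
  subnormal p-subgroup.\<close>

lemma subnormal_normal_p_subgroup: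
  assumes p: "prime p" and "subnormal G K" and "Q \<lhd> sub K" "p_power p Q"
  shows "\<exists>P. P \<lhd> G \<and> Q \<subseteq> P \<and> p_power p P"
  using assms(2-)
proof (induction arbitrary: Q rule: subnormal.induct)
  case whole
  then show ?case by auto
next
  case (step K L)
  interpret K: fin_group "sub K" by (rule sub_fin_group[OF subnormal_subgroup[OF step.hyps(1)]])
  obtain P where P: "P \<lhd> sub K" "Q \<subseteq> P" "p_power p P"
    using K.normal_p_subgroup_step[OF p step.hyps(2), of Q] step.prems by auto
  show ?case using step.IH[OF P(1,3)] P(2) by blast
qed

end

section \<open>Stabilizers and semidirect products\<close>

text \<open>Here N and the invariant sets are stable under all of X; p-subgroups of X come back
  through \<open>p_action_fixed_subgroup\<close>.\<close>

locale whole_action = aut_action N G X \<sigma> "carrier X"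
  for N and G (structure) and X :: "('x, 'c) monoid_scheme" and \<sigma> :: "'x \<Rightarrow> 'a \<Rightarrow> 'a"
begin

lemma subgroup_stabilizer:
  assumes K: "invset K" and \<theta>: "\<theta> \<in> Irr (sub K)"
  shows "subgroup {x \<in> carrier X. chact K x \<theta> = \<theta>} X"
proof (rule X.subgroupI)
  show "{x \<in> carrier X. chact K x \<theta> = \<theta>} \<noteq> {}" using chact_one[OF K \<theta>] by blast
next
  fix x assume "x \<in> {x \<in> carrier X. chact K x \<theta> = \<theta>}"
  then have x: "x \<in> carrier X" "chact K x \<theta> = \<theta>" by auto
  have "chact K (inv\<^bsub>X\<^esub> x \<otimes>\<^bsub>X\<^esub> x) \<theta> = chact K (inv\<^bsub>X\<^esub> x) \<theta>"
    using chact_mult[OF K, of "inv\<^bsub>X\<^esub> x" x \<theta>] x by simp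
  then show "inv\<^bsub>X\<^esub> x \<in> {x \<in> carrier X. chact K x \<theta> = \<theta>}" using x chact_one[OF K \<theta>] by simp
qed (auto simp: chact_mult[OF K])

text \<open>Write q x as x followed by its conjugate x^-1 q x: the latter lies in Q and fixes
  \<theta>.\<close>

lemma chact_normalizer:
  assumes K: "invset K" and \<theta>: "\<theta> \<in> Irr_inv X \<sigma> Q (sub K)" and Q: "Q \<subseteq> carrier X"
    and x: "x \<in> carrier X" "\<And>q. q \<in> Q \<Longrightarrow> inv\<^bsub>X\<^esub> x \<otimes>\<^bsub>X\<^esub> q \<otimes>\<^bsub>X\<^esub> x \<in> Q"
  shows "chact K x \<theta> \<in> Irr_inv X \<sigma> Q (sub K)"
  unfolding Irr_inv_def
proof (intro CollectI conjI ballI)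
  have I: "\<theta> \<in> Irr (sub K)" and inv: "\<And>q. q \<in> Q \<Longrightarrow> chact K q \<theta> = \<theta>" using \<theta> unfolding Irr_inv_def by auto
  show "chact K x \<theta> \<in> Irr (sub K)" by (rule chact_Irr[OF K x(1) I])
  fix q assume q: "q \<in> Q"
  then have qX: "q \<in> carrier X" using Q by auto
  have "chact K q (chact K x \<theta>) = chact K (q \<otimes>\<^bsub>X\<^esub> x) \<theta>" using chact_mult[OF K qX x(1)] by simp
  also have "q \<otimes>\<^bsub>X\<^esub> x = x \<otimes>\<^bsub>X\<^esub> (inv\<^bsub>X\<^esub> x \<otimes>\<^bsub>X\<^esub> q \<otimes>\<^bsub>X\<^esub> x)" using qX x(1) by (simp add: X.m_assoc[symmetric])
  also have "chact K \<dots> \<theta> = chact K x \<theta>"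
    using chact_mult[OF K x(1), of "inv\<^bsub>X\<^esub> x \<otimes>\<^bsub>X\<^esub> q \<otimes>\<^bsub>X\<^esub> x"] qX x(1) inv[OF x(2)[OF q]] by simp
  finally show "chact K q (chact K x \<theta>) = chact K x \<theta>" .
qed

lemma p_action_fixed_subgroup:
  assumes p: "prime p" and p_index: "\<not> p dvd card (carrier G) div card N"
    and Q: "subgroup Q X" and card_Q: "p_power p Q" and H: "invset H" and NH: "N \<subseteq> H"
    and fixed_cosets: "\<And>Y. Y \<in> rcosets N \<Longrightarrow> (\<And>b. b \<in> Q \<Longrightarrow> \<sigma> b ` Y = Y) \<Longrightarrow> Y \<subseteq> H"
  shows "p_action_fixed N G X \<sigma> Q p H"
proof -
  have QX: "Q \<subseteq> carrier X" by (rule subgroup.subset[OF Q])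
  interpret Q: aut_action N G X \<sigma> Q
  proof (intro aut_action.intro aut_action_axioms.intro fin_normal_axioms X.group_axioms)
    show "\<sigma> \<in> hom X (AutoGroup G)" "subgroup Q X" by (fact hom_aut Q)+
    show "\<sigma> b ` N = N" if "b \<in> Q" for b using N_inv[of b] QX that by auto
  qed
  show ?thesis
  proof (unfold_locales)
    show "Q.invset H" using H QX unfolding invset_def Q.invset_def by auto
    show "\<And>Y. Y \<in> rcosets N \<Longrightarrow> (\<And>b. b \<in> Q \<Longrightarrow> \<sigma> b ` Y = Y) \<Longrightarrow> Y \<subseteq> H"
      by (rule fixed_cosets)
    show "\<exists>k. card Q = p ^ k" using card_Q unfolding p_power_def .
  qed (fact p p_index NH)+
qed

text \<open>The correspondence of \<open>B\<close> is that of every larger \<open>p\<close>-subgroup \<open>Q\<close> fixing one of the two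
  characters. Taking \<open>Q\<close> to be the intersection of the stabilizer with a normal \<open>p\<close>-subgroup
  \<open>P\<close>, the stabilizer permutes the \<open>Q\<close>-invariant characters and preserves multiplicities.\<close>

lemma stabilizer_correspondence:
  assumes p: "prime p" and p_index: "\<not> p dvd card (carrier G) div card N"
    and P: "P \<lhd> X" "p_power p P" and B: "subgroup B X" "B \<subseteq> P" "p_power p B"
    and H: "invset H" "N \<subseteq> H"
    and fixed_cosets: "\<And>Y. Y \<in> rcosets N \<Longrightarrow> (\<And>b. b \<in> B \<Longrightarrow> \<sigma> b ` Y = Y) \<Longrightarrow> Y \<subseteq> H"
    and \<chi>: "\<chi> \<in> Irr_inv X \<sigma> B (sub (carrier G))" and \<phi>: "\<phi> \<in> Irr_inv X \<sigma> B (sub H)"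
    and m: "\<not> p dvd cmult H \<chi> \<phi>" and x: "x \<in> carrier X"
  shows "chact (carrier G) x \<chi> = \<chi> \<longleftrightarrow> chact H x \<phi> = \<phi>"
proof -
  \<comment> \<open>A larger group fixes fewer cosets, so every p-subgroup containing B satisfies
    the hypotheses with the same H and has its own correspondence.\<close>
  have action: "p_action_fixed N G X \<sigma> Q p H" if Q: "subgroup Q X" "B \<subseteq> Q" "p_power p Q" for Q
    by (rule p_action_fixed_subgroup[OF p p_index Q(1,3) H]) (rule fixed_cosets, use Q(2) in auto)
  interpret B: p_action_fixed N G X \<sigma> B p H by (rule action[OF B(1) subset_refl B(3)])
  define T where "T K \<theta> = P \<inter> {x \<in> carrier X. chact K x \<theta> = \<theta>}" for K \<theta>
  note PS = normal_imp_subgroup[OF P(1)]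
  have T: "subgroup (T K \<theta>) X" "B \<subseteq> T K \<theta>" "p_power p (T K \<theta>)" "\<theta> \<in> Irr_inv X \<sigma> (T K \<theta>) (sub K)"
    if K: "invset K" and \<theta>: "\<theta> \<in> Irr_inv X \<sigma> B (sub K)" for K \<theta>
  proof -
    have \<theta>I: "\<theta> \<in> Irr (sub K)" using \<theta> unfolding Irr_inv_def by simp
    show S: "subgroup (T K \<theta>) X"
      unfolding T_def by (rule X.subgroups_Inter_pair[OF PS subgroup_stabilizer[OF K \<theta>I]])
    show "B \<subseteq> T K \<theta>" using B(2) subgroup.subset[OF B(1)] \<theta> unfolding T_def Irr_inv_def by auto
    have "subgroup (T K \<theta>) (X\<lparr>carrier := P\<rparr>)"
      using X.subgroup_incl[OF S PS] unfolding T_def by blast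
    then have "card (rcosets\<^bsub>X\<lparr>carrier := P\<rparr>\<^esub> T K \<theta>) * card (T K \<theta>) = card P"
      using group.lagrange[OF X.subgroup_imp_group[OF PS], of "T K \<theta>"] by (simp add: Coset.order_def)
    then have "card (T K \<theta>) dvd card P" by (metis dvd_triv_right)
    then show "p_power p (T K \<theta>)" using P(2) p unfolding p_power_def by (auto simp: divides_primepow_nat)
    show "\<theta> \<in> Irr_inv X \<sigma> (T K \<theta>) (sub K)" using \<theta>I unfolding T_def Irr_inv_def by auto
  qed
  \<comment> \<open>Conjugation by x preserves P because P is normal, and the stabilizer because x
    belongs to it. For B itself there is no such statement.\<close>
  have T_conj: "inv\<^bsub>X\<^esub> x \<otimes>\<^bsub>X\<^esub> q \<otimes>\<^bsub>X\<^esub> x \<in> T K \<theta>"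
    if K: "invset K" and \<theta>: "\<theta> \<in> Irr (sub K)" and stable: "chact K x \<theta> = \<theta>" and q: "q \<in> T K \<theta>" for K \<theta> q
  proof -
    have "inv\<^bsub>X\<^esub> x \<otimes>\<^bsub>X\<^esub> q \<otimes>\<^bsub>X\<^esub> x \<in> P"
      using X.normal_invE(2)[OF P(1) X.inv_closed[OF x], of q] q x unfolding T_def by simp
    moreover have "inv\<^bsub>X\<^esub> x \<otimes>\<^bsub>X\<^esub> q \<otimes>\<^bsub>X\<^esub> x \<in> {x \<in> carrier X. chact K x \<theta> = \<theta>}" (is "_ \<in> ?S")
    proof -
      note ST = subgroup_stabilizer[OF K \<theta>]
      have xS: "x \<in> ?S" and qS: "q \<in> ?S" using x stable q unfolding T_def by simp_all
      show ?thesis by (rule subgroup.m_closed[OF ST subgroup.m_closed[OF ST subgroup.m_inv_closed[OF ST xS] qS] xS])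
    qed
    ultimately show ?thesis unfolding T_def by (rule IntI)
  qed
  have mult_x: "cmult H (chact (carrier G) x \<chi>) (chact H x \<phi>) = cmult H \<chi> \<phi>"
    by (rule cmult_chact[OF invset_G H(1) subgroup.subset[OF invset_subgroup[OF H(1)]] x])
  have B_inv: "\<theta> \<in> Irr_inv X \<sigma> B K" if "\<theta> \<in> Irr_inv X \<sigma> Q K" "B \<subseteq> Q" for \<theta> Q and K :: "('a, 'b) monoid_scheme"
    using that unfolding Irr_inv_def by blast
  show ?thesis
  proof
    assume stable: "chact (carrier G) x \<chi> = \<chi>"
    note TG = T[OF invset_G \<chi>]
    interpret Q: p_action_fixed N G X \<sigma> "T (carrier G) \<chi>" p H by (rule action[OF TG(1-3)])
    obtain \<psi> where \<psi>: "\<psi> \<in> Q.IrrB H" "\<not> p dvd cmult H \<chi> \<psi>" using Q.exists_character_under[OF TG(4)] by blast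
    have "\<psi> = \<phi>" by (rule B.unique_under[OF \<chi> B_inv[OF \<psi>(1) TG(2)] \<phi> \<psi>(2) m])
    then have \<phi>Q: "\<phi> \<in> Q.IrrB H" using \<psi>(1) by simp
    have x\<phi>: "chact H x \<phi> \<in> Q.IrrB H"
      by (rule chact_normalizer[OF H(1) \<phi>Q subgroup.subset[OF TG(1)] x T_conj[OF invset_G B.IrrB_sub[OF \<chi>] stable]])
    have "\<not> p dvd cmult H \<chi> (chact H x \<phi>)" using m mult_x unfolding stable by (simp only: not_False_eq_True)
    then show "chact H x \<phi> = \<phi>" by (rule Q.unique_under[OF TG(4) x\<phi> \<phi>Q _ m])
  next
    assume stable: "chact H x \<phi> = \<phi>"
    note TH = T[OF H(1) \<phi>]
    interpret Q: p_action_fixed N G X \<sigma> "T H \<phi>" p H by (rule action[OF TH(1-3)])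
    obtain \<eta> where \<eta>: "\<eta> \<in> Q.IrrB (carrier G)" "\<not> p dvd cmult H \<eta> \<phi>" using Q.exists_character_over[OF TH(4)] by blast
    have "\<eta> = \<chi>" by (rule B.unique_over[OF \<phi> B_inv[OF \<eta>(1) TH(2)] \<chi> \<eta>(2) m])
    then have \<chi>Q: "\<chi> \<in> Q.IrrB (carrier G)" using \<eta>(1) by simp
    have x\<chi>: "chact (carrier G) x \<chi> \<in> Q.IrrB (carrier G)"
      by (rule chact_normalizer[OF invset_G \<chi>Q subgroup.subset[OF TH(1)] x T_conj[OF H(1) B.IrrB_sub[OF \<phi>] stable]])
    have "\<not> p dvd cmult H (chact (carrier G) x \<chi>) \<phi>" using m mult_x unfolding stable by (simp only: not_False_eq_True)
    then show "chact (carrier G) x \<chi> = \<chi>" by (rule Q.unique_over[OF TH(4) x\<chi> \<chi>Q _ m])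
  qed
qed

section \<open>The semidirect product as a group acting on G\<close>

abbreviation S where "S \<equiv> semidirect X \<sigma> G N"
abbreviation \<tau> where "\<tau> \<equiv> semidirect_act \<sigma> G"

lemma \<sigma>_N: "a \<in> carrier X \<Longrightarrow> n \<in> N \<Longrightarrow> \<sigma> a n \<in> N"
  using invset_mem[OF invset_N, of a n] by simp

lemma carrier_semidirect: "carrier S = carrier X \<times> N"
  by (simp add: semidirect_def)

lemma mult_semidirect: "(a, n) \<otimes>\<^bsub>S\<^esub> (b, m) = (a \<otimes>\<^bsub>X\<^esub> b, n \<otimes> \<sigma> a m)"
  by (simp add: semidirect_def)

lemma one_semidirect: "\<one>\<^bsub>S\<^esub> = (\<one>\<^bsub>X\<^esub>, \<one>)"
  by (simp add: semidirect_def)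

lemma group_semidirect: "group S"
proof (rule groupI)
  fix x assume x: "x \<in> carrier S"
  obtain a n where an: "x = (a, n)" "a \<in> carrier X" "n \<in> N" using x unfolding carrier_semidirect by auto
  show "\<one>\<^bsub>S\<^esub> \<otimes>\<^bsub>S\<^esub> x = x" unfolding an(1) one_semidirect mult_semidirect using an by (simp add: \<sigma>_one)
  have "(inv\<^bsub>X\<^esub> a, \<sigma> (inv\<^bsub>X\<^esub> a) (inv n)) \<otimes>\<^bsub>S\<^esub> x = \<one>\<^bsub>S\<^esub>"
    unfolding an(1) one_semidirect mult_semidirect using an by (simp add: \<sigma>_mult[symmetric])
  moreover have "(inv\<^bsub>X\<^esub> a, \<sigma> (inv\<^bsub>X\<^esub> a) (inv n)) \<in> carrier S"
    unfolding carrier_semidirect using an by (simp add: \<sigma>_N)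
  ultimately show "\<exists>y\<in>carrier S. y \<otimes>\<^bsub>S\<^esub> x = \<one>\<^bsub>S\<^esub>" by blast
  fix y assume y: "y \<in> carrier S"
  obtain b m where bm: "y = (b, m)" "b \<in> carrier X" "m \<in> N" using y unfolding carrier_semidirect by auto
  show "x \<otimes>\<^bsub>S\<^esub> y \<in> carrier S" unfolding an(1) bm(1) mult_semidirect carrier_semidirect using an bm by (simp add: \<sigma>_N)
  fix z assume z: "z \<in> carrier S"
  obtain c k where ck: "z = (c, k)" "c \<in> carrier X" "k \<in> N" using z unfolding carrier_semidirect by auto
  show "x \<otimes>\<^bsub>S\<^esub> y \<otimes>\<^bsub>S\<^esub> z = x \<otimes>\<^bsub>S\<^esub> (y \<otimes>\<^bsub>S\<^esub> z)"
    unfolding an(1) bm(1) ck(1) mult_semidirect using an bm ck by (simp add: X.m_assoc m_assoc \<sigma>_mult \<sigma>_comp)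
qed (simp add: carrier_semidirect one_semidirect)

lemma \<tau>_apply: "g \<in> carrier G \<Longrightarrow> \<tau> (a, n) g = n \<otimes> \<sigma> a g \<otimes> inv n"
  by (simp add: semidirect_act_def)

lemma \<tau>_comp:
  assumes "x \<in> carrier S" "y \<in> carrier S" "g \<in> carrier G"
  shows "\<tau> (x \<otimes>\<^bsub>S\<^esub> y) g = \<tau> x (\<tau> y g)"
  using assms unfolding carrier_semidirect
  by (auto simp: mult_semidirect \<tau>_apply \<sigma>_mult \<sigma>_comp \<sigma>_inv_G inv_mult_group m_assoc)

lemma \<tau>_one: "g \<in> carrier G \<Longrightarrow> \<tau> \<one>\<^bsub>S\<^esub> g = g"
  unfolding one_semidirect by (simp add: \<tau>_apply \<sigma>_one)

lemma \<tau>_closed: "x \<in> carrier S \<Longrightarrow> g \<in> carrier G \<Longrightarrow> \<tau> x g \<in> carrier G"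
  unfolding carrier_semidirect by (auto simp: \<tau>_apply)

lemma \<tau>_image:
  assumes K: "invset K" and NK: "N \<subseteq> K" and x: "x \<in> carrier S"
  shows "\<tau> x ` K = K"
proof -
  interpret K: subgroup K G by (rule invset_subgroup[OF K])
  interpret S: group S by (rule group_semidirect)
  have closed: "\<tau> y g \<in> K" if "y \<in> carrier S" "g \<in> K" for y g
    using that NK invset_mem[OF K] unfolding carrier_semidirect by (auto simp: \<tau>_apply subset_iff)
  show ?thesis
  proof (intro equalityI subsetI)
    fix g assume g: "g \<in> K"
    have "\<tau> x (\<tau> (inv\<^bsub>S\<^esub> x) g) = g" using \<tau>_comp[of x "inv\<^bsub>S\<^esub> x" g] \<tau>_one x g by simp
    then show "g \<in> \<tau> x ` K" using closed[OF S.inv_closed[OF x] g] by (metis image_eqI)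
  qed (use closed[OF x] in auto)
qed

lemma hom_semidirect_act: "\<tau> \<in> hom S (AutoGroup G)"
proof -
  interpret S: group S by (rule group_semidirect)
  have Bij: "\<tau> x \<in> Bij (carrier G)" if x: "x \<in> carrier S" for x
  proof -
    have "bij_betw (\<tau> x) (carrier G) (carrier G)"
      by (rule bij_betw_byWitness[of _ "\<tau> (inv\<^bsub>S\<^esub> x)"])
        (use x in \<open>auto simp: \<tau>_comp[symmetric] \<tau>_one \<tau>_closed\<close>)
    moreover have "\<tau> x \<in> extensional (carrier G)" by (cases x) (simp add: semidirect_act_def)
    ultimately show ?thesis unfolding Bij_def by simp
  qed
  have "\<tau> x \<in> hom G G" if x: "x \<in> carrier S" for x
  proof (rule homI[OF \<tau>_closed[OF x]])
    fix g h assume gh: "g \<in> carrier G" "h \<in> carrier G"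
    obtain a n where an: "x = (a, n)" "a \<in> carrier X" "n \<in> N" using x unfolding carrier_semidirect by auto
    show "\<tau> x (g \<otimes> h) = \<tau> x g \<otimes> \<tau> x h"
      unfolding an(1) using gh an by (simp add: \<tau>_apply \<sigma>_mult m_assoc)
  qed
  moreover have "\<tau> (x \<otimes>\<^bsub>S\<^esub> y) = compose (carrier G) (\<tau> x) (\<tau> y)" if "x \<in> carrier S" "y \<in> carrier S" for x y
  proof (rule extensionalityI[OF _ compose_extensional])
    show "\<tau> (x \<otimes>\<^bsub>S\<^esub> y) \<in> extensional (carrier G)" using Bij[of "x \<otimes>\<^bsub>S\<^esub> y"] that unfolding Bij_def by simp
  qed (simp add: compose_eq \<tau>_comp that)
  ultimately show ?thesis
    using Bij by (auto simp: hom_def[of S] AutoGroup_def BijGroup_def auto_def)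
qed

text \<open>The pairs (a, 1) form the copy of X in the semidirect product, so stabilizers in X can
  be compared inside the larger group.\<close>

lemma char_act_semidirect:
  assumes "K \<subseteq> carrier G" "a \<in> carrier X"
  shows "char_act S \<tau> (sub K) (a, \<one>) \<theta> = char_act X \<sigma> (sub K) a \<theta>"
proof -
  interpret S: group S by (rule group_semidirect)
  have "inv\<^bsub>S\<^esub> (a, \<one>) = (inv\<^bsub>X\<^esub> a, \<one>)"
    using assms(2) by (intro S.inv_equality) (simp_all add: mult_semidirect one_semidirect carrier_semidirect)
  then show ?thesis using assms unfolding char_act_def by (auto simp: \<tau>_apply subset_iff)
qed

lemma semidirect_action: "whole_action N G S \<tau>"
proof -
  interpret S: group S by (rule group_semidirect)
  show ?thesis
    by unfold_locales (use hom_semidirect_act S.subgroup_self \<tau>_image[OF invset_N] in auto)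
qed

end

theorem theorem3p4:
  fixes p :: nat
    and A :: "('a, 'm) monoid_scheme"
    and G :: "('g, 'n) monoid_scheme"
    and \<alpha> :: "'a \<Rightarrow> 'g \<Rightarrow> 'g"
    and N C H :: "'g set"
    and B :: "('a \<times> 'g) set"
    and \<chi> \<phi> :: "'g \<Rightarrow> complex"
  defines "Ahat \<equiv> semidirect A \<alpha> G N"
    and "\<alpha>hat \<equiv> semidirect_act \<alpha> G"
  assumes "prime p"
    and "group A" and "finite (carrier A)"
    and "group G" and "finite (carrier G)"
    and "\<alpha> \<in> hom A (AutoGroup G)"
    and "N \<lhd> G" and "invariant_subset A \<alpha> N"
    and "subnormal Ahat B" and "p_subgroup p Ahat B"
    and "\<not> p dvd card (rcosets\<^bsub>G\<^esub> N)"
    and "subgroup C G" and "N \<subseteq> C"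
    and "carrier (G\<lparr>carrier := C\<rparr> Mod N) = quot_centralizer \<alpha>hat B G N"
    and "subgroup H G" and "C \<subseteq> H" and "invariant_subset A \<alpha> H"
    and "\<chi> \<in> Irr_inv Ahat \<alpha>hat B G"
    and "\<phi> = f_corr p Ahat \<alpha>hat B G H \<chi>"
  shows "stabilizer A (char_act A \<alpha> G) \<chi> = stabilizer A (char_act A \<alpha> (G\<lparr>carrier := H\<rparr>)) \<phi> \<and>
    (\<forall>D. p_subgroup p A D \<and> D \<subseteq> stabilizer A (char_act A \<alpha> G) \<chi> \<and>
         quot_centralizer \<alpha> D G N \<subseteq> carrier (G\<lparr>carrier := H\<rparr> Mod N) \<longrightarrow>
         f_corr p A \<alpha> D G H \<chi> = \<phi>)"
proof -
  interpret fin_normal N G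
    using assms by (simp add: fin_normal_def fin_group_def fin_group_axioms_def)
  interpret A: fin_group A
    using assms by (simp add: fin_group_def fin_group_axioms_def)
  interpret whole_action N G A \<alpha>
  proof (intro whole_action.intro aut_action.intro aut_action_axioms.intro fin_normal_axioms A.is_group A.subgroup_self)
    show "\<alpha> \<in> hom A (AutoGroup G)" by fact
    show "\<alpha> b ` N = N" if "b \<in> carrier A" for b
      using \<open>invariant_subset A \<alpha> N\<close> that unfolding invariant_subset_def by blast
  qed
  let ?H = "G\<lparr>carrier := H\<rparr>"
  have p: "prime p" by fact
  have H: "subgroup H G" and NH: "N \<subseteq> H" using assms by auto
  have GG: "G\<lparr>carrier := carrier G\<rparr> = G" by simp
  have invH: "invset H"
    using H \<open>invariant_subset A \<alpha> H\<close> unfolding invset_def invariant_subset_def by blast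
  have p_index: "\<not> p dvd card (carrier G) div card N"
  proof -
    have "card (rcosets\<^bsub>G\<^esub> N) * card N = card (carrier G)"
      using lagrange[OF subgroup_N] by (simp add: Coset.order_def)
    then have "card (carrier G) div card N = card (rcosets\<^bsub>G\<^esub> N)"
      using card_sub_pos[OF subgroup_N] by (metis div_mult_self_is_m)
    then show ?thesis using \<open>\<not> p dvd card (rcosets\<^bsub>G\<^esub> N)\<close> by simp
  qed
  have sub_rcosets: "Y \<subseteq> K" if K: "subgroup K G" "N \<subseteq> K" "Y \<in> carrier (G\<lparr>carrier := K\<rparr> Mod N)" for K Y
  proof -
    interpret K: subgroup K G by fact
    obtain a where a: "a \<in> K" "Y = N #>\<^bsub>G\<^esub> a" using K(3) unfolding FactGroup_def RCOSETS_def r_coset_def by auto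
    then show ?thesis using K(2) unfolding r_coset_def by auto
  qed
  interpret hat: whole_action N G Ahat \<alpha>hat unfolding Ahat_def \<alpha>hat_def by (rule semidirect_action)
  interpret Ahat: fin_group Ahat
    using hat.X.group_axioms \<open>finite (carrier A)\<close> finite_sub[OF subgroup_N]
    by (simp add: fin_group_def fin_group_axioms_def Ahat_def carrier_semidirect)
  have invH_hat: "hat.invset H"
    unfolding hat.invset_def using H \<tau>_image[OF invH NH] unfolding Ahat_def \<alpha>hat_def by blast
  have B: "subgroup B Ahat" "p_power p B"
    using \<open>p_subgroup p Ahat B\<close> unfolding p_subgroup_def p_power_def by auto
  \<comment> \<open>B is a normal p-subgroup of itself, which starts the ascent along the subnormal
    chain.\<close>
  obtain P where P: "P \<lhd> Ahat" "B \<subseteq> P" "p_power p P"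
    using Ahat.subnormal_normal_p_subgroup[OF p \<open>subnormal Ahat B\<close> Ahat.normal_self[OF B(1)] B(2)] by blast
  have fixed_B: "Y \<subseteq> H" if Y: "Y \<in> rcosets\<^bsub>G\<^esub> N" "\<And>b. b \<in> B \<Longrightarrow> \<alpha>hat b ` Y = Y" for Y
  proof -
    have "Y \<in> quot_centralizer \<alpha>hat B G N" using Y unfolding quot_centralizer_def FactGroup_def by simp
    then have "Y \<in> carrier (G\<lparr>carrier := C\<rparr> Mod N)" using assms by simp
    then show ?thesis using sub_rcosets[OF \<open>subgroup C G\<close> \<open>N \<subseteq> C\<close>] \<open>C \<subseteq> H\<close> by blast
  qed
  interpret B: p_action_fixed N G Ahat \<alpha>hat B p H
    by (rule hat.p_action_fixed_subgroup[OF p p_index B invH_hat NH fixed_B])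
  have \<chi>: "\<chi> \<in> B.IrrB (carrier G)" using assms by simp
  have \<phi>: "\<phi> \<in> B.IrrB H" and m: "\<not> p dvd cmult H \<chi> \<phi>"
    using B.f_corr_props[OF \<chi>] assms by simp_all
  have stab: "stabilizer A (char_act A \<alpha> G) \<chi> = stabilizer A (char_act A \<alpha> ?H) \<phi>"
  proof -
    have "char_act A \<alpha> G a \<chi> = \<chi> \<longleftrightarrow> char_act A \<alpha> ?H a \<phi> = \<phi>" if a: "a \<in> carrier A" for a
    proof -
      have a1: "(a, \<one>\<^bsub>G\<^esub>) \<in> carrier Ahat" unfolding Ahat_def carrier_semidirect using a by simp
      have "hat.chact (carrier G) (a, \<one>\<^bsub>G\<^esub>) \<chi> = \<chi> \<longleftrightarrow> hat.chact H (a, \<one>\<^bsub>G\<^esub>) \<phi> = \<phi>"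
        by (rule hat.stabilizer_correspondence[OF p p_index P(1,3) B(1) P(2) B(2) invH_hat NH fixed_B \<chi> \<phi> m a1])
      then show ?thesis
        using char_act_semidirect[OF subset_refl a] char_act_semidirect[OF subgroup.subset[OF H] a]
        unfolding Ahat_def \<alpha>hat_def GG by simp
    qed
    then show ?thesis unfolding stabilizer_def by blast
  qed
  \<comment> \<open>By the equality of stabilizers D also fixes \<phi>, and the multiplicity of
    \<phi> in \<chi> is already known to be prime to p. Uniqueness in the correspondence of D,
    acting as a subgroup of A, does the rest.\<close>
  moreover have "f_corr p A \<alpha> D G H \<chi> = \<phi>"
    if D: "p_subgroup p A D" "D \<subseteq> stabilizer A (char_act A \<alpha> G) \<chi>"
      "quot_centralizer \<alpha> D G N \<subseteq> carrier (?H Mod N)" for D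
  proof -
    have DS: "subgroup D A" "p_power p D" using D(1) unfolding p_subgroup_def p_power_def by auto
    have fixed_D: "Y \<subseteq> H" if Y: "Y \<in> rcosets\<^bsub>G\<^esub> N" "\<And>b. b \<in> D \<Longrightarrow> \<alpha> b ` Y = Y" for Y
    proof -
      have "Y \<in> quot_centralizer \<alpha> D G N" using Y unfolding quot_centralizer_def FactGroup_def by simp
      then show ?thesis using sub_rcosets[OF H NH] D(3) by blast
    qed
    interpret D: p_action_fixed N G A \<alpha> D p H
      by (rule p_action_fixed_subgroup[OF p p_index DS invH NH fixed_D])
    show ?thesis
    proof (rule D.f_corr_eqI[OF _ _ m])
      show "\<chi> \<in> D.IrrB (carrier G)"
        using B.IrrB_sub[OF \<chi>] D(2) unfolding GG Irr_inv_def stabilizer_def by blast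
      show "\<phi> \<in> D.IrrB H"
        using B.IrrB_sub[OF \<phi>] D(2) unfolding stab unfolding Irr_inv_def stabilizer_def by blast
    qed
  qed
  ultimately show ?thesis by blast
qed

end
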